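(* Let $\Phi$ be one of the root systems $A_{n-1}$, $B_n$, $C_n$, $D_n$, $BC_n$ with $n\ge 2$, with ambient space $V$ of dimension $l$ ($V=\{x\in\mathbb{R}^n: x_1+\cdots+x_n=0\}$, $l=n-1$, for $A_{n-1}$; $V=\mathbb{R}^n$, $l=n$, otherwise). Let $a,b$ be nonnegative integers, not both zero, with $a\le b$, and let $\hat{\mathcal A}=\hat{\mathcal A}^{[-a+1,b]}(\Phi)$. If $h$ denotes the number of hyperplanes of $\hat{\mathcal A}$, then every root of the characteristic polynomial $\chi(\hat{\mathcal A},q)$ has real part equal to $h/l$.
   Context: A hyperplane arrangement $\mathcal A$ in a real vector space $V$ is a finite set of affine hyperplanes of $V$. Let $L_{\mathcal A}$ be the poset, ordered by reverse inclusion, of all nonempty affine subspaces of $V$ that are intersections of some hyperplanes of $\mathcal A$ (including $V$ itself, the minimum $\hat 0$). The characteristic polynomial is $\chi(\mathcal A,q)=\sum_{x\in L_{\mathcal A}}\mu(\hat 0,x)\,q^{\dim x}$, where $\mu$ is the Möbius function of $L_{\mathcal A}$. For integers $c\le d$ and a root system $\Phi$ with chosen positive roots $\Phi^+$, $\hat{\mathcal A}^{[c,d]}(\Phi)$ is the arrangement in the ambient space of $\Phi$ consisting of the hyperplanes $(\alpha,x)=k$ for $\alpha\in\Phi^+$ and $k=c,c+1,\dots,d$. Here $e_1,\dots,e_n$ is the standard basis of $\mathbb{R}^n$ and the positive roots are: $A_{n-1}$: $e_i-e_j$ ($1\le i<j\le n$), acting on $V=\{x:\sum x_i=0\}$; $B_n$: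 $e_i$ and $e_i\pm e_j$ ($i<j$); $C_n$: $2e_i$ and $e_i\pm e_j$ ($i<j$); $D_n$: $e_i\pm e_j$ ($i<j$); $BC_n$ (the non-reduced system $B_n\cup C_n$): $e_i$, $2e_i$, and $e_i\pm e_j$ ($i<j$). *)

theory Defs
  imports "HOL-Analysis.Analysis" "HOL-Computational_Algebra.Polynomial"
begin

datatype root_type = TA | TB | TC | TD | TBC

text \<open>Vectors in R^n are modelled as real ^ 'n, the index type 'n being finite and
linearly ordered (the order is used to choose positive roots e_i - e_j with i < j).
The standard basis vector e_i is axis i 1.\<close>

definition pos_roots :: "root_type \<Rightarrow> (real ^ 'n::{finite,linorder}) set" where
  "pos_roots t =
    (case t of
       TA \<Rightarrow> {axis i 1 - axis j 1 | i j. i < j}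
     | TB \<Rightarrow> {axis i 1 | i. True} \<union> {axis i 1 - axis j 1 | i j. i < j} \<union> {axis i 1 + axis j 1 | i j. i < j}
     | TC \<Rightarrow> {2 *\<^sub>R axis i 1 | i. True} \<union> {axis i 1 - axis j 1 | i j. i < j} \<union> {axis i 1 + axis j 1 | i j. i < j}
     | TD \<Rightarrow> {axis i 1 - axis j 1 | i j. i < j} \<union> {axis i 1 + axis j 1 | i j. i < j}
     | TBC \<Rightarrow> {axis i 1 | i. True} \<union> {2 *\<^sub>R axis i 1 | i. True}
              \<union> {axis i 1 - axis j 1 | i j. i < j} \<union> {axis i 1 + axis j 1 | i j. i < j})"

definition ambient :: "root_type \<Rightarrow> (real ^ 'n::{finite,linorder}) set" where
  "ambient t = (if t = TA then {x. (\<Sum>i\<in>UNIV. x $ i) = 0} else UNIV)"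

definition ambient_dim :: "root_type \<Rightarrow> 'n::{finite,linorder} itself \<Rightarrow> nat" where
  "ambient_dim t _ = (if t = TA then CARD('n) - 1 else CARD('n))"

definition hat_arr :: "int \<Rightarrow> int \<Rightarrow> root_type \<Rightarrow> (real ^ 'n::{finite,linorder}) set set" where
  "hat_arr c d t = {{x \<in> ambient t. \<alpha> \<bullet> x = of_int k} | \<alpha> k. \<alpha> \<in> pos_roots t \<and> c \<le> k \<and> k \<le> d}"

text \<open>Intersection poset L_A: all nonempty intersections of subsets of A, taken inside V
(the empty intersection being V itself). Ordered by reverse inclusion.\<close>
definition int_poset :: "'a set \<Rightarrow> 'a set set \<Rightarrow> 'a set set" where
  "int_poset V A = {X. (\<exists>B \<subseteq> A. X = V \<inter> \<Inter>B) \<and> X \<noteq> {}}"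

definition mobius :: "'a set \<Rightarrow> ('a \<Rightarrow> 'a \<Rightarrow> bool) \<Rightarrow> 'a \<Rightarrow> 'a \<Rightarrow> int" where
  "mobius P le = (THE m.
     (\<forall>x\<in>P. \<forall>y\<in>P. m x y =
        (if x = y then 1
         else if le x y then - (\<Sum>z\<in>{z\<in>P. le x z \<and> le z y \<and> z \<noteq> y}. m x z)
         else 0)) \<and>
     (\<forall>x y. x \<notin> P \<or> y \<notin> P \<longrightarrow> m x y = 0))"

definition char_poly :: "('a::euclidean_space) set \<Rightarrow> 'a set set \<Rightarrow> int poly" where
  "char_poly V A =
     (\<Sum>X\<in>int_poset V A.
        monom (mobius (int_poset V A) (\<lambda>X Y. Y \<subseteq> X) V X) (nat (aff_dim X)))"

end

theory Submission
  imports Defs "HOL-Computational_Algebra.Computational_Algebra" "HOL-Number_Theory.Cong"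
begin

text \<open>By the finite field method, \<open>\<chi>\<close> at a suitable modulus \<open>q\<close> counts the points \<open>x\<close> modulo \<open>q\<close> at which no
root takes a value in \<open>{1 - a..b}\<close>. Place a label at each \<open>x i\<close> on a circle of length \<open>q\<close> and,
outside type \<open>A\<close>, the negative label at \<open>- x i\<close>. For a suitable numbering of the labels the condition
says that, going round the circle, a label is followed by a larger one at distance at least \<open>a\<close> and by
a smaller one at distance at least \<open>a + m\<close>, where \<open>m = b + 1 - a\<close>. Only consecutive labels matter.
Hence in the generating function \<open>F\<close> over the
length of the circle the gaps contribute a power of \<open>X\<close> and a substitution \<open>X \<mapsto> X\<^sup>m\<close>: a
suitable \<open>F * (1 - X) ^ k1 * (1 - X\<^sup>2) ^ k2\<close> is \<open>X ^ \<alpha>\<close> times the dilation of the same expression for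
unconstrained labels, whose counts are powers \<open>j ^ l\<close>.

So \<open>\<chi>\<close> arises from a monomial by translations and by operators \<open>f(q) \<mapsto> (\<Sum>i<L. f(q - c i))\<close>. These
keep all roots on a common vertical line: if the roots of \<open>f\<close> have real part \<open>r\<close>, then \<open>\<bar>f(x - c)\<bar>\<close> and
\<open>\<bar>f(x)\<bar>\<close> differ off the line \<open>Re x = r + c / 2\<close>, and the symbol \<open>(\<Sum>i<L. w ^ i)\<close> has only unimodular
roots. As the sum of the \<open>l\<close> roots of \<open>\<chi>\<close> is the number \<open>h\<close> of hyperplanes, the line is \<open>Re x = h / l\<close>.\<close>

section \<open>Polynomials with all roots on a vertical line\<close>

text \<open>The comparison is with \<open>a = 0\<close>, \<open>m = 1\<close>, that is
  \<open>b = 0\<close>: the arrangement is empty and all counts are powers. A gap contributes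
  \<open>X ^ a / (1 - X)\<close>, and a further \<open>X ^ m\<close> at a descent; with
  \<open>X ^ a\<close> and the denominators stripped, a descent is the image of \<open>X\<close>
  under \<open>X \<mapsto> X ^ m\<close>. In a symmetric configuration gaps come in mirror pairs,
  which cost \<open>1 - X ^ 2\<close>. Where the axis crosses the circle away from the label 0 there
  is one gap \<open>1 - X\<close>, or two of them if a label does not constrain its negative. So
  \<open>k1\<close> is 1 for BC, 2 for B and C, and 4 for D, while type A has only factors
  \<open>1 - X\<close>. Always \<open>k1 + k2 = l + 1\<close>, just enough steps to replace the
  indicator of \<open>m dvd y\<close> by its mean. For even \<open>m\<close>, stride 2 preserves
  parity and the coefficients may depend on the parity of \<open>q\<close>; the proof follows odd
  \<open>q\<close> only. The obstacle in type D is that a cut at a label may leave an empty arc, on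
  which nothing constrains the label and its negative. Summing over all cuts with two inhabited arcs
  counts each configuration \<open>n - 2\<close> times, so \<open>n = 2\<close> is treated
  apart.\<close>

definition roots_on_line :: "real \<Rightarrow> complex poly \<Rightarrow> bool" where
  "roots_on_line r f \<longleftrightarrow> (\<forall>z. poly f z = 0 \<longrightarrow> Re z = r)"

text \<open>This is \<open>g\<close> evaluated at the translation of \<open>f\<close> by
  \<open>c\<close>, so that a factorization of \<open>g\<close> becomes a composition of
  operators.\<close>

definition shift_op :: "real \<Rightarrow> complex poly \<Rightarrow> complex poly \<Rightarrow> complex poly" where
  "shift_op c g f = (\<Sum>i\<le>degree g. smult (coeff g i) (f \<circ>\<^sub>p [:- of_real (c * real i), 1:]))"

text \<open>To the right of the bisector \<open>Re x = r + c / 2\<close> the point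
  \<open>x - c\<close> is strictly closer than \<open>x\<close> to every point of the line
  \<open>Re = r\<close>, hence to every root; the linear factors are compared one by one.\<close>

lemma norm_poly_shift_less:
  fixes f :: "complex poly"
  assumes f: "roots_on_line r f" "degree f > 0" and c: "c > 0" and x: "Re x > r + c / 2"
  shows "norm (poly f (x - of_real c)) < norm (poly f x)"
proof -
  obtain root where root: "smult (lead_coeff f) (\<Prod>i<degree f. [:-root i, 1:]) = f"
    using complex_poly_decompose' by blast
  have ev: "poly f y = lead_coeff f * (\<Prod>i<degree f. y - root i)" for y
    by (subst root[symmetric]) (simp add: poly_prod)
  have re: "Re (root i) = r" if "i < degree f" for i
  proof -
    have "poly f (root i) = 0"
      unfolding ev using that by (auto intro!: prod_zero)
    then show ?thesis using f by (auto simp: roots_on_line_def)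
  qed
  have less: "norm (x - of_real c - root i) < norm (x - root i)" if "i < degree f" for i
  proof -
    have "(Re x - c - r)\<^sup>2 < (Re x - r)\<^sup>2"
    proof -
      have "(Re x - r)\<^sup>2 - (Re x - c - r)\<^sup>2 = c * (2 * (Re x - r - c / 2))"
        by (simp add: power2_eq_square algebra_simps)
      also have "\<dots> > 0" using c x by (intro mult_pos_pos) auto
      finally show ?thesis by simp
    qed
    then show ?thesis using re[OF that] by (simp add: cmod_def)
  qed
  have "(\<Prod>i<degree f. norm (x - of_real c - root i)) < (\<Prod>i<degree f. norm (x - root i))"
    using f(2) less by (intro prod_mono_strict[where i=0]) (auto intro: less_imp_le dest: less)
  moreover have "lead_coeff f \<noteq> 0" using f(2) by auto
  ultimately show ?thesis
    unfolding ev norm_mult prod_norm[symmetric] by simp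
qed

text \<open>The reflection \<open>x \<mapsto> - x\<close> reduces this to the preceding lemma:
  \<open>g\<close> has its roots on \<open>Re = - r\<close>, and the point used is
  \<open>c - x\<close>.\<close>

lemma norm_poly_shift_greater:
  fixes f :: "complex poly"
  assumes f: "roots_on_line r f" "degree f > 0" and c: "c > 0" and x: "Re x < r + c / 2"
  shows "norm (poly f x) < norm (poly f (x - of_real c))"
proof -
  define g where "g = f \<circ>\<^sub>p [:0, -1:]"
  have g: "roots_on_line (-r) g"
    unfolding roots_on_line_def
  proof (intro allI impI)
    fix z assume "poly g z = 0"
    then have "poly f (- z) = 0" by (simp add: g_def poly_pcompose)
    then show "Re z = - r" using f(1) unfolding roots_on_line_def by (metis minus_equation_iff uminus_complex.sel(1))
  qed
  have dg: "degree g > 0" using f(2) by (simp add: g_def degree_pcompose)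
  have "Re (of_real c - x) > - r + c / 2" using x by simp
  from norm_poly_shift_less[OF g dg c this] show ?thesis
    by (simp add: g_def poly_pcompose)
qed

text \<open>At a root, \<open>\<bar>w\<bar> = 1\<close> makes the absolute values of
  \<open>f\<close> at \<open>z - c\<close> and at \<open>z\<close> equal, which the two strict
  inequalities allow only on the bisector. For constant \<open>f\<close> the difference is a nonzero
  constant.\<close>

lemma roots_on_line_diff:
  assumes f: "roots_on_line r f" and c: "c > 0" and w: "norm w = 1"
    and nz: "f \<circ>\<^sub>p [:- of_real c, 1:] - smult w f \<noteq> 0"
  shows "roots_on_line (r + c / 2) (f \<circ>\<^sub>p [:- of_real c, 1:] - smult w f)"
  unfolding roots_on_line_def
proof (intro allI impI)
  fix z assume z: "poly (f \<circ>\<^sub>p [:- of_real c, 1:] - smult w f) z = 0"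
  show "Re z = r + c / 2"
  proof (cases "degree f = 0")
    case True
    then obtain k where k: "f = [:k:]" by (metis degree_eq_zeroE)
    then show ?thesis using z nz by (auto simp: pcompose_pCons)
  next
    case False
    have "poly f (z - of_real c) = w * poly f z" using z by (simp add: poly_pcompose)
    then have "norm (poly f (z - of_real c)) = norm (poly f z)" using w by (simp add: norm_mult)
    then show ?thesis
      using norm_poly_shift_less[OF f _ c, of z] norm_poly_shift_greater[OF f _ c, of z] False
      by (cases "Re z" "r + c / 2" rule: linorder_cases) auto
  qed
qed

lemma smult_sum_right2: "smult w (\<Sum>i\<in>A. f i) = (\<Sum>i\<in>A. smult w (f i))"
  by (induction A rule: infinite_finite_induct) (auto simp: smult_add_right)

lemma shift_op_sum_bound:
  assumes "degree g \<le> N"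
  shows "shift_op c g f = (\<Sum>i\<le>N. smult (coeff g i) (f \<circ>\<^sub>p [:- of_real (c * real i), 1:]))"
  unfolding shift_op_def using assms
  by (intro sum.mono_neutral_left) (auto simp: coeff_eq_0)

text \<open>A factor \<open>X - w\<close> of the symbol acts as one more translation minus
  \<open>w\<close> times the identity. This allows the roots of \<open>g\<close> to be removed one
  at a time.\<close>

lemma shift_op_root_factor:
  "shift_op c ([:- w, 1:] * g) f
     = shift_op c g f \<circ>\<^sub>p [:- of_real c, 1:] - smult w (shift_op c g f)"
proof -
  have co: "coeff ([:- w, 1:] * g) i = (if i = 0 then 0 else coeff g (i - 1)) - w * coeff g i" for i
    by (cases i) (auto simp: coeff_pCons)
  have sh: "f \<circ>\<^sub>p [:- of_real (c * real i), 1:] \<circ>\<^sub>p [:- of_real c, 1:]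
      = f \<circ>\<^sub>p [:- of_real (c * real (Suc i)), 1:]" for i
    by (simp add: pcompose_assoc[symmetric] pcompose_pCons algebra_simps)
  let ?t = "\<lambda>i. f \<circ>\<^sub>p [:- of_real (c * real i), 1:]"
  let ?N = "degree g"
  have "degree ([:- w, 1:] * g) \<le> Suc ?N"
    by (rule order_trans[OF degree_mult_le]) simp
  then have "shift_op c ([:- w, 1:] * g) f = (\<Sum>i\<le>Suc ?N. smult (coeff ([:- w, 1:] * g) i) (?t i))"
    by (rule shift_op_sum_bound)
  also have "\<dots> = (\<Sum>i\<le>Suc ?N. smult (if i = 0 then 0 else coeff g (i - 1)) (?t i))
      - smult w (\<Sum>i\<le>Suc ?N. smult (coeff g i) (?t i))"
    by (simp only: co smult_diff_left sum_subtractf smult_sum_right2 smult_smult[symmetric])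
  also have "(\<Sum>i\<le>Suc ?N. smult (if i = 0 then 0 else coeff g (i - 1)) (?t i))
      = (\<Sum>i\<le>?N. smult (coeff g i) (?t (Suc i)))"
    by (subst sum.atMost_Suc_shift) simp
  also have "\<dots> = shift_op c g f \<circ>\<^sub>p [:- of_real c, 1:]"
    unfolding shift_op_def pcompose_sum pcompose_smult sh ..
  also have "(\<Sum>i\<le>Suc ?N. smult (coeff g i) (?t i)) = shift_op c g f"
    by (rule shift_op_sum_bound[symmetric]) simp
  finally show ?thesis .
qed

text \<open>Each root \<open>w\<close> of \<open>g\<close> is one application of
  \<open>roots_on_line_diff\<close> and moves the line by \<open>c / 2\<close>. Intermediate
  polynomials cannot vanish, because the remaining operators would map 0 to 0.\<close>

lemma roots_on_line_shift_op:
  assumes f: "roots_on_line r f" and c: "c > 0"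
    and g: "\<And>w. poly g w = 0 \<Longrightarrow> norm w = 1" and nz: "shift_op c g f \<noteq> 0"
  shows "\<exists>s. roots_on_line s (shift_op c g f)"
  using g nz
proof (induction "degree g" arbitrary: g)
  case 0
  then obtain k where k: "g = [:k:]" by (metis degree_eq_zeroE)
  then have "shift_op c g f = smult k f"
    by (simp add: shift_op_def)
  then show ?case using 0 f by (auto simp: roots_on_line_def)
next
  case (Suc d)
  obtain w where w: "poly g w = 0"
    using fundamental_theorem_of_algebra_alt[of g] Suc.hyps(2) by (metis Suc_neq_Zero constant_degree fundamental_theorem_of_algebra)
  then obtain h where h: "g = [:- w, 1:] * h" by (metis dvdE poly_eq_0_iff_dvd)
  have "g \<noteq> 0" using Suc.hyps(2) by auto
  then have "h \<noteq> 0" using h by auto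
  then have "degree g = 1 + degree h" unfolding h by (subst degree_mult_eq) auto
  then have dh: "d = degree h" using Suc.hyps(2) by simp
  have eq: "shift_op c g f = shift_op c h f \<circ>\<^sub>p [:- of_real c, 1:] - smult w (shift_op c h f)"
    unfolding h by (rule shift_op_root_factor)
  have "shift_op c h f \<noteq> 0" using eq Suc.prems(2) by auto
  then obtain s where s: "roots_on_line s (shift_op c h f)"
    using Suc.hyps(1)[OF dh] Suc.prems(1) h by auto
  have "norm w = 1" using Suc.prems(1) w by blast
  then show ?case
    using roots_on_line_diff[OF s c] eq Suc.prems(2) by metis
qed

lemma roots_on_line_shift:
  "roots_on_line r f \<Longrightarrow> roots_on_line (r + c) (f \<circ>\<^sub>p [:- of_real c, 1:])"
  unfolding roots_on_line_def
proof (intro allI impI)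
  fix z assume *: "\<forall>z. poly f z = 0 \<longrightarrow> Re z = r" "poly (f \<circ>\<^sub>p [:- of_real c, 1:]) z = 0"
  then have "Re (z - of_real c) = r" by (simp add: poly_pcompose del: minus_complex.sel)
  then show "Re z = r + c" unfolding minus_complex.sel Re_complex_of_real by linarith
qed

text \<open>Vieta for the two highest coefficients. The degree bound belongs to the induction
  because it makes the coefficient of index \<open>Suc n\<close> of the shorter product
  vanish.\<close>

lemma monic_prod_linear_coeffs:
  fixes root :: "nat \<Rightarrow> 'a::comm_ring_1"
  shows "coeff (\<Prod>i<n. [:- root i, 1:]) n = 1 \<and> degree (\<Prod>i<n. [:- root i, 1:]) \<le> n
    \<and> (n > 0 \<longrightarrow> coeff (\<Prod>i<n. [:- root i, 1:]) (n - 1) = - (\<Sum>i<n. root i))"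
proof (induction n)
  case (Suc n)
  let ?P = "\<Prod>i<n. [:- root i, 1:]"
  have eq: "(\<Prod>i<Suc n. [:- root i, 1:]) = pCons 0 ?P - smult (root n) ?P"
    by (simp add: mult.commute)
  have "degree (pCons 0 ?P - smult (root n) ?P) \<le> Suc n"
    using Suc.IH by (intro degree_diff_le) (auto intro: order_trans[OF degree_pCons_le] order_trans[OF degree_smult_le])
  moreover have "coeff ?P (Suc n) = 0" using Suc.IH by (intro coeff_eq_0) auto
  ultimately show ?case unfolding eq using Suc.IH
    by (cases n) (auto simp: coeff_pCons)
qed auto

text \<open>The operators only show that some vertical line contains the roots. Its position is read
  off from the sum of the \<open>l\<close> roots, which is minus the subleading coefficient and has
  real part \<open>l * r\<close>.\<close>

lemma roots_on_line_subleading: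
  assumes f: "roots_on_line r f" and d: "degree f = l" "l > 0" "lead_coeff f = 1"
    and h: "coeff f (l - 1) = - of_real h"
  shows "r = h / real l"
proof -
  obtain root where root: "smult (lead_coeff f) (\<Prod>i<degree f. [:-root i, 1:]) = f"
    using complex_poly_decompose' by blast
  then have fe: "f = (\<Prod>i<l. [:-root i, 1:])" using d by simp
  have re: "Re (root i) = r" if "i < l" for i
  proof -
    have "poly f (root i) = 0"
      unfolding fe poly_prod using that by (auto intro!: prod_zero)
    then show ?thesis using f by (auto simp: roots_on_line_def)
  qed
  have "complex_of_real h = (\<Sum>i<l. root i)"
    using monic_prod_linear_coeffs[where n=l and root=root] h d fe by auto
  then have "h = (\<Sum>i<l. Re (root i))" by (metis Re_complex_of_real Re_sum)
  also have "\<dots> = real l * r" using re by simp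
  finally show ?thesis using d by (simp add: field_simps)
qed

text \<open>Multiplication by \<open>w - 1\<close> turns the sum into \<open>w ^ L - 1\<close>, so
  \<open>w\<close> is a root of unity.\<close>

lemma norm_root_geometric_poly:
  fixes w :: complex
  assumes "poly (\<Sum>i<L. monom 1 i) w = 0" "L > 0"
  shows "norm w = 1"
proof -
  have "(\<Sum>i<L. w ^ i) = 0" using assms by (simp add: poly_sum poly_monom)
  moreover have "w ^ L - 1 = (w - 1) * (\<Sum>i<L. w ^ i)" by (rule power_diff_1_eq)
  ultimately have "w ^ L = 1" by simp
  then show ?thesis using power_eq_1_iff[of w L] assms(2) by simp
qed

section \<open>Dilated power series\<close>

definition step_sum :: "nat \<Rightarrow> nat \<Rightarrow> (int \<Rightarrow> complex) \<Rightarrow> int \<Rightarrow> complex" where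
  "step_sum c L f y = (\<Sum>i<L. f (y - int (c * i)))"

text \<open>These are polynomials in \<open>y\<close> of degree below \<open>d\<close> whose
  coefficients are functions \<open>w\<close> annihilated by every operator in \<open>ops\<close>.
  The bound \<open>d\<close> is the number of such operators that suffice to reach 0.\<close>

inductive quasi_null :: "(nat \<times> nat) set \<Rightarrow> nat \<Rightarrow> (int \<Rightarrow> complex) \<Rightarrow> bool" for ops where
  zero: "quasi_null ops d (\<lambda>_. 0)"
| add: "quasi_null ops d f \<Longrightarrow> quasi_null ops d g \<Longrightarrow> quasi_null ops d (\<lambda>y. f y + g y)"
| monom: "(\<And>c L y. (c, L) \<in> ops \<Longrightarrow> step_sum c L w y = 0) \<Longrightarrow> i < d
           \<Longrightarrow> quasi_null ops d (\<lambda>y. w y * of_int y ^ i)"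

lemma quasi_null_sum:
  assumes "\<And>i. i \<in> A \<Longrightarrow> quasi_null ops d (f i)"
  shows "quasi_null ops d (\<lambda>y. \<Sum>i\<in>A. f i y)"
  using assms
  by (induction A rule: infinite_finite_induct) (auto intro: quasi_null.intros)

lemma quasi_null_0: "quasi_null ops 0 f \<Longrightarrow> f y = 0"
  by (induction "0::nat" f rule: quasi_null.induct) auto

text \<open>After expanding \<open>(y - c * k) ^ i\<close>, the coefficient of \<open>y ^ i\<close>
  is the step sum of \<open>w\<close>, hence 0, and the degree drops. The lower coefficients
  \<open>v e\<close> combine translates of \<open>w\<close> and are therefore still annihilated by
  all operators.\<close>

lemma quasi_null_step:
  assumes "quasi_null ops (Suc d) f" "(c, L) \<in> ops"
  shows "quasi_null ops d (step_sum c L f)"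
  using assms
proof (induction "Suc d" f rule: quasi_null.induct)
  case zero
  then show ?case by (simp add: step_sum_def[abs_def] quasi_null.zero)
next
  case (add f g)
  have "step_sum c L (\<lambda>y. f y + g y) = (\<lambda>y. step_sum c L f y + step_sum c L g y)"
    by (simp add: step_sum_def[abs_def] sum.distrib)
  then show ?case using add by (auto intro: quasi_null.add)
next
  case (monom w i)
  define v where "v e y = of_nat (i choose e) * (\<Sum>k<L. w (y - int (c * k)) * (- of_nat (c * k)) ^ (i - e))" for e y
  have v0: "step_sum c' L' (v e) y = 0" if "(c', L') \<in> ops" for c' L' e y
  proof -
    have "step_sum c' L' (v e) y
       = of_nat (i choose e) * (\<Sum>k<L. (- of_nat (c * k)) ^ (i - e) * step_sum c' L' w (y - int (c * k)))"
      unfolding step_sum_def v_def sum_distrib_left sum_distrib_right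
      by (subst sum.swap) (simp add: algebra_simps)
    then show ?thesis using monom(1)[OF that] by simp
  qed
  have vi: "v i y = 0" for y
    using monom(1)[OF monom.prems] by (simp add: v_def step_sum_def)
  have "step_sum c L (\<lambda>y. w y * of_int y ^ i) y = (\<Sum>e<i. v e y * of_int y ^ e)" for y
  proof -
    have "step_sum c L (\<lambda>y. w y * of_int y ^ i) y
        = (\<Sum>k<L. w (y - int (c * k)) * (of_int y + - of_nat (c * k)) ^ i)"
      by (simp add: step_sum_def)
    also have "\<dots> = (\<Sum>e\<le>i. v e y * of_int y ^ e)"
      unfolding binomial_ring v_def sum_distrib_left sum_distrib_right
      by (subst sum.swap) (simp add: algebra_simps)
    also have "\<dots> = (\<Sum>e<i. v e y * of_int y ^ e)"
      using vi by (simp add: lessThan_Suc_atMost[symmetric])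
    finally show ?thesis .
  qed
  then have "step_sum c L (\<lambda>y. w y * of_int y ^ i) = (\<lambda>y. \<Sum>e\<in>{..<i}. v e y * of_int y ^ e)" by auto
  moreover have "quasi_null ops d (\<lambda>y. \<Sum>e\<in>{..<i}. v e y * of_int y ^ e)"
    using monom(2) v0 by (intro quasi_null_sum quasi_null.monom) auto
  ultimately show ?case by simp
qed

lemma quasi_null_funpow:
  assumes "quasi_null ops (k + d) f" "(c, L) \<in> ops"
  shows "quasi_null ops d ((step_sum c L ^^ k) f)"
  using assms
proof (induction k arbitrary: f)
  case (Suc k)
  have "quasi_null ops (k + d) (step_sum c L f)" using Suc.prems by (intro quasi_null_step) auto
  from Suc.IH[OF this] Suc.prems(2) show ?case by (simp add: funpow_swap1)
qed auto

lemma step_sum_diff: "step_sum c L (\<lambda>y. f y - g y) = (\<lambda>y. step_sum c L f y - step_sum c L g y)"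
  by (simp add: step_sum_def[abs_def] sum_subtractf)

lemma funpow_step_sum_diff:
  "(step_sum c L ^^ k) (\<lambda>y. f y - g y) = (\<lambda>y. (step_sum c L ^^ k) f y - (step_sum c L ^^ k) g y)"
  by (induction k) (auto simp: step_sum_diff)

text \<open>Equality is asked for large arguments only, since a coefficient function is 0 at
  negative arguments and a polynomial in general is not.\<close>

definition agree :: "(int \<Rightarrow> complex) \<Rightarrow> (int \<Rightarrow> complex) \<Rightarrow> bool" where
  "agree f g \<longleftrightarrow> (\<exists>y0. \<forall>y\<ge>y0. f y = g y)"

lemma agree_step_sum:
  assumes "agree f g"
  shows "agree (step_sum c L f) (step_sum c L g)"
proof -
  obtain y0 where y0: "\<And>y. y \<ge> y0 \<Longrightarrow> f y = g y" using assms by (auto simp: agree_def)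
  have "step_sum c L f y = step_sum c L g y" if y: "y \<ge> y0 + int (c * L)" for y
    unfolding step_sum_def
  proof (intro sum.cong refl y0)
    fix i assume "i \<in> {..<L}"
    then have "c * i \<le> c * L" by simp
    then have "int (c * i) \<le> int (c * L)" by linarith
    then show "y0 \<le> y - int (c * i)" using y by linarith
  qed
  then show ?thesis by (auto simp: agree_def)
qed

lemma agree_funpow: "agree f g \<Longrightarrow> agree ((step_sum c L ^^ k) f) ((step_sum c L ^^ k) g)"
  by (induction k) (auto intro: agree_step_sum)

definition aligned :: "complex poly \<Rightarrow> bool" where
  "aligned p \<longleftrightarrow> p = 0 \<or> (\<exists>r. roots_on_line r p)"

definition geo_poly :: "nat \<Rightarrow> complex poly" where
  "geo_poly L = (\<Sum>i<L. monom 1 i)"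

lemma aligned_shift_op:
  assumes "aligned p" "c > 0" "\<And>w. poly g w = 0 \<Longrightarrow> norm w = 1"
  shows "aligned (shift_op c g p)"
proof (cases "p = 0")
  case True
  then show ?thesis by (simp add: aligned_def shift_op_def)
next
  case False
  then show ?thesis using assms roots_on_line_shift_op unfolding aligned_def by metis
qed

lemma aligned_geo:
  assumes "aligned p" "c > 0" "L > 0"
  shows "aligned (shift_op c (geo_poly L) p)"
  using assms norm_root_geometric_poly unfolding geo_poly_def by (intro aligned_shift_op) auto

lemma aligned_funpow_geo:
  assumes "aligned p" "c > 0" "L > 0"
  shows "aligned ((shift_op c (geo_poly L) ^^ k) p)"
  by (induction k) (use assms aligned_geo in auto)

lemma aligned_smult: "aligned p \<Longrightarrow> aligned (smult k p)"
  by (cases "k = 0") (auto simp: aligned_def roots_on_line_def)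

lemma aligned_shift: "aligned p \<Longrightarrow> aligned (p \<circ>\<^sub>p [:- of_real c, 1:])"
  unfolding aligned_def using roots_on_line_shift[of _ p c] by auto

lemma aligned_monom: "aligned (monom 1 l)"
  by (auto simp: aligned_def roots_on_line_def poly_monom)

lemma poly_shift_geo:
  "poly (shift_op (real c) (geo_poly L) p) (of_int y) = step_sum c L (\<lambda>y. poly p (of_int y)) y"
proof (cases "L = 0")
  case True
  then show ?thesis by (simp add: step_sum_def geo_poly_def shift_op_def)
next
  case False
  have co: "coeff (geo_poly L) i = (if i < L then 1 else 0)" for i
    by (simp add: geo_poly_def coeff_sum)
  have "degree (geo_poly L) \<le> L - 1" by (rule degree_le) (auto simp: co)
  then have "shift_op (real c) (geo_poly L) p =
      (\<Sum>i\<le>L - 1. smult (coeff (geo_poly L) i) (p \<circ>\<^sub>p [:- of_real (real c * real i), 1:]))"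
    by (rule shift_op_sum_bound)
  also have "\<dots> = (\<Sum>i<L. p \<circ>\<^sub>p [:- of_real (real c * real i), 1:])"
    using False by (intro sum.cong) (auto simp: co)
  finally show ?thesis by (simp add: step_sum_def poly_sum poly_pcompose)
qed

lemma poly_funpow_shift_geo:
  "(\<lambda>y. poly ((shift_op (real c) (geo_poly L) ^^ k) p) (of_int y))
     = (step_sum c L ^^ k) (\<lambda>y. poly p (of_int y))"
proof (induction k)
  case (Suc k)
  show ?case by (rule ext) (simp add: poly_shift_geo Suc)
qed auto

section \<open>Coefficient functions and dilation of power series\<close>

text \<open>Extension by 0 to negative integers makes multiplication by \<open>X ^ k\<close> an
  exact translation.\<close>

definition fps_fun :: "complex fps \<Rightarrow> int \<Rightarrow> complex" where
  "fps_fun F y = (if y \<ge> 0 then fps_nth F (nat y) else 0)"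

lemma fps_fun_X_power_mult: "fps_fun (fps_X ^ k * F) y = fps_fun F (y - int k)"
proof -
  have "nat y - k = nat (y - int k)" by simp
  then show ?thesis
    by (cases "y < 0"; cases "y < int k") (auto simp: fps_fun_def fps_X_power_mult_nth nat_less_iff)
qed

lemma fps_fun_sum: "fps_fun (\<Sum>i\<in>A. F i) y = (\<Sum>i\<in>A. fps_fun (F i) y)"
  by (simp add: fps_fun_def fps_sum_nth)

lemma fps_fun_geo: "fps_fun ((\<Sum>i<L. fps_X ^ (c * i)) * F) = step_sum c L (fps_fun F)"
  by (rule ext) (simp add: sum_distrib_right fps_fun_sum fps_fun_X_power_mult step_sum_def)

lemma fps_fun_geo_power:
  "fps_fun ((\<Sum>i<L. fps_X ^ (c * i)) ^ k * F) = (step_sum c L ^^ k) (fps_fun F)"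
  by (induction k) (auto simp: fps_fun_geo mult.assoc)

definition power_fps :: "nat \<Rightarrow> complex fps" where
  "power_fps l = Abs_fps (\<lambda>j. of_nat j ^ l)"

definition dilate :: "nat \<Rightarrow> complex fps \<Rightarrow> complex fps" where
  "dilate m F = F oo fps_X ^ m"

lemma dilate_mult: "m > 0 \<Longrightarrow> dilate m (F * G) = dilate m F * dilate m G"
  unfolding dilate_def by (rule fps_compose_mult_distrib) auto

lemma dilate_1 [simp]: "dilate m 1 = 1"
  by (simp add: dilate_def)

lemma dilate_power: "m > 0 \<Longrightarrow> dilate m (F ^ k) = dilate m F ^ k"
  by (induction k) (auto simp: dilate_mult)

lemma dilate_0 [simp]: "dilate m 0 = 0"
  by (simp add: dilate_def)

lemma dilate_add: "dilate m (F + G) = dilate m F + dilate m G"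
  by (simp add: dilate_def fps_compose_add_distrib)

lemma dilate_diff: "dilate m (F - G) = dilate m F - dilate m G"
  by (simp add: dilate_def fps_compose_sub_distrib)

lemma dilate_sum: "dilate m (\<Sum>i\<in>A. F i) = (\<Sum>i\<in>A. dilate m (F i))"
  by (induction A rule: infinite_finite_induct) (auto simp: dilate_add)

lemma dilate_X [simp]: "m > 0 \<Longrightarrow> dilate m fps_X = fps_X ^ m"
  by (simp add: dilate_def fps_X_fps_compose_startby0)

lemma dilate_X_power: "m > 0 \<Longrightarrow> dilate m (fps_X ^ k) = fps_X ^ (m * k)"
  by (simp add: dilate_power power_mult)

lemma dilate_nth: "m > 0 \<Longrightarrow> fps_nth (dilate m F) n = (if m dvd n then fps_nth F (n div m) else 0)"
proof -
  assume m: "m > 0"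
  have "fps_nth (dilate m F) n = (\<Sum>i=0..n. fps_nth F i * (if n = m * i then 1 else 0))"
    by (simp add: dilate_def fps_compose_nth power_mult[symmetric] fps_X_power_nth)
  also have "\<dots> = (\<Sum>i\<in>{i\<in>{0..n}. n = m * i}. fps_nth F i)"
    by (subst sum.inter_filter) (auto intro!: sum.cong)
  also have "{i\<in>{0..n}. n = m * i} = (if m dvd n then {n div m} else {})"
    using m by (auto simp: div_le_dividend)
  finally show ?thesis by simp
qed

text \<open>As \<open>1 - X ^ m\<close> is \<open>1 - X\<close> times a geometric sum, the dilated
  denominators are divisible by the original ones. After cancellation there remain geometric
  factors, which act on coefficients as step sums of length \<open>m\<close> with strides 1 and
  2.\<close>

lemma gap_series_solve:
  assumes m: "m > 0"
    and F: "F * (1 - fps_X) ^ k1 * (1 - fps_X ^ 2) ^ k2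
      = fps_X ^ al * dilate m ((1 - fps_X) ^ k1 * (1 - fps_X ^ 2) ^ k2 * D)"
  shows "F = fps_X ^ al * ((\<Sum>i<m. fps_X ^ (1 * i)) ^ k1 * ((\<Sum>i<m. fps_X ^ (2 * i)) ^ k2 * dilate m D))"
proof -
  have g1: "1 - fps_X ^ m = (1 - fps_X :: complex fps) * (\<Sum>i<m. fps_X ^ i)"
    using power_diff_1_eq[of "fps_X :: complex fps" m] by (simp add: algebra_simps)
  have g2: "1 - fps_X ^ (m * 2) = (1 - fps_X ^ 2 :: complex fps) * (\<Sum>i<m. fps_X ^ (2 * i))"
    using power_diff_1_eq[of "fps_X ^ 2 :: complex fps" m]
    by (simp add: algebra_simps power_mult[symmetric])
  let ?K = "(1 - fps_X :: complex fps) ^ k1 * (1 - fps_X ^ 2) ^ k2"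
  have "dilate m ((1 - fps_X) ^ k1 * (1 - fps_X ^ 2) ^ k2 * D)
      = (1 - fps_X ^ m) ^ k1 * (1 - fps_X ^ (m * 2)) ^ k2 * dilate m D"
    using m by (simp add: dilate_mult dilate_power dilate_diff power_mult)
  also have "\<dots> = ?K * ((\<Sum>i<m. fps_X ^ i) ^ k1 * ((\<Sum>i<m. fps_X ^ (2 * i)) ^ k2 * dilate m D))"
    unfolding g1 g2 power_mult_distrib by (simp add: algebra_simps)
  finally have "?K * F = ?K * (fps_X ^ al * ((\<Sum>i<m. fps_X ^ (1 * i)) ^ k1 * ((\<Sum>i<m. fps_X ^ (2 * i)) ^ k2 * dilate m D)))"
    using F by (simp add: algebra_simps)
  moreover have "(1 - fps_X :: complex fps) \<noteq> 0" "(1 - fps_X ^ 2 :: complex fps) \<noteq> 0"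
  proof -
    have "fps_nth (1 - fps_X :: complex fps) 0 = 1" "fps_nth (1 - fps_X ^ 2 :: complex fps) 0 = 1" by auto
    then show "(1 - fps_X :: complex fps) \<noteq> 0" "(1 - fps_X ^ 2 :: complex fps) \<noteq> 0" by (metis fps_zero_nth zero_neq_one)+
  qed
  ultimately show ?thesis by simp
qed

text \<open>Since \<open>c\<close> is invertible modulo \<open>m\<close>, the multiples
  \<open>c * i\<close> with \<open>i < m\<close> meet every residue exactly once. Hence averaging
  over \<open>m\<close> steps of stride \<open>c\<close> gives a value independent of
  \<open>y\<close>.\<close>

lemma sum_indicator_residue:
  assumes "m > 0" "coprime c m"
  shows "(\<Sum>i<m. if int m dvd y - int (c * i) then 1 else 0) = (1::complex)"
proof -
  have "\<exists>!i. i < m \<and> int m dvd y - int (c * i)"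
  proof -
    obtain d where d: "[int c * d = 1] (mod int m)"
      using assms(2) by (metis cong_solve_coprime_int coprime_int_iff)
    define i where "i = nat ((d * y) mod int m)"
    have i: "int i = (d * y) mod int m" using assms(1) by (simp add: i_def)
    have "[int c * int i = int c * (d * y)] (mod int m)" unfolding i by (intro cong_mult) auto
    also have "[int c * (d * y) = 1 * y] (mod int m)" unfolding mult.assoc[symmetric] using d by (intro cong_mult) auto
    finally have "int m dvd y - int (c * i)" by (simp add: cong_iff_dvd_diff dvd_diff_commute)
    moreover have "i < m" using i assms(1) by (metis mod_less_divisor of_nat_0_less_iff of_nat_less_iff pos_mod_bound)
    moreover have "j = i" if "j < m" "int m dvd y - int (c * j)" for j
    proof -
      have "int m dvd (y - int (c * j)) - (y - int (c * i))"
        using that \<open>int m dvd y - int (c * i)\<close> by (rule_tac dvd_diff)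
      also have "(y - int (c * j)) - (y - int (c * i)) = int c * (int i - int j)" by (simp add: algebra_simps)
      finally have "int m dvd int i - int j"
        using assms(2) by (simp add: coprime_commute coprime_dvd_mult_right_iff)
      then have "[i = j] (mod m)" by (metis cong_iff_dvd_diff cong_int_iff)
      then show ?thesis using that(1) \<open>i < m\<close> by (auto dest: cong_less_modulus_unique_nat)
    qed
    ultimately show ?thesis by blast
  qed
  then obtain i where i: "{j \<in> {..<m}. int m dvd y - int (c * j)} = {i}" by blast
  have "(\<Sum>i<m. if int m dvd y - int (c * i) then 1 else 0) = (\<Sum>j\<in>{j \<in> {..<m}. int m dvd y - int (c * j)}. (1::complex))"
    by (rule sum.inter_filter[symmetric]) simp
  then show ?thesis unfolding i by simp
qed

text \<open>Writing \<open>F\<close> as the fully dilated series \<open>dilate m (power_fps l)\<close> hit by \<open>k1\<close> averaging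
steps of stride 1 and \<open>k2\<close> of stride 2, the \<open>l + 1 = k1 + k2\<close> steps annihilate the difference
between the indicator of \<open>m dvd y\<close> and its mean \<open>1 / m\<close>. If \<open>m\<close> is even and stride 2 occurs, the mean
has to be taken over even \<open>y\<close> only.\<close>

lemma agree_dilate_power:
  assumes "m > 0"
  shows "agree (fps_fun (dilate m (power_fps l)))
    (\<lambda>y. (if int m dvd y then 1 / of_nat m ^ l else 0) * of_int y ^ l)"
proof -
  have "fps_fun (dilate m (power_fps l)) y = (if int m dvd y then 1 / of_nat m ^ l else 0) * of_int y ^ l" if y: "y \<ge> 0" for y
  proof -
    obtain n where n: "y = int n" using nonneg_int_cases[OF y] by blast
    have "fps_fun (dilate m (power_fps l)) y = (if m dvd n then of_nat (n div m) ^ l else 0)"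
      using assms by (simp add: n fps_fun_def dilate_nth power_fps_def)
    also have "\<dots> = (if int m dvd y then 1 / of_nat m ^ l else 0) * of_int y ^ l"
    proof (cases "m dvd n")
      case True
      then obtain k where k: "n = m * k" by blast
      have "n div m = k" using k assms by simp
      then show ?thesis using k assms by (simp add: n power_mult_distrib)
    next
      case False
      then have "\<not> int m dvd y" by (simp add: n)
      then show ?thesis using False by simp
    qed
    finally show ?thesis .
  qed
  then show ?thesis unfolding agree_def by (intro exI[of _ 0]) simp
qed

text \<open>The polynomial obtained when the indicator is replaced by its mean \<open>s\<close>
  under the same step sums.\<close>

definition mean_poly :: "nat \<Rightarrow> nat \<Rightarrow> nat \<Rightarrow> nat \<Rightarrow> complex \<Rightarrow> nat \<Rightarrow> nat \<Rightarrow> nat \<Rightarrow> complex poly" where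
  "mean_poly c1 L1 c2 L2 s k1 k2 l =
     (shift_op (real c1) (geo_poly L1) ^^ k1) ((shift_op (real c2) (geo_poly L2) ^^ k2) (smult s (monom 1 l)))"

lemma aligned_mean_poly:
  "c1 > 0 \<Longrightarrow> L1 > 0 \<Longrightarrow> c2 > 0 \<Longrightarrow> L2 > 0 \<Longrightarrow> aligned (mean_poly c1 L1 c2 L2 s k1 k2 l)"
  unfolding mean_poly_def by (intro aligned_funpow_geo aligned_smult aligned_monom) auto

lemma poly_mean_poly:
  "(\<lambda>y. poly (mean_poly c1 L1 c2 L2 s k1 k2 l) (of_int y))
    = (step_sum c1 L1 ^^ k1) ((step_sum c2 L2 ^^ k2) (\<lambda>y. s * of_int y ^ l))"
  unfolding mean_poly_def poly_funpow_shift_geo by (simp add: poly_monom)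

text \<open>The difference has degree \<open>l\<close> in \<open>y\<close> with annihilated
  coefficient \<open>u - v\<close>, so \<open>l + 1\<close> operators reduce it to 0. This is why
  the number of gap factors has to be \<open>l + 1\<close>.\<close>

lemma funpow_step_sum_eqI:
  assumes k: "k1 + k2 = Suc l"
    and w: "\<And>c L y. (c, L) \<in> ops \<Longrightarrow> step_sum c L (\<lambda>y. u y - v y) y = 0"
    and ops: "(c1, L1) \<in> ops" "k2 > 0 \<Longrightarrow> (c2, L2) \<in> ops"
  shows "(step_sum c1 L1 ^^ k1) ((step_sum c2 L2 ^^ k2) (\<lambda>y. u y * of_int y ^ l))
       = (step_sum c1 L1 ^^ k1) ((step_sum c2 L2 ^^ k2) (\<lambda>y. v y * of_int y ^ l))"
proof -
  have "quasi_null ops (k2 + k1) (\<lambda>y. (u y - v y) * of_int y ^ l)"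
    using k w by (intro quasi_null.monom) auto
  then have "quasi_null ops k1 ((step_sum c2 L2 ^^ k2) (\<lambda>y. (u y - v y) * of_int y ^ l))"
    using ops(2) quasi_null_funpow[of ops k2 k1] by (cases "k2 = 0") auto
  then have "quasi_null ops 0 ((step_sum c1 L1 ^^ k1) ((step_sum c2 L2 ^^ k2) (\<lambda>y. (u y - v y) * of_int y ^ l)))"
    using ops(1) quasi_null_funpow[of ops k1 0] by simp
  from quasi_null_0[OF this] show ?thesis
    by (simp add: left_diff_distrib funpow_step_sum_diff fun_eq_iff)
qed

lemma step_sum_const: "step_sum c L (\<lambda>y. k) y = of_nat L * k"
  by (simp add: step_sum_def)

text \<open>Every stride that occurs is coprime to \<open>m\<close>, so each step sum sees the
  indicator only through its mean over all integers.\<close>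

lemma odd_count_polynomial_unit:
  assumes m: "m > 0" "odd m \<or> k2 = 0" and k: "k1 + k2 = Suc l"
  shows "\<exists>H. aligned H \<and> agree ((step_sum 1 m ^^ k1) ((step_sum 2 m ^^ k2) (fps_fun (dilate m (power_fps l)))))
     (\<lambda>y. poly H (of_int y))"
proof -
  define u where "u y = (if int m dvd y then 1 / of_nat m ^ l else 0 :: complex)" for y
  \<comment> \<open>\<open>u\<close> has the value \<open>1 / m ^ l\<close> on one residue class out
    of \<open>m\<close>; the mean has one more factor \<open>1 / m\<close>.\<close>
  define s :: complex where "s = 1 / of_nat m ^ Suc l"
  have c: "step_sum c m (\<lambda>y. u y - s) y = 0" if "coprime c m" for c y
  proof -
    have "step_sum c m u y = (\<Sum>i<m. if int m dvd y - int (c * i) then 1 else 0) / of_nat m ^ l"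
      unfolding step_sum_def u_def sum_divide_distrib by (intro sum.cong) auto
    also have "\<dots> = 1 / of_nat m ^ l" using sum_indicator_residue[OF m(1) that] by simp
    finally show ?thesis using m(1) by (simp add: step_sum_diff step_sum_const s_def)
  qed
  define ops where "ops = (if k2 = 0 then {(1, m)} else {(1::nat, m), (2, m)})"
  have "(step_sum 1 m ^^ k1) ((step_sum 2 m ^^ k2) (\<lambda>y. u y * of_int y ^ l))
       = (step_sum 1 m ^^ k1) ((step_sum 2 m ^^ k2) (\<lambda>y. s * of_int y ^ l))"
    by (rule funpow_step_sum_eqI[OF k, where ops=ops])
       (use c m(2) in \<open>auto simp: ops_def split: if_splits\<close>)
  also have "\<dots> = (\<lambda>y. poly (mean_poly 1 m 2 m s k1 k2 l) (of_int y))"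
    by (rule poly_mean_poly[symmetric])
  finally have eq: "(step_sum 1 m ^^ k1) ((step_sum 2 m ^^ k2) (\<lambda>y. u y * of_int y ^ l))
       = (\<lambda>y. poly (mean_poly 1 m 2 m s k1 k2 l) (of_int y))" .
  have "agree ((step_sum 1 m ^^ k1) ((step_sum 2 m ^^ k2) (fps_fun (dilate m (power_fps l)))))
     (\<lambda>y. poly (mean_poly 1 m 2 m s k1 k2 l) (of_int y))"
    using agree_funpow[OF agree_funpow[OF agree_dilate_power[OF m(1), of l], of k2 2 m], of k1 1 m]
    unfolding u_def[symmetric] eq .
  then show ?thesis using aligned_mean_poly[of 1 m 2 m s k1 k2 l] m by auto
qed

definition pair_sum :: "(int \<Rightarrow> complex) \<Rightarrow> int \<Rightarrow> complex" where
  "pair_sum f y = f y + f (y - 1)"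

lemma step_sum_add: "step_sum c (A + B) f y = step_sum c A f y + step_sum c B f (y - int (c * A))"
  by (induction B) (auto simp: step_sum_def algebra_simps)

text \<open>A block of \<open>2 * M\<close> consecutive terms consists of two interleaved blocks of
  stride 2.\<close>

lemma step_sum_1_even: "step_sum 1 (2 * M) f = pair_sum (step_sum 2 M f)"
proof
  fix y
  show "step_sum 1 (2 * M) f y = pair_sum (step_sum 2 M f) y"
    by (induction M) (auto simp: step_sum_def pair_sum_def algebra_simps)
qed

lemma pair_sum_step_sum: "pair_sum (step_sum c L f) = step_sum c L (pair_sum f)"
  by (rule ext) (simp add: pair_sum_def step_sum_def sum.distrib algebra_simps)

lemma funpow_step_sum_1_even:
  "(step_sum 1 (2 * M) ^^ k) f = (pair_sum ^^ k) ((step_sum 2 M ^^ k) f)"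
proof (induction k)
  case (Suc k)
  have "step_sum c L ((pair_sum ^^ k) g) = (pair_sum ^^ k) (step_sum c L g)" for c L g
    by (induction k) (auto simp: pair_sum_step_sum[symmetric])
  from this[of 2 M] show ?case using Suc step_sum_1_even[of M] by (simp add: funpow_swap1[symmetric])
qed auto

lemma agree_pair_sum: "agree f g \<Longrightarrow> agree (pair_sum f) (pair_sum g)"
proof -
  assume "agree f g"
  then obtain y0 where "\<And>y. y \<ge> y0 \<Longrightarrow> f y = g y" by (auto simp: agree_def)
  then have "\<forall>y\<ge>y0 + 1. pair_sum f y = pair_sum g y" by (simp add: pair_sum_def)
  then show ?thesis unfolding agree_def by blast
qed

lemma agree_funpow_pair_sum: "agree f g \<Longrightarrow> agree ((pair_sum ^^ k) f) ((pair_sum ^^ k) g)"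
  by (induction k) (auto intro: agree_pair_sum)

lemma funpow_step_sum_2_even_support:
  "(step_sum 2 L ^^ k) (\<lambda>y. if even y then g y else 0) = (\<lambda>y. if even y then (step_sum 2 L ^^ k) g y else 0)"
  by (induction k) (auto simp: step_sum_def fun_eq_iff)

text \<open>Stride 2 never leaves the parity class of \<open>y\<close> and can average over even
  integers only. Therefore stride 1 is split into \<open>pair_sum\<close> and stride 2 with
  \<open>M\<close> terms; all averaging is done with stride 2, and the \<open>k1\<close> pair sums
  mix the parities at the end.\<close>

lemma even_count_polynomial:
  assumes m: "m > 0" "even m" and k: "k1 + k2 = Suc l"
  shows "\<exists>H. aligned H \<and> agree ((step_sum 1 m ^^ k1) ((step_sum 2 m ^^ k2) (fps_fun (dilate m (power_fps l)))))
     ((pair_sum ^^ k1) (\<lambda>y. if even y then poly H (of_int y) else 0))"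
proof -
  obtain M where M: "m = 2 * M" using m by auto
  then have M0: "M > 0" using m by auto
  define u where "u y = (if int m dvd y then 1 / of_nat m ^ l else 0 :: complex)" for y
  \<comment> \<open>Among the even integers the multiples of \<open>m = 2 * M\<close> have density
    \<open>1 / M\<close>.\<close>
  define s where "s = 1 / (of_nat m ^ l * of_nat M :: complex)"
  define v where "v y = (if even y then s else 0)" for y :: int
  have un: "step_sum 2 M u y = (if even y then 1 / of_nat m ^ l else 0)" for y
  proof (cases "even y")
    case True
    then obtain x where x: "y = 2 * x" by auto
    have "step_sum 2 M u y = (\<Sum>i<M. if int M dvd x - int (1 * i) then 1 else 0) / of_nat m ^ l"
      unfolding step_sum_def u_def sum_divide_distrib
    proof (intro sum.cong refl)
      fix i
      have "y - int (2 * i) = 2 * (x - int (1 * i))" by (simp add: x)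
      then have "int m dvd y - int (2 * i) \<longleftrightarrow> int M dvd x - int (1 * i)"
        unfolding M of_nat_mult of_nat_numeral by (simp only: dvd_times_left_cancel_iff)
      then show "(if int m dvd y - int (2 * i) then 1 / of_nat m ^ l else 0)
         = (if int M dvd x - int (1 * i) then 1 else 0 :: complex) / of_nat m ^ l" by simp
    qed
    also have "\<dots> = 1 / of_nat m ^ l" using sum_indicator_residue[OF M0, of 1 x] by simp
    finally show ?thesis using True by simp
  next
    case False
    have "\<not> int m dvd y - int (2 * i)" for i
    proof
      assume "int m dvd y - int (2 * i)"
      then have "even (y - int (2 * i))" unfolding M by (metis dvd_mult_left int_ops(7) of_nat_numeral)
      then show False using False by simp
    qed
    then show ?thesis using False by (simp add: step_sum_def u_def)
  qed
  have vn: "step_sum 2 L v y = (if even y then of_nat L * s else 0)" for L y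
    by (simp add: step_sum_def v_def)
  have w1: "step_sum 2 M (\<lambda>y. u y - v y) y = 0" for y
    using M0 by (simp add: step_sum_diff un vn s_def)
  have w2: "step_sum 2 m (\<lambda>y. u y - v y) y = 0" for y
  proof -
    show ?thesis unfolding M mult_2 step_sum_add w1 by simp
  qed
  define H where "H = mean_poly 2 M 2 m s k1 k2 l"
  have "(step_sum 2 M ^^ k1) ((step_sum 2 m ^^ k2) (\<lambda>y. u y * of_int y ^ l))
       = (step_sum 2 M ^^ k1) ((step_sum 2 m ^^ k2) (\<lambda>y. v y * of_int y ^ l))"
    by (rule funpow_step_sum_eqI[OF k, where ops="{(2, M), (2, m)}"]) (auto simp only: insert_iff empty_iff prod.inject w1 w2)
  also have "(\<lambda>y. v y * of_int y ^ l) = (\<lambda>y. if even y then s * of_int y ^ l else 0)"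
    by (auto simp: v_def)
  also have "(step_sum 2 M ^^ k1) ((step_sum 2 m ^^ k2) (\<lambda>y. if even y then s * of_int y ^ l else 0))
     = (\<lambda>y. if even y then poly H (of_int y) else 0)"
    using fun_cong[OF poly_mean_poly[of 2 M 2 m s k1 k2 l]]
    by (simp only: funpow_step_sum_2_even_support H_def)
  finally have eq: "(step_sum 2 M ^^ k1) ((step_sum 2 m ^^ k2) (\<lambda>y. u y * of_int y ^ l))
     = (\<lambda>y. if even y then poly H (of_int y) else 0)" .
  have "agree ((step_sum 2 M ^^ k1) ((step_sum 2 m ^^ k2) (fps_fun (dilate m (power_fps l)))))
     (\<lambda>y. if even y then poly H (of_int y) else 0)"
    using agree_funpow[OF agree_funpow[OF agree_dilate_power[OF m(1), of l], of k2 2 m], of k1 2 M]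
    unfolding u_def[symmetric] eq .
  from agree_funpow_pair_sum[OF this, of k1]
  have "agree ((step_sum 1 m ^^ k1) ((step_sum 2 m ^^ k2) (fps_fun (dilate m (power_fps l)))))
     ((pair_sum ^^ k1) (\<lambda>y. if even y then poly H (of_int y) else 0))"
    by (simp only: M funpow_step_sum_1_even)
  moreover have "aligned H" unfolding H_def using M0 m by (intro aligned_mean_poly) auto
  ultimately show ?thesis by blast
qed

text \<open>At an argument of fixed parity, the \<open>k1\<close> pair sums weight \<open>H\<close>
  by the binomial coefficients of one parity. The condition \<open>par\<close> covers the cases that
  arise, and in each the operator keeps the roots aligned: a single term, one term of weight 2, or
  two terms of weight 4. For \<open>k1 = 4\<close> the even arguments would give the weights 1, 6,
  1, and \<open>1 + 6 * w + w ^ 2\<close> has no unimodular root; this forces odd \<open>q\<close>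
  together with even \<open>al\<close>.\<close>

lemma gap_series_polynomial:
  fixes F :: "complex fps"
  assumes m: "m > 0" and k: "k1 + k2 = Suc l"
    and par: "k2 = 0 \<or> k1 = 1 \<or> (even al \<and> k1 \<in> {2, 4})"
    and F: "F * (1 - fps_X) ^ k1 * (1 - fps_X ^ 2) ^ k2
      = fps_X ^ al * dilate m ((1 - fps_X) ^ k1 * (1 - fps_X ^ 2) ^ k2 * power_fps l)"
  shows "\<exists>H q0. aligned H \<and> (\<forall>q\<ge>q0. odd q \<longrightarrow> fps_nth F q = poly H (of_nat q))"
proof -
  define G where "G = (step_sum 1 m ^^ k1) ((step_sum 2 m ^^ k2) (fps_fun (dilate m (power_fps l))))"
  have FG: "fps_fun F y = G (y - int al)" for y
  proof -
    have "fps_fun F y = fps_fun (fps_X ^ al * ((\<Sum>i<m. fps_X ^ (1 * i)) ^ k1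
        * ((\<Sum>i<m. fps_X ^ (2 * i)) ^ k2 * dilate m (power_fps l)))) y"
      using gap_series_solve[OF m F] by (rule arg_cong[where f="\<lambda>F. fps_fun F y"])
    also have "\<dots> = G (y - int al)"
      unfolding fps_fun_X_power_mult fps_fun_geo_power G_def ..
    finally show ?thesis .
  qed
  have "\<exists>H. aligned H \<and> (\<exists>y0. \<forall>y\<ge>y0. (odd (y + int al)) \<longrightarrow> G y = poly H (of_int y))"
  proof (cases "odd m \<or> k2 = 0")
    case True
    obtain H where "aligned H" "agree G (\<lambda>y. poly H (of_int y))"
      using odd_count_polynomial_unit[OF m True k] unfolding G_def by auto
    then show ?thesis unfolding agree_def by blast
  next
    case False
    then obtain H where H: "aligned H" and
      ag: "agree G ((pair_sum ^^ k1) (\<lambda>y. if even y then poly H (of_int y) else 0))"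
      using even_count_polynomial[OF m _ k] unfolding G_def by auto
    from ag obtain y0 where
      y0: "\<And>y. y \<ge> y0 \<Longrightarrow> G y = (pair_sum ^^ k1) (\<lambda>y. if even y then poly H (of_int y) else 0) y"
      unfolding agree_def by blast
    consider "k1 = 1" "odd al" | "k1 = 1" "even al" | "k1 = 2" "even al" | "k1 = 4" "even al"
      using par False by auto
    then show ?thesis
    proof cases
      case 1
      then have "\<forall>y\<ge>y0. odd (y + int al) \<longrightarrow> G y = poly H (of_int y)"
        using y0 by (auto simp: pair_sum_def)
      then show ?thesis using H by blast
    next
      case 2
      let ?H = "H \<circ>\<^sub>p [:- of_real 1, 1:]"
      have "\<forall>y\<ge>y0. odd (y + int al) \<longrightarrow> G y = poly ?H (of_int y)"
        using y0 2 by (auto simp: pair_sum_def poly_pcompose)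
      then show ?thesis using aligned_shift[OF H, of 1] by blast
    next
      case 3
      let ?H = "smult 2 (H \<circ>\<^sub>p [:- of_real 1, 1:])"
      have "\<forall>y\<ge>y0. odd (y + int al) \<longrightarrow> G y = poly ?H (of_int y)"
        using y0 3 by (auto simp: pair_sum_def poly_pcompose eval_nat_numeral)
      then show ?thesis using aligned_smult[OF aligned_shift[OF H, of 1], of 2] by blast
    next
      case 4
      \<comment> \<open>For odd \<open>y\<close> the fourfold pair sum is 4 times \<open>H\<close>
        at \<open>y - 1\<close> plus 4 times \<open>H\<close> at \<open>y - 3\<close>: a shift by 1
        after the operator with stride 2 and symbol \<open>1 + w\<close>, whose root is
        \<open>- 1\<close>.\<close>
      let ?H1 = "shift_op 2 [:1, 1:] H"
      let ?H = "smult 4 (?H1 \<circ>\<^sub>p [:- of_real 1, 1:])"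
      have "aligned ?H1"
        by (rule aligned_shift_op[OF H]) (auto simp: add_eq_0_iff)
      then have "aligned ?H" by (intro aligned_smult aligned_shift)
      have ev: "poly ?H1 x = poly H x + poly H (x - 2)" for x
        by (simp add: shift_op_def poly_pcompose)
      have "\<forall>y\<ge>y0. odd (y + int al) \<longrightarrow> G y = poly ?H (of_int y)"
      proof (intro allI impI)
        fix y assume y: "y \<ge> y0" "odd (y + int al)"
        then have "odd y" using 4 by simp
        moreover have "poly ?H (of_int y) = 4 * (poly H (of_int (y - 1)) + poly H (of_int (y - 3)))"
          by (simp add: poly_pcompose ev algebra_simps)
        ultimately show "G y = poly ?H (of_int y)"
          using y0[OF y(1)] 4 by (simp add: pair_sum_def numeral_nat)
      qed
      with \<open>aligned ?H\<close> show ?thesis by blast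
    qed
  qed
  then obtain H y0 where H: "aligned H" and y0: "\<And>y. y \<ge> y0 \<Longrightarrow> odd (y + int al) \<Longrightarrow> G y = poly H (of_int y)"
    by blast
  have "fps_nth F q = poly (H \<circ>\<^sub>p [:- of_real (real al), 1:]) (of_nat q)" if q: "q \<ge> nat (y0 + int al)" "odd q" for q
  proof -
    have "fps_nth F q = fps_fun F (int q)" by (simp add: fps_fun_def)
    also have "\<dots> = poly H (of_int (int q - int al))"
      unfolding FG using q by (intro y0) auto
    finally show ?thesis by (simp add: poly_pcompose)
  qed
  then show ?thesis using aligned_shift[OF H, of "real al"] by blast
qed

section \<open>Configurations on a segment\<close>

text \<open>\<open>ok a m u x v y\<close> says that label \<open>v\<close> at position \<open>y\<close> may follow label \<open>u\<close> at position \<open>x\<close>. With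
\<open>m = b + 1 - a\<close>, two labels \<open>u < v\<close> are \<open>comparable\<close> iff \<open>x - y\<close> is not one of \<open>1 - a, \<dots>, b\<close>.\<close>

definition ok :: "nat \<Rightarrow> nat \<Rightarrow> int \<Rightarrow> int \<Rightarrow> int \<Rightarrow> int \<Rightarrow> bool" where
  "ok a m u x v y \<longleftrightarrow> int a + (if u > v then int m else 0) \<le> y - x"

abbreviation comparable :: "nat \<Rightarrow> nat \<Rightarrow> int \<Rightarrow> int \<Rightarrow> int \<Rightarrow> int \<Rightarrow> bool" where
  "comparable a m u x v y \<equiv> ok a m u x v y \<or> ok a m v y u x"

definition signed :: "int set \<Rightarrow> int set" where
  "signed S = S \<union> uminus ` S"

text \<open>A function on positive labels is extended to negative ones by the reflection \<open>x \<mapsto> c - x\<close>.\<close>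

definition mpos :: "int \<Rightarrow> (int \<Rightarrow> int) \<Rightarrow> int \<Rightarrow> int" where
  "mpos c f u = (if u > 0 then f u else c - f (- u))"

text \<open>Symmetric configurations on the segment from \<open>u\<close> at \<open>0\<close> to \<open>- u\<close> at \<open>T\<close>. The flag \<open>full\<close> says whether
a label and its negative constrain each other, that is, whether the roots \<open>2e\<^sub>i\<close> are present.\<close>

definition region :: "bool \<Rightarrow> nat \<Rightarrow> nat \<Rightarrow> int \<Rightarrow> int \<Rightarrow> int set \<Rightarrow> (int \<Rightarrow> int) set" where
  "region full a m u T S = {f \<in> S \<rightarrow>\<^sub>E UNIV.
     (\<forall>v\<in>signed S. ok a m u 0 v (mpos T f v) \<and> ok a m v (mpos T f v) (- u) T) \<and>
     (\<forall>v\<in>signed S. \<forall>w\<in>signed S. v \<noteq> w \<longrightarrow> (v = - w \<longrightarrow> full) \<longrightarrow>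
        comparable a m v (mpos T f v) w (mpos T f w)) \<and>
     (full \<longrightarrow> ok a m u 0 (- u) T)}"

text \<open>If \<open>u > w\<close>, then one of the two intermediate comparisons is a descent as
  well, so the extra \<open>m\<close> is not lost.\<close>

lemma ok_trans: "ok a m u x v y \<Longrightarrow> ok a m v y w z \<Longrightarrow> ok a m u x w z"
  by (auto simp: ok_def split: if_splits)

text \<open>Exactly one of the two directions is a descent, so adding the inequalities would give
  \<open>2 * a + m \<le> 0\<close>.\<close>

lemma ok_antisym: "ok a m u x v y \<Longrightarrow> ok a m v y u x \<Longrightarrow> m > 0 \<Longrightarrow> u \<noteq> v \<Longrightarrow> False"
  by (auto simp: ok_def split: if_splits)

lemma ok_mirror: "ok a m (- v) (c - y) (- u) (c - x) \<longleftrightarrow> ok a m u x v y"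
  by (auto simp: ok_def)

lemma ok_shift: "ok a m u (x - c) v (y - c) \<longleftrightarrow> ok a m u x v y"
  by (auto simp: ok_def)

lemma ok_le: "ok a m u x v y \<Longrightarrow> x \<le> y"
  by (auto simp: ok_def split: if_splits)

lemma in_signed: "v \<in> signed S \<longleftrightarrow> v \<in> S \<or> - v \<in> S"
  unfolding signed_def by (auto simp: image_iff intro: bexI[of _ "- v"])

lemma signed_uminus [simp]: "- v \<in> signed S \<longleftrightarrow> v \<in> signed S"
  by (auto simp: in_signed)

lemma finite_signed [simp]: "finite S \<Longrightarrow> finite (signed S)"
  by (simp add: signed_def)

lemma signed_iff:
  assumes "\<And>s. s \<in> S \<Longrightarrow> s > 0"
  shows "v \<in> signed S \<longleftrightarrow> \<bar>v\<bar> \<in> S"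
  using assms[of v] assms[of "- v"] by (cases "v > 0") (auto simp: in_signed abs_if)

lemma signed_nonzero:
  assumes "\<And>s. s \<in> S \<Longrightarrow> s > 0" "v \<in> signed S"
  shows "v \<noteq> 0"
  using assms(1)[of "\<bar>v\<bar>"] assms signed_iff[of S v] by auto

lemma signed_cases:
  assumes "\<And>s. s \<in> S \<Longrightarrow> s > 0" "v \<in> signed S"
  obtains "v > 0" "v \<in> S" | "v < 0" "- v \<in> S"
  using assms(1)[of v] assms(1)[of "- v"] assms(2) by (auto simp: in_signed)

lemma mpos_uminus: "u \<noteq> 0 \<Longrightarrow> mpos c f (- u) = c - mpos c f u"
  by (auto simp: mpos_def)

lemma regionD:
  assumes "f \<in> region full a m u T S"
  shows "f \<in> S \<rightarrow>\<^sub>E UNIV"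
    "\<And>v. v \<in> signed S \<Longrightarrow> ok a m u 0 v (mpos T f v)"
    "\<And>v. v \<in> signed S \<Longrightarrow> ok a m v (mpos T f v) (- u) T"
    "\<And>v w. v \<in> signed S \<Longrightarrow> w \<in> signed S \<Longrightarrow> v \<noteq> w \<Longrightarrow> (v = - w \<Longrightarrow> full) \<Longrightarrow>
        comparable a m v (mpos T f v) w (mpos T f w)"
    "full \<Longrightarrow> ok a m u 0 (- u) T"
proof -
  have "f \<in> S \<rightarrow>\<^sub>E UNIV"
    and *: "\<forall>v\<in>signed S. ok a m u 0 v (mpos T f v) \<and> ok a m v (mpos T f v) (- u) T"
    and **: "\<forall>v\<in>signed S. \<forall>w\<in>signed S. v \<noteq> w \<longrightarrow> (v = - w \<longrightarrow> full) \<longrightarrow>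
        comparable a m v (mpos T f v) w (mpos T f w)"
    and ***: "full \<longrightarrow> ok a m u 0 (- u) T"
    using assms unfolding region_def mem_Collect_eq by - (elim conjE, assumption)+
  then show "f \<in> S \<rightarrow>\<^sub>E UNIV" by simp
  show "ok a m u 0 v (mpos T f v)" "ok a m v (mpos T f v) (- u) T" if "v \<in> signed S" for v
    using * that by auto
  show "comparable a m v (mpos T f v) w (mpos T f w)"
    if "v \<in> signed S" "w \<in> signed S" "v \<noteq> w" "v = - w \<Longrightarrow> full" for v w
    using ** that by simp
  show "ok a m u 0 (- u) T" if full using *** that by simp
qed

text \<open>By reflection, the constraint of \<open>v\<close> against the right end is that of
  \<open>- v\<close> against the left end and need not be verified separately.\<close>

lemma regionI:
  assumes f: "f \<in> S \<rightarrow>\<^sub>E UNIV" and pos: "\<And>s. s \<in> S \<Longrightarrow> s > 0"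
    and u: "\<And>v. v \<in> signed S \<Longrightarrow> ok a m u 0 v (mpos T f v)"
    and c: "\<And>v w. v \<in> signed S \<Longrightarrow> w \<in> signed S \<Longrightarrow> v \<noteq> w \<Longrightarrow> (v = - w \<Longrightarrow> full) \<Longrightarrow>
        comparable a m v (mpos T f v) w (mpos T f w)"
    and fu: "full \<Longrightarrow> ok a m u 0 (- u) T"
  shows "f \<in> region full a m u T S"
proof -
  have "ok a m v (mpos T f v) (- u) T" if v: "v \<in> signed S" for v
  proof -
    have "v \<noteq> 0" using signed_nonzero[OF pos v] .
    have "ok a m u 0 (- v) (mpos T f (- v))" using u v by simp
    then have "ok a m v (T - mpos T f (- v)) (- u) (T - 0)" using ok_mirror[of a m "- v" T "mpos T f (- v)" u 0] by simp
    then show ?thesis using mpos_uminus[OF \<open>v \<noteq> 0\<close>, of T f] by simp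
  qed
  then show ?thesis using f u fu
    unfolding region_def by (intro CollectI conjI ballI impI c) auto
qed

lemma region_subset:
  assumes pos: "\<And>s. s \<in> S \<Longrightarrow> s > 0"
  shows "region full a m u T S \<subseteq> S \<rightarrow>\<^sub>E {0..T}"
proof
  fix f assume f: "f \<in> region full a m u T S"
  have "f s \<in> {0..T}" if "s \<in> S" for s
  proof -
    have "s \<in> signed S" "mpos T f s = f s" using that pos by (auto simp: signed_def mpos_def)
    then show ?thesis using regionD(2,3)[OF f, of s] by (auto dest: ok_le)
  qed
  then show "f \<in> S \<rightarrow>\<^sub>E {0..T}" using regionD(1)[OF f] by (auto simp: PiE_iff)
qed

lemma finite_region: "finite S \<Longrightarrow> (\<And>s. s \<in> S \<Longrightarrow> s > 0) \<Longrightarrow> finite (region full a m u T S)"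
  by (rule finite_subset[OF region_subset]) (auto intro: finite_PiE)

text \<open>The configurations in which \<open>v\<close>, at position \<open>g\<close>, is the first label met.\<close>

definition region_first :: "bool \<Rightarrow> nat \<Rightarrow> nat \<Rightarrow> int \<Rightarrow> int \<Rightarrow> int set \<Rightarrow> int \<Rightarrow> int \<Rightarrow> (int \<Rightarrow> int) set" where
  "region_first full a m u T S v g = {f \<in> region full a m u T S. mpos T f v = g \<and>
     (\<forall>w\<in>signed S. \<bar>w\<bar> \<noteq> \<bar>v\<bar> \<longrightarrow> ok a m v g w (mpos T f w)) \<and>
     (full \<longrightarrow> ok a m v g (- v) (T - g))}"

lemma ex_lex_min:
  fixes p :: "int \<Rightarrow> int"
  assumes "finite V" "V \<noteq> {}"
  obtains v where "v \<in> V" "\<And>w. w \<in> V \<Longrightarrow> p v < p w \<or> (p v = p w \<and> v \<le> w)"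
proof -
  define q where "q = Min (p ` V)"
  define W where "W = {v\<in>V. p v = q}"
  have "q \<in> p ` V" unfolding q_def using assms by (intro Min_in) auto
  then have W: "finite W" "W \<noteq> {}" using assms by (auto simp: W_def)
  then have vW: "Min W \<in> W" by (rule Min_in)
  show ?thesis
  proof (rule that[of "Min W"])
    show "Min W \<in> V" using vW by (simp add: W_def)
    fix w assume w: "w \<in> V"
    have "q \<le> p w" unfolding q_def using assms w by simp
    moreover have "Min W \<le> w" if "p w = q" using W w that by (simp add: W_def)
    moreover have "p (Min W) = q" using vW by (simp add: W_def)
    ultimately show "p (Min W) < p w \<or> (p (Min W) = p w \<and> Min W \<le> w)"
      by (cases "p w = q") auto
  qed
qed

text \<open>The opposite direction would demand a nonnegative distance against the order of the
  positions, or the extra \<open>m\<close> at equal positions.\<close>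

lemma ok_of_lex:
  assumes "comparable a m v x w y" "x < y \<or> (x = y \<and> v < w)" "m > 0"
  shows "ok a m v x w y"
  using assms by (auto simp: ok_def split: if_splits)

lemma region_eq_Un_first:
  assumes S: "finite S" "\<And>s. s \<in> S \<Longrightarrow> s > 0" "S \<noteq> {}" and m: "m > 0"
  shows "region full a m u T S = (\<Union>v\<in>signed S. \<Union>g. region_first full a m u T S v g)"
proof
  show "(\<Union>v\<in>signed S. \<Union>g. region_first full a m u T S v g) \<subseteq> region full a m u T S"
    by (auto simp: region_first_def)
  show "region full a m u T S \<subseteq> (\<Union>v\<in>signed S. \<Union>g. region_first full a m u T S v g)"
  proof
    fix f assume f: "f \<in> region full a m u T S"
    have ne: "signed S \<noteq> {}" using S(3) by (auto simp: signed_def)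
    obtain v where v: "v \<in> signed S"
      and min: "\<And>w. w \<in> signed S \<Longrightarrow> mpos T f v < mpos T f w \<or> (mpos T f v = mpos T f w \<and> v \<le> w)"
      by (rule ex_lex_min[OF finite_signed[OF S(1)] ne, of "mpos T f"]) blast
    have ok: "ok a m v (mpos T f v) w (mpos T f w)" if w: "w \<in> signed S" "w \<noteq> v" "v = - w \<Longrightarrow> full" for w
      using ok_of_lex[OF regionD(4)[OF f v w(1)]] w min[OF w(1)] m by force
    have v0: "v \<noteq> 0" using signed_nonzero[OF S(2) v] .
    have "ok a m v (mpos T f v) (- v) (T - mpos T f v)" if full
    proof -
      have "- v \<noteq> v" using v0 by simp
      then show ?thesis using ok[of "- v"] v that mpos_uminus[OF v0, of T f] by simp
    qed
    then have "f \<in> region_first full a m u T S v (mpos T f v)"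
      using f ok by (auto simp: region_first_def)
    then show "f \<in> (\<Union>v\<in>signed S. \<Union>g. region_first full a m u T S v g)" using v by blast
  qed
qed

text \<open>Antisymmetry excludes two first labels of different absolute value. If \<open>v\<close>
  and \<open>- v\<close> were both first in the free case, mirroring the comparison with another
  label \<open>s\<close> would contradict antisymmetry. With a single free label both would indeed
  be first; that case is the base of the recursion.\<close>

lemma region_first_unique:
  assumes S: "\<And>s. s \<in> S \<Longrightarrow> s > 0" "full \<or> (\<forall>s. S \<noteq> {s})" and m: "m > 0"
    and v: "v \<in> signed S" "v' \<in> signed S"
    and f: "f \<in> region_first full a m u T S v g" "f \<in> region_first full a m u T S v' g'"
  shows "v = v' \<and> g = g'"
proof -
  have g: "mpos T f v = g" "mpos T f v' = g'" using f by (auto simp: region_first_def)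
  have o: "ok a m v g w (mpos T f w)" if "w \<in> signed S" "\<bar>w\<bar> \<noteq> \<bar>v\<bar>" for w
    using f(1) that unfolding region_first_def by blast
  have o': "ok a m v' g' w (mpos T f w)" if "w \<in> signed S" "\<bar>w\<bar> \<noteq> \<bar>v'\<bar>" for w
    using f(2) that unfolding region_first_def by blast
  have v0: "v \<noteq> 0" using signed_nonzero[OF S(1) v(1)] .
  have "v = v'"
  proof (rule ccontr)
    assume ne: "v \<noteq> v'"
    show False
    proof (cases "\<bar>v\<bar> = \<bar>v'\<bar>")
      case False
      then have "ok a m v g v' g'" "ok a m v' g' v g" using o[of v'] o'[of v] v g by auto
      then show False using ok_antisym m ne by blast
    next
      case True
      then have vv: "v' = - v" using ne by linarith
      then have g': "g' = T - g" using g mpos_uminus[OF v0, of T f] by simp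
      show False
      proof (cases full)
        case True
        then have "ok a m v g (- v) (T - g)" "ok a m v' g' (- v') (T - g')"
          using f by (auto simp: region_first_def)
        then show False using ok_antisym[of a m v g v' g'] vv g' m ne by simp
      next
        case False
        have "\<bar>v\<bar> \<in> S" using v S(1) by (simp add: signed_iff)
        with False S(2) obtain s where s: "s \<in> S" "s \<noteq> \<bar>v\<bar>" by blast
        then have s': "s \<in> signed S" "\<bar>s\<bar> \<noteq> \<bar>v\<bar>" "\<bar>- s\<bar> \<noteq> \<bar>v'\<bar>" "s \<noteq> 0" "- s \<noteq> v'"
          using S(1)[OF s(1)] vv by (auto simp: in_signed)
        have 1: "ok a m v g s (mpos T f s)" using o s' by blast
        have 2: "ok a m v' g' (- s) (mpos T f (- s))" using o' s' by simp
        have "ok a m (- s) (T - mpos T f s) (- v) (T - g)" using 1 ok_mirror by blast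
        then have "ok a m (- s) (mpos T f (- s)) v' g'"
          using vv g' mpos_uminus[OF s'(4), of T f] by simp
        then show False using 2 ok_antisym[of a m] m s'(5) by blast
      qed
    qed
  qed
  then show ?thesis using g by simp
qed

text \<open>Removing \<open>v\<close> at \<open>g\<close> and \<open>- v\<close> at
  \<open>T - g\<close> leaves a segment of length \<open>T - 2 * g\<close> whose ends are again a
  label and its negative. Constraints against the old ends follow by transitivity, so only the gap
  from \<open>u\<close> to \<open>v\<close> is left to impose.\<close>

lemma card_region_first:
  assumes S: "finite S" "\<And>s. s \<in> S \<Longrightarrow> s > 0" "full \<or> (\<forall>s. S \<noteq> {s})" and m: "m > 0"
    and v: "v \<in> signed S"
  shows "card (region_first full a m u T S v g) =
    (if ok a m u 0 v g then card (region full a m v (T - 2 * g) (S - {\<bar>v\<bar>})) else 0)"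
proof -
  let ?S = "S - {\<bar>v\<bar>}"
  have S': "\<And>s. s \<in> ?S \<Longrightarrow> s > 0" using S by auto
  have v0: "v \<noteq> 0" using signed_nonzero[OF S(2) v] .
  have av: "\<bar>v\<bar> \<in> S" using v signed_iff[of S v] S(2) by auto
  have sg: "w \<in> signed ?S \<longleftrightarrow> w \<in> signed S \<and> \<bar>w\<bar> \<noteq> \<bar>v\<bar>" for w
    using signed_iff[of S w] signed_iff[of ?S w] S(2) by auto
  show ?thesis
  proof (cases "ok a m u 0 v g")
    case False
    have "region_first full a m u T S v g = {}"
    proof (rule equals0I)
      fix f assume "f \<in> region_first full a m u T S v g"
      then have f: "f \<in> region full a m u T S" "mpos T f v = g" by (auto simp: region_first_def)
      then show False using regionD(2)[OF f(1) v] False by simp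
    qed
    then show ?thesis using False by simp
  next
    case True
    define \<phi> where "\<phi> f = restrict (\<lambda>s. f s - g) ?S" for f :: "int \<Rightarrow> int"
    define \<psi> where "\<psi> h = restrict (\<lambda>s. if s = \<bar>v\<bar> then (if v > 0 then g else T - g) else h s + g) S" for h :: "int \<Rightarrow> int"
    have mphi: "mpos (T - 2 * g) (\<phi> f) w = mpos T f w - g" if w: "w \<in> signed ?S" for f w
      by (rule signed_cases[OF S' w]) (auto simp: mpos_def \<phi>_def)
    have mpsi: "mpos T (\<psi> h) w = mpos (T - 2 * g) h w + g" if w: "w \<in> signed ?S" for h w
      by (rule signed_cases[OF S' w]) (auto simp: mpos_def \<psi>_def)
    have mpsiv: "mpos T (\<psi> h) v = g" "mpos T (\<psi> h) (- v) = T - g" for h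
      using av v0 by (auto simp: mpos_def \<psi>_def)
    have "bij_betw \<phi> (region_first full a m u T S v g) (region full a m v (T - 2 * g) ?S)"
    proof (rule bij_betw_byWitness[where f'=\<psi>])
      show "\<forall>f\<in>region_first full a m u T S v g. \<psi> (\<phi> f) = f"
      proof
        fix f assume "f \<in> region_first full a m u T S v g"
        then have f: "f \<in> S \<rightarrow>\<^sub>E UNIV" "mpos T f v = g" by (auto simp: region_first_def dest: regionD)
        show "\<psi> (\<phi> f) = f"
        proof (rule extensionalityI[of _ S])
          show "f \<in> extensional S" using f(1) by (simp add: PiE_iff)
          fix s assume "s \<in> S"
          then show "\<psi> (\<phi> f) s = f s" using f(2) v0 by (auto simp: \<psi>_def \<phi>_def mpos_def)
        qed (simp add: \<psi>_def)
      qed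
      show "\<forall>h\<in>region full a m v (T - 2 * g) ?S. \<phi> (\<psi> h) = h"
      proof
        fix h assume "h \<in> region full a m v (T - 2 * g) ?S"
        then have h: "h \<in> ?S \<rightarrow>\<^sub>E UNIV" by (rule regionD)
        show "\<phi> (\<psi> h) = h"
        proof (rule extensionalityI[of _ ?S])
          show "h \<in> extensional ?S" using h by (simp add: PiE_iff)
        qed (auto simp: \<psi>_def \<phi>_def)
      qed
      show "\<phi> ` region_first full a m u T S v g \<subseteq> region full a m v (T - 2 * g) ?S"
      proof (rule image_subsetI)
        fix f assume "f \<in> region_first full a m u T S v g"
        then have f: "f \<in> region full a m u T S"
          and o: "\<And>w. w \<in> signed S \<Longrightarrow> \<bar>w\<bar> \<noteq> \<bar>v\<bar> \<Longrightarrow> ok a m v g w (mpos T f w)"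
          and fu: "full \<Longrightarrow> ok a m v g (- v) (T - g)"
          unfolding region_first_def by blast+
        show "\<phi> f \<in> region full a m v (T - 2 * g) ?S"
        proof (rule regionI)
          show "\<phi> f \<in> ?S \<rightarrow>\<^sub>E UNIV" by (simp add: \<phi>_def)
          show "s > 0" if "s \<in> ?S" for s using S' that .
          show "ok a m v 0 w (mpos (T - 2 * g) (\<phi> f) w)" if w: "w \<in> signed ?S" for w
            using o[of w] w mphi[OF w] sg ok_shift[of a m v g g w] by simp
          show "comparable a m w (mpos (T - 2 * g) (\<phi> f) w) w' (mpos (T - 2 * g) (\<phi> f) w')"
            if w: "w \<in> signed ?S" "w' \<in> signed ?S" "w \<noteq> w'" "w = - w' \<Longrightarrow> full" for w w'
            using regionD(4)[OF f, of w w'] w mphi[OF w(1)] mphi[OF w(2)] sg ok_shift by simp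
          show "ok a m v 0 (- v) (T - 2 * g)" if full
            using fu[OF that] ok_shift[of a m v g g "- v" "T - g"] by simp
        qed
      qed
      show "\<psi> ` region full a m v (T - 2 * g) ?S \<subseteq> region_first full a m u T S v g"
      proof (rule image_subsetI)
        fix h assume h: "h \<in> region full a m v (T - 2 * g) ?S"
        have vw: "ok a m v g w (mpos T (\<psi> h) w)" if w: "w \<in> signed S" "\<bar>w\<bar> \<noteq> \<bar>v\<bar>" for w
        proof -
          have w': "w \<in> signed ?S" using w sg by blast
          show ?thesis
            using regionD(2)[OF h w'] ok_shift[of a m v g g w "mpos T (\<psi> h) w"] mpsi[OF w', of h] by simp
        qed
        \<comment> \<open>In the free case the order of \<open>v\<close> and \<open>- v\<close> is
          not a condition of the region; it follows from any label between them.\<close>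
        have vv: "ok a m v g (- v) (T - g)" if "full \<or> S \<noteq> {\<bar>v\<bar>}"
        proof (cases full)
          case True
          then show ?thesis using regionD(5)[OF h] ok_shift[of a m v g g "- v" "T - g"] by simp
        next
          case False
          with that av obtain s where s: "s \<in> S" "s \<noteq> \<bar>v\<bar>" by blast
          then have s': "s \<in> signed ?S" using S' by (auto simp: signed_def)
          have "ok a m v 0 (- v) (T - 2 * g)"
            using regionD(2,3)[OF h s'] by (rule ok_trans)
          then show ?thesis using ok_shift[of a m v g g "- v" "T - g"] by simp
        qed
        have vv': "ok a m v g (- v) (T - g)" using vv S(3) by blast
        have wv: "ok a m w (mpos T (\<psi> h) w) (- v) (T - g)" if w: "w \<in> signed S" "\<bar>w\<bar> \<noteq> \<bar>v\<bar>" for w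
        proof -
          have w': "w \<in> signed ?S" using w sg by blast
          show ?thesis
            using regionD(3)[OF h w'] ok_shift[of a m w "mpos T (\<psi> h) w" g "- v" "T - g"] mpsi[OF w', of h] by simp
        qed
        have cases: "w = v \<or> w = - v \<or> \<bar>w\<bar> \<noteq> \<bar>v\<bar>" for w :: int by linarith
        have "\<psi> h \<in> region full a m u T S"
        proof (rule regionI)
          show "\<psi> h \<in> S \<rightarrow>\<^sub>E UNIV" by (simp add: \<psi>_def)
          show "s > 0" if "s \<in> S" for s using S(2) that .
          show "ok a m u 0 w (mpos T (\<psi> h) w)" if w: "w \<in> signed S" for w
            using cases[of w] True mpsiv[of h] ok_trans[OF True vv'] ok_trans[OF True vw[OF w]] by auto
          show "ok a m u 0 (- u) T" if full
          proof -
            have "ok a m (- v) (T - g) (- u) (T - 0)" using True ok_mirror by blast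
            with ok_trans[OF True vv'] show ?thesis using ok_trans by fastforce
          qed
          show "comparable a m w (mpos T (\<psi> h) w) w' (mpos T (\<psi> h) w')"
            if w: "w \<in> signed S" "w' \<in> signed S" "w \<noteq> w'" "w = - w' \<Longrightarrow> full" for w w'
          proof (cases "\<bar>w\<bar> = \<bar>v\<bar> \<or> \<bar>w'\<bar> = \<bar>v\<bar>")
            case True
            then show ?thesis using cases[of w] cases[of w'] mpsiv[of h] vv' vw[OF w(1)] vw[OF w(2)] wv[OF w(1)] wv[OF w(2)] w(3)
              by auto
          next
            case False
            then have w': "w \<in> signed ?S" "w' \<in> signed ?S" using w sg by auto
            have "comparable a m w (mpos T (\<psi> h) w - g) w' (mpos T (\<psi> h) w' - g)"
              using regionD(4)[OF h w' w(3,4)] mpsi[OF w'(1), of h] mpsi[OF w'(2), of h] by simp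
            then show ?thesis by (simp add: ok_shift)
          qed
        qed
        then show "\<psi> h \<in> region_first full a m u T S v g"
          using mpsiv vw vv' by (simp add: region_first_def)
      qed
    qed
    then show ?thesis using True by (simp add: bij_betw_same_card)
  qed
qed

lemma region_negative:
  assumes "T < 0" "full \<or> S \<noteq> {}"
  shows "region full a m u T S = {}"
proof (rule equals0I)
  fix f assume f: "f \<in> region full a m u T S"
  have "ok a m u 0 (- u) T"
  proof (cases full)
    case True
    then show ?thesis by (rule regionD(5)[OF f])
  next
    case False
    then obtain s where "s \<in> signed S" using assms(2) by (auto simp: signed_def)
    from regionD(2,3)[OF f this] show ?thesis by (rule ok_trans)
  qed
  then show False using assms(1) by (auto dest: ok_le)
qed

text \<open>The index \<open>i\<close> is the joint length \<open>2 * g\<close> of the first gap and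
  its mirror image, hence even. In this form the sum is a Cauchy product.\<close>

lemma card_region_rec:
  assumes S: "finite S" "\<And>s. s \<in> S \<Longrightarrow> s > 0" "S \<noteq> {}" "full \<or> (\<forall>s. S \<noteq> {s})" and m: "m > 0"
  shows "card (region full a m u (int T) S) = (\<Sum>v\<in>signed S. \<Sum>i=0..T.
     if even i \<and> a + (if u > v then m else 0) \<le> i div 2
     then card (region full a m v (int (T - i)) (S - {\<bar>v\<bar>})) else 0)"
proof -
  define R where "R p = (if even (snd p) then region_first full a m u (int T) S (fst p) (int (snd p div 2)) else {})"
    for p :: "int \<times> nat"
  \<comment> \<open>The remaining region must still exclude negative lengths, so that
    \<open>2 * g\<close> cannot exceed \<open>T\<close>.\<close>
  have ne: "full \<or> S - {\<bar>v\<bar>} \<noteq> {}" for v using S(3,4) by blast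
  have finreg: "finite (region full a m u (int T) S)" by (rule finite_region[OF S(1,2)])
  have fin: "finite (region_first full a m u (int T) S v g)" for v g
    by (rule finite_subset[OF _ finreg]) (auto simp: region_first_def)
  have sub: "region_first full a m u (int T) S v g \<subseteq> \<Union>(R ` (signed S \<times> {0..T}))" if v: "v \<in> signed S" for v g
  proof (cases "region_first full a m u (int T) S v g = {}")
    case False
    have "card (region_first full a m u (int T) S v g) \<noteq> 0"
      using False fin by simp
    then have o: "ok a m u 0 v g" and "card (region full a m v (int T - 2 * g) (S - {\<bar>v\<bar>})) \<noteq> 0"
      using card_region_first[OF S(1,2,4) m v, of a u "int T" g] by (auto split: if_splits)
    then have "region full a m v (int T - 2 * g) (S - {\<bar>v\<bar>}) \<noteq> {}" by (metis card.empty)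
    then have "\<not> int T - 2 * g < 0" using region_negative[OF _ ne] by blast
    moreover have "g \<ge> 0" using ok_le[OF o] .
    then obtain k where k: "g = int k" using nonneg_int_cases by blast
    ultimately have "2 * k \<in> {0..T}" by simp
    then have "(v, 2 * k) \<in> signed S \<times> {0..T}" using v by simp
    moreover have "region_first full a m u (int T) S v g = R (v, 2 * k)"
      by (simp add: R_def k)
    ultimately show ?thesis by blast
  qed simp
  have "region full a m u (int T) S = (\<Union>p\<in>signed S \<times> {0..T}. R p)"
  proof
    have "region full a m u (int T) S = (\<Union>v\<in>signed S. \<Union>g. region_first full a m u (int T) S v g)"
      by (rule region_eq_Un_first[OF S(1,2,3) m])
    also have "\<dots> \<subseteq> (\<Union>p\<in>signed S \<times> {0..T}. R p)"
      by (intro UN_least sub)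
    finally show "region full a m u (int T) S \<subseteq> (\<Union>p\<in>signed S \<times> {0..T}. R p)" .
    show "(\<Union>p\<in>signed S \<times> {0..T}. R p) \<subseteq> region full a m u (int T) S"
      by (auto simp: R_def region_first_def split: if_splits)
  qed
  also have "card \<dots> = (\<Sum>p\<in>signed S \<times> {0..T}. card (R p))"
  proof (rule card_UN_disjoint)
    show "finite (signed S \<times> {0..T})" using S(1) by simp
    show "\<forall>p\<in>signed S \<times> {0..T}. finite (R p)"
      using fin by (simp add: R_def)
    show "\<forall>p\<in>signed S \<times> {0..T}. \<forall>p'\<in>signed S \<times> {0..T}. p \<noteq> p' \<longrightarrow> R p \<inter> R p' = {}"
    proof (intro ballI impI equals0I)
      fix p p' f assume p: "p \<in> signed S \<times> {0..T}" "p' \<in> signed S \<times> {0..T}" "p \<noteq> p'" "f \<in> R p \<inter> R p'"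
      then have e: "even (snd p)" "even (snd p')" by (auto simp: R_def split: if_splits)
      then have "f \<in> region_first full a m u (int T) S (fst p) (int (snd p div 2))"
        "f \<in> region_first full a m u (int T) S (fst p') (int (snd p' div 2))"
        using p(4) by (auto simp: R_def)
      then have "fst p = fst p' \<and> int (snd p div 2) = int (snd p' div 2)"
        using p(1,2) by (intro region_first_unique[OF S(2,4) m]) auto
      then have 1: "fst p = fst p'" and 2: "snd p div 2 = snd p' div 2" by simp_all
      have "2 * (snd p div 2) = snd p" "2 * (snd p' div 2) = snd p'" using e by simp_all
      with 2 have "snd p = snd p'" by linarith
      with 1 have "fst p = fst p'" "snd p = snd p'" by blast+
      then show False using p(3) by (simp add: prod_eq_iff)
    qed
  qed
  also have "\<dots> = (\<Sum>v\<in>signed S. \<Sum>i=0..T. card (R (v, i)))"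
    by (simp add: sum.cartesian_product)
  also have "\<dots> = (\<Sum>v\<in>signed S. \<Sum>i=0..T.
     if even i \<and> a + (if u > v then m else 0) \<le> i div 2
     then card (region full a m v (int (T - i)) (S - {\<bar>v\<bar>})) else 0)"
  proof (intro sum.cong refl)
    fix v i assume v: "v \<in> signed S" and i: "i \<in> {0..T}"
    show "card (R (v, i)) = (if even i \<and> a + (if u > v then m else 0) \<le> i div 2
     then card (region full a m v (int (T - i)) (S - {\<bar>v\<bar>})) else 0)"
    proof (cases "even i")
      case True
      have "ok a m u 0 v (int (i div 2)) \<longleftrightarrow> int (a + (if u > v then m else 0)) \<le> int (i div 2)"
        by (simp add: ok_def)
      then have "ok a m u 0 v (int (i div 2)) \<longleftrightarrow> a + (if u > v then m else 0) \<le> i div 2"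
        unfolding of_nat_le_iff .
      moreover have "int T - 2 * int (i div 2) = int (T - i)" using True i by auto
      ultimately show ?thesis using True card_region_first[OF S(1,2,4) m v, of a u "int T" "int (i div 2)"]
        by (simp add: R_def)
    qed (simp add: R_def)
  qed
  finally show ?thesis .
qed

section \<open>Generating functions of symmetric segments\<close>

text \<open>This is \<open>X ^ (c * k) / (1 - X ^ c)\<close>: gaps of at least \<open>k\<close>,
  each entering the length \<open>c\<close> times.\<close>

definition gap_fps :: "nat \<Rightarrow> nat \<Rightarrow> complex fps" where
  "gap_fps c k = Abs_fps (\<lambda>i. if c dvd i \<and> k \<le> i div c then 1 else 0)"

lemma gap_fps_mult: "c > 0 \<Longrightarrow> (1 - fps_X ^ c) * gap_fps c k = fps_X ^ (c * k)"
proof (rule fps_ext)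
  fix n assume c: "c > 0"
  have e: "fps_nth ((1 - fps_X ^ c) * gap_fps c k) n
      = fps_nth (gap_fps c k) n - (if n < c then 0 else fps_nth (gap_fps c k) (n - c))"
    by (simp add: left_diff_distrib fps_X_power_mult_nth)
  show "fps_nth ((1 - fps_X ^ c) * gap_fps c k) n = fps_nth (fps_X ^ (c * k)) n"
  proof (cases "c dvd n")
    case False
    then have "n \<noteq> c * k" by auto
    moreover have "\<not> c dvd n - c" if "\<not> n < c" using False that by (simp add: dvd_minus_self)
    ultimately show ?thesis using False unfolding e by (auto simp: gap_fps_def)
  next
    case True
    then obtain j where n: "n = c * j" by blast
    show ?thesis
    proof (cases j)
      case 0
      then show ?thesis unfolding e using n c by (auto simp: gap_fps_def)
    next
      case (Suc i)
      have nc: "n - c = c * i" "\<not> n < c" using n Suc by auto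
      have "c * Suc i = c * k \<longleftrightarrow> Suc i = k" using c by (simp only: mult_cancel1) simp
      then have "n div c = Suc i" "n = c * k \<longleftrightarrow> Suc i = k" using n Suc c by auto
      then show ?thesis unfolding e using nc True c by (auto simp: gap_fps_def fps_X_power_nth)
    qed
  qed
qed

text \<open>After multiplication by \<open>1 - X ^ c\<close> a gap is \<open>X ^ (c * a)\<close>,
  times \<open>X ^ (c * m)\<close> at a descent \<open>d v\<close>. The first factor is common to
  all summands; the second is the dilation of the \<open>X ^ c\<close> that stands in the same place
  for \<open>a = 0\<close>, \<open>m = 1\<close>. \<open>R\<close> collects the denominators of the
  later gaps.\<close>

lemma gap_recursion_dilate:
  assumes c: "c > 0" and m: "m > 0"
    and F: "F = (\<Sum>v\<in>V. gap_fps c (a + (if d v then m else 0)) * f v)"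
    and G: "G = (\<Sum>v\<in>V. gap_fps c (0 + (if d v then 1 else 0)) * g v)"
    and R: "\<And>v. v \<in> V \<Longrightarrow> R * f v = fps_X ^ al * dilate m (R * g v)"
  shows "(1 - fps_X ^ c) * R * F = fps_X ^ (al + c * a) * dilate m ((1 - fps_X ^ c) * R * G)"
proof -
  have "(1 - fps_X ^ c) * R * G = (\<Sum>v\<in>V. ((1 - fps_X ^ c) * gap_fps c (0 + (if d v then 1 else 0))) * (R * g v))"
    unfolding G sum_distrib_left by (simp add: mult_ac)
  then have G': "(1 - fps_X ^ c) * R * G = (\<Sum>v\<in>V. fps_X ^ (c * (0 + (if d v then 1 else 0))) * (R * g v))"
    unfolding gap_fps_mult[OF c] .
  have "(1 - fps_X ^ c) * R * F = (\<Sum>v\<in>V. ((1 - fps_X ^ c) * gap_fps c (a + (if d v then m else 0))) * (R * f v))"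
    unfolding F sum_distrib_left by (simp add: mult_ac)
  also have "\<dots> = (\<Sum>v\<in>V. fps_X ^ (c * (a + (if d v then m else 0))) * (fps_X ^ al * dilate m (R * g v)))"
    unfolding gap_fps_mult[OF c] using R by (intro sum.cong) auto
  also have "\<dots> = fps_X ^ (al + c * a) * (\<Sum>v\<in>V. fps_X ^ (m * (c * (0 + (if d v then 1 else 0)))) * dilate m (R * g v))"
    unfolding sum_distrib_left
  proof (intro sum.cong refl)
    fix v
    have "c * (a + (if d v then m else 0)) + al = (al + c * a) + m * (c * (0 + (if d v then 1 else 0)))"
      by (simp add: algebra_simps)
    then show "fps_X ^ (c * (a + (if d v then m else 0))) * (fps_X ^ al * dilate m (R * g v))
      = fps_X ^ (al + c * a) * (fps_X ^ (m * (c * (0 + (if d v then 1 else 0)))) * dilate m (R * g v))"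
      unfolding mult.assoc[symmetric] power_add[symmetric] by (rule arg_cong)
  qed
  also have "\<dots> = fps_X ^ (al + c * a) * dilate m ((1 - fps_X ^ c) * R * G)"
    unfolding G' dilate_sum dilate_mult[OF m] dilate_X_power[OF m] ..
  finally show ?thesis .
qed

definition region_fps :: "bool \<Rightarrow> nat \<Rightarrow> nat \<Rightarrow> int \<Rightarrow> int set \<Rightarrow> complex fps" where
  "region_fps full a m u S = Abs_fps (\<lambda>T. of_nat (card (region full a m u (int T) S)))"

lemma region_fps_rec:
  assumes S: "finite S" "\<And>s. s \<in> S \<Longrightarrow> s > 0" "S \<noteq> {}" "full \<or> (\<forall>s. S \<noteq> {s})" and m: "m > 0"
  shows "region_fps full a m u S
    = (\<Sum>v\<in>signed S. gap_fps 2 (a + (if u > v then m else 0)) * region_fps full a m v (S - {\<bar>v\<bar>}))"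
proof (rule fps_ext)
  fix T
  show "fps_nth (region_fps full a m u S) T = fps_nth (\<Sum>v\<in>signed S.
      gap_fps 2 (a + (if u > v then m else 0)) * region_fps full a m v (S - {\<bar>v\<bar>})) T"
  proof -
    have c: "card (region full a m u (int T) S) = (\<Sum>v\<in>signed S. \<Sum>i=0..T.
     if even i \<and> a + (if u > v then m else 0) \<le> i div 2
     then card (region full a m v (int (T - i)) (S - {\<bar>v\<bar>})) else 0)"
      by (rule card_region_rec[OF S m])
    show ?thesis
      unfolding fps_sum_nth fps_mult_nth region_fps_def gap_fps_def fps_nth_Abs_fps c of_nat_sum
      by (intro sum.cong refl) auto
  qed
qed

text \<open>There are a mirrored pair of gaps for each element of \<open>S\<close> and one gap
  across the axis, together \<open>2 * card S + 1\<close>.\<close>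

lemma region_fps_full_dilate:
  assumes S: "finite S" "\<And>s. s \<in> S \<Longrightarrow> s > 0" and m: "m > 0"
  shows "(1 - fps_X ^ 2) ^ card S * (1 - fps_X) * region_fps True a m u S
    = fps_X ^ (a * (2 * card S + 1)) * dilate m ((1 - fps_X ^ 2) ^ card S * (1 - fps_X) * region_fps True 0 1 u S)"
  using S
proof (induction "card S" arbitrary: S u)
  case 0
  then have S: "S = {}" by simp
  \<comment> \<open>Without labels only the gap from \<open>u\<close> to \<open>- u\<close> remains.
    It is its own mirror image and enters the length once.\<close>
  have e: "region_fps True a m u {} = gap_fps 1 (a + (if u > - u then m else 0))" for a m
  proof (rule fps_ext)
    fix T
    have "region True a m u (int T) {} = (if ok a m u 0 (- u) (int T) then {\<lambda>_. undefined} else {})"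
      by (auto simp: region_def signed_def)
    moreover have "ok a m u 0 (- u) (int T) \<longleftrightarrow> int (a + (if u > - u then m else 0)) \<le> int T"
      by (simp add: ok_def)
    ultimately show "fps_nth (region_fps True a m u {}) T = fps_nth (gap_fps 1 (a + (if u > - u then m else 0))) T"
      by (simp add: region_fps_def gap_fps_def)
  qed
  have g: "(1 - fps_X) * gap_fps 1 k = fps_X ^ k" for k using gap_fps_mult[of 1 k] by simp
  show ?case unfolding S using m
    by (auto simp: e g[unfolded One_nat_def] dilate_X_power power_add[symmetric])
next
  case (Suc k)
  let ?R = "(1 - fps_X ^ 2) ^ k * (1 - fps_X) :: complex fps"
  have S: "finite S" "\<And>s. s \<in> S \<Longrightarrow> s > 0" "S \<noteq> {}" using Suc by auto
  have "?R * region_fps True a m v (S - {\<bar>v\<bar>})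
      = fps_X ^ (a * (2 * k + 1)) * dilate m (?R * region_fps True 0 1 v (S - {\<bar>v\<bar>}))" if v: "v \<in> signed S" for v
  proof -
    have "\<bar>v\<bar> \<in> S" using v signed_iff[of S v] S(2) by auto
    then have k: "k = card (S - {\<bar>v\<bar>})" using Suc.hyps(2) S(1) by simp
    show ?thesis unfolding k
      by (rule Suc.hyps(1)[OF k]) (use S in auto)
  qed
  note IH = this
  have rec: "region_fps True a m u S = (\<Sum>v\<in>signed S. gap_fps 2 (a + (if u > v then m else 0)) * region_fps True a m v (S - {\<bar>v\<bar>}))"
    if "m > 0" for a m
    by (rule region_fps_rec) (use S that in auto)
  from gap_recursion_dilate[OF zero_less_numeral m rec[OF m] rec[OF zero_less_one] IH]
  have "(1 - fps_X ^ 2) * ?R * region_fps True a m u S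
     = fps_X ^ (a * (2 * k + 1) + 2 * a) * dilate m ((1 - fps_X ^ 2) * ?R * region_fps True 0 1 u S)"
    by simp
  moreover have "(1 - fps_X ^ 2) ^ card S * (1 - fps_X) = (1 - fps_X ^ 2) * ?R"
    unfolding Suc.hyps(2)[symmetric] by (simp add: mult_ac)
  moreover have "a * (2 * card S + 1) = a * (2 * k + 1) + 2 * a"
    unfolding Suc.hyps(2)[symmetric] by (simp add: algebra_simps)
  ultimately show ?case by metis
qed

text \<open>The innermost label \<open>s\<close> and its negative do not constrain each other, so
  \<open>s\<close> only has to keep its distance from both ends. These two independent gaps of
  stride 1 are the base case and cost \<open>(1 - X) ^ 2\<close>, where the full case has
  \<open>(1 - X ^ 2) * (1 - X)\<close>.\<close>

lemma region_fps_free_dilate: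
  assumes S: "finite S" "\<And>s. s \<in> S \<Longrightarrow> s > 0" "S \<noteq> {}" and m: "m > 0"
  shows "(1 - fps_X ^ 2) ^ (card S - 1) * (1 - fps_X) ^ 2 * region_fps False a m u S
    = fps_X ^ (2 * a * card S) * dilate m ((1 - fps_X ^ 2) ^ (card S - 1) * (1 - fps_X) ^ 2 * region_fps False 0 1 u S)"
  using S
proof (induction "card S - 1" arbitrary: S u)
  case 0
  have "card S > 0" using 0(2,4) by (simp add: card_gt_0_iff)
  then have "card S = 1" using 0(1) by linarith
  then obtain s where S: "S = {s}" by (auto simp: card_1_singleton_iff)
  then have s: "s > 0" using 0 by auto
  have e: "region_fps False a m u {s} = gap_fps 1 (a + (if u > s then m else 0)) * gap_fps 1 (a + (if s > - u then m else 0))" for a m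
  proof (rule fps_ext)
    fix T
    let ?A = "a + (if u > s then m else 0)" and ?B = "a + (if s > - u then m else 0)"
    have "bij_betw (\<lambda>f. nat (f s)) (region False a m u (int T) {s}) {i\<in>{0..T}. ?A \<le> i \<and> ?B \<le> T - i}"
    proof (rule bij_betw_byWitness[where f'="\<lambda>i. restrict (\<lambda>_. int i) {s}"])
      show "\<forall>f\<in>region False a m u (int T) {s}. restrict (\<lambda>_. int (nat (f s))) {s} = f"
      proof
        fix f assume f: "f \<in> region False a m u (int T) {s}"
        then have "f \<in> {s} \<rightarrow>\<^sub>E {0..int T}" using region_subset[of "{s}"] s by blast
        then show "restrict (\<lambda>_. int (nat (f s))) {s} = f"
          by (auto simp: PiE_iff extensional_def restrict_def fun_eq_iff)
      qed
      show "\<forall>i\<in>{i\<in>{0..T}. ?A \<le> i \<and> ?B \<le> T - i}. nat (restrict (\<lambda>_. int i) {s} s) = i" by simp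
      show "(\<lambda>f. nat (f s)) ` region False a m u (int T) {s} \<subseteq> {i\<in>{0..T}. ?A \<le> i \<and> ?B \<le> T - i}"
      proof (rule image_subsetI)
        fix f assume f: "f \<in> region False a m u (int T) {s}"
        have "s \<in> signed {s}" "mpos (int T) f s = f s" using s by (auto simp: signed_def mpos_def)
        then have "ok a m u 0 s (f s)" "ok a m s (f s) (- u) (int T)" using regionD(2,3)[OF f, of s] by auto
        then show "nat (f s) \<in> {i\<in>{0..T}. ?A \<le> i \<and> ?B \<le> T - i}"
          by (auto simp: ok_def split: if_splits)
      qed
      show "(\<lambda>i. restrict (\<lambda>_. int i) {s}) ` {i\<in>{0..T}. ?A \<le> i \<and> ?B \<le> T - i} \<subseteq> region False a m u (int T) {s}"
      proof (rule image_subsetI)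
        fix i assume i: "i \<in> {i\<in>{0..T}. ?A \<le> i \<and> ?B \<le> T - i}"
        have sg: "v = s \<or> v = - s" if "v \<in> signed {s}" for v using that by (auto simp: signed_def)
        show "restrict (\<lambda>_. int i) {s} \<in> region False a m u (int T) {s}"
        proof (rule regionI)
          show "ok a m u 0 v (mpos (int T) (restrict (\<lambda>_. int i) {s}) v)" if "v \<in> signed {s}" for v
            using sg[OF that] i s by (auto simp: mpos_def ok_def split: if_splits)
          show "comparable a m v (mpos (int T) (restrict (\<lambda>_. int i) {s}) v) w (mpos (int T) (restrict (\<lambda>_. int i) {s}) w)"
            if "v \<in> signed {s}" "w \<in> signed {s}" "v \<noteq> w" "v = - w \<Longrightarrow> False" for v w
            using sg[OF that(1)] sg[OF that(2)] that(3,4) by auto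
        qed (use s in auto)
      qed
    qed
    then have c: "card (region False a m u (int T) {s}) = card {i\<in>{0..T}. ?A \<le> i \<and> ?B \<le> T - i}"
      by (rule bij_betw_same_card)
    have "of_nat (card {i\<in>{0..T}. ?A \<le> i \<and> ?B \<le> T - i}) = (\<Sum>i\<in>{i\<in>{0..T}. ?A \<le> i \<and> ?B \<le> T - i}. 1 :: complex)" by simp
    also have "\<dots> = (\<Sum>i=0..T. if ?A \<le> i \<and> ?B \<le> T - i then 1 else 0)" by (rule sum.inter_filter) simp
    also have "\<dots> = fps_nth (gap_fps 1 ?A * gap_fps 1 ?B) T"
      unfolding fps_mult_nth by (intro sum.cong refl) (simp add: gap_fps_def)
    finally show "fps_nth (region_fps False a m u {s}) T = fps_nth (gap_fps 1 ?A * gap_fps 1 ?B) T"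
      by (simp add: region_fps_def c)
  qed
  have g: "(1 - fps_X) * gap_fps 1 k = fps_X ^ k" for k using gap_fps_mult[of 1 k] by simp
  have "(1 - fps_X) ^ 2 * (gap_fps 1 k * gap_fps 1 l) = fps_X ^ (k + l)" for k l
  proof -
    have "(1 - fps_X) ^ 2 * (gap_fps 1 k * gap_fps 1 l) = ((1 - fps_X) * gap_fps 1 k) * ((1 - fps_X) * gap_fps 1 l)"
      by (simp only: power2_eq_square mult_ac)
    then show ?thesis unfolding g by (simp add: power_add)
  qed
  note g2 = this
  show ?case unfolding S using m
    by (auto simp: e g2[unfolded One_nat_def] dilate_X_power power_add[symmetric] algebra_simps)
next
  case (Suc k)
  let ?R = "(1 - fps_X ^ 2) ^ k * (1 - fps_X) ^ 2 :: complex fps"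
  have S: "finite S" "\<And>s. s \<in> S \<Longrightarrow> s > 0" "S \<noteq> {}" and ns: "False \<or> (\<forall>s. S \<noteq> {s})" using Suc by auto
  have "?R * region_fps False a m v (S - {\<bar>v\<bar>})
      = fps_X ^ (2 * a * Suc k) * dilate m (?R * region_fps False 0 1 v (S - {\<bar>v\<bar>}))" if v: "v \<in> signed S" for v
  proof -
    have vS: "\<bar>v\<bar> \<in> S" using v signed_iff[of S v] S(2) by auto
    then have k: "Suc k = card (S - {\<bar>v\<bar>})" using Suc.hyps(2) S(1) by simp
    then have k': "k = card (S - {\<bar>v\<bar>}) - 1" by simp
    have "S - {\<bar>v\<bar>} \<noteq> {}" using k by (metis card.empty nat.distinct(1))
    then have "(1 - fps_X ^ 2) ^ (card (S - {\<bar>v\<bar>}) - 1) * (1 - fps_X) ^ 2 * region_fps False a m v (S - {\<bar>v\<bar>})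
    = fps_X ^ (2 * a * card (S - {\<bar>v\<bar>})) * dilate m ((1 - fps_X ^ 2) ^ (card (S - {\<bar>v\<bar>}) - 1) * (1 - fps_X) ^ 2 * region_fps False 0 1 v (S - {\<bar>v\<bar>}))"
      by (intro Suc.hyps(1)[OF k']) (use S in auto)
    then show ?thesis unfolding k[symmetric] diff_Suc_1 .
  qed
  note IH = this
  have rec: "region_fps False a m u S = (\<Sum>v\<in>signed S. gap_fps 2 (a + (if u > v then m else 0)) * region_fps False a m v (S - {\<bar>v\<bar>}))"
    if "m > 0" for a m
    by (rule region_fps_rec) (use S that ns in auto)
  from gap_recursion_dilate[OF zero_less_numeral m rec[OF m] rec[OF zero_less_one] IH]
  have "(1 - fps_X ^ 2) * ?R * region_fps False a m u S
     = fps_X ^ (2 * a * Suc k + 2 * a) * dilate m ((1 - fps_X ^ 2) * ?R * region_fps False 0 1 u S)"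
    by simp
  moreover have "(1 - fps_X ^ 2) ^ (card S - 1) * (1 - fps_X) ^ 2 = (1 - fps_X ^ 2) * ?R"
    unfolding Suc.hyps(2)[symmetric] by (simp add: mult_ac)
  moreover have "2 * a * card S = 2 * a * Suc k + 2 * a"
  proof -
    have "card S = Suc (Suc k)" using Suc.hyps(2) by linarith
    then show ?thesis by (simp add: algebra_simps)
  qed
  ultimately show ?case by metis
qed

text \<open>For \<open>a = 0\<close>, \<open>m = 1\<close> two distinct labels are comparable
  wherever they are; only the ends still restrict a label.\<close>

lemma region_unconstrained:
  assumes S: "\<And>s. s \<in> S \<Longrightarrow> s > 0" and ne: "full \<Longrightarrow> S \<noteq> {}"
  shows "region full 0 1 u T S = (S \<rightarrow>\<^sub>E UNIV) \<inter> {f. \<forall>s\<in>S. ok 0 1 u 0 s (f s) \<and> ok 0 1 s (f s) (- u) T}" (is "_ = ?R")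
proof
  show "region full 0 1 u T S \<subseteq> ?R"
  proof
    fix f assume f: "f \<in> region full 0 1 u T S"
    have "ok 0 1 u 0 s (f s) \<and> ok 0 1 s (f s) (- u) T" if "s \<in> S" for s
    proof -
      have "s \<in> signed S" "mpos T f s = f s" using that S by (auto simp: signed_def mpos_def)
      then show ?thesis using regionD(2,3)[OF f, of s] by auto
    qed
    then show "f \<in> ?R" using regionD(1)[OF f] by auto
  qed
  show "?R \<subseteq> region full 0 1 u T S"
  proof
    fix f assume f: "f \<in> ?R"
    show "f \<in> region full 0 1 u T S"
    proof (rule regionI[OF _ S])
      show "ok 0 1 u 0 v (mpos T f v)" if v: "v \<in> signed S" for v
      proof (rule signed_cases[OF S v])
        assume "v > 0" "v \<in> S"
        then show ?thesis using f by (auto simp: mpos_def)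
      next
        assume v: "v < 0" "- v \<in> S"
        then have "ok 0 1 (- v) (f (- v)) (- u) T" using f by auto
        then have "ok 0 1 (- v) (T - (T - f (- v))) (- u) (T - 0)" by simp
        then have "ok 0 1 u 0 v (T - f (- v))" unfolding ok_mirror .
        then show ?thesis using v by (simp add: mpos_def)
      qed
      show "ok 0 1 u 0 (- u) T" if fu: full
      proof -
        obtain s where "s \<in> S" using ne[OF fu] by blast
        then have "ok 0 1 u 0 s (f s)" "ok 0 1 s (f s) (- u) T" using f by auto
        then show ?thesis by (rule ok_trans)
      qed
    qed (use f in \<open>auto simp: ok_def\<close>)
  qed
qed

lemma card_region_unconstrained:
  assumes S: "finite S" "\<And>s. s \<in> S \<Longrightarrow> s > 0" and ne: "full \<Longrightarrow> S \<noteq> {}"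
  shows "card (region full 0 1 u T S)
    = (\<Prod>s\<in>S. nat (T + 1 - (if u > s then 1 else 0) - (if s > - u then 1 else 0)))"
proof -
  have "region full 0 1 u T S
      = (\<Pi>\<^sub>E s\<in>S. {(if u > s then 1 else 0) .. T - (if s > - u then 1 else 0)})"
  proof -
    have r: "region full 0 1 u T S = (S \<rightarrow>\<^sub>E UNIV) \<inter> {f. \<forall>s\<in>S. ok 0 1 u 0 s (f s) \<and> ok 0 1 s (f s) (- u) T}"
      by (rule region_unconstrained[OF S(2) ne])
    have e: "ok 0 1 u 0 s x \<and> ok 0 1 s x (- u) T
        \<longleftrightarrow> x \<in> {(if u > s then 1 else 0) .. T - (if s > - u then 1 else 0)}" for s x
      by (auto simp: ok_def)
    show ?thesis unfolding r set_eq_iff Int_iff PiE_iff mem_Collect_eq e by blast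
  qed
  then show ?thesis using S(1) by (simp add: card_PiE algebra_simps)
qed

text \<open>From 0 up to a positive label there is no descent, from the label back to 0 there is
  one. This excludes one of the \<open>T + 1\<close> positions.\<close>

lemma region_fps_zero_unconstrained:
  assumes S: "finite S" "\<And>s. s \<in> S \<Longrightarrow> s > 0" "S \<noteq> {}"
  shows "region_fps full 0 1 0 S = power_fps (card S)"
proof (rule fps_ext)
  fix T
  have "card (region full 0 1 0 (int T) S) = (\<Prod>s\<in>S. T)"
  proof -
    have "card (region full 0 1 0 (int T) S)
      = (\<Prod>s\<in>S. nat (int T + 1 - (if 0 > s then 1 else 0) - (if s > - 0 then 1 else 0)))"
      by (rule card_region_unconstrained[OF S(1,2)]) (use S(3) in auto)
    also have "\<dots> = (\<Prod>s\<in>S. T)"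
      by (intro prod.cong refl) (use S(2) in \<open>force\<close>)
    finally show ?thesis .
  qed
  then show "fps_nth (region_fps full 0 1 0 S) T = fps_nth (power_fps (card S)) T"
    by (simp add: region_fps_def power_fps_def)
qed

section \<open>Configurations on a circle with a fixed label\<close>

text \<open>Type A has no reflection: the circle is cut at a label \<open>e\<close>, whose second
  copy is at \<open>T\<close>. The left end \<open>u\<close> changes in the recursion, the right end
  \<open>e\<close> does not.\<close>

definition line_region :: "nat \<Rightarrow> nat \<Rightarrow> int \<Rightarrow> int \<Rightarrow> int \<Rightarrow> int set \<Rightarrow> (int \<Rightarrow> int) set" where
  "line_region a m e u T S = {f \<in> S \<rightarrow>\<^sub>E UNIV.
     (\<forall>v\<in>S. ok a m u 0 v (f v)) \<and> (\<forall>v\<in>S. ok a m v (f v) e T) \<and>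
     (\<forall>v\<in>S. \<forall>w\<in>S. v \<noteq> w \<longrightarrow> comparable a m v (f v) w (f w)) \<and> ok a m u 0 e T}"

lemma line_regionD:
  assumes "f \<in> line_region a m e u T S"
  shows "f \<in> S \<rightarrow>\<^sub>E UNIV"
    "\<And>v. v \<in> S \<Longrightarrow> ok a m u 0 v (f v)"
    "\<And>v. v \<in> S \<Longrightarrow> ok a m v (f v) e T"
    "\<And>v w. v \<in> S \<Longrightarrow> w \<in> S \<Longrightarrow> v \<noteq> w \<Longrightarrow> comparable a m v (f v) w (f w)"
    "ok a m u 0 e T"
  using assms by (simp_all add: line_region_def)

lemma finite_line_region: "finite S \<Longrightarrow> finite (line_region a m e u T S)"
proof (rule finite_subset)
  show "line_region a m e u T S \<subseteq> S \<rightarrow>\<^sub>E {0..T}"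
  proof
    fix f assume f: "f \<in> line_region a m e u T S"
    have "f s \<in> {0..T}" if s: "s \<in> S" for s
      using ok_le[OF line_regionD(2)[OF f s]] ok_le[OF line_regionD(3)[OF f s]] by simp
    then show "f \<in> S \<rightarrow>\<^sub>E {0..T}" using line_regionD(1)[OF f] by (simp add: PiE_iff)
  qed
qed (simp add: finite_PiE)

definition line_first :: "nat \<Rightarrow> nat \<Rightarrow> int \<Rightarrow> int \<Rightarrow> int \<Rightarrow> int set \<Rightarrow> int \<Rightarrow> int \<Rightarrow> (int \<Rightarrow> int) set" where
  "line_first a m e u T S v g = {f \<in> line_region a m e u T S. f v = g \<and> (\<forall>w\<in>S. w \<noteq> v \<longrightarrow> ok a m v g w (f w))}"

text \<open>The argument of \<open>card_region_first\<close>, except that a single label is removed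
  and the gap enters the length once.\<close>

lemma card_line_first:
  assumes v: "v \<in> S"
  shows "card (line_first a m e u T S v g) =
    (if ok a m u 0 v g then card (line_region a m e v (T - g) (S - {v})) else 0)"
proof (cases "ok a m u 0 v g")
  case False
  have "line_first a m e u T S v g = {}"
  proof (rule equals0I)
    fix f assume "f \<in> line_first a m e u T S v g"
    then have f: "f \<in> line_region a m e u T S" "f v = g" by (auto simp: line_first_def)
    then show False using line_regionD(2)[OF f(1) v] False by simp
  qed
  then show ?thesis using False by simp
next
  case True
  let ?S = "S - {v}"
  define \<phi> where "\<phi> f = restrict (\<lambda>s. f s - g) ?S" for f :: "int \<Rightarrow> int"
  define \<psi> where "\<psi> h = restrict (\<lambda>s. if s = v then g else h s + g) S" for h :: "int \<Rightarrow> int"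
  have phi: "\<phi> f w = f w - g" if "w \<in> ?S" for f w using that by (simp add: \<phi>_def)
  have psi: "\<psi> h w = h w + g" if "w \<in> ?S" for h w using that by (simp add: \<psi>_def)
  have psiv: "\<psi> h v = g" for h using v by (simp add: \<psi>_def)
  have "bij_betw \<phi> (line_first a m e u T S v g) (line_region a m e v (T - g) ?S)"
  proof (rule bij_betw_byWitness[where f'=\<psi>])
    show "\<forall>f\<in>line_first a m e u T S v g. \<psi> (\<phi> f) = f"
    proof
      fix f assume "f \<in> line_first a m e u T S v g"
      then have f: "f \<in> S \<rightarrow>\<^sub>E UNIV" "f v = g" by (auto simp: line_first_def dest: line_regionD)
      show "\<psi> (\<phi> f) = f"
      proof (rule extensionalityI[of _ S])
        show "f \<in> extensional S" using f(1) by (simp add: PiE_iff)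
        fix s assume "s \<in> S"
        then show "\<psi> (\<phi> f) s = f s" using f(2) by (simp add: \<psi>_def \<phi>_def)
      qed (simp add: \<psi>_def)
    qed
    show "\<forall>h\<in>line_region a m e v (T - g) ?S. \<phi> (\<psi> h) = h"
    proof
      fix h assume "h \<in> line_region a m e v (T - g) ?S"
      then have h: "h \<in> ?S \<rightarrow>\<^sub>E UNIV" by (rule line_regionD)
      show "\<phi> (\<psi> h) = h"
      proof (rule extensionalityI[of _ ?S])
        show "h \<in> extensional ?S" using h by (simp add: PiE_iff)
      qed (auto simp: \<psi>_def \<phi>_def)
    qed
    show "\<phi> ` line_first a m e u T S v g \<subseteq> line_region a m e v (T - g) ?S"
    proof (rule image_subsetI)
      fix f assume f': "f \<in> line_first a m e u T S v g"
      then have f: "f \<in> line_region a m e u T S"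
        and o: "\<And>w. w \<in> S \<Longrightarrow> w \<noteq> v \<Longrightarrow> ok a m v g w (f w)" and fv: "f v = g"
        by (auto simp: line_first_def)
      have "ok a m v g e T" using line_regionD(3)[OF f v] fv by simp
      moreover have "\<phi> f \<in> ?S \<rightarrow>\<^sub>E UNIV" by (simp add: \<phi>_def)
      moreover have "\<forall>w\<in>?S. ok a m v g w (f w)" using o by simp
      moreover have "\<forall>w\<in>?S. ok a m w (f w) e T" using line_regionD(3)[OF f] by simp
      moreover have "\<forall>w\<in>?S. \<forall>w'\<in>?S. w \<noteq> w' \<longrightarrow> comparable a m w (f w) w' (f w')"
        using line_regionD(4)[OF f] by simp
      ultimately show "\<phi> f \<in> line_region a m e v (T - g) ?S"
        using ok_shift[of a m v g g] ok_shift[of a m _ _ g]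
        by (simp add: line_region_def phi)
    qed
    show "\<psi> ` line_region a m e v (T - g) ?S \<subseteq> line_first a m e u T S v g"
    proof (rule image_subsetI)
      fix h assume h: "h \<in> line_region a m e v (T - g) ?S"
      have vw: "ok a m v g w (\<psi> h w)" if "w \<in> ?S" for w
        using line_regionD(2)[OF h that] psi[OF that, of h] ok_shift[of a m v g g w "\<psi> h w"] by simp
      have we: "ok a m w (\<psi> h w) e T" if "w \<in> ?S" for w
        using line_regionD(3)[OF h that] psi[OF that, of h] ok_shift[of a m w "\<psi> h w" g e T] by simp
      have ve: "ok a m v g e T" using line_regionD(5)[OF h] ok_shift[of a m v g g e T] by simp
      have ww: "comparable a m w (\<psi> h w) w' (\<psi> h w')" if "w \<in> ?S" "w' \<in> ?S" "w \<noteq> w'" for w w'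
        using line_regionD(4)[OF h that] psi[OF that(1), of h] psi[OF that(2), of h]
          ok_shift[of a m w "\<psi> h w" g w' "\<psi> h w'"] ok_shift[of a m w' "\<psi> h w'" g w "\<psi> h w"] by simp
      have "\<psi> h \<in> S \<rightarrow>\<^sub>E UNIV" by (simp add: \<psi>_def)
      moreover have "ok a m u 0 w (\<psi> h w)" if "w \<in> S" for w
        using that True vw[of w] psiv[of h] ok_trans[OF True vw[of w]] by (cases "w = v") auto
      moreover have "ok a m w (\<psi> h w) e T" if "w \<in> S" for w
        using that we[of w] ve psiv[of h] by (cases "w = v") auto
      moreover have "comparable a m w (\<psi> h w) w' (\<psi> h w')" if "w \<in> S" "w' \<in> S" "w \<noteq> w'" for w w'
        using that vw[of w] vw[of w'] ww[of w w'] psiv[of h] by (cases "w = v"; cases "w' = v") auto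
      moreover have "ok a m u 0 e T" using True ve by (rule ok_trans)
      ultimately show "\<psi> h \<in> line_first a m e u T S v g"
        using vw psiv by (simp add: line_first_def line_region_def)
    qed
  qed
  then show ?thesis using True by (simp add: bij_betw_same_card)
qed

lemma card_line_region_rec:
  assumes S: "finite S" "S \<noteq> {}" and m: "m > 0"
  shows "card (line_region a m e u (int T) S) = (\<Sum>v\<in>S. \<Sum>i=0..T.
     if a + (if u > v then m else 0) \<le> i
     then card (line_region a m e v (int (T - i)) (S - {v})) else 0)"
proof -
  define R where "R p = line_first a m e u (int T) S (fst p) (int (snd p))" for p :: "int \<times> nat"
  have fin: "finite (line_first a m e u (int T) S v g)" for v g
    by (rule finite_subset[OF _ finite_line_region[OF S(1)]]) (auto simp: line_first_def)
  have "line_region a m e u (int T) S = (\<Union>p\<in>S \<times> {0..T}. R p)"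
  proof
    show "line_region a m e u (int T) S \<subseteq> (\<Union>p\<in>S \<times> {0..T}. R p)"
    proof
      fix f assume f: "f \<in> line_region a m e u (int T) S"
      obtain v where v: "v \<in> S" and min: "\<And>w. w \<in> S \<Longrightarrow> f v < f w \<or> (f v = f w \<and> v \<le> w)"
        by (rule ex_lex_min[OF S, of f]) blast
      have "ok a m v (f v) w (f w)" if w: "w \<in> S" "w \<noteq> v" for w
        using ok_of_lex[OF line_regionD(4)[OF f v w(1)]] w min[OF w(1)] m by force
      then have 1: "f \<in> line_first a m e u (int T) S v (f v)" using f by (simp add: line_first_def)
      have "0 \<le> f v" "f v \<le> int T" using ok_le[OF line_regionD(2)[OF f v]] ok_le[OF line_regionD(3)[OF f v]] by auto
      then have "f \<in> R (v, nat (f v))" "(v, nat (f v)) \<in> S \<times> {0..T}" using 1 v by (auto simp: R_def)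
      then show "f \<in> (\<Union>p\<in>S \<times> {0..T}. R p)" by blast
    qed
    show "(\<Union>p\<in>S \<times> {0..T}. R p) \<subseteq> line_region a m e u (int T) S"
      by (auto simp: R_def line_first_def)
  qed
  also have "card \<dots> = (\<Sum>p\<in>S \<times> {0..T}. card (R p))"
  proof (rule card_UN_disjoint)
    show "finite (S \<times> {0..T})" using S(1) by simp
    show "\<forall>p\<in>S \<times> {0..T}. finite (R p)" using fin by (simp add: R_def)
    show "\<forall>p\<in>S \<times> {0..T}. \<forall>p'\<in>S \<times> {0..T}. p \<noteq> p' \<longrightarrow> R p \<inter> R p' = {}"
    proof (intro ballI impI equals0I)
      fix p p' f assume p: "p \<in> S \<times> {0..T}" "p' \<in> S \<times> {0..T}" "p \<noteq> p'" "f \<in> R p \<inter> R p'"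
      have f: "f (fst p) = int (snd p)" "f (fst p') = int (snd p')"
        "\<And>w. w \<in> S \<Longrightarrow> w \<noteq> fst p \<Longrightarrow> ok a m (fst p) (int (snd p)) w (f w)"
        "\<And>w. w \<in> S \<Longrightarrow> w \<noteq> fst p' \<Longrightarrow> ok a m (fst p') (int (snd p')) w (f w)"
        using p(4) by (auto simp: R_def line_first_def)
      show False
      proof (cases "fst p = fst p'")
        case True
        then have "snd p = snd p'" using f(1,2) by simp
        then show False using p(3) True by (simp add: prod_eq_iff)
      next
        case False
        have "fst p \<in> S" "fst p' \<in> S" using p(1,2) by auto
        then show False using f(3)[of "fst p'"] f(4)[of "fst p"] f(1,2) False
          ok_antisym[OF _ _ m False, of a "int (snd p)" "int (snd p')"] by auto
      qed
    qed
  qed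
  also have "\<dots> = (\<Sum>v\<in>S. \<Sum>i=0..T. card (R (v, i)))"
    by (simp add: sum.cartesian_product)
  also have "\<dots> = (\<Sum>v\<in>S. \<Sum>i=0..T.
     if a + (if u > v then m else 0) \<le> i
     then card (line_region a m e v (int (T - i)) (S - {v})) else 0)"
  proof (intro sum.cong refl)
    fix v i assume v: "v \<in> S" and i: "i \<in> {0..T}"
    have "ok a m u 0 v (int i) \<longleftrightarrow> int (a + (if u > v then m else 0)) \<le> int i"
      by (simp add: ok_def)
    then have 1: "ok a m u 0 v (int i) \<longleftrightarrow> a + (if u > v then m else 0) \<le> i"
      unfolding of_nat_le_iff .
    have 2: "int T - int i = int (T - i)" using i by auto
    show "card (R (v, i)) = (if a + (if u > v then m else 0) \<le> i
     then card (line_region a m e v (int (T - i)) (S - {v})) else 0)"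
      unfolding R_def fst_conv snd_conv card_line_first[OF v] 1 2 ..
  qed
  finally show ?thesis .
qed

definition line_fps :: "nat \<Rightarrow> nat \<Rightarrow> int \<Rightarrow> int \<Rightarrow> int set \<Rightarrow> complex fps" where
  "line_fps a m e u S = Abs_fps (\<lambda>T. of_nat (card (line_region a m e u (int T) S)))"

lemma line_fps_rec:
  assumes S: "finite S" "S \<noteq> {}" and m: "m > 0"
  shows "line_fps a m e u S
    = (\<Sum>v\<in>S. gap_fps 1 (a + (if u > v then m else 0)) * line_fps a m e v (S - {v}))"
proof (rule fps_ext)
  fix T
  show "fps_nth (line_fps a m e u S) T
    = fps_nth (\<Sum>v\<in>S. gap_fps 1 (a + (if u > v then m else 0)) * line_fps a m e v (S - {v})) T"
    unfolding fps_sum_nth fps_mult_nth line_fps_def gap_fps_def fps_nth_Abs_fps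
      card_line_region_rec[OF S m] of_nat_sum
    by (intro sum.cong refl) auto
qed

text \<open>The \<open>card S\<close> labels leave \<open>card S + 1\<close> gaps, all of stride
  1.\<close>

lemma line_fps_dilate:
  assumes S: "finite S" and m: "m > 0"
  shows "(1 - fps_X) ^ Suc (card S) * line_fps a m e u S
    = fps_X ^ (a * Suc (card S)) * dilate m ((1 - fps_X) ^ Suc (card S) * line_fps 0 1 e u S)"
  using S
proof (induction "card S" arbitrary: S u)
  case 0
  then have S: "S = {}" by simp
  have e: "line_fps a m e u {} = gap_fps 1 (a + (if u > e then m else 0))" for a m
  proof (rule fps_ext)
    fix T
    have "line_region a m e u (int T) {} = (if ok a m u 0 e (int T) then {\<lambda>_. undefined} else {})"
      by (auto simp: line_region_def)
    moreover have "ok a m u 0 e (int T) \<longleftrightarrow> int (a + (if u > e then m else 0)) \<le> int T"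
      by (simp add: ok_def)
    ultimately show "fps_nth (line_fps a m e u {}) T = fps_nth (gap_fps 1 (a + (if u > e then m else 0))) T"
      by (simp add: line_fps_def gap_fps_def)
  qed
  have g: "(1 - fps_X) * gap_fps 1 k = fps_X ^ k" for k using gap_fps_mult[of 1 k] by simp
  show ?case unfolding S using m
    by (auto simp: e g[unfolded One_nat_def] dilate_X_power power_add[symmetric])
next
  case (Suc k)
  have S: "finite S" "S \<noteq> {}" using Suc by auto
  have IH: "(1 - fps_X) ^ Suc k * line_fps a m e v (S - {v})
      = fps_X ^ (a * Suc k) * dilate m ((1 - fps_X) ^ Suc k * line_fps 0 1 e v (S - {v}))" if v: "v \<in> S" for v
  proof -
    have k: "k = card (S - {v})" using Suc.hyps(2) S(1) v by simp
    show ?thesis unfolding k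
      by (rule Suc.hyps(1)[OF k]) (use S in auto)
  qed
  from gap_recursion_dilate[OF zero_less_one m line_fps_rec[OF S m] line_fps_rec[OF S zero_less_one] IH]
  have "(1 - fps_X ^ 1) * (1 - fps_X) ^ Suc k * line_fps a m e u S
     = fps_X ^ (a * Suc k + 1 * a) * dilate m ((1 - fps_X ^ 1) * (1 - fps_X) ^ Suc k * line_fps 0 1 e u S)" .
  moreover have "(1 - fps_X) ^ Suc (card S) = (1 - fps_X ^ 1) * (1 - fps_X :: complex fps) ^ Suc k"
    unfolding Suc.hyps(2)[symmetric] by simp
  moreover have "a * Suc (card S) = a * Suc k + 1 * a"
    unfolding Suc.hyps(2)[symmetric] by simp
  ultimately show ?case by metis
qed

text \<open>As \<open>e\<close> is below all labels, only the return to \<open>e\<close> is a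
  descent; position \<open>T\<close> is lost and position 0 is kept.\<close>

lemma line_fps_unconstrained:
  assumes S: "finite S" "\<And>s. s \<in> S \<Longrightarrow> s > e" "S \<noteq> {}"
  shows "line_fps 0 1 e e S = power_fps (card S)"
proof (rule fps_ext)
  fix T
  have "line_region 0 1 e e (int T) S = S \<rightarrow>\<^sub>E {0..<int T}"
  proof (intro set_eqI iffI)
    fix f assume f: "f \<in> line_region 0 1 e e (int T) S"
    have "f s \<in> {0..<int T}" if "s \<in> S" for s
      using line_regionD(2,3)[OF f that] S(2)[OF that] by (auto simp: ok_def)
    then show "f \<in> S \<rightarrow>\<^sub>E {0..<int T}" using line_regionD(1)[OF f] by (simp add: PiE_iff)
  next
    fix f assume f: "f \<in> S \<rightarrow>\<^sub>E {0..<int T}"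
    have 1: "ok 0 1 e 0 s (f s)" "ok 0 1 s (f s) e (int T)" if "s \<in> S" for s
      using f that S(2)[OF that] by (auto simp: ok_def PiE_iff)
    have 2: "comparable 0 1 v (f v) w (f w)" if "v \<noteq> w" for v w
      using that by (auto simp: ok_def)
    have 3: "ok 0 1 e 0 e (int T)" by (simp add: ok_def)
    show "f \<in> line_region 0 1 e e (int T) S"
      using f 1 2 3 unfolding line_region_def by (simp add: PiE_iff)
  qed
  then show "fps_nth (line_fps 0 1 e e S) T = fps_nth (power_fps (card S)) T"
    using S(1) by (simp add: line_fps_def power_fps_def card_PiE)
qed

section \<open>Validity on a circle and cutting at a fixed label\<close>

text \<open>Points of the circle are represented by arbitrary integers; quantifying over all lifts
  \<open>p v + k * q\<close> makes the condition independent of the representatives.\<close>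

definition circ_valid :: "bool \<Rightarrow> nat \<Rightarrow> nat \<Rightarrow> int \<Rightarrow> int set \<Rightarrow> (int \<Rightarrow> int) \<Rightarrow> bool" where
  "circ_valid full a m q L p \<longleftrightarrow> (\<forall>u\<in>L. \<forall>v\<in>L. u \<noteq> v \<longrightarrow> (u = - v \<longrightarrow> full) \<longrightarrow>
     (\<forall>k. comparable a m u (p u) v (p v + k * q)))"

lemma circ_validD:
  "circ_valid full a m q L p \<Longrightarrow> u \<in> L \<Longrightarrow> v \<in> L \<Longrightarrow> u \<noteq> v \<Longrightarrow> (u = - v \<Longrightarrow> full) \<Longrightarrow>
    comparable a m u (p u) v (p v + k * q)"
  by (simp add: circ_valid_def)

lemma circ_valid_cong_imp:
  assumes c: "circ_valid full a m q L p" and p: "\<And>v. v \<in> L \<Longrightarrow> \<exists>k. p' v = p v + c + k * q"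
  shows "circ_valid full a m q L p'"
  unfolding circ_valid_def
proof (intro ballI impI allI)
  fix u v k assume uv: "u \<in> L" "v \<in> L" "u \<noteq> v" "u = - v \<longrightarrow> full"
  obtain i where i: "p' u = p u + c + i * q" using p[OF uv(1)] by blast
  obtain j where j: "p' v = p v + c + j * q" using p[OF uv(2)] by blast
  have "comparable a m u (p u) v (p v + (j + k - i) * q)"
    by (rule circ_validD[OF c]) (use uv in auto)
  moreover have "p u = p' u - (c + i * q)" "p v + (j + k - i) * q = p' v + k * q - (c + i * q)"
    using i j by (auto simp: algebra_simps)
  ultimately show "comparable a m u (p' u) v (p' v + k * q)"
    by (simp only: ok_shift)
qed

lemma circ_valid_cong:
  assumes p: "\<And>v. v \<in> L \<Longrightarrow> \<exists>k. p' v = p v + c + k * q"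
  shows "circ_valid full a m q L p' \<longleftrightarrow> circ_valid full a m q L p"
proof
  assume "circ_valid full a m q L p'"
  then show "circ_valid full a m q L p"
  proof (rule circ_valid_cong_imp)
    fix v assume "v \<in> L"
    then obtain k where "p' v = p v + c + k * q" using p by blast
    then have "p v = p' v + (- c) + (- k) * q" by simp
    then show "\<exists>k. p v = p' v + (- c) + k * q" by blast
  qed
qed (rule circ_valid_cong_imp[OF _ p])

lemma ok_mono: "ok a m u x v y \<Longrightarrow> y \<le> y' \<Longrightarrow> ok a m u x v y'"
  by (simp add: ok_def)

lemma ok_mono_left: "ok a m u x v y \<Longrightarrow> x' \<le> x \<Longrightarrow> ok a m u x' v y"
  by (simp add: ok_def)

text \<open>Two neighbouring copies of \<open>v\<close> enclose \<open>u\<close> at admissible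
  distance; every other copy is farther away on the same side.\<close>

lemma comparable_lifts:
  assumes "ok a m u x v (y + q)" "ok a m v y u x" "q \<ge> 0"
  shows "comparable a m u x v (y + k * q)"
proof (cases "k \<ge> 1")
  case True
  then have "1 * q \<le> k * q" using assms(3) by (rule mult_right_mono)
  then show ?thesis using ok_mono[OF assms(1), of "y + k * q"] by simp
next
  case False
  then have "k * q \<le> 0" using assms(3) by (intro mult_nonpos_nonneg) auto
  then show ?thesis using ok_mono_left[OF assms(2), of "y + k * q"] by simp
qed

lemma comparable_all_swap:
  assumes "\<And>k. comparable a m v y u (x + k * q)"
  shows "comparable a m u x v (y + k * q)"
proof -
  have "comparable a m v y u (x + (- k) * q)" by (rule assms)
  then show ?thesis using ok_shift[of a m v "y + k * q" "k * q" u x] ok_shift[of a m u x "k * q" v "y + k * q"]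
    by (simp add: disj_commute)
qed

text \<open>Cutting at \<open>z\<close> opens the circle to a segment from \<open>z\<close> at 0 to
  \<open>z\<close> at \<open>q\<close>. Comparisons across the cut follow by transitivity through
  \<open>z\<close>, so those within one window suffice.\<close>

lemma circ_valid_base:
  assumes q: "q \<ge> 0" and z: "z \<in> L" "p z = 0"
    and base: "\<And>v. v \<in> L \<Longrightarrow> v \<noteq> z \<Longrightarrow> ok a m z 0 v (p v) \<and> ok a m v (p v) z q"
    and comp: "\<And>u v. u \<in> L \<Longrightarrow> v \<in> L \<Longrightarrow> u \<noteq> v \<Longrightarrow> u \<noteq> z \<Longrightarrow> v \<noteq> z \<Longrightarrow> (u = - v \<Longrightarrow> full) \<Longrightarrow>
      comparable a m u (p u) v (p v)"
  shows "circ_valid full a m q L p"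
  unfolding circ_valid_def
proof (intro ballI impI allI)
  have zl: "comparable a m z 0 v (p v + k * q)" if v: "v \<in> L" "v \<noteq> z" for v k
  proof (rule comparable_all_swap)
    fix k
    have "ok a m v (p v) z (0 + q)" "ok a m z 0 v (p v)" using base[OF v] by auto
    then show "comparable a m v (p v) z (0 + k * q)" using q by (rule comparable_lifts)
  qed
  have lift: "comparable a m u (p u) v (p v + k * q)"
    if uv: "u \<in> L" "v \<in> L" "u \<noteq> z" "v \<noteq> z" and o: "ok a m v (p v) u (p u)" for u v k
  proof (rule comparable_lifts[OF _ o q])
    have "ok a m z (0 + q) v (p v + q)" using base[OF uv(2,4)] ok_shift[of a m z q q v "p v + q"] by simp
    then show "ok a m u (p u) v (p v + q)" using base[OF uv(1,3)] ok_trans by fastforce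
  qed
  fix u v k assume uv: "u \<in> L" "v \<in> L" "u \<noteq> v" "u = - v \<longrightarrow> full"
  consider "u = z" | "v = z" | "u \<noteq> z" "v \<noteq> z" by blast
  then show "comparable a m u (p u) v (p v + k * q)"
  proof cases
    case 1
    then show ?thesis using zl[of v k] uv z by simp
  next
    case 2
    have "comparable a m u (p u) z (0 + k * q)"
      by (rule comparable_all_swap) (rule zl, use uv 2 in auto)
    then show ?thesis using 2 z by simp
  next
    case 3
    have "comparable a m u (p u) v (p v)" using comp uv 3 by blast
    then show ?thesis
    proof
      assume "ok a m v (p v) u (p u)"
      then show ?thesis using lift uv 3 by blast
    next
      assume o: "ok a m u (p u) v (p v)"
      show ?thesis
        by (rule comparable_all_swap) (rule lift[OF uv(2,1) 3(2,1) o])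
    qed
  qed
qed

text \<open>The half-open range comes from \<open>e\<close> being the smallest label: for
  \<open>a = 0\<close> a label may share position 0 with it, whereas the way back to
  \<open>e\<close> at \<open>q\<close> is a descent and has positive length.\<close>

lemma line_region_eq_circ_valid:
  assumes S: "\<And>s. s \<in> S \<Longrightarrow> s > e" "S \<noteq> {}" and m: "m > 0" and q: "q > 0"
  shows "line_region a m e e q S = {f \<in> S \<rightarrow>\<^sub>E {0..<q}. circ_valid True a m q (insert e S) (f(e := 0))}"
    (is "?A = ?B")
proof (intro set_eqI iffI)
  fix f assume f: "f \<in> ?A"
  have rng: "f s \<in> {0..<q}" if "s \<in> S" for s
    using line_regionD(2,3)[OF f that] S(1)[OF that] m by (auto simp: ok_def)
  have "circ_valid True a m q (insert e S) (f(e := 0))"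
  proof (rule circ_valid_base[of q e])
    show "ok a m e 0 v ((f(e := 0)) v) \<and> ok a m v ((f(e := 0)) v) e q" if "v \<in> insert e S" "v \<noteq> e" for v
      using line_regionD(2,3)[OF f, of v] that by simp
    show "comparable a m u ((f(e := 0)) u) v ((f(e := 0)) v)"
      if "u \<in> insert e S" "v \<in> insert e S" "u \<noteq> v" "u \<noteq> e" "v \<noteq> e" for u v
      using line_regionD(4)[OF f, of u v] that by simp
  qed (use q in auto)
  then show "f \<in> ?B" using rng line_regionD(1)[OF f] by (simp add: PiE_iff)
next
  fix f assume "f \<in> ?B"
  then have f: "f \<in> S \<rightarrow>\<^sub>E {0..<q}" and c: "circ_valid True a m q (insert e S) (f(e := 0))" by auto
  have eS: "e \<notin> S" using S(1) by blast
  have ne: "v \<noteq> e" if "v \<in> S" for v using that eS by blast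
  have cp: "comparable a m u ((f(e := 0)) u) v ((f(e := 0)) v + k * q)" if "u \<in> insert e S" "v \<in> insert e S" "u \<noteq> v" for u v k
    by (rule circ_validD[OF c that]) simp
  have 1: "ok a m e 0 v (f v)" if v: "v \<in> S" for v
  proof (rule ok_of_lex)
    show "comparable a m e 0 v (f v)" using cp[of e v 0] v ne[OF v] by auto
    show "0 < f v \<or> 0 = f v \<and> e < v" using f v S(1)[OF v] by (auto simp: PiE_iff)
  qed (rule m)
  have 2: "ok a m v (f v) e q" if v: "v \<in> S" for v
  proof (rule ok_of_lex)
    show "comparable a m v (f v) e q" using cp[of v e 1] v ne[OF v] by auto
    show "f v < q \<or> f v = q \<and> v < e" using f v by (auto simp: PiE_iff)
  qed (rule m)
  have 3: "comparable a m v (f v) w (f w)" if "v \<in> S" "w \<in> S" "v \<noteq> w" for v w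
    using cp[of v w 0] that ne by auto
  obtain s where s: "s \<in> S" using S(2) by blast
  have 4: "ok a m e 0 e q" using 1[OF s] 2[OF s] by (rule ok_trans)
  show "f \<in> ?A" using f 1 2 3 4 unfolding line_region_def by (simp add: PiE_iff)
qed

text \<open>Signed positions on the circle, where the reflection is \<open>x \<mapsto> - x\<close>
  and the label 0 lies on its axis.\<close>

definition spos :: "(int \<Rightarrow> int) \<Rightarrow> int \<Rightarrow> int" where
  "spos f v = (if v = 0 then 0 else mpos 0 f v)"

lemma mpos_spos: "v \<noteq> 0 \<Longrightarrow> mpos c f v = spos f v + (if v < 0 then c else 0)"
  by (simp add: mpos_def spos_def)

text \<open>A negative label lies at \<open>q - f s\<close> on the segment and at
  \<open>- f s\<close> on the circle; these are lifts of one point, so only the choice of window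
  differs.\<close>

lemma region_zero_eq_circ_valid:
  assumes S: "\<And>s. s \<in> S \<Longrightarrow> s > 0" "S \<noteq> {}" and m: "m > 0" and q: "q > 0"
  shows "region full a m 0 q S = {f \<in> S \<rightarrow>\<^sub>E {0..<q}. circ_valid full a m q (insert 0 (signed S)) (spos f)}"
    (is "?A = ?B")
proof (intro set_eqI iffI)
  fix f assume f: "f \<in> ?A"
  have rng: "f s \<in> {0..<q}" if "s \<in> S" for s
  proof -
    have "s \<in> signed S" "mpos q f s = f s" "s > 0" using that S(1) by (auto simp: signed_def mpos_def)
    then show ?thesis using regionD(2,3)[OF f, of s] m by (auto simp: ok_def)
  qed
  define p where "p v = (if v = 0 then 0 else mpos q f v)" for v
  have nz: "v \<noteq> 0" if "v \<in> signed S" for v using signed_nonzero[OF S(1) that] .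
  have "circ_valid full a m q (insert 0 (signed S)) p"
  proof (rule circ_valid_base[of q 0])
    show "ok a m 0 0 v (p v) \<and> ok a m v (p v) 0 q" if "v \<in> insert 0 (signed S)" "v \<noteq> 0" for v
      using regionD(2,3)[OF f, of v] that by (simp add: p_def)
    show "comparable a m u (p u) v (p v)"
      if "u \<in> insert 0 (signed S)" "v \<in> insert 0 (signed S)" "u \<noteq> v" "u \<noteq> 0" "v \<noteq> 0" "u = - v \<Longrightarrow> full" for u v
      using regionD(4)[OF f, of u v] that by (simp add: p_def)
  qed (use q in \<open>auto simp: p_def\<close>)
  then have "circ_valid full a m q (insert 0 (signed S)) (spos f)"
  proof (rule circ_valid_cong_imp)
    fix v
    have "spos f v = p v + 0 + (if v < 0 then - 1 else 0) * q"
      by (simp add: p_def spos_def mpos_def)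
    then show "\<exists>k. spos f v = p v + 0 + k * q" by blast
  qed
  then show "f \<in> ?B" using rng regionD(1)[OF f] by (simp add: PiE_iff)
next
  fix f assume "f \<in> ?B"
  then have f: "f \<in> S \<rightarrow>\<^sub>E {0..<q}" and c: "circ_valid full a m q (insert 0 (signed S)) (spos f)" by auto
  have nz: "v \<noteq> 0" if "v \<in> signed S" for v using signed_nonzero[OF S(1) that] .
  have 1: "ok a m 0 0 v (mpos q f v)" if v: "v \<in> signed S" for v
  proof (rule ok_of_lex)
    have "comparable a m 0 (spos f 0) v (spos f v + (if v < 0 then 1 else 0) * q)"
      by (rule circ_validD[OF c]) (use v nz[OF v] in auto)
    then show "comparable a m 0 0 v (mpos q f v)"
      using nz[OF v] mpos_spos[of v q f] by (simp add: spos_def split: if_splits)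
    show "0 < mpos q f v \<or> 0 = mpos q f v \<and> 0 < v"
      by (rule signed_cases[OF S(1) v]) (use f in \<open>auto simp: mpos_def PiE_iff dest!: bspec\<close>)
  qed (rule m)
  show "f \<in> ?A"
  proof (rule regionI[OF _ S(1)])
    show "f \<in> S \<rightarrow>\<^sub>E UNIV" using f by (simp add: PiE_iff)
    show "comparable a m v (mpos q f v) w (mpos q f w)"
      if vw: "v \<in> signed S" "w \<in> signed S" "v \<noteq> w" "v = - w \<Longrightarrow> full" for v w
    proof -
      define i j where "i = (if v < 0 then 1 else 0 :: int)" "j = (if w < 0 then 1 else 0 :: int)"
      have e: "mpos q f v = spos f v + i * q" "mpos q f w = spos f w + j * q"
        using mpos_spos[of v q f] mpos_spos[of w q f] nz vw by (auto simp: i_j_def)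
      have "comparable a m v (spos f v) w (spos f w + (j - i) * q)"
        by (rule circ_validD[OF c]) (use vw in auto)
      moreover have "spos f v = mpos q f v - i * q" "spos f w + (j - i) * q = mpos q f w - i * q"
        using e by (auto simp: algebra_simps)
      ultimately show ?thesis by (simp only: ok_shift)
    qed
    show "ok a m 0 0 (- 0) q" if full
    proof -
      obtain s where s: "s \<in> S" using S(2) by blast
      then have s': "s \<in> signed S" "- s \<in> signed S" "s > 0" using S(1) by (auto simp: in_signed)
      have "ok a m 0 0 (- s) (q - f s)" using 1[OF s'(2)] s'(3) by (simp add: mpos_def)
      then have "ok a m (- (- s)) (q - (q - f s)) (- 0) (q - 0)" by (subst ok_mirror)
      then have "ok a m s (f s) 0 q" by simp
      moreover have "ok a m 0 0 s (f s)" using 1[OF s'(1)] s'(3) by (simp add: mpos_def)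
      ultimately show ?thesis using ok_trans by fastforce
    qed
  qed (use 1 in auto)
qed

text \<open>The count for type A: stride 2 is absent and \<open>k1 = card S + 1\<close>.\<close>

theorem line_count_polynomial:
  assumes S: "finite S" "\<And>s. s \<in> S \<Longrightarrow> s > e" "S \<noteq> {}" and m: "m > 0"
  shows "\<exists>H q0. aligned H \<and> (\<forall>q\<ge>q0. odd q \<longrightarrow>
    of_nat (card {f \<in> S \<rightarrow>\<^sub>E {0..<int q}. circ_valid True a m (int q) (insert e S) (f(e := 0))}) = poly H (of_nat q))"
proof -
  have u: "line_fps 0 1 e e S = power_fps (card S)" by (rule line_fps_unconstrained[OF S])
  have "line_fps a m e e S * (1 - fps_X) ^ Suc (card S) * (1 - fps_X ^ 2) ^ 0
     = fps_X ^ (a * Suc (card S)) * dilate m ((1 - fps_X) ^ Suc (card S) * (1 - fps_X ^ 2) ^ 0 * power_fps (card S))"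
    using line_fps_dilate[OF S(1) m, of a e e] unfolding u by (simp add: mult.commute)
  from gap_series_polynomial[OF m _ _ this]
  obtain H q0 where H: "aligned H" "\<And>q. q \<ge> q0 \<Longrightarrow> odd q \<Longrightarrow> fps_nth (line_fps a m e e S) q = poly H (of_nat q)"
    by auto
  have "of_nat (card {f \<in> S \<rightarrow>\<^sub>E {0..<int q}. circ_valid True a m (int q) (insert e S) (f(e := 0))}) = poly H (of_nat q)"
    if "q \<ge> q0" "odd q" for q
  proof -
    have "int q > 0" using that(2) by (cases q) auto
    have "line_region a m e e (int q) S = {f \<in> S \<rightarrow>\<^sub>E {0..<int q}. circ_valid True a m (int q) (insert e S) (f(e := 0))}"
      by (rule line_region_eq_circ_valid[OF S(2,3) m \<open>int q > 0\<close>])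
    then show ?thesis using H(2)[OF that] by (simp add: line_fps_def)
  qed
  then show ?thesis using H(1) by blast
qed

text \<open>The counts for BC (\<open>full\<close>) and B, where the roots \<open>e_i\<close> are
  the constraints against the label 0. The axis crosses the circle once more, opposite to 0, which
  gives \<open>k1 = 1\<close> in the full case and \<open>k1 = 2\<close> in the free one.\<close>

theorem zero_label_count_polynomial:
  assumes S: "finite S" "\<And>s. s \<in> S \<Longrightarrow> s > 0" "S \<noteq> {}" and m: "m > 0"
  shows "\<exists>H q0. aligned H \<and> (\<forall>q\<ge>q0. odd q \<longrightarrow>
    of_nat (card {f \<in> S \<rightarrow>\<^sub>E {0..<int q}. circ_valid full a m (int q) (insert 0 (signed S)) (spos f)}) = poly H (of_nat q))"
proof -
  have u: "region_fps full 0 1 0 S = power_fps (card S)" by (rule region_fps_zero_unconstrained[OF S])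
  have c0: "card S > 0" using S by (simp add: card_gt_0_iff)
  have "\<exists>H q0. aligned H \<and> (\<forall>q\<ge>q0. odd q \<longrightarrow> fps_nth (region_fps full a m 0 S) q = poly H (of_nat q))"
  proof (cases full)
    case True
    have "(1 - fps_X ^ 2) ^ card S * (1 - fps_X) * region_fps True a m 0 S
      = fps_X ^ (a * (2 * card S + 1)) * dilate m ((1 - fps_X ^ 2) ^ card S * (1 - fps_X) * region_fps True 0 1 0 S)"
      by (rule region_fps_full_dilate[OF S(1,2) m])
    then have "region_fps full a m 0 S * (1 - fps_X) ^ 1 * (1 - fps_X ^ 2) ^ card S
      = fps_X ^ (a * (2 * card S + 1)) * dilate m ((1 - fps_X) ^ 1 * (1 - fps_X ^ 2) ^ card S * power_fps (card S))"
      using True u by (simp add: mult_ac)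
    from gap_series_polynomial[OF m _ _ this] show ?thesis by auto
  next
    case False
    have "(1 - fps_X ^ 2) ^ (card S - 1) * (1 - fps_X) ^ 2 * region_fps False a m 0 S
      = fps_X ^ (2 * a * card S) * dilate m ((1 - fps_X ^ 2) ^ (card S - 1) * (1 - fps_X) ^ 2 * region_fps False 0 1 0 S)"
      by (rule region_fps_free_dilate[OF S m])
    then have "region_fps full a m 0 S * (1 - fps_X) ^ 2 * (1 - fps_X ^ 2) ^ (card S - 1)
      = fps_X ^ (2 * a * card S) * dilate m ((1 - fps_X) ^ 2 * (1 - fps_X ^ 2) ^ (card S - 1) * power_fps (card S))"
      using False u by (simp add: mult_ac)
    from gap_series_polynomial[OF m _ _ this] c0 show ?thesis by auto
  qed
  then obtain H q0 where H: "aligned H" "\<And>q. q \<ge> q0 \<Longrightarrow> odd q \<Longrightarrow> fps_nth (region_fps full a m 0 S) q = poly H (of_nat q)"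
    by blast
  have "of_nat (card {f \<in> S \<rightarrow>\<^sub>E {0..<int q}. circ_valid full a m (int q) (insert 0 (signed S)) (spos f)}) = poly H (of_nat q)"
    if "q \<ge> q0" "odd q" for q
  proof -
    have "int q > 0" using that(2) by (cases q) auto
    have "region full a m 0 (int q) S = {f \<in> S \<rightarrow>\<^sub>E {0..<int q}. circ_valid full a m (int q) (insert 0 (signed S)) (spos f)}"
      by (rule region_zero_eq_circ_valid[OF S(2,3) m \<open>int q > 0\<close>])
    then show ?thesis using H(2)[OF that] by (simp add: region_fps_def)
  qed
  then show ?thesis using H(1) by blast
qed

section \<open>Symmetric configurations without a fixed label\<close>

text \<open>Without a label at the origin, a symmetric configuration on a circle of odd length is rotated
so that \<open>s0\<close> is at \<open>0\<close>. Then \<open>- s0\<close> is at some \<open>d\<close> in \<open>{1..q}\<close>, and each other label lies, together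
with its negative, on one of the two arcs between \<open>s0\<close> and \<open>- s0\<close>.\<close>

definition cut_range :: "int \<Rightarrow> int \<Rightarrow> int \<Rightarrow> int set" where
  "cut_range q s0 s = {(if s < s0 then 1 else 0) .. q - (if s > s0 then 1 else 0)}"

text \<open>After the rotation the reflection is \<open>x \<mapsto> d - x\<close>. A label in the
  same place as \<open>s0\<close> is put at 0 if it is larger and at \<open>q\<close> if it is
  smaller, in accordance with the order of ties.\<close>

definition cut_configs :: "bool \<Rightarrow> nat \<Rightarrow> nat \<Rightarrow> int \<Rightarrow> int set \<Rightarrow> int \<Rightarrow> int \<Rightarrow> (int \<Rightarrow> int) set" where
  "cut_configs full a m q S s0 d = {t \<in> (\<Pi>\<^sub>E s\<in>S - {s0}. cut_range q s0 s).
     circ_valid full a m q (signed S) (mpos d (t(s0 := 0)))}"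

definition arc_labels :: "int set \<Rightarrow> int \<Rightarrow> int \<Rightarrow> (int \<Rightarrow> int) \<Rightarrow> int set" where
  "arc_labels S s0 d t = {s \<in> S - {s0}. t s < d}"

text \<open>The first arc runs from \<open>s0\<close> at 0 to \<open>- s0\<close> at
  \<open>d\<close>, the second from there to \<open>s0\<close> at \<open>q\<close>. Each is
  symmetric about its midpoint and hence a \<open>region\<close>, and constraints between labels of
  different arcs follow by transitivity through \<open>- s0\<close>. In the free case an empty arc
  would leave the order of its ends open, hence \<open>ne\<close>.\<close>

lemma bij_betw_cut_arcs:
  assumes S: "\<And>s. s \<in> S \<Longrightarrow> s > 0" and s0: "s0 \<in> S" and m: "m > 0" and q: "q > 0"
    and d: "d \<in> {1..q}" and S0: "S0 \<subseteq> S - {s0}" and ne: "full \<or> (S0 \<noteq> {} \<and> S0 \<noteq> S - {s0})"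
  shows "bij_betw (\<lambda>t. (restrict t S0, restrict (\<lambda>s. t s - d) (S - {s0} - S0)))
    {t \<in> cut_configs full a m q S s0 d. arc_labels S s0 d t = S0}
    (region full a m s0 d S0 \<times> region full a m (- s0) (q - d) (S - {s0} - S0))"
    (is "bij_betw ?F ?A (?R0 \<times> ?R1)")
proof -
  let ?S1 = "S - {s0} - S0"
  define G where "G fg = restrict (\<lambda>s. if s \<in> S0 then fst fg s else snd fg s + d) (S - {s0})"
    for fg :: "(int \<Rightarrow> int) \<times> (int \<Rightarrow> int)"
  have s0p: "s0 > 0" using S s0 by simp
  have S0p: "\<And>s. s \<in> S0 \<Longrightarrow> s > 0" and S1p: "\<And>s. s \<in> ?S1 \<Longrightarrow> s > 0" using S S0 by auto
  have ne1: "full \<or> ?S1 \<noteq> {}" and ne0: "full \<or> S0 \<noteq> {}" using ne S0 by auto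
  have lab: "v = s0 \<or> v = - s0 \<or> v \<in> signed S0 \<or> v \<in> signed ?S1" if "v \<in> signed S" for v
    using that S0 by (auto simp: in_signed)
  have sub: "signed S0 \<subseteq> signed S" "signed ?S1 \<subseteq> signed S" "s0 \<in> signed S" "- s0 \<in> signed S"
    using S0 s0 by (auto simp: in_signed)
  have abs0: "v \<in> signed S0 \<longleftrightarrow> \<bar>v\<bar> \<in> S0" and abs1: "v \<in> signed ?S1 \<longleftrightarrow> \<bar>v\<bar> \<in> ?S1" for v
    by (rule signed_iff[OF S0p], assumption) (rule signed_iff[OF S1p], assumption)
  have not: "v \<noteq> s0" "v \<noteq> - s0" "v \<noteq> 0" if "v \<in> signed S0 \<or> v \<in> signed ?S1" for v
  proof -
    have "\<bar>v\<bar> \<in> S - {s0}" using that S0 unfolding abs0 abs1 by blast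
    then have "\<bar>v\<bar> \<noteq> s0" "\<bar>v\<bar> > 0" using S by blast+
    then show "v \<noteq> s0" "v \<noteq> - s0" "v \<noteq> 0" using s0p by auto
  qed
  have disj: "\<not> (v \<in> signed S0 \<and> v \<in> signed ?S1)" for v
    unfolding abs0 abs1 by blast
  define P where "P t v = mpos d (t(s0 := 0)) v" for t v
  have Ps: "P t s0 = 0" "P t (- s0) = d" for t using s0p by (auto simp: P_def mpos_def)
  have P0: "mpos d f0 v = P t v" if v: "v \<in> signed S0" and t: "\<And>s. s \<in> S0 \<Longrightarrow> f0 s = t s" for v t f0
    by (rule signed_cases[OF S0p v]) (use v not[of v] t in \<open>auto simp: P_def mpos_def\<close>)
  have P1: "mpos (q - d) f1 v = P t v + (if v < 0 then q else 0) - d"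
    if v: "v \<in> signed ?S1" and t: "\<And>s. s \<in> ?S1 \<Longrightarrow> f1 s = t s - d" for v t f1
    by (rule signed_cases[OF S1p v]) (use v not[of v] t in \<open>auto simp: P_def mpos_def\<close>)
  show ?thesis
  proof (rule bij_betw_byWitness[where f'=G])
    show "\<forall>t\<in>?A. G (?F t) = t"
    proof
      fix t assume "t \<in> ?A"
      then have t: "t \<in> extensional (S - {s0})" by (auto simp: cut_configs_def PiE_iff)
      show "G (?F t) = t"
        by (rule extensionalityI[OF _ t]) (auto simp: G_def)
    qed
    show "\<forall>fg\<in>?R0 \<times> ?R1. ?F (G fg) = fg"
    proof
      fix fg assume "fg \<in> ?R0 \<times> ?R1"
      then have f: "fst fg \<in> extensional S0" "snd fg \<in> extensional ?S1"
        by (auto simp: PiE_iff dest!: regionD(1))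
      have "restrict (G fg) S0 = fst fg"
        by (rule extensionalityI[OF _ f(1)]) (use S0 in \<open>auto simp: G_def\<close>)
      moreover have "restrict (\<lambda>s. G fg s - d) ?S1 = snd fg"
        by (rule extensionalityI[OF _ f(2)]) (auto simp: G_def)
      ultimately show "?F (G fg) = fg" by (simp add: prod_eq_iff)
    qed
    show "?F ` ?A \<subseteq> ?R0 \<times> ?R1"
    proof (rule image_subsetI)
      fix t assume "t \<in> ?A"
      then have rng: "\<And>s. s \<in> S - {s0} \<Longrightarrow> t s \<in> cut_range q s0 s"
        and c: "circ_valid full a m q (signed S) (P t)" and arc: "{s \<in> S - {s0}. t s < d} = S0"
        by (auto simp: cut_configs_def arc_labels_def P_def[abs_def])
      have cmp: "comparable a m u (P t u) v (P t v + k * q)"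
        if "u \<in> signed S" "v \<in> signed S" "u \<noteq> v" "u = - v \<Longrightarrow> full" for u v k
        by (rule circ_validD[OF c that])
      have P0': "mpos d (restrict t S0) v = P t v" if "v \<in> signed S0" for v by (rule P0[OF that]) simp
      have P1': "mpos (q - d) (restrict (\<lambda>s. t s - d) ?S1) v = P t v + (if v < 0 then q else 0) - d"
        if "v \<in> signed ?S1" for v by (rule P1[OF that]) simp
      have sne: "s0 \<noteq> - s0" using s0p by simp
      have "restrict t S0 \<in> ?R0"
      proof (rule regionI[OF _ S0p])
        show "ok a m s0 0 v (mpos d (restrict t S0) v)" if v: "v \<in> signed S0" for v
        proof (rule ok_of_lex)
          show "comparable a m s0 0 v (mpos d (restrict t S0) v)"
            using cmp[of s0 v 0] P0'[OF v] Ps(1) v sub not[of v] by force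
          show "0 < mpos d (restrict t S0) v \<or> 0 = mpos d (restrict t S0) v \<and> s0 < v"
          proof (rule signed_cases[OF S0p v])
            assume v': "v > 0" "v \<in> S0"
            then have "t v \<in> cut_range q s0 v" "v \<noteq> s0" using rng[of v] S0 by auto
            then show ?thesis using v' by (auto simp: cut_range_def mpos_def split: if_splits)
          next
            assume v': "v < 0" "- v \<in> S0"
            then have "t (- v) < d" using arc by blast
            then show ?thesis using v' by (simp add: mpos_def)
          qed
        qed (rule m)
        show "comparable a m v (mpos d (restrict t S0) v) w (mpos d (restrict t S0) w)"
          if "v \<in> signed S0" "w \<in> signed S0" "v \<noteq> w" "v = - w \<Longrightarrow> full" for v w
          using cmp[of v w 0] that P0' sub by auto
        show "ok a m s0 0 (- s0) d" if full
          by (rule ok_of_lex) (use cmp[of s0 "- s0" 0] that Ps sub sne d m in auto)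
      qed auto
      moreover have "restrict (\<lambda>s. t s - d) ?S1 \<in> ?R1"
      proof (rule regionI[OF _ S1p])
        show "ok a m (- s0) 0 v (mpos (q - d) (restrict (\<lambda>s. t s - d) ?S1) v)" if v: "v \<in> signed ?S1" for v
        proof (rule ok_of_lex)
          let ?k = "if v < 0 then 1 else 0 :: int"
          have "comparable a m (- s0) (P t (- s0)) v (P t v + ?k * q)"
            by (rule cmp) (use v sub not[of v] in auto)
          then have "comparable a m (- s0) (P t (- s0) - d) v (P t v + ?k * q - d)"
            by (simp only: ok_shift)
          then show "comparable a m (- s0) 0 v (mpos (q - d) (restrict (\<lambda>s. t s - d) ?S1) v)"
            unfolding P1'[OF v] Ps by (cases "v < 0") simp_all
          show "0 < mpos (q - d) (restrict (\<lambda>s. t s - d) ?S1) v \<or>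
            0 = mpos (q - d) (restrict (\<lambda>s. t s - d) ?S1) v \<and> - s0 < v"
          proof (rule signed_cases[OF S1p v])
            assume v': "v > 0" "v \<in> ?S1"
            then have "\<not> t v < d" using arc by blast
            then show ?thesis using v' s0p by (auto simp: mpos_def)
          next
            assume v': "v < 0" "- v \<in> ?S1"
            then have "t (- v) \<in> cut_range q s0 (- v)" "- v \<noteq> s0" using rng[of "- v"] by auto
            then show ?thesis using v' by (auto simp: cut_range_def mpos_def split: if_splits)
          qed
        qed (rule m)
        show "comparable a m v (mpos (q - d) (restrict (\<lambda>s. t s - d) ?S1) v) w (mpos (q - d) (restrict (\<lambda>s. t s - d) ?S1) w)"
          if vw: "v \<in> signed ?S1" "w \<in> signed ?S1" "v \<noteq> w" "v = - w \<Longrightarrow> full" for v w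
        proof -
          define i j where "i = (if v < 0 then 1 else 0 :: int)" "j = (if w < 0 then 1 else 0 :: int)"
          have "comparable a m v (P t v) w (P t w + (j - i) * q)"
            by (rule cmp) (use vw sub in auto)
          moreover have "P t v = (P t v + (if v < 0 then q else 0) - d) - (i * q - d)"
            "P t w + (j - i) * q = (P t w + (if w < 0 then q else 0) - d) - (i * q - d)"
            by (auto simp: i_j_def algebra_simps)
          ultimately show ?thesis unfolding P1'[OF vw(1)] P1'[OF vw(2)] using ok_shift by metis
        qed
        show "ok a m (- s0) 0 (- (- s0)) (q - d)" if full
        proof (rule ok_of_lex)
          have "comparable a m (- s0) (P t (- s0)) s0 (P t s0 + 1 * q)"
            by (rule cmp) (use that sub sne in auto)
          then have "comparable a m (- s0) (P t (- s0) - d) s0 (P t s0 + 1 * q - d)"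
            by (simp only: ok_shift)
          then show "comparable a m (- s0) 0 (- (- s0)) (q - d)" using Ps by simp
        qed (use d m s0p in auto)
      qed auto
      ultimately show "?F t \<in> ?R0 \<times> ?R1" by simp
    qed
    show "G ` (?R0 \<times> ?R1) \<subseteq> ?A"
    proof (rule image_subsetI)
      fix fg assume fg: "fg \<in> ?R0 \<times> ?R1"
      define t where "t = G fg"
      have f0: "fst fg \<in> ?R0" and f1: "snd fg \<in> ?R1" using fg by auto
      have P0': "mpos d (fst fg) v = P t v" if "v \<in> signed S0" for v
        by (rule P0[OF that]) (use S0 in \<open>auto simp: t_def G_def\<close>)
      have P1': "mpos (q - d) (snd fg) v = P t v + (if v < 0 then q else 0) - d" if "v \<in> signed ?S1" for v
        by (rule P1[OF that]) (auto simp: t_def G_def)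
      \<comment> \<open>Negatives of labels on the second arc are lifted by \<open>q\<close>; then
        all labels lie in the window from 0 to \<open>q\<close>.\<close>
      define Q where "Q v = P t v + (if v \<in> signed ?S1 \<and> v < 0 then q else 0)" for v
      have Q0: "Q v = mpos d (fst fg) v" if "v \<in> signed S0" for v using P0'[OF that] disj[of v] that by (simp add: Q_def)
      have Q1: "Q v = mpos (q - d) (snd fg) v + d" if "v \<in> signed ?S1" for v using P1'[OF that] that by (simp add: Q_def)
      have Qs: "Q s0 = 0" "Q (- s0) = d" using Ps not[of s0] not[of "- s0"] by (auto simp: Q_def)
      have a0: "ok a m s0 0 v (Q v)" "ok a m v (Q v) (- s0) d" if v: "v \<in> signed S0" for v
        using regionD(2,3)[OF f0 v] Q0[OF v] by auto
      have a1: "ok a m (- s0) d v (Q v)" "ok a m v (Q v) s0 q" if v: "v \<in> signed ?S1" for v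
        using regionD(2,3)[OF f1 v] Q1[OF v] ok_shift[of a m "- s0" d d v "Q v"] ok_shift[of a m v "Q v" d s0 q] by auto
      have e1: "ok a m s0 0 (- s0) d"
      proof (cases full)
        case True
        then show ?thesis using regionD(5)[OF f0] by simp
      next
        case False
        then obtain s where "s \<in> signed S0" using ne0 by (auto simp: signed_def)
        from a0[OF this] show ?thesis by (rule ok_trans)
      qed
      have e2: "ok a m (- s0) d s0 q"
      proof (cases full)
        case True
        then show ?thesis using regionD(5)[OF f1] ok_shift[of a m "- s0" d d s0 q] by simp
      next
        case False
        then obtain s where "s \<in> signed ?S1" using ne1 by (auto simp: signed_def)
        from a1[OF this] show ?thesis by (rule ok_trans)
      qed
      have "circ_valid full a m q (signed S) Q"
      proof (rule circ_valid_base[of q s0])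
        show "ok a m s0 0 v (Q v) \<and> ok a m v (Q v) s0 q" if v: "v \<in> signed S" "v \<noteq> s0" for v
        proof -
          consider "v = - s0" | "v \<in> signed S0" | "v \<in> signed ?S1" using lab[OF v(1)] v(2) by blast
          then show ?thesis
          proof cases
            case 1
            then show ?thesis using e1 e2 Qs by simp
          next
            case 2
            then show ?thesis using a0[OF 2] e2 ok_trans by blast
          next
            case 3
            then show ?thesis using a1[OF 3] e1 ok_trans by blast
          qed
        qed
        have half: "comparable a m u (Q u) v (Q v)"
          if uv: "u \<noteq> v" "u = - v \<Longrightarrow> full" "(u \<in> signed S0 \<and> v \<in> signed S0) \<or> (u \<in> signed S0 \<and> v = - s0) \<or>
            (u \<in> signed S0 \<and> v \<in> signed ?S1) \<or> (u = - s0 \<and> v \<in> signed ?S1) \<or> (u \<in> signed ?S1 \<and> v \<in> signed ?S1)" for u v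
          using uv(3)
        proof (elim disjE conjE)
          assume "u \<in> signed S0" "v \<in> signed S0"
          then show ?thesis using regionD(4)[OF f0, of u v] uv(1,2) Q0 by simp
        next
          assume "u \<in> signed S0" "v = - s0"
          then show ?thesis using a0[of u] Qs by simp
        next
          assume "u \<in> signed S0" "v \<in> signed ?S1"
          then show ?thesis using a0(2)[of u] a1(1)[of v] ok_trans by blast
        next
          assume "u = - s0" "v \<in> signed ?S1"
          then show ?thesis using a1(1)[of v] Qs by simp
        next
          assume u: "u \<in> signed ?S1" and v: "v \<in> signed ?S1"
          have "comparable a m u (Q u - d) v (Q v - d)" using regionD(4)[OF f1 u v] uv(1,2) Q1[OF u] Q1[OF v] by simp
          then show ?thesis by (simp only: ok_shift)
        qed
        show "comparable a m u (Q u) v (Q v)"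
          if uv: "u \<in> signed S" "v \<in> signed S" "u \<noteq> v" "u \<noteq> s0" "v \<noteq> s0" "u = - v \<Longrightarrow> full" for u v
        proof -
          have "v = - u \<Longrightarrow> full" using uv(6) by simp
          then show ?thesis using half[of u v] half[of v u] uv(3,6) lab[OF uv(1)] lab[OF uv(2)] uv(4,5) by blast
        qed
      qed (use q sub Qs in auto)
      then have cv: "circ_valid full a m q (signed S) (P t)"
      proof (rule circ_valid_cong_imp)
        fix v
        have "P t v = Q v + 0 + (if v \<in> signed ?S1 \<and> v < 0 then - 1 else 0) * q" by (simp add: Q_def)
        then show "\<exists>k. P t v = Q v + 0 + k * q" by blast
      qed
      have t0: "t s = Q s" if "s \<in> S - {s0}" for s
        using that S[of s] S1p by (auto simp: Q_def P_def mpos_def)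
      have c0: "t s \<in> cut_range q s0 s \<and> t s < d" if s: "s \<in> S0" for s
      proof -
        have "s \<in> signed S0" "s \<in> S - {s0}" "s > 0" using s S0 S0p by (auto simp: in_signed)
        then show ?thesis using a0[of s] t0[of s] m d s0p by (auto simp: ok_def cut_range_def split: if_splits)
      qed
      have c1: "t s \<in> cut_range q s0 s \<and> \<not> t s < d" if s: "s \<in> ?S1" for s
      proof -
        have "s \<in> signed ?S1" "s \<in> S - {s0}" "s > 0" using s S1p by (auto simp: in_signed)
        then show ?thesis using a1[of s] t0[of s] m d s0p by (auto simp: ok_def cut_range_def split: if_splits)
      qed
      have "t \<in> (\<Pi>\<^sub>E s\<in>S - {s0}. cut_range q s0 s)"
      proof -
        have "t s \<in> cut_range q s0 s" if "s \<in> S - {s0}" for s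
          using c0[of s] c1[of s] that by (cases "s \<in> S0") blast+
        moreover have "t \<in> extensional (S - {s0})" by (simp add: t_def G_def)
        ultimately show ?thesis unfolding PiE_iff by blast
      qed
      moreover have "arc_labels S s0 d t = S0" using c0 c1 S0 by (auto simp: arc_labels_def)
      ultimately show "G fg \<in> ?A" using cv by (simp add: cut_configs_def P_def[abs_def] t_def)
    qed
  qed
qed

text \<open>In the free case the empty label set is avoided on both arcs, since the dilation formula
  for free regions is about nonempty sets.\<close>

definition splits :: "bool \<Rightarrow> int set \<Rightarrow> int set set" where
  "splits full S = {S0 \<in> Pow S. full \<or> (S0 \<noteq> {} \<and> S0 \<noteq> S)}"

lemma finite_splits: "finite S \<Longrightarrow> finite (splits full S)"
  by (simp add: splits_def)

lemma card_cut_configs: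
  assumes S: "finite S" "\<And>s. s \<in> S \<Longrightarrow> s > 0" and s0: "s0 \<in> S" and m: "m > 0" and q: "q > 0" and d: "d \<in> {1..q}"
  shows "card {t \<in> cut_configs full a m q S s0 d. arc_labels S s0 d t \<in> splits full (S - {s0})}
    = (\<Sum>S0\<in>splits full (S - {s0}). card (region full a m s0 d S0) * card (region full a m (- s0) (q - d) (S - {s0} - S0)))"
proof -
  let ?A = "\<lambda>S0. {t \<in> cut_configs full a m q S s0 d. arc_labels S s0 d t = S0}"
  have fin: "finite (cut_configs full a m q S s0 d)"
  proof (rule finite_subset)
    show "cut_configs full a m q S s0 d \<subseteq> (\<Pi>\<^sub>E s\<in>S - {s0}. cut_range q s0 s)" by (auto simp: cut_configs_def)
    show "finite (\<Pi>\<^sub>E s\<in>S - {s0}. cut_range q s0 s)" using S(1) by (auto intro!: finite_PiE simp: cut_range_def)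
  qed
  have "{t \<in> cut_configs full a m q S s0 d. arc_labels S s0 d t \<in> splits full (S - {s0})}
    = (\<Union>S0\<in>splits full (S - {s0}). ?A S0)" by auto
  also have "card \<dots> = (\<Sum>S0\<in>splits full (S - {s0}). card (?A S0))"
    by (rule card_UN_disjoint) (use fin S(1) finite_splits in auto)
  also have "\<dots> = (\<Sum>S0\<in>splits full (S - {s0}). card (region full a m s0 d S0) * card (region full a m (- s0) (q - d) (S - {s0} - S0)))"
  proof (intro sum.cong refl)
    fix S0 assume S0: "S0 \<in> splits full (S - {s0})"
    then have sub: "S0 \<subseteq> S - {s0}" "full \<or> (S0 \<noteq> {} \<and> S0 \<noteq> S - {s0})" by (auto simp: splits_def)
    show "card (?A S0) = card (region full a m s0 d S0) * card (region full a m (- s0) (q - d) (S - {s0} - S0))"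
    proof -
      have "card (?A S0) = card (region full a m s0 d S0 \<times> region full a m (- s0) (q - d) (S - {s0} - S0))"
        by (rule bij_betw_same_card, rule bij_betw_cut_arcs[OF S(2) s0 m q d sub])
      then show ?thesis unfolding card_cartesian_product .
    qed
  qed
  finally show ?thesis .
qed

section \<open>Rotating a configuration so that a chosen label is at 0\<close>

definition rot :: "int \<Rightarrow> int \<Rightarrow> (int \<Rightarrow> int) \<Rightarrow> int \<Rightarrow> int" where
  "rot q s0 X s = (if s > s0 then (X s - X s0) mod q else q - (X s0 - X s) mod q)"

text \<open>The position of \<open>- s0\<close> relative to \<open>s0\<close>, as a residue in
  \<open>{1..q}\<close>: because \<open>- s0 < s0\<close>, a tie is resolved at \<open>q\<close> and
  not at 0.\<close>

definition antipode :: "int \<Rightarrow> int \<Rightarrow> (int \<Rightarrow> int) \<Rightarrow> int" where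
  "antipode q s0 X = q - (2 * X s0) mod q"

lemma cong_interval_eq:
  fixes x y :: int
  assumes "x \<in> {c..<c + q}" "y \<in> {c..<c + q}" "x = y + k * q"
  shows "x = y"
proof -
  have b: "c \<le> x" "x < c + q" "c \<le> y" "y < c + q" using assms(1,2) by simp_all
  have q: "q > 0" using b by linarith
  have "k * q < 1 * q" "(- 1) * q < k * q" using b assms(3) by linarith+
  then have "k < 1" "- 1 < k" unfolding mult_less_cancel_right_pos[OF q] by simp_all
  then have "k = 0" by linarith
  then show ?thesis using assms(3) by simp
qed

lemma rot_in_range:
  assumes "q > 0" "s \<noteq> s0"
  shows "rot q s0 X s \<in> cut_range q s0 s"
proof -
  define r1 r2 where "r1 = (X s - X s0) mod q" and "r2 = (X s0 - X s) mod q"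
  have "0 \<le> r1" "r1 < q" "0 \<le> r2" "r2 < q" using assms(1) by (simp_all add: r1_def r2_def)
  then show ?thesis using assms(2)
    unfolding rot_def cut_range_def r1_def[symmetric] r2_def[symmetric] by auto
qed

lemma rot_cong: "\<exists>k. rot q s0 X s = X s - X s0 + k * q"
proof (cases "s > s0")
  case True
  have "rot q s0 X s = X s - X s0 + (- ((X s - X s0) div q)) * q"
    using True div_mult_mod_eq[of "X s - X s0" q] by (simp add: rot_def algebra_simps)
  then show ?thesis by blast
next
  case False
  have "rot q s0 X s = X s - X s0 + (1 + (X s0 - X s) div q) * q"
    using False div_mult_mod_eq[of "X s0 - X s" q] by (simp add: rot_def algebra_simps)
  then show ?thesis by blast
qed

lemma antipode_in_range:
  assumes "q > 0"
  shows "antipode q s0 X \<in> {1..q}"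
proof -
  define r where "r = (2 * X s0) mod q"
  have "0 \<le> r" "r < q" using assms by (simp_all add: r_def)
  then show ?thesis unfolding antipode_def r_def[symmetric] by auto
qed

lemma antipode_cong: "\<exists>k. antipode q s0 X = - (2 * X s0) + k * q"
proof -
  have "antipode q s0 X = - (2 * X s0) + (1 + (2 * X s0) div q) * q"
    using div_mult_mod_eq[of "2 * X s0" q] by (simp add: antipode_def algebra_simps)
  then show ?thesis by blast
qed

lemma cut_range_unique:
  assumes "x \<in> cut_range q s0 s" "y \<in> cut_range q s0 s" "s \<noteq> s0" "x = y + k * q"
  shows "x = y"
  by (rule cong_interval_eq[of x "if s < s0 then 1 else 0" q y k])
     (use assms in \<open>auto simp: cut_range_def\<close>)

text \<open>The only information lost by a rotation is \<open>X s0\<close>, and for odd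
  \<open>q\<close> it is recovered from the distance \<open>d\<close>, which is
  \<open>- 2 * X s0\<close> modulo \<open>q\<close>.\<close>

lemma bij_betw_rot:
  assumes S: "\<And>s. s \<in> S \<Longrightarrow> s > 0" and s0: "s0 \<in> S" and q: "q > 0" "odd q"
  shows "bij_betw (\<lambda>X. (antipode q s0 X, restrict (rot q s0 X) (S - {s0})))
    {X \<in> S \<rightarrow>\<^sub>E {0..<q}. circ_valid full a m q (signed S) (spos X)}
    (SIGMA d:{1..q}. cut_configs full a m q S s0 d)" (is "bij_betw ?F ?A ?B")
  unfolding bij_betw_def
proof
  have valid_iff: "circ_valid full a m q (signed S) (mpos d (t(s0 := 0))) \<longleftrightarrow> circ_valid full a m q (signed S) (spos X)"
    if d: "\<exists>k. d = - (2 * X s0) + k * q" and t: "\<And>s. s \<in> S - {s0} \<Longrightarrow> \<exists>k. t s = X s - X s0 + k * q" for d t X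
  proof (rule circ_valid_cong)
    fix v assume v: "v \<in> signed S"
    obtain kd where kd: "d = - (2 * X s0) + kd * q" using d by blast
    have ts: "\<exists>k. (t(s0 := 0)) s = X s - X s0 + k * q" if "s \<in> S" for s
      using t[of s] that by (cases "s = s0") (auto intro: exI[of _ 0])
    show "\<exists>k. mpos d (t(s0 := 0)) v = spos X v + (- X s0) + k * q"
    proof (rule signed_cases[OF S v])
      assume v: "v > 0" "v \<in> S"
      then show ?thesis using ts[of v] by (simp add: mpos_def spos_def)
    next
      assume v: "v < 0" "- v \<in> S"
      then obtain k where "(t(s0 := 0)) (- v) = X (- v) - X s0 + k * q" using ts by blast
      then have "mpos d (t(s0 := 0)) v = spos X v + (- X s0) + (kd - k) * q"
        using v kd by (simp add: mpos_def spos_def algebra_simps)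
      then show ?thesis by blast
    qed
  qed
  show "inj_on ?F ?A"
  proof (rule inj_onI)
    fix X Y assume X: "X \<in> ?A" and Y: "Y \<in> ?A" and e: "?F X = ?F Y"
    have rX: "X s \<in> {0..<0 + q}" "Y s \<in> {0..<0 + q}" if "s \<in> S" for s using X Y that by (auto simp: PiE_iff)
    obtain k where "antipode q s0 X = - (2 * X s0) + k * q" using antipode_cong by blast
    moreover obtain k' where "antipode q s0 Y = - (2 * Y s0) + k' * q" using antipode_cong by blast
    ultimately have k2: "2 * (X s0 - Y s0) = (k - k') * q" using e by (simp add: algebra_simps)
    then have "even ((k - k') * q)" by (metis dvd_triv_left)
    then have "even (k - k')" using q(2) by simp
    then obtain j where "k - k' = 2 * j" by blast
    then have "X s0 = Y s0 + j * q" using k2 by simp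
    then have x0: "X s0 = Y s0" by (rule cong_interval_eq[OF rX[OF s0]])
    show "X = Y"
    proof (rule extensionalityI[of _ S])
      show "X \<in> extensional S" "Y \<in> extensional S" using X Y by (auto simp: PiE_iff)
      fix s assume s: "s \<in> S"
      show "X s = Y s"
      proof (cases "s = s0")
        case False
        have "restrict (rot q s0 X) (S - {s0}) s = restrict (rot q s0 Y) (S - {s0}) s" using e by (simp only: prod.inject)
        then have "rot q s0 X s = rot q s0 Y s" using s False by simp
        moreover obtain i where "rot q s0 X s = X s - X s0 + i * q" using rot_cong by blast
        moreover obtain i' where "rot q s0 Y s = Y s - Y s0 + i' * q" using rot_cong by blast
        ultimately have "X s = Y s + (i' - i) * q" using x0 by (simp add: algebra_simps)
        then show ?thesis by (rule cong_interval_eq[OF rX[OF s]])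
      qed (use x0 in simp)
    qed
  qed
  show "?F ` ?A = ?B"
  proof (intro equalityI subsetI)
    fix p assume "p \<in> ?F ` ?A"
    then obtain X where p: "p = ?F X" and X: "circ_valid full a m q (signed S) (spos X)" by blast
    have "circ_valid full a m q (signed S) (mpos (antipode q s0 X) ((restrict (rot q s0 X) (S - {s0}))(s0 := 0)))"
      using X by (subst valid_iff[of _ X]) (use antipode_cong rot_cong in auto)
    moreover have "restrict (rot q s0 X) (S - {s0}) \<in> (\<Pi>\<^sub>E s\<in>S - {s0}. cut_range q s0 s)"
      using rot_in_range[OF q(1)] by (simp add: PiE_iff)
    ultimately show "p \<in> ?B" using antipode_in_range[OF q(1)] unfolding p by (simp add: cut_configs_def)
  next
    fix p assume "p \<in> ?B"
    then obtain d t where p: "p = (d, t)" and d: "d \<in> {1..q}"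
      and t: "t \<in> (\<Pi>\<^sub>E s\<in>S - {s0}. cut_range q s0 s)" and c: "circ_valid full a m q (signed S) (mpos d (t(s0 := 0)))"
      by (auto simp: cut_configs_def)
    \<comment> \<open>\<open>h\<close> is \<open>- 1 / 2\<close> modulo \<open>q\<close>, so
      \<open>d * h\<close> solves \<open>d = - 2 * X s0\<close> for \<open>X s0\<close>.\<close>
    define h where "h = (q - 1) div 2"
    have h: "2 * h = q - 1" using q(2) by (simp add: h_def)
    define X where "X = restrict (\<lambda>s. (d * h + (t(s0 := 0)) s) mod q) S"
    have Xs: "\<exists>k. X s = d * h + (t(s0 := 0)) s + k * q" if "s \<in> S" for s
    proof -
      have "X s = d * h + (t(s0 := 0)) s + (- ((d * h + (t(s0 := 0)) s) div q)) * q"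
        using that div_mult_mod_eq[of "d * h + (t(s0 := 0)) s" q] by (simp add: X_def algebra_simps)
      then show ?thesis by blast
    qed
    obtain k0 where k0: "X s0 = d * h + k0 * q" using Xs[OF s0] by auto
    have "2 * X s0 = d * (2 * h) + 2 * k0 * q" using k0 by (simp add: algebra_simps)
    then have "d = - (2 * X s0) + (d + 2 * k0) * q" unfolding h by (simp add: algebra_simps)
    then have dX: "\<exists>k. d = - (2 * X s0) + k * q" by blast
    have tX: "\<exists>k. t s = X s - X s0 + k * q" if s: "s \<in> S - {s0}" for s
    proof -
      obtain k where "X s = d * h + t s + k * q" using Xs[of s] s by auto
      then have "t s = X s - X s0 + (k0 - k) * q" using k0 by (simp add: algebra_simps)
      then show ?thesis by blast
    qed
    have "circ_valid full a m q (signed S) (mpos d (t(s0 := 0))) \<longleftrightarrow> circ_valid full a m q (signed S) (spos X)"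
      by (rule valid_iff[where X=X, OF dX tX])
    moreover have "X \<in> S \<rightarrow>\<^sub>E {0..<q}" using q(1) by (simp add: X_def PiE_iff)
    ultimately have XA: "X \<in> ?A" using c by blast
    have 1: "antipode q s0 X = d"
    proof -
      obtain k k' where "antipode q s0 X = - (2 * X s0) + k * q" "d = - (2 * X s0) + k' * q"
        using antipode_cong dX by blast
      then have e: "antipode q s0 X = d + (k - k') * q" by (simp add: algebra_simps)
      show ?thesis
        by (rule cong_interval_eq[OF _ _ e, of 1]) (use d antipode_in_range[OF q(1), of s0 X] in auto)
    qed
    have 2: "restrict (rot q s0 X) (S - {s0}) = t"
    proof (rule extensionalityI[of _ "S - {s0}"])
      show "t \<in> extensional (S - {s0})" using t by (simp add: PiE_iff)
      fix s assume s: "s \<in> S - {s0}"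
      obtain k k' where "rot q s0 X s = X s - X s0 + k * q" "t s = X s - X s0 + k' * q"
        using rot_cong tX[OF s] by blast
      then have e: "rot q s0 X s = t s + (k - k') * q" by (simp add: algebra_simps)
      have "rot q s0 X s = t s"
        by (rule cut_range_unique[OF rot_in_range[OF q(1)] _ _ e]) (use s t in \<open>auto simp: PiE_iff\<close>)
      then show "restrict (rot q s0 X) (S - {s0}) s = t s" using s by simp
    qed simp
    show "p \<in> ?F ` ?A" unfolding p using XA 1 2 by (intro image_eqI[of _ _ X]) auto
  qed
qed

definition cut_split :: "int \<Rightarrow> int set \<Rightarrow> int \<Rightarrow> (int \<Rightarrow> int) \<Rightarrow> int set" where
  "cut_split q S s0 X = {s \<in> S - {s0}. rot q s0 X s < antipode q s0 X}"

lemma card_circ_valid_cut: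
  assumes S: "finite S" "\<And>s. s \<in> S \<Longrightarrow> s > 0" and s0: "s0 \<in> S" and m: "m > 0" and q: "q > 0" "odd q"
  shows "card {X \<in> S \<rightarrow>\<^sub>E {0..<q}. circ_valid full a m q (signed S) (spos X) \<and> cut_split q S s0 X \<in> splits full (S - {s0})}
    = (\<Sum>d\<in>{1..q}. \<Sum>S0\<in>splits full (S - {s0}).
        card (region full a m s0 d S0) * card (region full a m (- s0) (q - d) (S - {s0} - S0)))"
proof -
  let ?F = "\<lambda>X. (antipode q s0 X, restrict (rot q s0 X) (S - {s0}))"
  let ?C = "\<lambda>d. {t \<in> cut_configs full a m q S s0 d. arc_labels S s0 d t \<in> splits full (S - {s0})}"
  have bij: "bij_betw ?F {X \<in> S \<rightarrow>\<^sub>E {0..<q}. circ_valid full a m q (signed S) (spos X)}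
     (SIGMA d:{1..q}. cut_configs full a m q S s0 d)"
    by (rule bij_betw_rot[OF S(2) s0 q])
  have arc: "arc_labels S s0 (antipode q s0 X) (restrict (rot q s0 X) (S - {s0})) = cut_split q S s0 X" for X
    by (auto simp: arc_labels_def cut_split_def)
  have b: "bij_betw ?F {X \<in> {X \<in> S \<rightarrow>\<^sub>E {0..<q}. circ_valid full a m q (signed S) (spos X)}. cut_split q S s0 X \<in> splits full (S - {s0})}
     {p \<in> (SIGMA d:{1..q}. cut_configs full a m q S s0 d). arc_labels S s0 (fst p) (snd p) \<in> splits full (S - {s0})}"
    unfolding bij_betw_def
  proof
    show "inj_on ?F {X \<in> {X \<in> S \<rightarrow>\<^sub>E {0..<q}. circ_valid full a m q (signed S) (spos X)}. cut_split q S s0 X \<in> splits full (S - {s0})}"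
      by (rule inj_on_subset[OF bij_betw_imp_inj_on[OF bij]]) blast
    show "?F ` {X \<in> {X \<in> S \<rightarrow>\<^sub>E {0..<q}. circ_valid full a m q (signed S) (spos X)}. cut_split q S s0 X \<in> splits full (S - {s0})}
      = {p \<in> (SIGMA d:{1..q}. cut_configs full a m q S s0 d). arc_labels S s0 (fst p) (snd p) \<in> splits full (S - {s0})}"
      unfolding bij_betw_imp_surj_on[OF bij, symmetric] arc[symmetric] by (auto simp del: restrict_apply)
  qed
  have e1: "{p \<in> (SIGMA d:{1..q}. cut_configs full a m q S s0 d). arc_labels S s0 (fst p) (snd p) \<in> splits full (S - {s0})}
      = (SIGMA d:{1..q}. ?C d)" by auto
  have e2: "{X \<in> {X \<in> S \<rightarrow>\<^sub>E {0..<q}. circ_valid full a m q (signed S) (spos X)}. cut_split q S s0 X \<in> splits full (S - {s0})}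
    = {X \<in> S \<rightarrow>\<^sub>E {0..<q}. circ_valid full a m q (signed S) (spos X) \<and> cut_split q S s0 X \<in> splits full (S - {s0})}" by blast
  have "card {X \<in> S \<rightarrow>\<^sub>E {0..<q}. circ_valid full a m q (signed S) (spos X) \<and> cut_split q S s0 X \<in> splits full (S - {s0})}
      = card (SIGMA d:{1..q}. ?C d)"
    using bij_betw_same_card[OF b] unfolding e1 e2 .
  also have "\<dots> = (\<Sum>d\<in>{1..q}. card (?C d))"
  proof (rule card_SigmaI)
    have "finite (cut_configs full a m q S s0 d)" for d
    proof (rule finite_subset)
      show "cut_configs full a m q S s0 d \<subseteq> (\<Pi>\<^sub>E s\<in>S - {s0}. cut_range q s0 s)" by (auto simp: cut_configs_def)
      show "finite (\<Pi>\<^sub>E s\<in>S - {s0}. cut_range q s0 s)" using S(1) by (auto intro!: finite_PiE simp: cut_range_def)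
    qed
    then show "\<forall>d\<in>{1..q}. finite (?C d)" by simp
  qed simp
  also have "\<dots> = (\<Sum>d\<in>{1..q}. \<Sum>S0\<in>splits full (S - {s0}).
        card (region full a m s0 d S0) * card (region full a m (- s0) (q - d) (S - {s0} - S0)))"
    by (intro sum.cong refl card_cut_configs[OF S(1,2) s0 m q(1)])
  finally show ?thesis .
qed

section \<open>Generating functions for the two arcs\<close>

definition arc_fps :: "bool \<Rightarrow> nat \<Rightarrow> nat \<Rightarrow> int \<Rightarrow> int set \<Rightarrow> complex fps" where
  "arc_fps full a m s0 S = (\<Sum>S0\<in>splits full (S - {s0}).
     region_fps full a m s0 S0 * region_fps full a m (- s0) (S - {s0} - S0))"

text \<open>The way from \<open>s0\<close> to \<open>- s0\<close> is a descent and has positive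
  length. So the Cauchy product may start at \<open>d = 0\<close>, although \<open>antipode\<close>
  takes values in \<open>{1..q}\<close>.\<close>

lemma region_zero_length:
  assumes S: "\<And>s. s \<in> S \<Longrightarrow> s > 0" and s0: "s0 > 0" and m: "m > 0" and ne: "full \<or> S \<noteq> {}"
  shows "region full a m s0 0 S = {}"
proof (rule equals0I)
  fix f assume f: "f \<in> region full a m s0 0 S"
  have "ok a m s0 0 (- s0) 0"
  proof (cases full)
    case True
    then show ?thesis by (rule regionD(5)[OF f])
  next
    case False
    then obtain s where "s \<in> signed S" using ne by (auto simp: signed_def)
    from regionD(2,3)[OF f this] show ?thesis by (rule ok_trans)
  qed
  then show False using s0 m by (simp add: ok_def)
qed

lemma arc_fps_nth:
  assumes S: "finite S" "\<And>s. s \<in> S \<Longrightarrow> s > 0" and s0: "s0 \<in> S" and m: "m > 0"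
  shows "fps_nth (arc_fps full a m s0 S) q = of_nat (\<Sum>d\<in>{1..q}. \<Sum>S0\<in>splits full (S - {s0}).
        card (region full a m s0 (int d) S0) * card (region full a m (- s0) (int q - int d) (S - {s0} - S0)))"
proof -
  have "fps_nth (arc_fps full a m s0 S) q = (\<Sum>S0\<in>splits full (S - {s0}). \<Sum>d=0..q.
      of_nat (card (region full a m s0 (int d) S0) * card (region full a m (- s0) (int (q - d)) (S - {s0} - S0))))"
    unfolding arc_fps_def fps_sum_nth fps_mult_nth region_fps_def by simp
  also have "\<dots> = (\<Sum>S0\<in>splits full (S - {s0}). \<Sum>d=1..q.
      of_nat (card (region full a m s0 (int d) S0) * card (region full a m (- s0) (int q - int d) (S - {s0} - S0))))"
  proof (rule sum.cong[OF refl])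
    fix S0 assume S0: "S0 \<in> splits full (S - {s0})"
    have "region full a m s0 0 S0 = {}"
      by (rule region_zero_length) (use S0 S s0 m in \<open>auto simp: splits_def\<close>)
    then have "(\<Sum>d=0..q. of_nat (card (region full a m s0 (int d) S0) * card (region full a m (- s0) (int (q - d)) (S - {s0} - S0))))
       = (\<Sum>d=1..q. of_nat (card (region full a m s0 (int d) S0) * card (region full a m (- s0) (int (q - d)) (S - {s0} - S0))) :: complex)"
      by (subst sum.atLeast_Suc_atMost) simp_all
    also have "\<dots> = (\<Sum>d=1..q. of_nat (card (region full a m s0 (int d) S0) * card (region full a m (- s0) (int q - int d) (S - {s0} - S0))))"
      by (intro sum.cong refl) (simp add: of_nat_diff)
    finally show "(\<Sum>d=0..q. of_nat (card (region full a m s0 (int d) S0) * card (region full a m (- s0) (int (q - d)) (S - {s0} - S0))))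
       = (\<Sum>d=1..q. of_nat (card (region full a m s0 (int d) S0) * card (region full a m (- s0) (int q - int d) (S - {s0} - S0))) :: complex)" .
  qed
  also have "\<dots> = of_nat (\<Sum>d\<in>{1..q}. \<Sum>S0\<in>splits full (S - {s0}).
        card (region full a m s0 (int d) S0) * card (region full a m (- s0) (int q - int d) (S - {s0} - S0)))"
    unfolding of_nat_sum by (rule sum.swap)
  finally show ?thesis .
qed

lemma card_circ_valid_cut_arc_fps:
  assumes S: "finite S" "\<And>s. s \<in> S \<Longrightarrow> s > 0" and s0: "s0 \<in> S" and m: "m > 0" and q: "odd q"
  shows "of_nat (card {X \<in> S \<rightarrow>\<^sub>E {0..<int q}. circ_valid full a m (int q) (signed S) (spos X)
     \<and> cut_split (int q) S s0 X \<in> splits full (S - {s0})}) = fps_nth (arc_fps full a m s0 S) q"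
proof -
  have "int q > 0" using q by (cases q) auto
  have "card {X \<in> S \<rightarrow>\<^sub>E {0..<int q}. circ_valid full a m (int q) (signed S) (spos X)
     \<and> cut_split (int q) S s0 X \<in> splits full (S - {s0})}
     = (\<Sum>d\<in>{1..int q}. \<Sum>S0\<in>splits full (S - {s0}).
        card (region full a m s0 d S0) * card (region full a m (- s0) (int q - d) (S - {s0} - S0)))"
    by (rule card_circ_valid_cut[OF S s0 m \<open>int q > 0\<close>]) (use q in auto)
  also have "\<dots> = (\<Sum>d\<in>{1..q}. \<Sum>S0\<in>splits full (S - {s0}).
        card (region full a m s0 (int d) S0) * card (region full a m (- s0) (int q - int d) (S - {s0} - S0)))"
  proof (rule sum.reindex_cong[of int])
    show "{1..int q} = int ` {1..q}" by (simp add: image_int_atLeastAtMost)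
  qed auto
  finally have e: "card {X \<in> S \<rightarrow>\<^sub>E {0..<int q}. circ_valid full a m (int q) (signed S) (spos X)
     \<and> cut_split (int q) S s0 X \<in> splits full (S - {s0})} = \<dots>" .
  show ?thesis unfolding e by (rule arc_fps_nth[OF S s0 m, symmetric])
qed

text \<open>Each arc has one gap across the axis, hence \<open>(1 - X) ^ 2\<close>. The product of
  the denominators depends on \<open>card S\<close> alone, not on the split, and can be taken out of
  the sum.\<close>

lemma arc_fps_full_dilate:
  assumes S: "finite S" "\<And>s. s \<in> S \<Longrightarrow> s > 0" and s0: "s0 \<in> S" and m: "m > 0"
  shows "arc_fps True a m s0 S * (1 - fps_X) ^ 2 * (1 - fps_X ^ 2) ^ (card S - 1)
    = fps_X ^ (2 * a * card S) * dilate m ((1 - fps_X) ^ 2 * (1 - fps_X ^ 2) ^ (card S - 1) * arc_fps True 0 1 s0 S)"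
proof -
  let ?K = "\<lambda>S. (1 - fps_X ^ 2) ^ card S * (1 - fps_X) :: complex fps"
  let ?R = "region_fps True"
  have c0: "card S > 0" using S s0 by (auto simp: card_gt_0_iff)
  have split: "(1 - fps_X) ^ 2 * (1 - fps_X ^ 2) ^ (card S - 1) = ?K S0 * ?K (S - {s0} - S0)"
    and ex: "2 * a * card S = a * (2 * card S0 + 1) + a * (2 * card (S - {s0} - S0) + 1)"
    if "S0 \<in> splits True (S - {s0})" for S0
  proof -
    have sub: "S0 \<subseteq> S - {s0}" using that by (simp add: splits_def)
    then have "card (S - {s0} - S0) = card (S - {s0}) - card S0" "card S0 \<le> card (S - {s0})"
      using S(1) by (auto intro: card_Diff_subset finite_subset card_mono)
    then have c: "card S - 1 = card S0 + card (S - {s0} - S0)" using s0 S(1) by simp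
    show "(1 - fps_X) ^ 2 * (1 - fps_X ^ 2) ^ (card S - 1) = ?K S0 * ?K (S - {s0} - S0)"
      unfolding c by (simp add: power_add power2_eq_square mult_ac)
    have c': "card S = Suc (card S0 + card (S - {s0} - S0))" using c c0 by linarith
    show "2 * a * card S = a * (2 * card S0 + 1) + a * (2 * card (S - {s0} - S0) + 1)"
      unfolding c' by (simp add: algebra_simps)
  qed
  have dil: "?K S0 * ?R a m u S0 = fps_X ^ (a * (2 * card S0 + 1)) * dilate m (?K S0 * ?R 0 1 u S0)"
    if "S0 \<subseteq> S" for S0 u
    by (rule region_fps_full_dilate) (use that S m in \<open>auto intro: finite_subset\<close>)
  have "arc_fps True a m s0 S * (1 - fps_X) ^ 2 * (1 - fps_X ^ 2) ^ (card S - 1)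
     = (\<Sum>S0\<in>splits True (S - {s0}). (1 - fps_X) ^ 2 * (1 - fps_X ^ 2) ^ (card S - 1) * (?R a m s0 S0 * ?R a m (- s0) (S - {s0} - S0)))"
    unfolding arc_fps_def sum_distrib_right by (intro sum.cong refl) (simp add: mult_ac)
  also have "\<dots> = (\<Sum>S0\<in>splits True (S - {s0}). fps_X ^ (2 * a * card S) * dilate m ((1 - fps_X) ^ 2 * (1 - fps_X ^ 2) ^ (card S - 1) * (?R 0 1 s0 S0 * ?R 0 1 (- s0) (S - {s0} - S0))))"
  proof (intro sum.cong refl)
    fix S0 assume S0: "S0 \<in> splits True (S - {s0})"
    then have sub: "S0 \<subseteq> S" "S - {s0} - S0 \<subseteq> S" by (auto simp: splits_def)
    have "(1 - fps_X) ^ 2 * (1 - fps_X ^ 2) ^ (card S - 1) * (?R a m s0 S0 * ?R a m (- s0) (S - {s0} - S0))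
      = (?K S0 * ?R a m s0 S0) * (?K (S - {s0} - S0) * ?R a m (- s0) (S - {s0} - S0))"
      unfolding split[OF S0] by (simp only: mult_ac)
    also have "\<dots> = fps_X ^ (2 * a * card S) * dilate m ((?K S0 * ?R 0 1 s0 S0) * (?K (S - {s0} - S0) * ?R 0 1 (- s0) (S - {s0} - S0)))"
      unfolding dil[OF sub(1)] dil[OF sub(2)] ex[OF S0] dilate_mult[OF m] power_add by (simp only: mult_ac)
    also have "(?K S0 * ?R 0 1 s0 S0) * (?K (S - {s0} - S0) * ?R 0 1 (- s0) (S - {s0} - S0))
      = (1 - fps_X) ^ 2 * (1 - fps_X ^ 2) ^ (card S - 1) * (?R 0 1 s0 S0 * ?R 0 1 (- s0) (S - {s0} - S0))"
      unfolding split[OF S0] by (simp only: mult_ac)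
    finally show "(1 - fps_X) ^ 2 * (1 - fps_X ^ 2) ^ (card S - 1) * (?R a m s0 S0 * ?R a m (- s0) (S - {s0} - S0))
      = fps_X ^ (2 * a * card S) * dilate m ((1 - fps_X) ^ 2 * (1 - fps_X ^ 2) ^ (card S - 1) * (?R 0 1 s0 S0 * ?R 0 1 (- s0) (S - {s0} - S0)))" .
  qed
  also have "\<dots> = fps_X ^ (2 * a * card S) * dilate m ((1 - fps_X) ^ 2 * (1 - fps_X ^ 2) ^ (card S - 1) * arc_fps True 0 1 s0 S)"
    unfolding arc_fps_def sum_distrib_left dilate_sum ..
  finally show ?thesis .
qed

text \<open>Each arc contributes \<open>(1 - X) ^ 2\<close> and a mirrored pair of gaps for all but
  one of its labels. The \<open>card S - 1\<close> labels other than \<open>s0\<close> thus give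
  \<open>card S - 3\<close> pairs.\<close>

lemma arc_fps_free_dilate:
  assumes S: "finite S" "\<And>s. s \<in> S \<Longrightarrow> s > 0" and s0: "s0 \<in> S" and m: "m > 0"
  shows "arc_fps False a m s0 S * (1 - fps_X) ^ 4 * (1 - fps_X ^ 2) ^ (card S - 3)
    = fps_X ^ (2 * a * (card S - 1)) * dilate m ((1 - fps_X) ^ 4 * (1 - fps_X ^ 2) ^ (card S - 3) * arc_fps False 0 1 s0 S)"
proof -
  let ?K = "\<lambda>S. (1 - fps_X ^ 2) ^ (card S - 1) * (1 - fps_X) ^ 2 :: complex fps"
  let ?R = "region_fps False"
  have split: "(1 - fps_X) ^ 4 * (1 - fps_X ^ 2) ^ (card S - 3) = ?K S0 * ?K (S - {s0} - S0)"
    and ex: "2 * a * (card S - 1) = 2 * a * card S0 + 2 * a * card (S - {s0} - S0)"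
    if "S0 \<in> splits False (S - {s0})" for S0
  proof -
    have sub: "S0 \<subseteq> S - {s0}" "S0 \<noteq> {}" "S - {s0} - S0 \<noteq> {}" using that by (auto simp: splits_def)
    then have "card (S - {s0} - S0) = card (S - {s0}) - card S0" "card S0 \<le> card (S - {s0})"
      using S(1) by (auto intro: card_Diff_subset finite_subset card_mono)
    then have c: "card S - 1 = card S0 + card (S - {s0} - S0)" using s0 S(1) by simp
    have "card S0 > 0" "card (S - {s0} - S0) > 0"
      using sub S(1) by (auto simp: card_gt_0_iff intro: finite_subset)
    then have c3: "card S - 3 = (card S0 - 1) + (card (S - {s0} - S0) - 1)" using c by linarith
    have p4: "x ^ 4 = x ^ 2 * x ^ 2" for x :: "complex fps" by (simp add: power_add[symmetric])
    show "(1 - fps_X) ^ 4 * (1 - fps_X ^ 2) ^ (card S - 3) = ?K S0 * ?K (S - {s0} - S0)"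
      unfolding c3 p4 power_add by (simp only: mult_ac)
    show "2 * a * (card S - 1) = 2 * a * card S0 + 2 * a * card (S - {s0} - S0)"
      unfolding c by (simp add: algebra_simps)
  qed
  have dil: "?K S0 * ?R a m u S0 = fps_X ^ (2 * a * card S0) * dilate m (?K S0 * ?R 0 1 u S0)"
    if "S0 \<subseteq> S" "S0 \<noteq> {}" for S0 u
    by (rule region_fps_free_dilate) (use that S m in \<open>auto intro: finite_subset\<close>)
  have "arc_fps False a m s0 S * (1 - fps_X) ^ 4 * (1 - fps_X ^ 2) ^ (card S - 3)
     = (\<Sum>S0\<in>splits False (S - {s0}). (1 - fps_X) ^ 4 * (1 - fps_X ^ 2) ^ (card S - 3) * (?R a m s0 S0 * ?R a m (- s0) (S - {s0} - S0)))"
    unfolding arc_fps_def sum_distrib_right by (intro sum.cong refl) (simp add: mult_ac)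
  also have "\<dots> = (\<Sum>S0\<in>splits False (S - {s0}). fps_X ^ (2 * a * (card S - 1)) * dilate m ((1 - fps_X) ^ 4 * (1 - fps_X ^ 2) ^ (card S - 3) * (?R 0 1 s0 S0 * ?R 0 1 (- s0) (S - {s0} - S0))))"
  proof (intro sum.cong refl)
    fix S0 assume S0: "S0 \<in> splits False (S - {s0})"
    then have sub: "S0 \<subseteq> S" "S0 \<noteq> {}" "S - {s0} - S0 \<subseteq> S" "S - {s0} - S0 \<noteq> {}" by (auto simp: splits_def)
    have "(1 - fps_X) ^ 4 * (1 - fps_X ^ 2) ^ (card S - 3) * (?R a m s0 S0 * ?R a m (- s0) (S - {s0} - S0))
      = (?K S0 * ?R a m s0 S0) * (?K (S - {s0} - S0) * ?R a m (- s0) (S - {s0} - S0))"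
      unfolding split[OF S0] by (simp only: mult_ac)
    also have "\<dots> = fps_X ^ (2 * a * (card S - 1)) * dilate m ((?K S0 * ?R 0 1 s0 S0) * (?K (S - {s0} - S0) * ?R 0 1 (- s0) (S - {s0} - S0)))"
      unfolding dil[OF sub(1,2)] dil[OF sub(3,4)] ex[OF S0] dilate_mult[OF m] power_add by (simp only: mult_ac)
    also have "(?K S0 * ?R 0 1 s0 S0) * (?K (S - {s0} - S0) * ?R 0 1 (- s0) (S - {s0} - S0))
      = (1 - fps_X) ^ 4 * (1 - fps_X ^ 2) ^ (card S - 3) * (?R 0 1 s0 S0 * ?R 0 1 (- s0) (S - {s0} - S0))"
      unfolding split[OF S0] by (simp only: mult_ac)
    finally show "(1 - fps_X) ^ 4 * (1 - fps_X ^ 2) ^ (card S - 3) * (?R a m s0 S0 * ?R a m (- s0) (S - {s0} - S0))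
      = fps_X ^ (2 * a * (card S - 1)) * dilate m ((1 - fps_X) ^ 4 * (1 - fps_X ^ 2) ^ (card S - 3) * (?R 0 1 s0 S0 * ?R 0 1 (- s0) (S - {s0} - S0)))" .
  qed
  also have "\<dots> = fps_X ^ (2 * a * (card S - 1)) * dilate m ((1 - fps_X) ^ 4 * (1 - fps_X ^ 2) ^ (card S - 3) * arc_fps False 0 1 s0 S)"
    unfolding arc_fps_def sum_distrib_left dilate_sum ..
  finally show ?thesis .
qed

text \<open>This and \<open>outer_weight\<close> are the numbers of positions on the two arcs
  without constraints. A label below \<open>s0\<close> loses a position on the first arc, where
  leaving \<open>s0\<close> is a descent, and gains one on the second, so the weights add up to the
  length of the circle.\<close>

definition inner_weight :: "int \<Rightarrow> nat \<Rightarrow> int \<Rightarrow> complex" where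
  "inner_weight s0 d s = of_nat d - (if s < s0 then 1 else 0)"

definition outer_weight :: "int \<Rightarrow> nat \<Rightarrow> int \<Rightarrow> complex" where
  "outer_weight s0 e s = of_nat e + (if s < s0 then 1 else 0)"

lemma card_region_inner:
  assumes S: "finite S" "\<And>s. s \<in> S \<Longrightarrow> s > 0" and s0: "s0 > 0" and d: "d \<ge> 1"
  shows "of_nat (card (region full 0 1 s0 (int d) S)) = (\<Prod>s\<in>S. inner_weight s0 d s)"
proof (cases "S = {}")
  case True
  have "region full 0 1 s0 (int d) {} = {\<lambda>_. undefined}"
    using d by (auto simp: region_def signed_def ok_def)
  then show ?thesis using True by simp
next
  case False
  have "card (region full 0 1 s0 (int d) S)
    = (\<Prod>s\<in>S. nat (int d + 1 - (if s0 > s then 1 else 0) - (if s > - s0 then 1 else 0)))"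
    by (rule card_region_unconstrained[OF S]) (use False in auto)
  also have "of_nat \<dots> = (\<Prod>s\<in>S. inner_weight s0 d s)"
    unfolding of_nat_prod
  proof (intro prod.cong refl)
    fix s assume "s \<in> S"
    then have "s > - s0" using S(2)[of s] s0 by simp
    then have "nat (int d + 1 - (if s0 > s then 1 else 0) - (if s > - s0 then 1 else 0)) = d - (if s < s0 then 1 else 0)"
      by auto
    then show "of_nat (nat (int d + 1 - (if s0 > s then 1 else 0) - (if s > - s0 then 1 else 0))) = inner_weight s0 d s"
      using d by (simp add: inner_weight_def of_nat_diff)
  qed
  finally show ?thesis .
qed

lemma card_region_outer:
  assumes S: "finite S" "\<And>s. s \<in> S \<Longrightarrow> s > 0" "s0 \<notin> S" and s0: "s0 > 0"
  shows "of_nat (card (region full 0 1 (- s0) (int e) S)) = (\<Prod>s\<in>S. outer_weight s0 e s)"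
proof (cases "S = {}")
  case True
  have "region full 0 1 (- s0) (int e) {} = {\<lambda>_. undefined}"
    using s0 by (auto simp: region_def signed_def ok_def)
  then show ?thesis using True by simp
next
  case False
  have "card (region full 0 1 (- s0) (int e) S)
    = (\<Prod>s\<in>S. nat (int e + 1 - (if - s0 > s then 1 else 0) - (if s > - (- s0) then 1 else 0)))"
    by (rule card_region_unconstrained[OF S(1,2)]) (use False in auto)
  also have "of_nat \<dots> = (\<Prod>s\<in>S. outer_weight s0 e s)"
    unfolding of_nat_prod
  proof (intro prod.cong refl)
    fix s assume s: "s \<in> S"
    then have "\<not> - s0 > s" "s \<noteq> s0" using S(2)[of s] S(3) s0 by auto
    then have "nat (int e + 1 - (if - s0 > s then 1 else 0) - (if s > - (- s0) then 1 else 0)) = e + (if s < s0 then 1 else 0)"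
      by auto
    then show "of_nat (nat (int e + 1 - (if - s0 > s then 1 else 0) - (if s > - (- s0) then 1 else 0))) = outer_weight s0 e s"
      by (simp add: outer_weight_def)
  qed
  finally show ?thesis .
qed

lemma arc_fps_unconstrained_nth:
  assumes S: "finite S" "\<And>s. s \<in> S \<Longrightarrow> s > 0" and s0: "s0 \<in> S"
  shows "fps_nth (arc_fps full 0 1 s0 S) j = (\<Sum>d=1..j. \<Sum>S0\<in>splits full (S - {s0}).
    (\<Prod>s\<in>S0. inner_weight s0 d s) * (\<Prod>s\<in>S - {s0} - S0. outer_weight s0 (j - d) s))"
proof -
  have e: "fps_nth (arc_fps full 0 1 s0 S) j = of_nat (\<Sum>d\<in>{1..j}. \<Sum>S0\<in>splits full (S - {s0}).
        card (region full 0 1 s0 (int d) S0) * card (region full 0 1 (- s0) (int j - int d) (S - {s0} - S0)))"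
    by (rule arc_fps_nth[OF S s0 zero_less_one])
  show ?thesis unfolding e of_nat_sum of_nat_mult
  proof (intro sum.cong refl)
  fix d S0 assume d: "d \<in> {1..j}" and S0: "S0 \<in> splits full (S - {s0})"
  have sub: "finite S0" "S0 \<subseteq> S" using S0 S(1) by (auto simp: splits_def intro: finite_subset)
  have e1: "of_nat (card (region full 0 1 s0 (int d) S0)) = (\<Prod>s\<in>S0. inner_weight s0 d s)"
    by (rule card_region_inner) (use sub S s0 d in auto)
  have e2: "of_nat (card (region full 0 1 (- s0) (int (j - d)) (S - {s0} - S0))) = (\<Prod>s\<in>S - {s0} - S0. outer_weight s0 (j - d) s)"
    by (rule card_region_outer) (use S s0 in auto)
  have e3: "int j - int d = int (j - d)" using d by auto
  show "of_nat (card (region full 0 1 s0 (int d) S0)) * of_nat (card (region full 0 1 (- s0) (int j - int d) (S - {s0} - S0)))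
    = (\<Prod>s\<in>S0. inner_weight s0 d s) * (\<Prod>s\<in>S - {s0} - S0. outer_weight s0 (j - d) s)"
    unfolding e3 e1 e2 ..
  qed
qed

text \<open>Choosing an arc for every label is the expansion of a product of two-term sums, each
  equal to \<open>j\<close>.\<close>

lemma sum_Pow_weights:
  assumes S: "finite S" and s0: "s0 \<in> S" and d: "d \<in> {1..j}"
  shows "(\<Sum>S0\<in>Pow (S - {s0}). (\<Prod>s\<in>S0. inner_weight s0 d s) * (\<Prod>s\<in>S - {s0} - S0. outer_weight s0 (j - d) s))
    = of_nat j ^ (card S - 1)"
proof -
  have "(\<Sum>S0\<in>Pow (S - {s0}). (\<Prod>s\<in>S0. inner_weight s0 d s) * (\<Prod>s\<in>S - {s0} - S0. outer_weight s0 (j - d) s))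
      = (\<Prod>s\<in>S - {s0}. inner_weight s0 d s + outer_weight s0 (j - d) s)"
    using S by (subst prod_add) auto
  also have "\<dots> = (\<Prod>s\<in>S - {s0}. of_nat j)"
    using d by (intro prod.cong) (auto simp: inner_weight_def outer_weight_def of_nat_diff)
  also have "\<dots> = of_nat j ^ (card S - 1)" using S s0 by simp
  finally show ?thesis .
qed

text \<open>The labels other than \<open>s0\<close> give \<open>j ^ (card S - 1)\<close>, and the
  \<open>j\<close> values of \<open>d\<close> account for \<open>s0\<close> itself.\<close>

lemma arc_fps_full_unconstrained:
  assumes S: "finite S" "\<And>s. s \<in> S \<Longrightarrow> s > 0" and s0: "s0 \<in> S"
  shows "arc_fps True 0 1 s0 S = power_fps (card S)"
proof (rule fps_ext)
  fix j
  have c0: "card S > 0" using S s0 by (auto simp: card_gt_0_iff)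
  have "splits True (S - {s0}) = Pow (S - {s0})" by (auto simp: splits_def)
  moreover have "fps_nth (arc_fps True 0 1 s0 S) j = (\<Sum>d=1..j. \<Sum>S0\<in>splits True (S - {s0}).
    (\<Prod>s\<in>S0. inner_weight s0 d s) * (\<Prod>s\<in>S - {s0} - S0. outer_weight s0 (j - d) s))"
    by (rule arc_fps_unconstrained_nth[OF S s0])
  ultimately have "fps_nth (arc_fps True 0 1 s0 S) j = (\<Sum>d=1..j. of_nat j ^ (card S - 1))"
    using sum_Pow_weights[OF S(1) s0] by simp
  also have "\<dots> = of_nat j ^ card S" using c0 by (cases "card S") auto
  finally show "fps_nth (arc_fps True 0 1 s0 S) j = fps_nth (power_fps (card S)) j"
    by (simp add: power_fps_def)
qed

text \<open>The summand for \<open>s0\<close> is \<open>(x + 1) ^ (s0 - 1) * x ^ (n - s0)\<close>,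
  so this is the factorization of a difference of \<open>n\<close>-th powers.\<close>

lemma sum_staircase:
  fixes x :: complex
  shows "(\<Sum>s0\<in>{1..int n}. \<Prod>s\<in>{1..int n} - {s0}. x + (if s < s0 then 1 else 0)) = (x + 1) ^ n - x ^ n"
proof -
  have "(\<Prod>s\<in>{1..int n} - {s0}. x + (if s < s0 then 1 else 0)) = (x + 1) ^ nat (s0 - 1) * x ^ nat (int n - s0)"
    if s0: "s0 \<in> {1..int n}" for s0
  proof -
    have "{1..int n} - {s0} = {1..s0 - 1} \<union> {s0 + 1..int n}" using s0 by auto
    then have "(\<Prod>s\<in>{1..int n} - {s0}. x + (if s < s0 then 1 else 0))
      = (\<Prod>s\<in>{1..s0 - 1}. x + (if s < s0 then 1 else 0)) * (\<Prod>s\<in>{s0 + 1..int n}. x + (if s < s0 then 1 else 0))"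
      by (simp only:, subst prod.union_disjoint) auto
    also have "(\<Prod>s\<in>{1..s0 - 1}. x + (if s < s0 then 1 else 0)) = (\<Prod>s\<in>{1..s0 - 1}. x + 1)" by (intro prod.cong) auto
    also have "(\<Prod>s\<in>{s0 + 1..int n}. x + (if s < s0 then 1 else 0)) = (\<Prod>s\<in>{s0 + 1..int n}. x)" by (intro prod.cong) auto
    finally show ?thesis by simp
  qed
  then have "(\<Sum>s0\<in>{1..int n}. \<Prod>s\<in>{1..int n} - {s0}. x + (if s < s0 then 1 else 0))
      = (\<Sum>s0\<in>{1..int n}. (x + 1) ^ nat (s0 - 1) * x ^ nat (int n - s0))" by (intro sum.cong) auto
  also have "\<dots> = (\<Sum>i<n. (x + 1) ^ i * x ^ (n - Suc i))"
  proof (rule sum.reindex_cong[of "\<lambda>i. int i + 1"])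
    show "{1..int n} = (\<lambda>i. int i + 1) ` {..<n}"
    proof (intro equalityI subsetI)
      fix s assume "s \<in> {1..int n}"
      then show "s \<in> (\<lambda>i. int i + 1) ` {..<n}" by (intro image_eqI[of _ _ "nat (s - 1)"]) auto
    qed auto
    show "(x + 1) ^ nat (int i + 1 - 1) * x ^ nat (int n - (int i + 1)) = (x + 1) ^ i * x ^ (n - Suc i)" if "i \<in> {..<n}" for i
    proof -
      have "nat (int n - (int i + 1)) = n - Suc i" using that by auto
      then show ?thesis by simp
    qed
  qed (auto simp: inj_on_def)
  also have "\<dots> = (x + 1) ^ n - x ^ n"
  proof -
    have "(x + 1) ^ n - x ^ n = (x + 1 - x) * (\<Sum>i<n. x ^ (n - Suc i) * (x + 1) ^ i)"
      by (rule power_diff_sumr2)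
    then show ?thesis by (simp add: mult.commute)
  qed
  finally show ?thesis .
qed

text \<open>All splits together give \<open>n * j ^ n\<close>. The two improper splits, summed over
  \<open>s0\<close>, are differences of consecutive \<open>n\<close>-th powers, which telescope over
  \<open>d\<close> to \<open>j ^ n\<close> each.\<close>

lemma arc_fps_free_unconstrained:
  assumes n: "n \<ge> 3"
  shows "(\<Sum>s0\<in>{1..int n}. arc_fps False 0 1 s0 {1..int n}) = fps_const (of_nat (n - 2)) * power_fps n"
proof (rule fps_ext)
  fix j
  let ?S = "{1..int n}"
  let ?W = "\<lambda>s0 d S0. (\<Prod>s\<in>S0. inner_weight s0 d s) * (\<Prod>s\<in>?S - {s0} - S0. outer_weight s0 (j - d) s)"
  have "(\<Sum>S0\<in>splits False (?S - {s0}). ?W s0 d S0)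
      = of_nat j ^ (n - 1) - (\<Prod>s\<in>?S - {s0}. inner_weight s0 d s) - (\<Prod>s\<in>?S - {s0}. outer_weight s0 (j - d) s)"
    if s0: "s0 \<in> ?S" and d: "d \<in> {1..j}" for s0 d
  proof -
    have ne: "?S - {s0} \<noteq> {}"
    proof -
      have "card (?S - {s0}) = n - 1" using s0 by simp
      then show ?thesis using n by (metis card.empty diff_is_0_eq le_trans not_less_eq_eq numeral_3_eq_3 Suc_leD le_numeral_extra(4) One_nat_def)
    qed
    have "Pow (?S - {s0}) = insert {} (insert (?S - {s0}) (splits False (?S - {s0})))"
      by (auto simp: splits_def)
    then have "(\<Sum>S0\<in>Pow (?S - {s0}). ?W s0 d S0) = ?W s0 d {} + (?W s0 d (?S - {s0}) + (\<Sum>S0\<in>splits False (?S - {s0}). ?W s0 d S0))"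
      using ne by (simp only:) (subst sum.insert; auto simp: splits_def finite_splits)
    moreover have "(\<Sum>S0\<in>Pow (?S - {s0}). ?W s0 d S0) = of_nat j ^ (n - 1)"
      using sum_Pow_weights[of ?S s0 d j] s0 d by simp
    ultimately show ?thesis by (simp add: algebra_simps)
  qed
  note W = this
  have "fps_nth (\<Sum>s0\<in>?S. arc_fps False 0 1 s0 ?S) j
     = (\<Sum>s0\<in>?S. \<Sum>d=1..j. \<Sum>S0\<in>splits False (?S - {s0}). ?W s0 d S0)"
    unfolding fps_sum_nth by (intro sum.cong refl arc_fps_unconstrained_nth) auto
  also have "\<dots> = (\<Sum>s0\<in>?S. \<Sum>d=1..j. of_nat j ^ (n - 1) - (\<Prod>s\<in>?S - {s0}. inner_weight s0 d s) - (\<Prod>s\<in>?S - {s0}. outer_weight s0 (j - d) s))"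
    using W by (intro sum.cong refl) auto
  also have "\<dots> = (\<Sum>d=1..j. \<Sum>s0\<in>?S. of_nat j ^ (n - 1) - (\<Prod>s\<in>?S - {s0}. inner_weight s0 d s) - (\<Prod>s\<in>?S - {s0}. outer_weight s0 (j - d) s))"
    by (rule sum.swap)
  also have "\<dots> = (\<Sum>d=1..j. of_nat n * of_nat j ^ (n - 1) - (of_nat d ^ n - of_nat (d - 1) ^ n) - (of_nat (Suc j - d) ^ n - of_nat (j - d) ^ n))"
  proof (intro sum.cong refl)
    fix d assume d: "d \<in> {1..j}"
    have 1: "(\<Sum>s0\<in>?S. \<Prod>s\<in>?S - {s0}. outer_weight s0 (j - d) s) = of_nat (Suc j - d) ^ n - of_nat (j - d) ^ n"
    proof -
      have "of_nat (Suc j - d) = (of_nat (j - d) + 1 :: complex)" using d by (simp add: Suc_diff_le)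
      then show ?thesis unfolding outer_weight_def by (simp only: sum_staircase)
    qed
    \<comment> \<open>The inner weight is minus the staircase factor at \<open>x = - d\<close>, so
      the same identity serves both kinds of weight.\<close>
    have "(\<Prod>s\<in>?S - {s0}. inner_weight s0 d s) = (- 1) ^ (n - 1) * (\<Prod>s\<in>?S - {s0}. - of_nat d + (if s < s0 then 1 else 0))"
      if s0: "s0 \<in> ?S" for s0
    proof -
      have "(\<Prod>s\<in>?S - {s0}. inner_weight s0 d s) = (\<Prod>s\<in>?S - {s0}. (- 1) * (- of_nat d + (if s < s0 then 1 else 0)))"
        by (intro prod.cong refl) (simp add: inner_weight_def)
      also have "\<dots> = (\<Prod>s\<in>?S - {s0}. - 1) * (\<Prod>s\<in>?S - {s0}. - of_nat d + (if s < s0 then 1 else 0))"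
        by (rule prod.distrib)
      finally show ?thesis using s0 by simp
    qed
    then have "(\<Sum>s0\<in>?S. \<Prod>s\<in>?S - {s0}. inner_weight s0 d s) = (- 1) ^ (n - 1) * ((- of_nat d + 1) ^ n - (- of_nat d) ^ n)"
      unfolding sum_staircase[symmetric] sum_distrib_left by (intro sum.cong) auto
    also have "\<dots> = of_nat d ^ n - of_nat (d - 1) ^ n"
    proof -
      obtain k where k: "n = Suc k" using n by (cases n) auto
      have "(- of_nat d + 1 :: complex) = - of_nat (d - 1)" using d by (simp add: of_nat_diff)
      then show ?thesis unfolding k by (simp only: power_minus[of "of_nat (d - 1)"] power_minus[of "of_nat d"])
          (simp add: algebra_simps power_mult_distrib[symmetric])
    qed
    finally have 2: "(\<Sum>s0\<in>?S. \<Prod>s\<in>?S - {s0}. inner_weight s0 d s) = of_nat d ^ n - of_nat (d - 1) ^ n" .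
    show "(\<Sum>s0\<in>?S. of_nat j ^ (n - 1) - (\<Prod>s\<in>?S - {s0}. inner_weight s0 d s) - (\<Prod>s\<in>?S - {s0}. outer_weight s0 (j - d) s))
      = of_nat n * of_nat j ^ (n - 1) - (of_nat d ^ n - of_nat (d - 1) ^ n) - (of_nat (Suc j - d) ^ n - of_nat (j - d) ^ n)"
      unfolding sum_subtractf 1 2 by simp
  qed
  also have "\<dots> = of_nat j * (of_nat n * of_nat j ^ (n - 1)) - of_nat j ^ n - of_nat j ^ n"
  proof -
    have 1: "(\<Sum>d=1..j. of_nat d ^ n - of_nat (d - 1) ^ n) = (of_nat j ^ n :: complex)"
      using n by (induction j) auto
    have "(\<Sum>d=1..j. of_nat (Suc j - d) ^ n - of_nat (j - d) ^ n) = (\<Sum>d=1..j. of_nat d ^ n - of_nat (d - 1) ^ n :: complex)"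
      by (rule sum.reindex_bij_witness[of _ "\<lambda>d. Suc j - d" "\<lambda>d. Suc j - d"]) auto
    then have 2: "(\<Sum>d=1..j. of_nat (Suc j - d) ^ n - of_nat (j - d) ^ n) = (of_nat j ^ n :: complex)" using 1 by simp
    show ?thesis unfolding sum_subtractf[of "\<lambda>d. of_nat n * of_nat j ^ (n - 1) - (of_nat d ^ n - of_nat (d - 1) ^ n)"] 2
      unfolding sum_subtractf[of "\<lambda>d. of_nat n * of_nat j ^ (n - 1)"] 1 by simp
  qed
  also have "\<dots> = of_nat (n - 2) * of_nat j ^ n"
  proof -
    define k where "k = n - 2"
    have k: "n = Suc (Suc k)" using n by (simp add: k_def)
    show ?thesis unfolding k by (simp add: algebra_simps)
  qed
  finally show "fps_nth (\<Sum>s0\<in>?S. arc_fps False 0 1 s0 ?S) j = fps_nth (fps_const (of_nat (n - 2)) * power_fps n) j"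
    by (simp add: power_fps_def)
qed

text \<open>The labels cut off an empty arc are exactly the two that are closest to, and farthest from, the
axis of reflection. \<open>centered_key\<close> is the distance from the axis, with ties broken by the labels.\<close>

definition centered :: "int \<Rightarrow> int \<Rightarrow> int" where
  "centered q x = (if 2 * x < q then x else x - q)"

definition centered_key :: "nat \<Rightarrow> int \<Rightarrow> (int \<Rightarrow> int) \<Rightarrow> int \<Rightarrow> int" where
  "centered_key n q X s = (let c = centered q (X s) in (2 * int n + 1) * \<bar>c\<bar> + (if c < 0 then - s else s))"

text \<open>The tie-breaking terms lie between \<open>- n\<close> and \<open>n\<close>, so the
  factor \<open>2 * n + 1\<close> makes the key lexicographic.\<close>

lemma centered_key_less:
  assumes "s \<in> {1..int n}" "s' \<in> {1..int n}"
  shows "centered_key n q X s < centered_key n q X s' \<longleftrightarrow>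
    (let c = centered q (X s); c' = centered q (X s') in
     \<bar>c\<bar> < \<bar>c'\<bar> \<or> (\<bar>c\<bar> = \<bar>c'\<bar> \<and> (if c < 0 then - s else s) < (if c' < 0 then - s' else s')))"
proof -
  define c c' where "c = \<bar>centered q (X s)\<bar>" "c' = \<bar>centered q (X s')\<bar>"
  define r r' where "r = (if centered q (X s) < 0 then - s else s)" "r' = (if centered q (X s') < 0 then - s' else s')"
  have r: "- int n \<le> r" "r \<le> int n" "- int n \<le> r'" "r' \<le> int n" using assms by (auto simp: r_r'_def)
  let ?K = "2 * int n + 1"
  have "?K * c + r < ?K * c' + r' \<longleftrightarrow> c < c' \<or> (c = c' \<and> r < r')"
  proof (cases c c' rule: linorder_cases)
    case less
    then have "?K * (c + 1) \<le> ?K * c'" by (intro mult_left_mono) auto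
    then show ?thesis using less r by (simp add: algebra_simps)
  next
    case greater
    then have "?K * (c' + 1) \<le> ?K * c" by (intro mult_left_mono) auto
    then show ?thesis using greater r by (simp add: algebra_simps)
  qed auto
  then show ?thesis by (simp add: centered_key_def Let_def c_c'_def r_r'_def)
qed

text \<open>If \<open>s0\<close> is on the nonnegative side, the arc from \<open>s0\<close> up to
  \<open>- s0\<close> passes the point opposite 0 and holds the labels farther from 0. On the
  negative side the arc passes through 0 and holds the nearer ones. As \<open>q\<close> is odd, no
  label lies exactly at \<open>q / 2\<close>.\<close>

lemma cut_split_eq:
  assumes X: "X \<in> {1..int n} \<rightarrow>\<^sub>E {0..<q}" and q: "q > 0" "odd q" and s0: "s0 \<in> {1..int n}"
  shows "cut_split q {1..int n} s0 X = {s \<in> {1..int n} - {s0}. if centered q (X s0) < 0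
    then centered_key n q X s < centered_key n q X s0 else centered_key n q X s0 < centered_key n q X s}"
proof -
  have "rot q s0 X s < antipode q s0 X \<longleftrightarrow> (if centered q (X s0) < 0
    then centered_key n q X s < centered_key n q X s0 else centered_key n q X s0 < centered_key n q X s)"
    if s: "s \<in> {1..int n}" "s \<noteq> s0" for s
  proof -
    define c c0 where "c = centered q (X s)" and "c0 = centered q (X s0)"
    have Xr: "0 \<le> X s" "X s < q" "0 \<le> X s0" "X s0 < q" using X s s0 by (auto simp: PiE_iff)
    have odd2: "2 * x \<noteq> q" for x using q(2) by auto
    have cb: "2 * c < q" "- q < 2 * c" "2 * c0 < q" "- q < 2 * c0"
      using Xr odd2[of "X s"] odd2[of "X s0"] by (auto simp: c_def c0_def centered_def)
    have Xc: "X s = c + (if c < 0 then q else 0)" "X s0 = c0 + (if c0 < 0 then q else 0)"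
      using Xr by (auto simp: c_def c0_def centered_def)
    have md: "x mod q = x + k * q" if "0 \<le> x + k * q" "x + k * q < q" for x k
      using that by (metis mod_mult_self1 mod_pos_pos_trivial)
    have an: "antipode q s0 X = (if c0 < 0 then - 2 * c0 else q - 2 * c0)"
    proof (cases "c0 < 0")
      case True
      have "(2 * X s0) mod q = 2 * X s0 + (- 1) * q" by (rule md) (use Xc True cb in auto)
      then show ?thesis using Xc True by (simp add: antipode_def)
    next
      case False
      have "(2 * X s0) mod q = 2 * X s0 + 0 * q" by (rule md) (use Xc False cb in auto)
      then show ?thesis using Xc False by (simp add: antipode_def)
    qed
    define e where "e = c - c0"
    have Xe: "\<exists>k. X s - X s0 = e + k * q"
      unfolding e_def Xc by (intro exI[of _ "(if c < 0 then 1 else 0) - (if c0 < 0 then 1 else 0)"]) (auto simp: algebra_simps)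
    then obtain k where k: "X s - X s0 = e + k * q" by blast
    have ro: "rot q s0 X s = (if e > 0 \<or> (e = 0 \<and> s > s0) then e else e + q)"
    proof (cases "s > s0")
      case True
      have "(X s - X s0) mod q = e mod q" unfolding k by simp
      also have "\<dots> = (if e \<ge> 0 then e else e + q)"
        using md[of e 0] md[of e 1] cb by (auto simp: e_def)
      finally show ?thesis using True by (auto simp: rot_def)
    next
      case False
      have "(X s0 - X s) = - e + (- k) * q" using k by simp
      then have "(X s0 - X s) mod q = (- e) mod q" by (metis mod_mult_self1)
      also have "\<dots> = (if e > 0 then - e + q else - e)"
        using md[of "- e" 0] md[of "- e" 1] cb by (auto simp: e_def)
      finally show ?thesis using False s(2) by (auto simp: rot_def)
    qed
    show ?thesis
      unfolding centered_key_less[OF s(1) s0] centered_key_less[OF s0 s(1)] c_def[symmetric] c0_def[symmetric] Let_def an ro e_def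
      using cb s s0 by (auto simp: abs_if split: if_splits)
  qed
  then show ?thesis unfolding cut_split_def by blast
qed

text \<open>Whichever side \<open>P\<close> selects, the set is empty or everything exactly for the
  minimum and the maximum of the key.\<close>

lemma card_inner_elements:
  fixes \<kappa> :: "'a \<Rightarrow> int"
  assumes S: "finite S" "card S \<ge> 2" and inj: "inj_on \<kappa> S"
  shows "card {s0 \<in> S. {s \<in> S - {s0}. if P s0 then \<kappa> s < \<kappa> s0 else \<kappa> s0 < \<kappa> s} \<noteq> {} \<and>
    {s \<in> S - {s0}. if P s0 then \<kappa> s < \<kappa> s0 else \<kappa> s0 < \<kappa> s} \<noteq> S - {s0}} = card S - 2"
proof -
  have ne: "\<kappa> ` S \<noteq> {}" "finite (\<kappa> ` S)" using S by auto
  obtain l where l: "l \<in> S" "\<kappa> l = Min (\<kappa> ` S)" using Min_in[OF ne(2,1)] by (metis imageE)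
  obtain u where u: "u \<in> S" "\<kappa> u = Max (\<kappa> ` S)" using Max_in[OF ne(2,1)] by (metis imageE)
  have lmin: "\<kappa> l < \<kappa> s" if "s \<in> S" "s \<noteq> l" for s
  proof -
    have "\<kappa> l \<le> \<kappa> s" using l that ne by simp
    moreover have "\<kappa> l \<noteq> \<kappa> s" using inj l that by (metis inj_onD)
    ultimately show ?thesis by simp
  qed
  have umax: "\<kappa> s < \<kappa> u" if "s \<in> S" "s \<noteq> u" for s
  proof -
    have "\<kappa> s \<le> \<kappa> u" using u that ne by simp
    moreover have "\<kappa> s \<noteq> \<kappa> u" using inj u that by (metis inj_onD)
    ultimately show ?thesis by simp
  qed
  have lu: "l \<noteq> u"
  proof
    assume "l = u"
    then have "S \<subseteq> {l}" using lmin umax by force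
    then have "card S \<le> card {l}" by (intro card_mono) auto
    then show False using S(2) by simp
  qed
  have iff: "({s \<in> S - {s0}. if P s0 then \<kappa> s < \<kappa> s0 else \<kappa> s0 < \<kappa> s} \<noteq> {} \<and>
    {s \<in> S - {s0}. if P s0 then \<kappa> s < \<kappa> s0 else \<kappa> s0 < \<kappa> s} \<noteq> S - {s0}) \<longleftrightarrow> s0 \<notin> {l, u}" if s0: "s0 \<in> S" for s0
  proof (cases "s0 \<in> {l, u}")
    case False
    then have "\<kappa> l < \<kappa> s0" "\<kappa> s0 < \<kappa> u" "l \<in> S - {s0}" "u \<in> S - {s0}" using lmin umax s0 l u by auto
    then show ?thesis using False by (cases "P s0") (auto dest: less_asym)
  next
    case True
    show ?thesis
    proof (cases "s0 = l")
      case t: True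
      have "\<not> \<kappa> s < \<kappa> s0 \<and> \<kappa> s0 < \<kappa> s" if "s \<in> S - {s0}" for s using lmin[of s] that t by auto
      then show ?thesis using True by (cases "P s0") auto
    next
      case f: False
      then have t: "s0 = u" using True by simp
      have "\<kappa> s < \<kappa> s0 \<and> \<not> \<kappa> s0 < \<kappa> s" if "s \<in> S - {s0}" for s using umax[of s] that t by auto
      then show ?thesis using True by (cases "P s0") auto
    qed
  qed
  have "{s0 \<in> S. {s \<in> S - {s0}. if P s0 then \<kappa> s < \<kappa> s0 else \<kappa> s0 < \<kappa> s} \<noteq> {} \<and>
    {s \<in> S - {s0}. if P s0 then \<kappa> s < \<kappa> s0 else \<kappa> s0 < \<kappa> s} \<noteq> S - {s0}} = S - {l, u}"
    using iff by blast
  also have "card \<dots> = card S - 2" using l u lu S(1) by (simp add: card_Diff_subset)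
  finally show ?thesis .
qed

lemma card_proper_cuts:
  assumes X: "X \<in> {1..int n} \<rightarrow>\<^sub>E {0..<q}" and q: "q > 0" "odd q" and n: "n \<ge> 2"
  shows "card {s0 \<in> {1..int n}. cut_split q {1..int n} s0 X \<in> splits False ({1..int n} - {s0})} = n - 2"
proof -
  let ?S = "{1..int n}"
  let ?\<kappa> = "centered_key n q X"
  let ?A = "\<lambda>s0. {s \<in> ?S - {s0}. if centered q (X s0) < 0 then ?\<kappa> s < ?\<kappa> s0 else ?\<kappa> s0 < ?\<kappa> s}"
  have inj: "inj_on ?\<kappa> ?S"
  proof (rule inj_onI)
    fix s s' assume s: "s \<in> ?S" "s' \<in> ?S" "?\<kappa> s = ?\<kappa> s'"
    then have "\<not> ?\<kappa> s < ?\<kappa> s'" "\<not> ?\<kappa> s' < ?\<kappa> s" by auto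
    then show "s = s'" unfolding centered_key_less[OF s(1,2)] centered_key_less[OF s(2,1)] Let_def
      using s(1,2) by (auto split: if_splits)
  qed
  have "{s0 \<in> ?S. cut_split q ?S s0 X \<in> splits False (?S - {s0})} = {s0 \<in> ?S. ?A s0 \<noteq> {} \<and> ?A s0 \<noteq> ?S - {s0}}"
  proof (intro Collect_cong conj_cong refl)
    fix s0 assume "s0 \<in> ?S"
    then have "cut_split q ?S s0 X = ?A s0" by (rule cut_split_eq[OF X q])
    moreover have "?A s0 \<subseteq> ?S - {s0}" by blast
    ultimately show "cut_split q ?S s0 X \<in> splits False (?S - {s0}) \<longleftrightarrow> ?A s0 \<noteq> {} \<and> ?A s0 \<noteq> ?S - {s0}"
      unfolding splits_def mem_Collect_eq Pow_iff by simp
  qed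
  also have "card \<dots> = card ?S - 2"
    by (rule card_inner_elements[OF _ _ inj]) (use n in auto)
  finally show ?thesis by simp
qed

text \<open>The count for type C. Arcs may be empty, so one fixed \<open>s0\<close> serves as the
  cut for all configurations.\<close>

theorem signed_full_count_polynomial:
  assumes S: "finite S" "\<And>s. s \<in> S \<Longrightarrow> s > 0" "S \<noteq> {}" and m: "m > 0"
  shows "\<exists>H q0. aligned H \<and> (\<forall>q\<ge>q0. odd q \<longrightarrow>
    of_nat (card {X \<in> S \<rightarrow>\<^sub>E {0..<int q}. circ_valid True a m (int q) (signed S) (spos X)}) = poly H (of_nat q))"
proof -
  obtain s0 where s0: "s0 \<in> S" using S(3) by blast
  have c0: "card S > 0" using S s0 by (auto simp: card_gt_0_iff)
  have "arc_fps True a m s0 S * (1 - fps_X) ^ 2 * (1 - fps_X ^ 2) ^ (card S - 1)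
    = fps_X ^ (2 * a * card S) * dilate m ((1 - fps_X) ^ 2 * (1 - fps_X ^ 2) ^ (card S - 1) * power_fps (card S))"
    using arc_fps_full_dilate[OF S(1,2) s0 m, of a] arc_fps_full_unconstrained[OF S(1,2) s0] by simp
  from gap_series_polynomial[OF m _ _ this] c0
  obtain H q0 where H: "aligned H" "\<And>q. q \<ge> q0 \<Longrightarrow> odd q \<Longrightarrow> fps_nth (arc_fps True a m s0 S) q = poly H (of_nat q)"
    by auto
  have "of_nat (card {X \<in> S \<rightarrow>\<^sub>E {0..<int q}. circ_valid True a m (int q) (signed S) (spos X)}) = poly H (of_nat q)"
    if q: "q \<ge> q0" "odd q" for q
  proof -
    have "cut_split (int q) S s0 X \<in> splits True (S - {s0})" for X by (auto simp: cut_split_def splits_def)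
    then show ?thesis using card_circ_valid_cut_arc_fps[OF S(1,2) s0 m q(2), of True a] H(2)[OF q] by simp
  qed
  then show ?thesis using H(1) by blast
qed

text \<open>The count for type D. Counting pairs of a configuration and a proper cut in two ways
  yields \<open>n - 2\<close> times the wanted number, and the division requires
  \<open>n \<ge> 3\<close>.\<close>

theorem signed_free_count_polynomial:
  assumes n: "n \<ge> 3" and m: "m > 0"
  shows "\<exists>H q0. aligned H \<and> (\<forall>q\<ge>q0. odd q \<longrightarrow>
    of_nat (card {X \<in> {1..int n} \<rightarrow>\<^sub>E {0..<int q}. circ_valid False a m (int q) (signed {1..int n}) (spos X)}) = poly H (of_nat q))"
proof -
  let ?S = "{1..int n}"
  define F where "F = fps_const (inverse (of_nat (n - 2))) * (\<Sum>s0\<in>?S. arc_fps False a m s0 ?S)"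
  have n2: "of_nat (n - 2) \<noteq> (0 :: complex)" unfolding of_nat_eq_0_iff using n by simp
  let ?K = "(1 - fps_X) ^ 4 * (1 - fps_X ^ 2) ^ (n - 3) :: complex fps"
  have dc: "dilate m (fps_const c * G) = fps_const c * dilate m G" for c G
    by (simp add: dilate_def fps_const_mult_apply_left)
  have "F * (1 - fps_X) ^ 4 * (1 - fps_X ^ 2) ^ (n - 3)
    = fps_const (inverse (of_nat (n - 2))) * (\<Sum>s0\<in>?S. arc_fps False a m s0 ?S * (1 - fps_X) ^ 4 * (1 - fps_X ^ 2) ^ (card ?S - 3))"
    unfolding F_def by (simp add: sum_distrib_right mult.assoc)
  also have "(\<Sum>s0\<in>?S. arc_fps False a m s0 ?S * (1 - fps_X) ^ 4 * (1 - fps_X ^ 2) ^ (card ?S - 3))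
    = (\<Sum>s0\<in>?S. fps_X ^ (2 * a * (card ?S - 1)) * dilate m ((1 - fps_X) ^ 4 * (1 - fps_X ^ 2) ^ (card ?S - 3) * arc_fps False 0 1 s0 ?S))"
    by (intro sum.cong refl arc_fps_free_dilate[OF _ _ _ m]) auto
  also have "\<dots> = fps_X ^ (2 * a * (n - 1)) * dilate m (?K * (\<Sum>s0\<in>?S. arc_fps False 0 1 s0 ?S))"
    unfolding sum_distrib_left dilate_sum by simp
  also have "(\<Sum>s0\<in>?S. arc_fps False 0 1 s0 ?S) = fps_const (of_nat (n - 2)) * power_fps n"
    by (rule arc_fps_free_unconstrained[OF n])
  also have "fps_const (inverse (of_nat (n - 2))) * (fps_X ^ (2 * a * (n - 1)) * dilate m (?K * (fps_const (of_nat (n - 2)) * power_fps n)))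
    = fps_X ^ (2 * a * (n - 1)) * dilate m (?K * power_fps n)"
  proof -
    have "?K * (fps_const (of_nat (n - 2)) * power_fps n) = fps_const (of_nat (n - 2)) * (?K * power_fps n)"
      by (simp only: mult_ac)
    then have "dilate m (?K * (fps_const (of_nat (n - 2)) * power_fps n)) = fps_const (of_nat (n - 2)) * dilate m (?K * power_fps n)"
      by (simp only: dc)
    moreover have "fps_const (inverse (of_nat (n - 2))) * fps_const (of_nat (n - 2)) = (1 :: complex fps)"
      unfolding fps_const_mult left_inverse[OF n2] by simp
    moreover have "x * (y * (z * w)) = (x * z) * (y * w)" for x y z w :: "complex fps"
      by (simp only: mult_ac)
    ultimately show ?thesis by (simp only: mult_1_left)
  qed
  finally have key: "F * (1 - fps_X) ^ 4 * (1 - fps_X ^ 2) ^ (n - 3)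
    = fps_X ^ (2 * a * (n - 1)) * dilate m ((1 - fps_X) ^ 4 * (1 - fps_X ^ 2) ^ (n - 3) * power_fps n)" .
  from gap_series_polynomial[OF m _ _ key] n
  obtain H q0 where H: "aligned H" "\<And>q. q \<ge> q0 \<Longrightarrow> odd q \<Longrightarrow> fps_nth F q = poly H (of_nat q)"
    by auto
  have "of_nat (card {X \<in> ?S \<rightarrow>\<^sub>E {0..<int q}. circ_valid False a m (int q) (signed ?S) (spos X)}) = poly H (of_nat q)"
    if q: "q \<ge> q0" "odd q" for q
  proof -
    let ?A = "{X \<in> ?S \<rightarrow>\<^sub>E {0..<int q}. circ_valid False a m (int q) (signed ?S) (spos X)}"
    let ?C = "\<lambda>s0 X. cut_split (int q) ?S s0 X \<in> splits False (?S - {s0})"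
    have qp: "int q > 0" "odd (int q)" using q(2) by (cases q, auto)
    have fin: "finite ?A" by (rule finite_subset[of _ "?S \<rightarrow>\<^sub>E {0..<int q}"]) (auto intro!: finite_PiE)
    have "(n - 2) * card ?A = (\<Sum>X\<in>?A. card {s0 \<in> ?S. ?C s0 X})"
      using card_proper_cuts[OF _ qp, of _ n] n by simp
    also have "\<dots> = (\<Sum>s0\<in>?S. card {X \<in> ?A. ?C s0 X})"
      by (rule sum_multicount_gen[symmetric]) (use fin in auto)
    finally have e: "(n - 2) * card ?A = (\<Sum>s0\<in>?S. card {X \<in> ?A. ?C s0 X})" .
    have "of_nat (n - 2) * of_nat (card ?A) = (\<Sum>s0\<in>?S. of_nat (card {X \<in> ?A. ?C s0 X}) :: complex)"
      using arg_cong[OF e, of "of_nat :: nat \<Rightarrow> complex"] unfolding of_nat_mult of_nat_sum .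
    also have "\<dots> = (\<Sum>s0\<in>?S. fps_nth (arc_fps False a m s0 ?S) q)"
    proof (intro sum.cong refl)
      fix s0 assume s0: "s0 \<in> ?S"
      have "{X \<in> ?A. ?C s0 X} = {X \<in> ?S \<rightarrow>\<^sub>E {0..<int q}. circ_valid False a m (int q) (signed ?S) (spos X) \<and> ?C s0 X}" by blast
      then show "of_nat (card {X \<in> ?A. ?C s0 X}) = fps_nth (arc_fps False a m s0 ?S) q"
        using card_circ_valid_cut_arc_fps[OF _ _ s0 m q(2), of False a] by simp
    qed
    also have "\<dots> = of_nat (n - 2) * fps_nth F q"
    proof -
      have "of_nat (n - 2) * (inverse (of_nat (n - 2)) * x) = (x :: complex)" for x
        unfolding mult.assoc[symmetric] right_inverse[OF n2] by simp
      then show ?thesis unfolding F_def fps_mult_left_const_nth fps_sum_nth by simp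
    qed
    finally have "of_nat (card ?A) = fps_nth F q" unfolding mult_left_cancel[OF n2] .
    then show ?thesis using H(2)[OF q] by simp
  qed
  then show ?thesis using H(1) by blast
qed

section \<open>Affine equations over the reals and modulo an integer\<close>

text \<open>A pair \<open>(c, k)\<close> stands for the equation \<open>(\<Sum>i. c i * x i) = k\<close>. Gaussian elimination is done once
for values in an additive group \<open>X\<close> modulo a subgroup \<open>P\<close> in which \<open>N\<close> can be cancelled. The two
instances are the reals modulo \<open>0\<close> and the integers modulo \<open>q\<close> with \<open>q\<close> coprime to \<open>N\<close>.\<close>

definition aff :: "('n::finite \<Rightarrow> int) \<times> int \<Rightarrow> ('n \<Rightarrow> real) \<Rightarrow> real" where
  "aff e x = (\<Sum>i\<in>UNIV. of_int (fst e i) * x i) - of_int (snd e)"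

definition fscale :: "int \<Rightarrow> ('n \<Rightarrow> int) \<times> int \<Rightarrow> ('n \<Rightarrow> int) \<times> int" where
  "fscale z e = (\<lambda>i. z * fst e i, z * snd e)"

definition fplus :: "('n \<Rightarrow> int) \<times> int \<Rightarrow> ('n \<Rightarrow> int) \<times> int \<Rightarrow> ('n \<Rightarrow> int) \<times> int" where
  "fplus e f = (\<lambda>i. fst e i + fst f i, snd e + snd f)"

definition fdrop :: "'n \<Rightarrow> ('n \<Rightarrow> int) \<times> int \<Rightarrow> ('n \<Rightarrow> int) \<times> int" where
  "fdrop j e = ((fst e)(j := 0), snd e)"

lemma aff_fscale: "aff (fscale z e) x = of_int z * aff e x"
  by (simp add: aff_def fscale_def sum_distrib_left algebra_simps)

lemma aff_fplus: "aff (fplus e f) x = aff e x + aff f x"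
  by (simp add: aff_def fplus_def sum.distrib algebra_simps)

lemma aff_fdrop: "aff (fdrop j e) x = aff e x - of_int (fst e j) * x j"
proof -
  have "(\<Sum>i\<in>UNIV. of_int (((fst e)(j := 0)) i) * x i) = (\<Sum>i\<in>UNIV. of_int (fst e i) * x i - (if i = j then of_int (fst e j) * x j else 0))"
    by (intro sum.cong) auto
  then show ?thesis by (simp add: aff_def fdrop_def sum_subtractf)
qed

definition residue_pair :: "int \<Rightarrow> real set \<Rightarrow> real set \<Rightarrow> bool" where
  "residue_pair N X P \<longleftrightarrow> range of_int \<subseteq> X \<and> (\<forall>s\<in>X. \<forall>t\<in>X. s + t \<in> X) \<and> (\<forall>t\<in>X. \<forall>z. of_int z * t \<in> X) \<and>
     0 \<in> P \<and> (\<forall>s\<in>P. \<forall>t\<in>P. s + t \<in> P) \<and> (\<forall>t\<in>P. \<forall>z. of_int z * t \<in> P) \<and> (\<forall>t\<in>X. of_int N * t \<in> P \<longrightarrow> t \<in> P)"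

lemma residue_pairD:
  assumes "residue_pair N X P"
  shows "of_int z \<in> X" "s \<in> X \<Longrightarrow> t \<in> X \<Longrightarrow> s + t \<in> X" "t \<in> X \<Longrightarrow> of_int z * t \<in> X"
    "0 \<in> P" "s \<in> P \<Longrightarrow> t \<in> P \<Longrightarrow> s + t \<in> P" "t \<in> P \<Longrightarrow> of_int z * t \<in> P"
    "t \<in> X \<Longrightarrow> of_int N * t \<in> P \<Longrightarrow> t \<in> P"
proof -
  have *: "range of_int \<subseteq> X" "\<forall>s\<in>X. \<forall>t\<in>X. s + t \<in> X" "\<forall>t\<in>X. \<forall>z. of_int z * t \<in> X"
    "0 \<in> P" "\<forall>s\<in>P. \<forall>t\<in>P. s + t \<in> P" "\<forall>t\<in>P. \<forall>z. of_int z * t \<in> P"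
    "\<forall>t\<in>X. of_int N * t \<in> P \<longrightarrow> t \<in> P"
    using assms unfolding residue_pair_def by - (elim conjE, assumption)+
  show "of_int z \<in> X" using *(1) by blast
  show "s \<in> X \<Longrightarrow> t \<in> X \<Longrightarrow> s + t \<in> X" using *(2) by blast
  show "t \<in> X \<Longrightarrow> of_int z * t \<in> X" using *(3) by blast
  show "0 \<in> P" by (rule *(4))
  show "s \<in> P \<Longrightarrow> t \<in> P \<Longrightarrow> s + t \<in> P" using *(5) by blast
  show "t \<in> P \<Longrightarrow> of_int z * t \<in> P" using *(6) by blast
  show "t \<in> X \<Longrightarrow> of_int N * t \<in> P \<Longrightarrow> t \<in> P" using *(7) by blast
qed

lemma residue_pair_diff:
  assumes "residue_pair N X P"
  shows "s \<in> P \<Longrightarrow> t \<in> P \<Longrightarrow> s - t \<in> P" "s \<in> X \<Longrightarrow> t \<in> X \<Longrightarrow> s - t \<in> X"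
  using residue_pairD(5)[OF assms, of s "of_int (- 1) * t"] residue_pairD(6)[OF assms, of t "- 1"]
    residue_pairD(2)[OF assms, of s "of_int (- 1) * t"] residue_pairD(3)[OF assms, of t "- 1"] by auto

text \<open>Cancelling a multiple of \<open>N\<close> allows cancelling \<open>N\<close>, so the
  multiplier may grow during the elimination without losing earlier equivalences.\<close>

lemma residue_pair_mult: "residue_pair (N * M) X P \<Longrightarrow> residue_pair N X P"
proof -
  assume r: "residue_pair (N * M) X P"
  have "t \<in> P" if "t \<in> X" "of_int N * t \<in> P" for t
  proof -
    have "of_int M * (of_int N * t) \<in> P" using residue_pairD(6)[OF r that(2)] .
    then have "of_int (N * M) * t \<in> P" by (simp add: mult_ac)
    then show ?thesis using residue_pairD(7)[OF r that(1)] by blast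
  qed
  then show ?thesis using r unfolding residue_pair_def by blast
qed

lemma residue_pair_sum:
  assumes "residue_pair N X P" "finite A"
  shows "(\<And>i. i \<in> A \<Longrightarrow> f i \<in> P) \<Longrightarrow> sum f A \<in> P" "(\<And>i. i \<in> A \<Longrightarrow> f i \<in> X) \<Longrightarrow> sum f A \<in> X"
  using assms(2)
  by (induction A rule: finite_induct)
     (auto intro: residue_pairD[OF assms(1)] residue_pairD(1)[OF assms(1), of 0, simplified])

lemma aff_in: "residue_pair N X P \<Longrightarrow> (\<And>i. x i \<in> X) \<Longrightarrow> aff e x \<in> X"
  unfolding aff_def
  by (intro residue_pair_diff(2) residue_pair_sum(2) residue_pairD(1) residue_pairD(3)) auto

section \<open>Gaussian elimination over the integers\<close>

text \<open>The condition \<open>1 \<notin> P\<close> discards trivial quotients, in which every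
  equation holds.\<close>

definition inconsistent :: "int \<Rightarrow> (('n::finite \<Rightarrow> int) \<times> int) set \<Rightarrow> bool" where
  "inconsistent N E \<longleftrightarrow> (\<forall>X P x. residue_pair N X P \<longrightarrow> 1 \<notin> P \<longrightarrow> (\<forall>i. x i \<in> X) \<longrightarrow> \<not> (\<forall>e\<in>E. aff e x \<in> P))"

text \<open>A reduced echelon form: the variables in \<open>J\<close> are free, and
  \<open>N * x i\<close> is expressed through them for all others. One \<open>N\<close> and one
  \<open>g\<close> serve all admissible \<open>X\<close> and \<open>P\<close> at once.\<close>

definition solved :: "int \<Rightarrow> (('n::finite \<Rightarrow> int) \<times> int) set \<Rightarrow> 'n set \<Rightarrow> ('n \<Rightarrow> ('n \<Rightarrow> int) \<times> int) \<Rightarrow> bool" where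
  "solved N E J g \<longleftrightarrow> (\<forall>i j. j \<notin> J \<longrightarrow> fst (g i) j = 0) \<and>
     (\<forall>X P x. residue_pair N X P \<longrightarrow> (\<forall>i. x i \<in> X) \<longrightarrow>
        ((\<forall>e\<in>E. aff e x \<in> P) \<longleftrightarrow> (\<forall>i. i \<notin> J \<longrightarrow> of_int N * x i - aff (g i) x \<in> P)))"

lemma inconsistentD:
  "inconsistent N E \<Longrightarrow> residue_pair N X P \<Longrightarrow> 1 \<notin> P \<Longrightarrow> (\<And>i. x i \<in> X) \<Longrightarrow> \<not> (\<forall>e\<in>E. aff e x \<in> P)"
  by (simp add: inconsistent_def)

lemma solvedD:
  assumes "solved N E J g"
  shows "j \<notin> J \<Longrightarrow> fst (g i) j = 0"
    "residue_pair N X P \<Longrightarrow> (\<And>i. x i \<in> X) \<Longrightarrow>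
      (\<forall>e\<in>E. aff e x \<in> P) \<longleftrightarrow> (\<forall>i. i \<notin> J \<longrightarrow> of_int N * x i - aff (g i) x \<in> P)"
  using assms by (simp_all add: solved_def)

text \<open>Substitution of the dependent variables turns the new equation into one in the free
  variables. It is void, contradictory or has a pivot, and the multiplier absorbs the numbers to be
  cancelled in each case.\<close>

lemma elimination_step:
  assumes s: "solved N E J g" and N: "N > 0"
  shows "\<exists>N'>0. inconsistent N' (insert e E) \<or> (\<exists>J g. solved N' (insert e E) J g)"
proof -
  \<comment> \<open>\<open>N * e\<close> with \<open>g i\<close> substituted for
    \<open>N * x i\<close> at every dependent variable.\<close>
  define e' where "e' = (\<lambda>j. if j \<in> J then N * fst e j + (\<Sum>i\<in>-J. fst e i * fst (g i) j) else 0,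
      N * snd e + (\<Sum>i\<in>-J. fst e i * snd (g i)))"
  have g0: "fst (g i) j = 0" if "j \<notin> J" for i j by (rule solvedD(1)[OF s that])
  have sol: "(\<forall>e\<in>E. aff e x \<in> P) \<longleftrightarrow> (\<forall>i. i \<notin> J \<longrightarrow> of_int N * x i - aff (g i) x \<in> P)"
    if "residue_pair N X P" "\<And>i. x i \<in> X" for X P x by (rule solvedD(2)[OF s that])
  have e': "of_int N * aff e x - aff e' x = (\<Sum>i\<in>-J. of_int (fst e i) * (of_int N * x i - aff (g i) x))" for x
  proof -
    have 1: "(\<Sum>j\<in>UNIV. of_int (fst e' j) * x j)
       = (\<Sum>j\<in>UNIV. (if j \<in> J then of_int N * of_int (fst e j) * x j else 0))
         + (\<Sum>i\<in>-J. of_int (fst e i) * (\<Sum>j\<in>UNIV. of_int (fst (g i) j) * x j))"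
    proof -
      have "of_int (fst e' j) * x j = (if j \<in> J then of_int N * of_int (fst e j) * x j else 0)
          + (\<Sum>i\<in>-J. of_int (fst e i) * (of_int (fst (g i) j) * x j))" for j
      proof (cases "j \<in> J")
        case True
        then show ?thesis by (simp add: e'_def distrib_right sum_distrib_right mult.assoc)
      next
        case False
        then show ?thesis using g0[OF False] by (simp add: e'_def)
      qed
      then have "(\<Sum>j\<in>UNIV. of_int (fst e' j) * x j) = (\<Sum>j\<in>UNIV. (if j \<in> J then of_int N * of_int (fst e j) * x j else 0))
          + (\<Sum>j\<in>UNIV. \<Sum>i\<in>-J. of_int (fst e i) * (of_int (fst (g i) j) * x j))"
        by (simp only: sum.distrib)
      also have "(\<Sum>j\<in>UNIV. \<Sum>i\<in>-J. of_int (fst e i) * (of_int (fst (g i) j) * x j))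
          = (\<Sum>i\<in>-J. \<Sum>j\<in>UNIV. of_int (fst e i) * (of_int (fst (g i) j) * x j))" by (rule sum.swap)
      finally show ?thesis by (simp only: sum_distrib_left)
    qed
    have 2: "of_int N * (\<Sum>j\<in>UNIV. of_int (fst e j) * x j)
      = (\<Sum>j\<in>UNIV. (if j \<in> J then of_int N * of_int (fst e j) * x j else 0)) + (\<Sum>i\<in>-J. of_int N * of_int (fst e i) * x i)"
    proof -
      have "(\<Sum>i\<in>-J. of_int N * of_int (fst e i) * x i) = (\<Sum>j\<in>UNIV. (if j \<in> J then 0 else of_int N * of_int (fst e j) * x j))"
        by (rule sum.mono_neutral_cong_left) auto
      moreover have "of_int N * (of_int (fst e j) * x j) = (if j \<in> J then of_int N * of_int (fst e j) * x j else 0)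
          + (if j \<in> J then 0 else of_int N * of_int (fst e j) * x j)" for j by simp
      ultimately show ?thesis by (simp only: sum_distrib_left sum.distrib)
    qed
    have "of_int N * aff e x - aff e' x = of_int N * (\<Sum>j\<in>UNIV. of_int (fst e j) * x j) - (\<Sum>j\<in>UNIV. of_int (fst e' j) * x j)
       + (\<Sum>i\<in>-J. of_int (fst e i) * of_int (snd (g i)))"
      by (simp add: aff_def e'_def algebra_simps)
    also have "\<dots> = (\<Sum>i\<in>-J. of_int (fst e i) * (of_int N * x i - aff (g i) x))"
    proof -
      have "of_int (fst e i) * (of_int N * x i - aff (g i) x) = of_int N * of_int (fst e i) * x i
          - of_int (fst e i) * (\<Sum>j\<in>UNIV. of_int (fst (g i) j) * x j) + of_int (fst e i) * of_int (snd (g i))" for i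
        by (simp add: aff_def algebra_simps)
      then show ?thesis unfolding 1 2 by (simp only: sum.distrib sum_subtractf)
    qed
    finally show ?thesis .
  qed
  have red: "aff e x \<in> P \<longleftrightarrow> aff e' x \<in> P"
    if r: "residue_pair N X P" and x: "\<And>i. x i \<in> X" and c: "\<And>i. i \<notin> J \<Longrightarrow> of_int N * x i - aff (g i) x \<in> P" for X P x
  proof -
    have aX: "aff e x \<in> X" by (rule aff_in[OF r]) (rule x)
    have d: "of_int N * aff e x - aff e' x \<in> P"
      unfolding e' by (intro residue_pair_sum(1)[OF r] residue_pairD(6)[OF r] c) auto
    show ?thesis
    proof
      assume "aff e x \<in> P"
      then have "of_int N * aff e x - (of_int N * aff e x - aff e' x) \<in> P"
        by (intro residue_pair_diff(1)[OF r] residue_pairD(6)[OF r] d)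
      then show "aff e' x \<in> P" by simp
    next
      assume "aff e' x \<in> P"
      then have "(of_int N * aff e x - aff e' x) + aff e' x \<in> P" by (intro residue_pairD(5)[OF r] d)
      then have "of_int N * aff e x \<in> P" by simp
      then show "aff e x \<in> P" by (rule residue_pairD(7)[OF r aX])
    qed
  qed
  have ins: "(\<forall>f\<in>insert e E. aff f x \<in> P) \<longleftrightarrow> (\<forall>i. i \<notin> J \<longrightarrow> of_int N * x i - aff (g i) x \<in> P) \<and> aff e' x \<in> P"
    if r: "residue_pair N X P" and x: "\<And>i. x i \<in> X" for X P x
    using sol[OF r, of x] red[OF r, of x] x by blast
  consider (zero) "\<forall>j. fst e' j = 0" "snd e' = 0" | (const) "\<forall>j. fst e' j = 0" "snd e' \<noteq> 0"
    | (pivot) j0 where "fst e' j0 \<noteq> 0" by blast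
  then show ?thesis
  proof cases
    case zero
    then have "aff e' x = 0" for x by (simp add: aff_def)
    then have "solved N (insert e E) J g"
      unfolding solved_def
    proof (intro conjI allI impI)
      show "fst (g i) j = 0" if "j \<notin> J" for i j using g0 that .
      fix X P and x :: "'a \<Rightarrow> real"
      assume r: "residue_pair N X P" and x: "\<forall>i. x i \<in> X"
      have "aff e' x \<in> P" using residue_pairD(4)[OF r] \<open>\<And>x. aff e' x = 0\<close> by simp
      then show "(\<forall>f\<in>insert e E. aff f x \<in> P) \<longleftrightarrow> (\<forall>i. i \<notin> J \<longrightarrow> of_int N * x i - aff (g i) x \<in> P)"
        using ins[OF r, of x] x by blast
    qed
    then show ?thesis using N by blast
  next
    case const
    \<comment> \<open>A solution would put this number into \<open>P\<close>; cancelling it would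
      put 1 into \<open>P\<close>.\<close>
    let ?N = "N * \<bar>snd e'\<bar>"
    have "inconsistent ?N (insert e E)"
      unfolding inconsistent_def
    proof (intro allI impI notI)
      fix X P and x :: "'a \<Rightarrow> real"
      assume r': "residue_pair ?N X P" and 1: "1 \<notin> P" and x: "\<forall>i. x i \<in> X" and sat: "\<forall>f\<in>insert e E. aff f x \<in> P"
      have r: "residue_pair N X P" by (rule residue_pair_mult[OF r'])
      have "aff e' x \<in> P" using ins[OF r, of x] x sat by blast
      moreover have "aff e' x = - of_int (snd e')" using const by (simp add: aff_def)
      ultimately have p: "of_int (- N * sgn (snd e')) * (- of_int (snd e')) \<in> P" using residue_pairD(6)[OF r] by metis
      have eq: "of_int (- N * sgn (snd e')) * (- of_int (snd e')) = of_int ?N * (1 :: real)"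
        by (simp add: abs_sgn)
      have "of_int ?N * 1 \<in> P" using p unfolding eq .
      moreover have "1 \<in> X" using residue_pairD(1)[OF r, of 1] by simp
      ultimately show False using residue_pairD(7)[OF r'] 1 by blast
    qed
    moreover have "?N > 0" using N const by simp
    ultimately show ?thesis by blast
  next
    case pivot
    then have j0: "j0 \<in> J" by (auto simp: e'_def split: if_splits)
    define b where "b = fst e' j0"
    have b: "b \<noteq> 0" using pivot by (simp add: b_def)
    \<comment> \<open>The pivot equation reads \<open>b * x j0 = h\<close>. Scaling it by
      \<open>N * b\<close> and the older equations by \<open>b * b\<close> brings all to the
      multiplier \<open>N * (b * b)\<close>, which is positive for either sign of
      \<open>b\<close>.\<close>
    define h where "h = fscale (- 1) (fdrop j0 e')"
    define g' where "g' i = (if i = j0 then fscale (N * b) h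
       else fplus (fscale (b * b) (fdrop j0 (g i))) (fscale (b * fst (g i) j0) h))" for i
    let ?N = "N * (b * b)" and ?J = "J - {j0}"
    have ah: "aff e' x = of_int b * x j0 - aff h x" for x
      by (simp add: h_def aff_fscale aff_fdrop b_def)
    have e'0: "fst e' j = 0" if "j \<notin> J" for j using that by (simp add: e'_def)
    have g'0: "fst (g' i) j = 0" if "j \<notin> ?J" for i j
      using that g0[of j] e'0[of j] by (auto simp: g'_def h_def fscale_def fplus_def fdrop_def)
    have "solved ?N (insert e E) ?J g'"
      unfolding solved_def
    proof (intro conjI allI impI)
      show "fst (g' i) j = 0" if "j \<notin> ?J" for i j using g'0 that .
      fix X P and x :: "'a \<Rightarrow> real"
      assume r': "residue_pair ?N X P" and x: "\<forall>i. x i \<in> X"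
      have r: "residue_pair N X P" by (rule residue_pair_mult[OF r'])
      have "residue_pair (b * (N * b)) X P" using r' by (simp add: mult_ac)
      then have rb: "residue_pair (N * b) X P" by (metis residue_pair_mult mult.commute)
      have rbb: "residue_pair (b * b) X P" using r' residue_pair_mult[of "b * b" N] by (simp add: mult_ac)
      have aX: "aff f x \<in> X" for f by (rule aff_in[OF r]) (use x in blast)
      have xX: "of_int z * x i \<in> X" for z i using residue_pairD(3)[OF r] x by blast
      have p0: "aff e' x \<in> P \<longleftrightarrow> of_int ?N * x j0 - aff (g' j0) x \<in> P"
      proof -
        have "of_int ?N * x j0 - aff (g' j0) x = of_int (N * b) * aff e' x"
          by (simp add: g'_def aff_fscale ah algebra_simps)
        then show ?thesis using residue_pairD(6)[OF r] residue_pairD(7)[OF rb aX] by metis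
      qed
      have pi: "of_int N * x i - aff (g i) x \<in> P \<longleftrightarrow> of_int ?N * x i - aff (g' i) x \<in> P"
        if i: "i \<notin> J" and e: "aff e' x \<in> P" for i
      proof -
        let ?s = "of_int N * x i - aff (g i) x"
        have ne: "i \<noteq> j0" using i j0 by blast
        have eq: "of_int ?N * x i - aff (g' i) x = of_int (b * b) * ?s + of_int (b * fst (g i) j0) * aff e' x"
          using ne by (simp add: g'_def aff_fplus aff_fscale aff_fdrop ah algebra_simps)
        have d: "of_int (b * fst (g i) j0) * aff e' x \<in> P" using residue_pairD(6)[OF r e] .
        have sX: "?s \<in> X" by (rule residue_pair_diff(2)[OF r xX aX])
        show ?thesis
        proof
          assume "?s \<in> P"
          then show "of_int ?N * x i - aff (g' i) x \<in> P"
            unfolding eq by (intro residue_pairD(5)[OF r] residue_pairD(6)[OF r] d)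
        next
          assume "of_int ?N * x i - aff (g' i) x \<in> P"
          then have "(of_int (b * b) * ?s + of_int (b * fst (g i) j0) * aff e' x) - of_int (b * fst (g i) j0) * aff e' x \<in> P"
            unfolding eq by (intro residue_pair_diff(1)[OF r] d)
          then have "of_int (b * b) * ?s \<in> P" by simp
          then show "?s \<in> P" by (rule residue_pairD(7)[OF rbb sX])
        qed
      qed
      have "(\<forall>f\<in>insert e E. aff f x \<in> P) \<longleftrightarrow> (\<forall>i. i \<notin> J \<longrightarrow> of_int N * x i - aff (g i) x \<in> P) \<and> aff e' x \<in> P"
        using ins[OF r, of x] x by blast
      also have "\<dots> \<longleftrightarrow> (\<forall>i. i \<notin> J \<longrightarrow> of_int ?N * x i - aff (g' i) x \<in> P) \<and> of_int ?N * x j0 - aff (g' j0) x \<in> P"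
        using pi p0 by blast
      also have "\<dots> \<longleftrightarrow> (\<forall>i. i \<notin> ?J \<longrightarrow> of_int ?N * x i - aff (g' i) x \<in> P)"
        by blast
      finally show "(\<forall>f\<in>insert e E. aff f x \<in> P) \<longleftrightarrow> (\<forall>i. i \<notin> ?J \<longrightarrow> of_int ?N * x i - aff (g' i) x \<in> P)" .
    qed
    moreover have "b * b > 0" using b by (simp add: zero_less_mult_iff) linarith
    then have "?N > 0" using N by simp
    ultimately show ?thesis by blast
  qed
qed

lemma elimination:
  assumes "finite E"
  shows "\<exists>N>0. inconsistent N E \<or> (\<exists>J g. solved N E J g)"
  using assms
proof (induction E rule: finite_induct)
  case empty
  have "solved 1 ({} :: (('a \<Rightarrow> int) \<times> int) set) UNIV (\<lambda>i. (\<lambda>_. 0, 0))" by (simp add: solved_def)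
  then show ?case by (intro exI[of _ 1]) auto
next
  case (insert e E)
  then obtain N where N: "N > 0" "inconsistent N E \<or> (\<exists>J g. solved N E J g)" by blast
  show ?case
  proof (cases "inconsistent N E")
    case True
    then have "inconsistent N (insert e E)" unfolding inconsistent_def by (metis insertCI)
    then show ?thesis using N by blast
  next
    case False
    then show ?thesis using N elimination_step by blast
  qed
qed

definition sol_real :: "(('n::finite \<Rightarrow> int) \<times> int) set \<Rightarrow> (real ^ 'n) set" where
  "sol_real E = {x. \<forall>e\<in>E. aff e (($) x) = 0}"

definition sol_mod :: "nat \<Rightarrow> (('n::finite \<Rightarrow> int) \<times> int) set \<Rightarrow> ('n \<Rightarrow> int) set" where
  "sol_mod q E = {x. (\<forall>i. x i \<in> {0..<int q}) \<and> (\<forall>e\<in>E. int q dvd (\<Sum>i\<in>UNIV. fst e i * x i) - snd e)}"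

lemma finite_sol_mod: "finite (sol_mod q E)"
proof (rule finite_subset)
  show "sol_mod q E \<subseteq> (\<Pi>\<^sub>E i\<in>UNIV. {0..<int q})" by (auto simp: sol_mod_def PiE_iff)
qed (auto intro: finite_PiE)

lemma residue_pair_real: "N > 0 \<Longrightarrow> residue_pair N UNIV {0}"
  by (auto simp: residue_pair_def)

lemma residue_pair_mod:
  assumes "coprime q N"
  shows "residue_pair N (range of_int) ((\<lambda>z. of_int (q * z)) ` UNIV)"
  unfolding residue_pair_def
proof (intro conjI ballI allI impI)
  fix t :: real assume t: "t \<in> range of_int" "of_int N * t \<in> (\<lambda>z. of_int (q * z)) ` UNIV"
  then obtain y z where y: "t = of_int y" and "of_int N * t = of_int (q * z)" by blast
  then have "of_int (N * y) = (of_int (q * z) :: real)" by simp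
  then have "N * y = q * z" by (simp only: of_int_eq_iff)
  then have "q dvd N * y" by simp
  then have "q dvd y" using assms by (simp add: coprime_dvd_mult_right_iff)
  then show "t \<in> (\<lambda>z. of_int (q * z)) ` UNIV" unfolding y by (metis dvdE rangeI)
next
  fix s t :: real assume "s \<in> (\<lambda>z. of_int (q * z)) ` UNIV" "t \<in> (\<lambda>z. of_int (q * z)) ` UNIV"
  then obtain y z where "s = of_int (q * y)" "t = of_int (q * z)" by blast
  then have "s + t = of_int (q * (y + z))" by (simp add: algebra_simps)
  then show "s + t \<in> (\<lambda>z. of_int (q * z)) ` UNIV" by blast
next
  fix t :: real and z assume "t \<in> (\<lambda>z. of_int (q * z)) ` UNIV"
  then obtain y where "t = of_int (q * y)" by blast
  then have "of_int z * t = of_int (q * (z * y))" by simp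
  then show "of_int z * t \<in> (\<lambda>z. of_int (q * z)) ` UNIV" by blast
next
  show "0 \<in> (\<lambda>z. of_int (q * z) :: real) ` UNIV" by (rule image_eqI[of _ _ 0]) auto
next
  fix s t :: real assume "s \<in> range of_int" "t \<in> range of_int"
  then show "s + t \<in> range of_int" by (metis Ints_add Ints_def)
next
  fix t :: real and z assume "t \<in> range of_int"
  then show "of_int z * t \<in> range of_int" by (metis Ints_def Ints_mult Ints_of_int)
qed auto

lemma aff_of_int: "aff e (\<lambda>i. of_int (x i)) = of_int ((\<Sum>i\<in>UNIV. fst e i * x i) - snd e)"
  by (simp add: aff_def)

lemma of_int_in_multiples: "(of_int y :: real) \<in> (\<lambda>z. of_int (q * z)) ` UNIV \<longleftrightarrow> q dvd y"
proof
  assume "(of_int y :: real) \<in> (\<lambda>z. of_int (q * z)) ` UNIV"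
  then obtain z where "(of_int y :: real) = of_int (q * z)" by blast
  then have "y = q * z" by (simp only: of_int_eq_iff)
  then show "q dvd y" by simp
next
  assume "q dvd y"
  then obtain z where "y = q * z" by blast
  then show "(of_int y :: real) \<in> (\<lambda>z. of_int (q * z)) ` UNIV" by blast
qed

lemma dim_coordinate_subspace: "dim {x :: real ^ 'n. \<forall>i. i \<notin> J \<longrightarrow> x $ i = 0} = card J"
proof -
  have "(\<lambda>i. axis i (1::real)) ` J \<subseteq> Basis" by (auto simp: Basis_vec_def)
  from dim_substandard[OF this]
  have "dim {x :: real ^ 'n. \<forall>b\<in>Basis. b \<notin> (\<lambda>i. axis i 1) ` J \<longrightarrow> x \<bullet> b = 0} = card ((\<lambda>i. axis i (1::real)) ` J :: (real ^ 'n) set)" .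
  moreover have "{x :: real ^ 'n. \<forall>b\<in>Basis. b \<notin> (\<lambda>i. axis i 1) ` J \<longrightarrow> x \<bullet> b = 0} = {x. \<forall>i. i \<notin> J \<longrightarrow> x $ i = 0}"
    by (auto simp: Basis_vec_def inner_axis axis_eq_axis)
  moreover have "card ((\<lambda>i. axis i (1::real)) ` J :: (real ^ 'n) set) = card J"
    by (rule card_image) (auto simp: inj_on_def axis_eq_axis)
  ultimately show ?thesis by simp
qed

text \<open>The solution set is the image of the coordinate subspace on \<open>J\<close> under an
  injective affine map, given by solving for the dependent variables.\<close>

lemma aff_dim_sol_real:
  assumes N: "N > 0" and s: "solved N E J g"
  shows "sol_real E \<noteq> {} \<and> aff_dim (sol_real E) = int (card J)"
proof -
  have g0: "fst (g i) j = 0" if "j \<notin> J" for i j by (rule solvedD(1)[OF s that])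
  have "(\<forall>e\<in>E. aff e x \<in> {0}) \<longleftrightarrow> (\<forall>i. i \<notin> J \<longrightarrow> of_int N * x i - aff (g i) x \<in> {0})" for x
    by (rule solvedD(2)[OF s residue_pair_real[OF N]]) simp
  then have sol: "sol_real E = {x. \<forall>i. i \<notin> J \<longrightarrow> of_int N * x $ i = aff (g i) (($) x)}"
    by (simp add: sol_real_def)
  define L where "L y = (\<chi> i. if i \<in> J then y $ i else (\<Sum>j\<in>UNIV. of_int (fst (g i) j) * y $ j) / of_int N)" for y :: "real ^ 'a"
  define v where "v = (\<chi> i. if i \<in> J then 0 else - of_int (snd (g i)) / (of_int N :: real))"
  define U where "U = {x :: real ^ 'a. \<forall>i. i \<notin> J \<longrightarrow> x $ i = 0}"
  have linL: "linear L"
    by (rule linearI) (auto simp: L_def vec_eq_iff sum.distrib algebra_simps add_divide_distrib sum_distrib_left sum_divide_distrib)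
  have U: "subspace U" by (auto simp: U_def subspace_def)
  have agr: "(\<Sum>j\<in>UNIV. of_int (fst (g i) j) * x $ j) = (\<Sum>j\<in>UNIV. of_int (fst (g i) j) * y $ j)"
    if "\<And>j. j \<in> J \<Longrightarrow> x $ j = y $ j" for i and x y :: "real ^ 'a"
    using that g0 by (intro sum.cong refl) (metis mult_eq_0_iff of_int_0)
  have "sol_real E = (+) v ` (L ` U)"
  proof (intro equalityI subsetI)
    fix x assume x: "x \<in> sol_real E"
    define y where "y = (\<chi> i. if i \<in> J then x $ i else 0)"
    have "x = v + L y"
      unfolding vec_eq_iff
    proof
      fix i
      show "x $ i = (v + L y) $ i"
      proof (cases "i \<in> J")
        case False
        then have "of_int N * x $ i = (\<Sum>j\<in>UNIV. of_int (fst (g i) j) * x $ j) - of_int (snd (g i))"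
          using x unfolding sol aff_def by simp
        also have "(\<Sum>j\<in>UNIV. of_int (fst (g i) j) * x $ j) = (\<Sum>j\<in>UNIV. of_int (fst (g i) j) * y $ j)"
          by (rule agr) (simp add: y_def)
        finally show ?thesis using False N by (simp add: v_def L_def field_simps)
      qed (simp add: v_def L_def y_def)
    qed
    moreover have "y \<in> U" by (simp add: U_def y_def)
    ultimately show "x \<in> (+) v ` (L ` U)" by blast
  next
    fix x assume "x \<in> (+) v ` (L ` U)"
    then obtain y where x: "x = v + L y" by blast
    have "of_int N * x $ i = aff (g i) (($) x)" if i: "i \<notin> J" for i
    proof -
      have "(\<Sum>j\<in>UNIV. of_int (fst (g i) j) * x $ j) = (\<Sum>j\<in>UNIV. of_int (fst (g i) j) * y $ j)"
        by (rule agr) (simp add: x v_def L_def)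
      then show ?thesis using i N by (simp add: aff_def) (simp add: x v_def L_def field_simps)
    qed
    then show "x \<in> sol_real E" unfolding sol by blast
  qed
  moreover have "aff_dim ((+) v ` (L ` U)) = int (dim (L ` U))"
    unfolding aff_dim_translation_eq by (rule aff_dim_subspace[OF linear_subspace_image[OF linL U]])
  moreover have "dim (L ` U) = dim U"
  proof (rule dim_image_eq[OF linL])
    have sp: "span U = U" using U by (simp add: span_eq_iff)
    show "inj_on L (span U)"
      unfolding sp
    proof (rule inj_onI)
      fix x y assume xy: "x \<in> U" "y \<in> U" "L x = L y"
      show "x = y"
        unfolding vec_eq_iff
      proof
        fix i
        have "L x $ i = L y $ i" using xy(3) by simp
        then show "x $ i = y $ i" using xy(1,2) by (cases "i \<in> J") (auto simp: L_def U_def)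
      qed
    qed
  qed
  moreover have "dim U = card J" unfolding U_def by (rule dim_coordinate_subspace)
  moreover have "(+) v ` (L ` U) \<noteq> {}" using subspace_0[OF U] by blast
  ultimately show ?thesis by simp
qed

text \<open>As \<open>N\<close> is invertible modulo \<open>q\<close>, every choice of residues for
  the free variables extends uniquely.\<close>

lemma card_sol_mod:
  assumes s: "solved N E J g" and q: "q > 0" "coprime (int q) N"
  shows "card (sol_mod q E) = q ^ card J"
proof -
  let ?P = "(\<lambda>z. of_int (int q * z)) ` UNIV :: real set"
  have g0: "fst (g i) j = 0" if "j \<notin> J" for i j by (rule solvedD(1)[OF s that])
  have eqv: "(\<forall>e\<in>E. int q dvd (\<Sum>i\<in>UNIV. fst e i * x i) - snd e) \<longleftrightarrow>
    (\<forall>i. i \<notin> J \<longrightarrow> int q dvd N * x i - ((\<Sum>j\<in>UNIV. fst (g i) j * x j) - snd (g i)))" for x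
  proof -
    have "(\<forall>e\<in>E. aff e (\<lambda>i. of_int (x i)) \<in> ?P) \<longleftrightarrow>
      (\<forall>i. i \<notin> J \<longrightarrow> of_int N * of_int (x i) - aff (g i) (\<lambda>i. of_int (x i)) \<in> ?P)"
      by (rule solvedD(2)[OF s residue_pair_mod[OF q(2)]]) simp
    moreover have "of_int N * of_int (x i) - aff (g i) (\<lambda>i. of_int (x i))
       = of_int (N * x i - ((\<Sum>j\<in>UNIV. fst (g i) j * x j) - snd (g i)))" for i
      unfolding aff_of_int by simp
    ultimately show ?thesis unfolding aff_of_int by (simp only: of_int_in_multiples)
  qed
  have agr: "(\<Sum>j\<in>UNIV. fst (g i) j * x j) = (\<Sum>j\<in>UNIV. fst (g i) j * y j)"
    if "\<And>j. j \<in> J \<Longrightarrow> x j = y j" for i and x y :: "'a \<Rightarrow> int"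
    using that g0 by (intro sum.cong refl) (metis mult_eq_0_iff)
  have cop: "int q dvd N * z \<longleftrightarrow> int q dvd z" for z using q(2) by (simp add: coprime_dvd_mult_right_iff)
  have "bij_betw (\<lambda>x. restrict x J) (sol_mod q E) (J \<rightarrow>\<^sub>E {0..<int q})"
    unfolding bij_betw_def
  proof
    show "inj_on (\<lambda>x. restrict x J) (sol_mod q E)"
    proof (rule inj_onI)
      fix x y assume x: "x \<in> sol_mod q E" and y: "y \<in> sol_mod q E" and e: "restrict x J = restrict y J"
      have J: "x j = y j" if "j \<in> J" for j using e that by (metis restrict_apply')
      show "x = y"
      proof
        fix i
        show "x i = y i"
        proof (cases "i \<in> J")
          case False
          have "int q dvd N * x i - ((\<Sum>j\<in>UNIV. fst (g i) j * x j) - snd (g i))"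
            "int q dvd N * y i - ((\<Sum>j\<in>UNIV. fst (g i) j * y j) - snd (g i))"
            using x y False eqv[of x] eqv[of y] by (auto simp: sol_mod_def)
          then have "int q dvd (N * x i - ((\<Sum>j\<in>UNIV. fst (g i) j * x j) - snd (g i)))
              - (N * y i - ((\<Sum>j\<in>UNIV. fst (g i) j * y j) - snd (g i)))" by (rule dvd_diff)
          also have "\<dots> = N * (x i - y i)" using agr[where i=i and x=x and y=y, OF J] by (simp add: algebra_simps)
          finally have "int q dvd x i - y i" unfolding cop .
          then have "x i mod int q = y i mod int q" by (simp add: mod_eq_dvd_iff)
          moreover have "x i \<in> {0..<int q}" "y i \<in> {0..<int q}" using x y by (auto simp: sol_mod_def)
          ultimately show ?thesis by simp
        qed (use J in blast)
      qed
    qed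
    show "(\<lambda>x. restrict x J) ` sol_mod q E = (J \<rightarrow>\<^sub>E {0..<int q})"
    proof (intro equalityI subsetI)
      fix y assume "y \<in> (\<lambda>x. restrict x J) ` sol_mod q E"
      then show "y \<in> (J \<rightarrow>\<^sub>E {0..<int q})" by (auto simp: sol_mod_def)
    next
      fix y assume y: "y \<in> (J \<rightarrow>\<^sub>E {0..<int q})"
      obtain N' where N': "[N * N' = 1] (mod int q)" using cong_solve_coprime_int[of N "int q"] q(2) by (auto simp: coprime_commute)
      define A where "A i = (\<Sum>j\<in>UNIV. fst (g i) j * y j) - snd (g i)" for i
      define x where "x i = (if i \<in> J then y i else (N' * A i) mod int q)" for i
      have xJ: "restrict x J = y"
        by (rule extensionalityI[of _ J]) (use y in \<open>auto simp: x_def PiE_iff\<close>)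
      have "x i \<in> {0..<int q}" for i using y q(1) by (auto simp: x_def PiE_iff)
      moreover have "int q dvd N * x i - ((\<Sum>j\<in>UNIV. fst (g i) j * x j) - snd (g i))" if i: "i \<notin> J" for i
      proof -
        have "(\<Sum>j\<in>UNIV. fst (g i) j * x j) - snd (g i) = A i"
          unfolding A_def using agr[of x y i] by (simp add: x_def)
        moreover have "[N * x i = A i] (mod int q)"
        proof -
          have "[x i = N' * A i] (mod int q)" using i by (simp add: x_def cong_def)
          then have "[N * x i = N * (N' * A i)] (mod int q)" by (rule cong_scalar_left)
          also have "[N * (N' * A i) = 1 * A i] (mod int q)"
            unfolding mult.assoc[symmetric] using N' by (rule cong_scalar_right)
          finally show ?thesis by simp
        qed
        ultimately show ?thesis by (simp add: cong_iff_dvd_diff)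
      qed
      ultimately have "x \<in> sol_mod q E" using eqv[of x] by (simp add: sol_mod_def)
      then show "y \<in> (\<lambda>x. restrict x J) ` sol_mod q E" using xJ by blast
    qed
  qed
  then have "card (sol_mod q E) = card (J \<rightarrow>\<^sub>E {0..<int q})" by (rule bij_betw_same_card)
  then show ?thesis by (simp add: card_PiE)
qed

text \<open>Both solution sets come from one elimination and have the same free variables.\<close>

theorem card_sol_mod_eq_power_aff_dim:
  assumes "finite E"
  shows "\<exists>N>0. \<forall>q>1. coprime (int q) N \<longrightarrow>
    (sol_real E = {} \<longrightarrow> sol_mod q E = {}) \<and>
    (sol_real E \<noteq> {} \<longrightarrow> card (sol_mod q E) = q ^ nat (aff_dim (sol_real E)))"
proof -
  obtain N where N: "N > 0" "inconsistent N E \<or> (\<exists>J g. solved N E J g)"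
    using elimination[OF assms] by blast
  have "(sol_real E = {} \<longrightarrow> sol_mod q E = {}) \<and>
    (sol_real E \<noteq> {} \<longrightarrow> card (sol_mod q E) = q ^ nat (aff_dim (sol_real E)))"
    if q: "q > 1" "coprime (int q) N" for q
  proof (cases "inconsistent N E")
    case True
    have "\<not> (\<forall>e\<in>E. aff e x \<in> {0})" for x
      by (rule inconsistentD[OF True residue_pair_real[OF N(1)]]) simp_all
    then have 1: "sol_real E = {}" by (auto simp: sol_real_def)
    let ?P = "(\<lambda>z. of_int (int q * z)) ` UNIV :: real set"
    have "(1 :: real) \<notin> ?P" using of_int_in_multiples[of 1 "int q"] q(1) by simp
    then have "\<not> (\<forall>e\<in>E. aff e (\<lambda>i. of_int (x i)) \<in> ?P)" for x
      by (intro inconsistentD[OF True residue_pair_mod[OF q(2)]]) simp_all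
    then have "\<not> (\<forall>e\<in>E. int q dvd (\<Sum>i\<in>UNIV. fst e i * x i) - snd e)" for x
      unfolding aff_of_int of_int_in_multiples .
    then have "sol_mod q E = {}" by (auto simp: sol_mod_def)
    then show ?thesis using 1 by simp
  next
    case False
    then obtain J g where s: "solved N E J g" using N(2) by blast
    then show ?thesis using aff_dim_sol_real[OF N(1) s] card_sol_mod[OF s _ q(2)] q(1) by simp
  qed
  then show ?thesis using N(1) by blast
qed

section \<open>The characteristic polynomial as a count modulo an integer\<close>

definition mobius_spec :: "'a set set \<Rightarrow> ('a set \<Rightarrow> 'a set \<Rightarrow> int) \<Rightarrow> bool" where
  "mobius_spec P m \<longleftrightarrow>
     (\<forall>x\<in>P. \<forall>y\<in>P. m x y =
        (if x = y then 1
         else if y \<subseteq> x then - (\<Sum>z\<in>{z\<in>P. z \<subseteq> x \<and> y \<subseteq> z \<and> z \<noteq> y}. m x z)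
         else 0)) \<and>
     (\<forall>x y. x \<notin> P \<or> y \<notin> P \<longrightarrow> m x y = 0)"

lemma wf_finite_supset:
  assumes "finite P"
  shows "wf {(z, y). z \<in> P \<and> y \<in> P \<and> y \<subset> z}"
proof (rule wf_subset)
  show "wf (Wellfounded.measure (\<lambda>y. card {z\<in>P. y \<subset> z}))" by simp
  show "{(z, y). z \<in> P \<and> y \<in> P \<and> y \<subset> z} \<subseteq> Wellfounded.measure (\<lambda>y. card {z\<in>P. y \<subset> z})"
  proof
    fix p assume "p \<in> {(z, y). z \<in> P \<and> y \<in> P \<and> y \<subset> z}"
    then obtain z y where p: "p = (z, y)" and zy: "z \<in> P" "y \<in> P" "y \<subset> z" by blast
    have "{w\<in>P. z \<subset> w} \<subset> {w\<in>P. y \<subset> w}" using zy by blast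
    then have "card {w\<in>P. z \<subset> w} < card {w\<in>P. y \<subset> w}" using assms by (intro psubset_card_mono) auto
    then show "p \<in> Wellfounded.measure (\<lambda>y. card {z\<in>P. y \<subset> z})" by (simp add: p)
  qed
qed

text \<open>\<open>mobius\<close> is a definite description, so existence and uniqueness must
  precede any use of its recursion. The recursion is well-founded because the values at
  \<open>y\<close> use only strictly larger sets.\<close>

lemma mobius_spec_ex:
  assumes "finite P"
  shows "\<exists>m. mobius_spec P m"
proof -
  let ?R = "{(z, y). z \<in> P \<and> y \<in> P \<and> y \<subset> z}"
  define H where "H x f y = (if x = y then 1 else if y \<subseteq> x
    then - (\<Sum>z\<in>{z\<in>P. z \<subseteq> x \<and> y \<subseteq> z \<and> z \<noteq> y}. f z) else 0 :: int)" for x f y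
  define m where "m x y = (if x \<in> P \<and> y \<in> P then wfrec ?R (H x) y else 0)" for x y
  have "m x y = (if x = y then 1 else if y \<subseteq> x
    then - (\<Sum>z\<in>{z\<in>P. z \<subseteq> x \<and> y \<subseteq> z \<and> z \<noteq> y}. m x z) else 0)" if xy: "x \<in> P" "y \<in> P" for x y
  proof -
    have "m x y = H x (cut (wfrec ?R (H x)) ?R y) y"
      using xy by (simp add: m_def wfrec[OF wf_finite_supset[OF assms]])
    also have "\<dots> = H x (m x) y"
    proof -
      have "(\<Sum>z\<in>{z\<in>P. z \<subseteq> x \<and> y \<subseteq> z \<and> z \<noteq> y}. cut (wfrec ?R (H x)) ?R y z)
         = (\<Sum>z\<in>{z\<in>P. z \<subseteq> x \<and> y \<subseteq> z \<and> z \<noteq> y}. m x z)"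
      proof (intro sum.cong refl)
        fix z assume "z \<in> {z\<in>P. z \<subseteq> x \<and> y \<subseteq> z \<and> z \<noteq> y}"
        then have z: "(z, y) \<in> ?R" "z \<in> P" using xy by auto
        show "cut (wfrec ?R (H x)) ?R y z = m x z" unfolding cut_apply[OF z(1)] using xy z by (simp add: m_def)
      qed
      then show ?thesis by (simp add: H_def)
    qed
    finally show ?thesis by (simp add: H_def)
  qed
  then have "mobius_spec P m" unfolding mobius_spec_def by (simp add: m_def)
  then show ?thesis by blast
qed

lemma mobius_spec_unique:
  assumes P: "finite P" and m: "mobius_spec P m" and m': "mobius_spec P m'"
  shows "m = m'"
proof (intro ext)
  fix x y
  have out: "u x y = 0" if "mobius_spec P u" "x \<notin> P \<or> y \<notin> P" for u x y
    using that unfolding mobius_spec_def by blast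
  have rec: "u x y = (if x = y then 1 else if y \<subseteq> x
    then - (\<Sum>z\<in>{z\<in>P. z \<subseteq> x \<and> y \<subseteq> z \<and> z \<noteq> y}. u x z) else 0)"
    if "mobius_spec P u" "x \<in> P" "y \<in> P" for u x y
    using that unfolding mobius_spec_def by blast
  show "m x y = m' x y"
  proof (cases "x \<in> P")
    case False
    then show ?thesis using out[OF m] out[OF m'] by metis
  next
    case x: True
    show ?thesis
      using wf_finite_supset[OF P]
    proof (induction y rule: wf_induct_rule)
      case (less y)
      show ?case
      proof (cases "y \<in> P")
        case False
        then show ?thesis using out[OF m] out[OF m'] by metis
      next
        case y: True
        have "(\<Sum>z\<in>{z\<in>P. z \<subseteq> x \<and> y \<subseteq> z \<and> z \<noteq> y}. m x z) = (\<Sum>z\<in>{z\<in>P. z \<subseteq> x \<and> y \<subseteq> z \<and> z \<noteq> y}. m' x z)"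
          by (intro sum.cong refl less.IH) (use y in auto)
        then show ?thesis unfolding rec[OF m x y] rec[OF m' x y] by (simp only:)
      qed
    qed
  qed
qed

lemma mobius_supset_rec:
  assumes P: "finite P" and xy: "x \<in> P" "y \<in> P"
  shows "mobius P (\<lambda>X Y. Y \<subseteq> X) x y = (if x = y then 1 else if y \<subseteq> x
    then - (\<Sum>z\<in>{z\<in>P. z \<subseteq> x \<and> y \<subseteq> z \<and> z \<noteq> y}. mobius P (\<lambda>X Y. Y \<subseteq> X) x z) else 0)"
proof -
  have eq: "mobius P (\<lambda>X Y. Y \<subseteq> X) = (THE m. mobius_spec P m)"
    by (simp add: mobius_def mobius_spec_def)
  obtain m where m: "mobius_spec P m" using mobius_spec_ex[OF P] by blast
  have "(THE m. mobius_spec P m) = m"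
    by (rule the_equality, rule m, erule mobius_spec_unique[OF P _ m])
  then have "mobius_spec P (mobius P (\<lambda>X Y. Y \<subseteq> X))" using m eq by simp
  then show ?thesis using xy unfolding mobius_spec_def by blast
qed

text \<open>The defining recursion with the term for \<open>Y\<close> moved to the other
  side.\<close>

lemma mobius_supset_sum:
  assumes P: "finite P" and V: "V \<in> P" "\<And>X. X \<in> P \<Longrightarrow> X \<subseteq> V" and Y: "Y \<in> P"
  shows "(\<Sum>X\<in>{X\<in>P. Y \<subseteq> X}. mobius P (\<lambda>X Y. Y \<subseteq> X) V X) = (if Y = V then 1 else 0)"
proof (cases "Y = V")
  case True
  then have "{X\<in>P. Y \<subseteq> X} = {V}" using V by blast
  then show ?thesis using True mobius_supset_rec[OF P V(1) V(1)] by simp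
next
  case False
  let ?Z = "{z\<in>P. z \<subseteq> V \<and> Y \<subseteq> z \<and> z \<noteq> Y}"
  have "{X\<in>P. Y \<subseteq> X} = insert Y ?Z" using V Y by blast
  then have "(\<Sum>X\<in>{X\<in>P. Y \<subseteq> X}. mobius P (\<lambda>X Y. Y \<subseteq> X) V X)
    = mobius P (\<lambda>X Y. Y \<subseteq> X) V Y + (\<Sum>X\<in>?Z. mobius P (\<lambda>X Y. Y \<subseteq> X) V X)" using P by simp
  also have "mobius P (\<lambda>X Y. Y \<subseteq> X) V Y = - (\<Sum>X\<in>?Z. mobius P (\<lambda>X Y. Y \<subseteq> X) V X)"
    using mobius_supset_rec[OF P V(1) Y] False V(2)[OF Y] by simp
  finally show ?thesis using False by simp
qed

lemma finite_int_poset: "finite A \<Longrightarrow> finite (int_poset V A)"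
  by (rule finite_subset[of _ "(\<lambda>B. V \<inter> \<Inter>B) ` Pow A"]) (auto simp: int_poset_def)

lemma int_poset_subset: "X \<in> int_poset V A \<Longrightarrow> X \<subseteq> V"
  by (auto simp: int_poset_def)

lemma top_in_int_poset: "V \<noteq> {} \<Longrightarrow> V \<in> int_poset V A"
  by (auto simp: int_poset_def intro!: exI[of _ "{}"])

lemma sol_real_Un: "sol_real (E \<union> F) = sol_real E \<inter> sol_real F"
  by (auto simp: sol_real_def)

lemma sol_mod_Un: "sol_mod q (E \<union> F) = sol_mod q E \<inter> sol_mod q F"
  by (auto simp: sol_mod_def)

lemma in_sol_real_iff: "sol_real E = {x. \<forall>e\<in>E. x \<in> sol_real {e}}"
  by (simp add: sol_real_def)

lemma in_sol_mod_iff: "x \<in> sol_mod q E' \<Longrightarrow> x \<in> sol_mod q E \<longleftrightarrow> (\<forall>e\<in>E. x \<in> sol_mod q {e})"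
  by (auto simp: sol_mod_def)

text \<open>A point \<open>x\<close> modulo \<open>q\<close> is sent to the real flat
  \<open>F x\<close> cut out by the equations it satisfies modulo \<open>q\<close>. Then
  \<open>q ^ dim X\<close> counts the points with \<open>F x \<subseteq> X\<close>. After exchanging
  the sums, the Moebius relation keeps only the points with \<open>F x = V\<close>, which satisfy no
  equation of \<open>Es\<close>.\<close>

theorem char_poly_eq_card_mod:
  fixes E0 Es :: "(('n::finite \<Rightarrow> int) \<times> int) set"
  assumes fin: "finite E0" "finite Es" and ne: "sol_real E0 \<noteq> {}"
    and proper: "\<And>e. e \<in> Es \<Longrightarrow> \<not> sol_real E0 \<subseteq> sol_real {e}"
  shows "\<exists>N>0. \<forall>q>1. coprime (int q) N \<longrightarrow>
    poly (char_poly (sol_real E0) ((\<lambda>e. sol_real E0 \<inter> sol_real {e}) ` Es)) (int q)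
      = int (card {x \<in> sol_mod q E0. \<forall>e\<in>Es. x \<notin> sol_mod q {e}})"
proof -
  let ?V = "sol_real E0"
  define A where "A = (\<lambda>e. ?V \<inter> sol_real {e}) ` Es"
  define P where "P = int_poset ?V A"
  define \<mu> where "\<mu> = mobius P (\<lambda>X Y. Y \<subseteq> X) ?V"
  have finA: "finite A" using fin by (simp add: A_def)
  have finP: "finite P" unfolding P_def by (rule finite_int_poset[OF finA])
  have VP: "?V \<in> P" unfolding P_def by (rule top_in_int_poset[OF ne])
  have PV: "X \<subseteq> ?V" if "X \<in> P" for X using that int_poset_subset unfolding P_def by blast
  have flat: "sol_real (E0 \<union> B) \<in> P" if "B \<subseteq> Es" "sol_real (E0 \<union> B) \<noteq> {}" for B
  proof -
    have "sol_real (E0 \<union> B) = ?V \<inter> \<Inter>((\<lambda>e. ?V \<inter> sol_real {e}) ` B)"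
      by (auto simp: sol_real_def)
    then show ?thesis using that unfolding P_def int_poset_def A_def
      by (intro CollectI conjI exI[of _ "(\<lambda>e. ?V \<inter> sol_real {e}) ` B"]) auto
  qed
  define Ex where "Ex X = {e \<in> Es. X \<subseteq> sol_real {e}}" for X
  have XEx: "X = sol_real (E0 \<union> Ex X)" "X \<noteq> {}" if X: "X \<in> P" for X
  proof -
    obtain B where B: "B \<subseteq> A" "X = ?V \<inter> \<Inter>B" and ne: "X \<noteq> {}" using X by (auto simp: P_def int_poset_def)
    then show "X \<noteq> {}" by simp
    show "X = sol_real (E0 \<union> Ex X)"
    proof
      show "X \<subseteq> sol_real (E0 \<union> Ex X)"
        unfolding sol_real_Un using PV[OF X] in_sol_real_iff[of "Ex X"] by (auto simp: Ex_def)
      show "sol_real (E0 \<union> Ex X) \<subseteq> X"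
      proof
        fix x assume x: "x \<in> sol_real (E0 \<union> Ex X)"
        then have xV: "x \<in> ?V" by (simp add: sol_real_Un)
        have "x \<in> H" if H: "H \<in> B" for H
        proof -
          obtain e where e: "e \<in> Es" "H = ?V \<inter> sol_real {e}" using H B(1) by (auto simp: A_def)
          have "X \<subseteq> H" using B(2) H by blast
          then have "e \<in> Ex X" using e by (auto simp: Ex_def)
          then have "x \<in> sol_real {e}" using x by (auto simp: sol_real_def)
          then show ?thesis using e xV by blast
        qed
        then show "x \<in> X" using B(2) xV by blast
      qed
    qed
  qed
  have "\<forall>E\<in>Pow (E0 \<union> Es). \<exists>N. N > 0 \<and> (\<forall>q>1. coprime (int q) N \<longrightarrow>
    (sol_real E = {} \<longrightarrow> sol_mod q E = {}) \<and>
    (sol_real E \<noteq> {} \<longrightarrow> card (sol_mod q E) = q ^ nat (aff_dim (sol_real E))))"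
    using card_sol_mod_eq_power_aff_dim fin by (metis PowD finite_UnI finite_subset)
  then obtain Nf where Nf: "\<And>E. E \<subseteq> E0 \<union> Es \<Longrightarrow> Nf E > 0"
    "\<And>E q. E \<subseteq> E0 \<union> Es \<Longrightarrow> q > 1 \<Longrightarrow> coprime (int q) (Nf E) \<Longrightarrow>
    (sol_real E = {} \<longrightarrow> sol_mod q E = {}) \<and>
    (sol_real E \<noteq> {} \<longrightarrow> card (sol_mod q E) = q ^ nat (aff_dim (sol_real E)))"
    by (metis (no_types, lifting) Pow_iff bchoice)
  \<comment> \<open>One number that works for all subsystems simultaneously.\<close>
  define N where "N = (\<Prod>E\<in>Pow (E0 \<union> Es). Nf E)"
  have N0: "N > 0" unfolding N_def using Nf(1) by (intro prod_pos) auto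
  have "poly (char_poly ?V A) (int q) = int (card {x \<in> sol_mod q E0. \<forall>e\<in>Es. x \<notin> sol_mod q {e}})"
    if q: "q > 1" "coprime (int q) N" for q
  proof -
    have cE: "coprime (int q) (Nf E)" if "E \<subseteq> E0 \<union> Es" for E
    proof (rule coprime_divisors[OF dvd_refl _ q(2)])
      show "Nf E dvd N" unfolding N_def by (rule dvd_prodI) (use that fin in auto)
    qed
    have cnt: "card (sol_mod q E) = q ^ nat (aff_dim (sol_real E))" if "E \<subseteq> E0 \<union> Es" "sol_real E \<noteq> {}" for E
      using Nf(2)[OF that(1) q(1) cE[OF that(1)]] that(2) by blast
    have emp: "sol_mod q E = {}" if "E \<subseteq> E0 \<union> Es" "sol_real E = {}" for E
      using Nf(2)[OF that(1) q(1) cE[OF that(1)]] that(2) by blast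
    let ?M = "sol_mod q E0"
    have finM: "finite ?M" by (rule finite_sol_mod)
    define B where "B x = {e \<in> Es. x \<in> sol_mod q {e}}" for x
    define F where "F x = sol_real (E0 \<union> B x)" for x
    have xB: "x \<in> sol_mod q (E0 \<union> B x)" if "x \<in> ?M" for x
      using that in_sol_mod_iff[OF that, of "B x"] by (simp add: sol_mod_Un B_def)
    have FP: "F x \<in> P" if x: "x \<in> ?M" for x
      unfolding F_def
    proof (rule flat)
      show "B x \<subseteq> Es" by (auto simp: B_def)
      \<comment> \<open>\<open>x\<close> itself solves this system modulo \<open>q\<close>, so the
        system cannot be inconsistent over the reals.\<close>
      show "sol_real (E0 \<union> B x) \<noteq> {}"
        using emp[of "E0 \<union> B x"] xB[OF x] by (auto simp: B_def)
    qed
    have key: "x \<in> sol_mod q (E0 \<union> Ex X) \<longleftrightarrow> F x \<subseteq> X" if x: "x \<in> ?M" and X: "X \<in> P" for x X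
    proof
      assume "x \<in> sol_mod q (E0 \<union> Ex X)"
      then have "Ex X \<subseteq> B x" using in_sol_mod_iff[OF x, of "Ex X"] by (auto simp: sol_mod_Un B_def Ex_def)
      then have "F x \<subseteq> sol_real (E0 \<union> Ex X)" unfolding F_def by (auto simp: sol_real_def)
      then show "F x \<subseteq> X" using XEx[OF X] by simp
    next
      assume FX: "F x \<subseteq> X"
      \<comment> \<open>Adding \<open>e\<close> to the equations valid at \<open>x\<close> leaves
        the real solutions unchanged, hence also the number of solutions modulo \<open>q\<close>.
        The smaller solution set is then the whole one, and it contains \<open>x\<close>.\<close>
      have "x \<in> sol_mod q {e}" if e: "e \<in> Ex X" for e
      proof -
        have eEs: "e \<in> Es" "X \<subseteq> sol_real {e}" using e by (auto simp: Ex_def)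
        have sub: "E0 \<union> B x \<union> {e} \<subseteq> E0 \<union> Es" "E0 \<union> B x \<subseteq> E0 \<union> Es" using eEs by (auto simp: B_def)
        have same: "sol_real (E0 \<union> B x \<union> {e}) = sol_real (E0 \<union> B x)"
          using FX eEs(2) unfolding sol_real_Un[of "E0 \<union> B x"] F_def[symmetric] by blast
        have nz: "sol_real (E0 \<union> B x) \<noteq> {}" using XEx(2)[OF FP[OF x]] by (simp add: F_def)
        have "card (sol_mod q (E0 \<union> B x \<union> {e})) = card (sol_mod q (E0 \<union> B x))"
          using cnt[OF sub(1)] cnt[OF sub(2)] same nz by simp
        moreover have "sol_mod q (E0 \<union> B x \<union> {e}) \<subseteq> sol_mod q (E0 \<union> B x)" by (auto simp: sol_mod_def)
        ultimately have "sol_mod q (E0 \<union> B x \<union> {e}) = sol_mod q (E0 \<union> B x)"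
          using finite_sol_mod by (intro card_subset_eq) auto
        then have "x \<in> sol_mod q (E0 \<union> B x \<union> {e})" using xB[OF x] by blast
        then show ?thesis by (simp add: sol_mod_def)
      qed
      then show "x \<in> sol_mod q (E0 \<union> Ex X)" using x in_sol_mod_iff[OF x, of "Ex X"] by (simp add: sol_mod_Un)
    qed
    have FV: "F x = ?V \<longleftrightarrow> (\<forall>e\<in>Es. x \<notin> sol_mod q {e})" for x
    proof
      assume FV: "F x = ?V"
      show "\<forall>e\<in>Es. x \<notin> sol_mod q {e}"
      proof (intro ballI notI)
        fix e assume e: "e \<in> Es" "x \<in> sol_mod q {e}"
        then have "e \<in> B x" by (simp add: B_def)
        then have "F x \<subseteq> sol_real {e}" by (auto simp: F_def sol_real_def)
        then show False using proper[OF e(1)] FV by simp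
      qed
    next
      assume "\<forall>e\<in>Es. x \<notin> sol_mod q {e}"
      then have "B x = {}" by (auto simp: B_def)
      then show "F x = ?V" by (simp add: F_def)
    qed
    have "poly (char_poly ?V A) (int q) = (\<Sum>X\<in>P. \<mu> X * int q ^ nat (aff_dim X))"
      by (simp add: char_poly_def P_def \<mu>_def poly_sum poly_monom)
    also have "\<dots> = (\<Sum>X\<in>P. \<mu> X * int (card (sol_mod q (E0 \<union> Ex X))))"
    proof (intro sum.cong refl)
      fix X assume X: "X \<in> P"
      have "E0 \<union> Ex X \<subseteq> E0 \<union> Es" by (auto simp: Ex_def)
      then have "card (sol_mod q (E0 \<union> Ex X)) = q ^ nat (aff_dim X)"
        using cnt[of "E0 \<union> Ex X"] XEx[OF X] by simp
      then show "\<mu> X * int q ^ nat (aff_dim X) = \<mu> X * int (card (sol_mod q (E0 \<union> Ex X)))" by simp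
    qed
    also have "\<dots> = (\<Sum>X\<in>P. \<Sum>x\<in>?M. if F x \<subseteq> X then \<mu> X else 0)"
    proof (intro sum.cong refl)
      fix X assume X: "X \<in> P"
      have "sol_mod q (E0 \<union> Ex X) = {x \<in> ?M. F x \<subseteq> X}" using key[OF _ X] by (auto simp: sol_mod_Un)
      moreover have "(\<Sum>x\<in>?M. if F x \<subseteq> X then \<mu> X else 0) = (\<Sum>x\<in>{x \<in> ?M. F x \<subseteq> X}. \<mu> X)"
        by (rule sum.inter_filter[OF finM, symmetric])
      ultimately show "\<mu> X * int (card (sol_mod q (E0 \<union> Ex X))) = (\<Sum>x\<in>?M. if F x \<subseteq> X then \<mu> X else 0)"
        by (simp add: mult.commute)
    qed
    also have "\<dots> = (\<Sum>x\<in>?M. \<Sum>X\<in>P. if F x \<subseteq> X then \<mu> X else 0)" by (rule sum.swap)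
    also have "\<dots> = (\<Sum>x\<in>?M. if F x = ?V then 1 else 0)"
    proof (intro sum.cong refl)
      fix x assume x: "x \<in> ?M"
      have "(\<Sum>X\<in>P. if F x \<subseteq> X then \<mu> X else 0) = (\<Sum>X\<in>{X \<in> P. F x \<subseteq> X}. \<mu> X)"
        by (rule sum.inter_filter[OF finP, symmetric])
      also have "\<dots> = (if F x = ?V then 1 else 0)"
        unfolding \<mu>_def by (rule mobius_supset_sum[OF finP VP PV FP[OF x]])
      finally show "(\<Sum>X\<in>P. if F x \<subseteq> X then \<mu> X else 0) = (if F x = ?V then 1 else 0)" .
    qed
    also have "\<dots> = int (card {x \<in> ?M. F x = ?V})"
      using finM by (simp add: sum.inter_filter[symmetric])
    finally show ?thesis unfolding FV .
  qed
  then show ?thesis using N0 unfolding A_def by blast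
qed

text \<open>\<open>V\<close> is the only flat of dimension \<open>l\<close>. The flats of dimension
  \<open>l - 1\<close> are the hyperplanes themselves, and their Moebius value is \<open>- 1\<close>
  because nothing lies strictly between them and \<open>V\<close>.\<close>

lemma char_poly_leading_coeffs:
  fixes V :: "'a::euclidean_space set"
  assumes V: "affine V" "V \<noteq> {}" "aff_dim V = int l" "l \<ge> 1" and A: "finite A"
    and H: "\<And>H. H \<in> A \<Longrightarrow> affine H \<and> H \<noteq> {} \<and> H \<subseteq> V \<and> aff_dim H = int l - 1"
  shows "coeff (char_poly V A) l = 1" "coeff (char_poly V A) (l - 1) = - int (card A)"
    "degree (char_poly V A) \<le> l"
proof -
  define P where "P = int_poset V A"
  define \<mu> where "\<mu> = mobius P (\<lambda>X Y. Y \<subseteq> X) V"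
  have finP: "finite P" unfolding P_def by (rule finite_int_poset[OF A])
  have VP: "V \<in> P" unfolding P_def by (rule top_in_int_poset[OF V(2)])
  have PV: "X \<subseteq> V" if "X \<in> P" for X using that int_poset_subset unfolding P_def by blast
  have AP: "H \<in> P" if h: "H \<in> A" for H
    unfolding P_def int_poset_def using H[OF h] h by (intro CollectI conjI exI[of _ "{H}"]) auto
  have Paff: "affine X \<and> X \<noteq> {}" if "X \<in> P" for X
  proof -
    obtain B where B: "B \<subseteq> A" "X = V \<inter> \<Inter>B" "X \<noteq> {}" using \<open>X \<in> P\<close> by (auto simp: P_def int_poset_def)
    have "affine (\<Inter>B)" using B(1) H by (intro affine_Inter) blast
    then show ?thesis using B V(1) by blast
  qed
  have PA: "\<exists>H\<in>A. X \<subseteq> H" if "X \<in> P" "X \<noteq> V" for X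
  proof -
    obtain B where B: "B \<subseteq> A" "X = V \<inter> \<Inter>B" using \<open>X \<in> P\<close> by (auto simp: P_def int_poset_def)
    then have "B \<noteq> {}" using that(2) by auto
    then show ?thesis using B by blast
  qed
  have dimle: "aff_dim X \<le> int l - 1" if "X \<in> P" "X \<noteq> V" for X
    using PA[OF that] H aff_dim_subset by metis
  have dimA: "X \<in> A" if X: "X \<in> P" "X \<noteq> V" "aff_dim X = int l - 1" for X
  proof -
    obtain h where h: "h \<in> A" "X \<subseteq> h" using PA[OF X(1,2)] by blast
    have "X = h" using affine_dim_equal[of X h] Paff[OF X(1)] H[OF h(1)] h(2) X(3) by simp
    then show ?thesis using h by simp
  qed
  have dim0: "aff_dim X \<ge> 0" if "X \<in> P" for X
  proof -
    have "aff_dim X \<noteq> - 1" using Paff[OF that] aff_dim_empty by blast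
    then show ?thesis using aff_dim_geq[of X] by linarith
  qed
  have VA: "V \<notin> A" using H V(3) by force
  have \<mu>V: "\<mu> V = 1" unfolding \<mu>_def using mobius_supset_rec[OF finP VP VP] by simp
  have \<mu>H: "\<mu> h = - 1" if h: "h \<in> A" for h
  proof -
    have "{X \<in> P. h \<subseteq> X} = {V, h}"
    proof
      show "{V, h} \<subseteq> {X \<in> P. h \<subseteq> X}" using VP AP[OF h] H[OF h] by blast
      show "{X \<in> P. h \<subseteq> X} \<subseteq> {V, h}"
      proof
        fix X assume X: "X \<in> {X \<in> P. h \<subseteq> X}"
        show "X \<in> {V, h}"
        proof (cases "X = V")
          case False
          have "aff_dim X = int l - 1"
            using dimle[of X] X False aff_dim_subset[of h X] H[OF h] by auto
          then have "h = X" using affine_dim_equal[of h X] H[OF h] Paff[of X] X by simp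
          then show ?thesis by simp
        qed simp
      qed
    qed
    moreover have "h \<noteq> V" using h VA by blast
    moreover have "(\<Sum>X\<in>{X \<in> P. h \<subseteq> X}. \<mu> X) = (if h = V then 1 else 0)"
      unfolding \<mu>_def by (rule mobius_supset_sum[OF finP VP PV AP[OF h]])
    ultimately have "\<mu> V + \<mu> h = 0" by simp
    then show ?thesis using \<mu>V by simp
  qed
  have co: "coeff (char_poly V A) k = (\<Sum>X\<in>{X \<in> P. nat (aff_dim X) = k}. \<mu> X)" for k
  proof -
    have "coeff (char_poly V A) k = (\<Sum>X\<in>P. if nat (aff_dim X) = k then \<mu> X else 0)"
      by (simp add: char_poly_def P_def[symmetric] \<mu>_def[symmetric] coeff_sum)
    then show ?thesis using finP by (simp add: sum.inter_filter)
  qed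
  have "nat (aff_dim X) = l \<longleftrightarrow> X = V" if "X \<in> P" for X
    using dimle[OF that] V(3,4) by (cases "X = V") auto
  then have "{X \<in> P. nat (aff_dim X) = l} = {V}" using VP by blast
  then show "coeff (char_poly V A) l = 1" unfolding co using \<mu>V by simp
  have "{X \<in> P. nat (aff_dim X) = l - 1} = A"
  proof
    show "A \<subseteq> {X \<in> P. nat (aff_dim X) = l - 1}" using AP H V(4) by auto
    show "{X \<in> P. nat (aff_dim X) = l - 1} \<subseteq> A"
    proof
      fix X assume X: "X \<in> {X \<in> P. nat (aff_dim X) = l - 1}"
      then have d: "aff_dim X = int l - 1" using dim0[of X] V(4) by auto
      then have "X \<noteq> V" using V(3) by auto
      then show "X \<in> A" using dimA[of X] X d by blast
    qed
  qed
  then show "coeff (char_poly V A) (l - 1) = - int (card A)" unfolding co using \<mu>H by simp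
  show "degree (char_poly V A) \<le> l"
  proof (rule degree_le, intro allI impI)
    fix k assume k: "l < k"
    have "nat (aff_dim X) \<noteq> k" if "X \<in> P" for X
      using dimle[OF that] V(3) k by (cases "X = V") auto
    then have e: "{X \<in> P. nat (aff_dim X) = k} = {}" by blast
    show "coeff (char_poly V A) k = 0" unfolding co e by simp
  qed
qed

section \<open>Root systems of classical type\<close>

definition unit_fun :: "'n \<Rightarrow> 'n \<Rightarrow> int" where
  "unit_fun i k = (if k = i then 1 else 0)"

definition simple_roots :: "('n \<Rightarrow> int) set" where
  "simple_roots = {unit_fun i | i. True}"

definition double_roots :: "('n \<Rightarrow> int) set" where
  "double_roots = {(\<lambda>k. 2 * unit_fun i k) | i. True}"

definition diff_roots :: "('n::linorder \<Rightarrow> int) set" where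
  "diff_roots = {(\<lambda>k. unit_fun i k - unit_fun j k) | i j. i < j}"

definition sum_roots :: "('n::linorder \<Rightarrow> int) set" where
  "sum_roots = {(\<lambda>k. unit_fun i k + unit_fun j k) | i j. i < j}"

text \<open>Integer coefficients, so that the same data define equations over the reals and modulo
  \<open>q\<close>.\<close>

definition iroots :: "root_type \<Rightarrow> ('n::{finite,linorder} \<Rightarrow> int) set" where
  "iroots t = (case t of TA \<Rightarrow> diff_roots | TB \<Rightarrow> simple_roots \<union> diff_roots \<union> sum_roots
     | TC \<Rightarrow> double_roots \<union> diff_roots \<union> sum_roots | TD \<Rightarrow> diff_roots \<union> sum_roots
     | TBC \<Rightarrow> simple_roots \<union> double_roots \<union> diff_roots \<union> sum_roots)"

definition root_vec :: "('n::finite \<Rightarrow> int) \<Rightarrow> real ^ 'n" where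
  "root_vec c = (\<chi> i. of_int (c i))"

lemma root_vec_simps:
  "root_vec (unit_fun i) = axis i 1"
  "root_vec (\<lambda>k. 2 * unit_fun i k) = 2 *\<^sub>R axis i 1"
  "root_vec (\<lambda>k. unit_fun i k - unit_fun j k) = axis i 1 - axis j 1"
  "root_vec (\<lambda>k. unit_fun i k + unit_fun j k) = axis i 1 + axis j 1"
  by (auto simp: root_vec_def vec_eq_iff axis_def unit_fun_def)

lemma image_setcompr1: "f ` {g i | i. P i} = {f (g i) | i. P i}" by blast

lemma image_setcompr2: "f ` {g i j | i j. P i j} = {f (g i j) | i j. P i j}" by blast

lemma root_vec_image:
  "root_vec ` simple_roots = {axis i 1 | i. True}"
  "root_vec ` double_roots = {2 *\<^sub>R axis i 1 | i. True}"
  "root_vec ` diff_roots = {axis i 1 - axis j 1 | i j. i < j}"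
  "root_vec ` sum_roots = {axis i 1 + axis j 1 | i j. i < j}"
  unfolding simple_roots_def double_roots_def diff_roots_def sum_roots_def
    image_setcompr1 image_setcompr2 root_vec_simps by (rule refl)+

lemma pos_roots_eq: "pos_roots t = root_vec ` iroots t"
  by (cases t) (simp_all add: pos_roots_def iroots_def image_Un root_vec_image)

lemma finite_iroots: "finite (iroots t :: ('n::{finite,linorder} \<Rightarrow> int) set)"
proof -
  have "iroots t \<subseteq> (\<Pi>\<^sub>E i\<in>(UNIV :: 'n set). {-2..2})"
    by (cases t) (auto simp: iroots_def simple_roots_def double_roots_def diff_roots_def sum_roots_def unit_fun_def PiE_iff)
  then show ?thesis by (rule finite_subset) (auto intro: finite_PiE)
qed

definition root_forms :: "root_type \<Rightarrow> nat \<Rightarrow> nat \<Rightarrow> (('n::{finite,linorder} \<Rightarrow> int) \<times> int) set" where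
  "root_forms t a b = iroots t \<times> {1 - int a..int b}"

definition ambient_forms :: "root_type \<Rightarrow> (('n::{finite,linorder} \<Rightarrow> int) \<times> int) set" where
  "ambient_forms t = (if t = TA then {(\<lambda>_. 1, 0)} else {})"

lemma ambient_eq: "ambient t = sol_real (ambient_forms t)"
  by (simp add: ambient_def ambient_forms_def sol_real_def aff_def)

lemma sol_real_form: "sol_real {(c, k)} = {x. root_vec c \<bullet> x = of_int k}"
  by (simp add: sol_real_def aff_def root_vec_def inner_vec_def)

lemma hat_arr_eq:
  "hat_arr (- int a + 1) (int b) t = (\<lambda>e. sol_real (ambient_forms t) \<inter> sol_real {e}) ` root_forms t a b"
proof -
  have "hat_arr (- int a + 1) (int b) t
    = {sol_real (ambient_forms t) \<inter> sol_real {(c, k)} | c k. c \<in> iroots t \<and> - int a + 1 \<le> k \<and> k \<le> int b}"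
    unfolding hat_arr_def pos_roots_eq ambient_eq sol_real_form by blast
  also have "\<dots> = (\<lambda>e. sol_real (ambient_forms t) \<inter> sol_real {e}) `
      {(c, k) | c k. c \<in> iroots t \<and> - int a + 1 \<le> k \<and> k \<le> int b}"
    by (rule image_setcompr2[symmetric])
  also have "{(c, k) | c k. c \<in> iroots t \<and> - int a + 1 \<le> k \<and> k \<le> int b} = root_forms t a b"
    by (auto simp: root_forms_def)
  finally show ?thesis .
qed

lemma root_vec_nonzero:
  assumes "c \<in> iroots t"
  shows "root_vec c \<noteq> 0"
proof -
  have "\<exists>k. c k \<noteq> 0"
  proof -
    have "c \<in> simple_roots \<union> double_roots \<union> diff_roots \<union> sum_roots"
      using assms by (cases t) (auto simp: iroots_def)
    then consider i where "c = unit_fun i" | i where "c = (\<lambda>k. 2 * unit_fun i k)"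
      | i j where "i < j" "c = (\<lambda>k. unit_fun i k - unit_fun j k)" | i j where "i < j" "c = (\<lambda>k. unit_fun i k + unit_fun j k)"
      unfolding simple_roots_def double_roots_def diff_roots_def sum_roots_def by blast
    then show ?thesis
    proof cases
      case (1 i)
      then show ?thesis by (intro exI[of _ i]) (simp add: unit_fun_def)
    next
      case (2 i)
      then show ?thesis by (intro exI[of _ i]) (simp add: unit_fun_def)
    next
      case (3 i j)
      then show ?thesis by (intro exI[of _ i]) (simp add: unit_fun_def)
    next
      case (4 i j)
      then show ?thesis by (intro exI[of _ i]) (simp add: unit_fun_def)
    qed
  qed
  then obtain k where "root_vec c $ k \<noteq> 0" by (auto simp: root_vec_def)
  then show ?thesis by auto
qed

lemma root_vec_in_ambient:
  assumes "c \<in> iroots t"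
  shows "s *\<^sub>R root_vec c \<in> ambient t"
proof (cases "t = TA")
  case True
  then obtain i j where "root_vec c = axis i 1 - axis j 1"
    using assms root_vec_simps(3) by (auto simp: iroots_def diff_roots_def)
  then have "(\<Sum>k\<in>UNIV. (s *\<^sub>R root_vec c) $ k) = 0"
    by (simp add: sum_distrib_left[symmetric] sum_subtractf axis_def)
  then show ?thesis using True by (simp add: ambient_def)
qed (simp add: ambient_def)

text \<open>A multiple of the root itself lies in the ambient space and takes any prescribed
  value.\<close>

lemma hyperplane_nonempty:
  assumes "c \<in> iroots t"
  shows "\<exists>x\<in>ambient t. root_vec c \<bullet> x = r"
proof
  let ?x = "(r / (root_vec c \<bullet> root_vec c)) *\<^sub>R root_vec c"
  show "?x \<in> ambient t" by (rule root_vec_in_ambient[OF assms])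
  show "root_vec c \<bullet> ?x = r" using root_vec_nonzero[OF assms] by simp
qed

lemma affine_ambient: "affine (ambient t :: (real ^ 'n::{finite,linorder}) set)"
proof -
  have "{x :: (real, 'n) vec. (\<Sum>i\<in>UNIV. x $ i) = 0} = {x. (\<chi> i. 1) \<bullet> x = 0}" by (simp add: inner_vec_def)
  then show ?thesis using affine_hyperplane[of "(\<chi> i. 1) :: (real, 'n) vec" 0] by (simp add: ambient_def)
qed

lemma aff_dim_ambient:
  assumes "CARD('n::{finite,linorder}) \<ge> 1"
  shows "aff_dim (ambient t :: (real ^ 'n::{finite,linorder}) set) = int (ambient_dim t TYPE('n::{finite,linorder}))"
proof (cases "t = TA")
  case True
  have "{x :: (real, 'n) vec. (\<Sum>i\<in>UNIV. x $ i) = 0} = {x. (\<chi> i. 1) \<bullet> x = 0}" by (simp add: inner_vec_def)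
  moreover have "((\<chi> i. 1) :: (real, 'n) vec) \<noteq> 0" by (simp add: vec_eq_iff)
  ultimately have "aff_dim (ambient t :: ((real, 'n) vec) set) = int CARD('n) - 1"
    using True by (simp add: ambient_def)
  then show ?thesis using True assms by (simp add: ambient_dim_def)
next
  case False
  then show ?thesis by (simp add: ambient_def ambient_dim_def)
qed

lemma hyperplane_properties:
  assumes n: "CARD('n::{finite,linorder}) \<ge> 1" and e: "e \<in> (root_forms t a b :: (('n::{finite,linorder} \<Rightarrow> int) \<times> int) set)"
  shows "\<not> ambient t \<subseteq> sol_real {e}"
    "affine (ambient t \<inter> sol_real {e})" "ambient t \<inter> sol_real {e} \<noteq> {}"
    "aff_dim (ambient t \<inter> sol_real {e}) = int (ambient_dim t TYPE('n::{finite,linorder})) - 1"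
proof -
  obtain c k where ck: "e = (c, k)" "c \<in> iroots t" using e by (auto simp: root_forms_def)
  obtain x where x: "x \<in> ambient t" "root_vec c \<bullet> x = of_int k + 1" using hyperplane_nonempty[OF ck(2)] by blast
  then show n1: "\<not> ambient t \<subseteq> sol_real {e}" unfolding ck sol_real_form by auto
  obtain y where y: "y \<in> ambient t" "root_vec c \<bullet> y = of_int k" using hyperplane_nonempty[OF ck(2)] by blast
  then show n2: "ambient t \<inter> sol_real {e} \<noteq> {}" unfolding ck sol_real_form by auto
  show "affine (ambient t \<inter> sol_real {e})"
    unfolding ck sol_real_form by (intro affine_Int affine_ambient affine_hyperplane)
  show "aff_dim (ambient t \<inter> sol_real {e}) = int (ambient_dim t TYPE('n)) - 1"
    using n1 n2 unfolding ck sol_real_form aff_dim_affine_Int_hyperplane[OF affine_ambient] aff_dim_ambient[OF n]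
    by simp
qed

section \<open>From root values modulo \<open>q\<close> to labels on a circle\<close>

definition nonres :: "nat \<Rightarrow> nat \<Rightarrow> int \<Rightarrow> int \<Rightarrow> bool" where
  "nonres a b q y \<longleftrightarrow> (\<forall>k\<in>{1 - int a..int b}. \<not> q dvd y - k)"

lemma nonres_cong: "y mod q = y' mod q \<Longrightarrow> nonres a b q y \<longleftrightarrow> nonres a b q y'"
  unfolding nonres_def mod_eq_dvd_iff[symmetric] by metis

definition avoiding :: "root_type \<Rightarrow> nat \<Rightarrow> nat \<Rightarrow> nat \<Rightarrow> ('n::{finite,linorder} \<Rightarrow> int) set" where
  "avoiding t a b q = {x \<in> sol_mod q (ambient_forms t). \<forall>e\<in>root_forms t a b. x \<notin> sol_mod q {e}}"

lemma sum_unit_fun: "(\<Sum>k\<in>UNIV. unit_fun i k * x k) = x (i :: 'n::finite)"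
proof -
  have "(\<Sum>k\<in>UNIV. unit_fun i k * x k) = (\<Sum>k\<in>UNIV. if k = i then x k else 0)"
    by (intro sum.cong) (auto simp: unit_fun_def)
  then show ?thesis by simp
qed

lemma avoiding_eq:
  "avoiding t a b q = {x. (\<forall>i. x i \<in> {0..<int q}) \<and> (t = TA \<longrightarrow> int q dvd (\<Sum>i\<in>UNIV. x i)) \<and>
     (\<forall>c\<in>iroots t. nonres a b (int q) (\<Sum>k\<in>UNIV. c k * x k))}"
  by (auto simp: avoiding_def sol_mod_def ambient_forms_def root_forms_def nonres_def)

lemma ball_roots:
  fixes x :: "'n::{finite,linorder} \<Rightarrow> int"
  shows "(\<forall>c\<in>simple_roots. Q (\<Sum>k\<in>UNIV. c k * x k)) \<longleftrightarrow> (\<forall>i. Q (x i))"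
    "(\<forall>c\<in>double_roots. Q (\<Sum>k\<in>UNIV. c k * x k)) \<longleftrightarrow> (\<forall>i. Q (2 * x i))"
    "(\<forall>c\<in>diff_roots. Q (\<Sum>k\<in>UNIV. c k * x k)) \<longleftrightarrow> (\<forall>i j. i < j \<longrightarrow> Q (x i - x j))"
    "(\<forall>c\<in>sum_roots. Q (\<Sum>k\<in>UNIV. c k * x k)) \<longleftrightarrow> (\<forall>i j. i < j \<longrightarrow> Q (x i + x j))"
proof -
  have "(\<Sum>k\<in>UNIV. (2 * unit_fun i k) * x k) = 2 * x i"
    "(\<Sum>k\<in>UNIV. (unit_fun i k - unit_fun j k) * x k) = x i - x j"
    "(\<Sum>k\<in>UNIV. (unit_fun i k + unit_fun j k) * x k) = x i + x j" for i j
    using sum_unit_fun[of i x] sum_unit_fun[of j x]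
    by (simp_all add: mult.assoc sum_distrib_left[symmetric] left_diff_distrib distrib_right sum_subtractf sum.distrib)
  note s = this sum_unit_fun[of _ x]
  show "(\<forall>c\<in>simple_roots. Q (\<Sum>k\<in>UNIV. c k * x k)) \<longleftrightarrow> (\<forall>i. Q (x i))"
    unfolding simple_roots_def Ball_def mem_Collect_eq using s by metis
  show "(\<forall>c\<in>double_roots. Q (\<Sum>k\<in>UNIV. c k * x k)) \<longleftrightarrow> (\<forall>i. Q (2 * x i))"
    unfolding double_roots_def Ball_def mem_Collect_eq using s(1) by fastforce
  show "(\<forall>c\<in>diff_roots. Q (\<Sum>k\<in>UNIV. c k * x k)) \<longleftrightarrow> (\<forall>i j. i < j \<longrightarrow> Q (x i - x j))"
    unfolding diff_roots_def Ball_def mem_Collect_eq using s(2) by fastforce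
  show "(\<forall>c\<in>sum_roots. Q (\<Sum>k\<in>UNIV. c k * x k)) \<longleftrightarrow> (\<forall>i j. i < j \<longrightarrow> Q (x i + x j))"
    unfolding sum_roots_def Ball_def mem_Collect_eq using s(3) by fastforce
qed

text \<open>For \<open>u < v\<close>, \<open>u\<close> may come first iff
  \<open>x - y \<le> - a\<close>, and \<open>v\<close> may come first iff
  \<open>x - y \<ge> a + m = b + 1\<close>. What remains is exactly the interval from
  \<open>1 - a\<close> to \<open>b\<close>.\<close>

lemma comparable_iff_nonres:
  assumes m: "m = b + 1 - a" "a \<le> b" and uv: "u < v"
  shows "(\<forall>k. comparable a m u x v (y + k * q)) \<longleftrightarrow> nonres a b q (x - y)"
proof -
  have mi: "int m = int b + 1 - int a" using m by auto
  have c: "comparable a m u x v z \<longleftrightarrow> x - z \<notin> {1 - int a..int b}" for z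
    using uv mi by (auto simp: ok_def)
  show ?thesis
  proof
    assume *: "\<forall>k. comparable a m u x v (y + k * q)"
    show "nonres a b q (x - y)"
      unfolding nonres_def
    proof (intro ballI notI)
      fix k assume k: "k \<in> {1 - int a..int b}" "q dvd x - y - k"
      then obtain j where "x - y - k = q * j" by blast
      then have "x - (y + j * q) = k" by (simp add: algebra_simps)
      then show False using *[rule_format, of j] k(1) unfolding c by simp
    qed
  next
    assume *: "nonres a b q (x - y)"
    show "\<forall>k. comparable a m u x v (y + k * q)"
      unfolding c
    proof (intro allI notI)
      fix k assume k: "x - (y + k * q) \<in> {1 - int a..int b}"
      have "q dvd x - y - (x - (y + k * q))" by simp
      then show False using * k unfolding nonres_def by blast
    qed
  qed
qed

lemma circ_valid_iff_nonres:
  assumes m: "m = b + 1 - a" "a \<le> b"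
  shows "circ_valid full a m q L p \<longleftrightarrow>
    (\<forall>u\<in>L. \<forall>v\<in>L. u < v \<longrightarrow> (u = - v \<longrightarrow> full) \<longrightarrow> nonres a b q (p u - p v))"
proof
  assume "circ_valid full a m q L p"
  then show "\<forall>u\<in>L. \<forall>v\<in>L. u < v \<longrightarrow> (u = - v \<longrightarrow> full) \<longrightarrow> nonres a b q (p u - p v)"
    unfolding circ_valid_def using comparable_iff_nonres[OF m] by (metis less_irrefl)
next
  assume *: "\<forall>u\<in>L. \<forall>v\<in>L. u < v \<longrightarrow> (u = - v \<longrightarrow> full) \<longrightarrow> nonres a b q (p u - p v)"
  show "circ_valid full a m q L p"
    unfolding circ_valid_def
  proof (intro ballI impI allI)
    fix u v k assume uv: "u \<in> L" "v \<in> L" "u \<noteq> v" "u = - v \<longrightarrow> full"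
    consider "u < v" | "v < u" using uv(3) by linarith
    then show "comparable a m u (p u) v (p v + k * q)"
    proof cases
      case 1
      then have "nonres a b q (p u - p v)" using * uv by blast
      then show ?thesis using comparable_iff_nonres[OF m 1] by blast
    next
      case 2
      have "v = - u \<longrightarrow> full" using uv(4) by auto
      then have "nonres a b q (p v - p u)" using * uv(1,2) 2 by blast
      then have "comparable a m v (p v) u (p u + k * q)" for k using comparable_iff_nonres[OF m 2] by blast
      then show ?thesis by (rule comparable_all_swap)
    qed
  qed
qed

definition rank :: "'n::{finite,linorder} \<Rightarrow> int" where
  "rank i = int (card {j. j \<le> i})"

lemma rank_mono: "i < j \<Longrightarrow> rank i < rank j"
proof -
  assume "i < j"
  then have "{k. k \<le> i} \<subseteq> {k. k \<le> j}" "j \<in> {k. k \<le> j}" "j \<notin> {k. k \<le> i}" by auto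
  then have "{k. k \<le> i} \<subset> {k. k \<le> j}" by blast
  then have "card {k. k \<le> i} < card {k. k \<le> j}" by (intro psubset_card_mono) auto
  then show ?thesis by (simp add: rank_def)
qed

lemma rank_less_iff: "rank i < rank j \<longleftrightarrow> i < j"
  using rank_mono[of i j] rank_mono[of j i] by (cases i j rule: linorder_cases) auto

lemma rank_eq_iff: "rank i = rank j \<longleftrightarrow> i = j"
  using rank_mono[of i j] rank_mono[of j i] by (cases i j rule: linorder_cases) auto

lemma bij_rank: "bij_betw (rank :: 'n::{finite,linorder} \<Rightarrow> int) UNIV {1..int CARD('n)}"
  unfolding bij_betw_def
proof
  show inj: "inj (rank :: 'n \<Rightarrow> int)" by (rule injI) (simp add: rank_eq_iff)
  have "rank i \<in> {1..int CARD('n)}" for i :: 'n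
  proof -
    have "card {j. j \<le> i} > 0" by (subst card_gt_0_iff) auto
    moreover have "card {j. j \<le> i} \<le> CARD('n)" by (rule card_mono) auto
    ultimately show ?thesis by (simp add: rank_def)
  qed
  then have "range (rank :: 'n \<Rightarrow> int) \<subseteq> {1..int CARD('n)}" by blast
  moreover have "card (range (rank :: 'n \<Rightarrow> int)) = card {1..int CARD('n)}" using card_image[OF inj] by simp
  ultimately show "range (rank :: 'n \<Rightarrow> int) = {1..int CARD('n)}" by (intro card_subset_eq) auto
qed

text \<open>The order is reversed so that \<open>- label i < - label j\<close> for
  \<open>i < j\<close>. With \<open>x i\<close> placed at \<open>- label i\<close>, the values
  \<open>x i - x j\<close>, \<open>x i + x j\<close>, \<open>2 * x i\<close> and, against the label
  0, \<open>x i\<close> are all of the form \<open>p u - p v\<close> with \<open>u < v\<close>, as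
  \<open>comparable_iff_nonres\<close> requires.\<close>

definition label :: "'n::{finite,linorder} \<Rightarrow> int" where
  "label i = int CARD('n) + 1 - rank i"

lemma label_less_iff: "label i < label j \<longleftrightarrow> j < i"
  by (simp add: label_def rank_less_iff)

lemma label_eq_iff: "label i = label j \<longleftrightarrow> i = j"
  by (simp add: label_def rank_eq_iff)

lemma range_label: "range (label :: 'n::{finite,linorder} \<Rightarrow> int) = {1..int CARD('n)}"
proof -
  have "range (label :: 'n \<Rightarrow> int) = (\<lambda>s. int CARD('n) + 1 - s) ` range (rank :: 'n \<Rightarrow> int)"
    by (auto simp: label_def)
  also have "\<dots> = (\<lambda>s. int CARD('n) + 1 - s) ` {1..int CARD('n)}"
    using bij_rank[where 'n='n] by (simp add: bij_betw_def)
  also have "\<dots> = {1..int CARD('n)}"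
  proof (intro equalityI subsetI)
    fix s assume "s \<in> {1..int CARD('n)}"
    then show "s \<in> (\<lambda>s. int CARD('n) + 1 - s) ` {1..int CARD('n)}"
      by (intro image_eqI[of _ _ "int CARD('n) + 1 - s"]) auto
  qed auto
  finally show ?thesis .
qed

text \<open>The sign places \<open>x i\<close> at the negative label
  \<open>- label i\<close>.\<close>

definition label_fun :: "nat \<Rightarrow> ('n::{finite,linorder} \<Rightarrow> int) \<Rightarrow> int \<Rightarrow> int" where
  "label_fun q x = restrict (\<lambda>s. (- x (inv label s)) mod int q) {1..int CARD('n)}"

lemma label_fun_label: "label_fun q x (label (i :: 'n::{finite,linorder})) = (- x i) mod int q"
proof -
  have "label i \<in> {1..int CARD('n)}" using range_label[where 'n='n] by blast
  moreover have "inv label (label i) = i" by (rule inv_f_f) (simp add: inj_def label_eq_iff)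
  ultimately show ?thesis by (simp add: label_fun_def)
qed

lemma bij_label_fun:
  assumes q: "q > 0"
  shows "bij_betw (label_fun q) {x :: 'n::{finite,linorder} \<Rightarrow> int. \<forall>i. x i \<in> {0..<int q}} ({1..int CARD('n)} \<rightarrow>\<^sub>E {0..<int q})"
  unfolding bij_betw_def
proof
  show "inj_on (label_fun q) {x :: 'n \<Rightarrow> int. \<forall>i. x i \<in> {0..<int q}}"
  proof (rule inj_onI, rule ext)
    fix x y :: "'n \<Rightarrow> int" and i
    assume x: "x \<in> {x. \<forall>i. x i \<in> {0..<int q}}" "y \<in> {x. \<forall>i. x i \<in> {0..<int q}}" "label_fun q x = label_fun q y"
    then have "(- x i) mod int q = (- y i) mod int q" using label_fun_label by metis
    then have "x i mod int q = y i mod int q" by (metis add.inverse_inverse mod_minus_eq)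
    moreover have "0 \<le> x i" "x i < int q" "0 \<le> y i" "y i < int q" using x by auto
    ultimately show "x i = y i" by simp
  qed
  show "label_fun q ` {x :: 'n \<Rightarrow> int. \<forall>i. x i \<in> {0..<int q}} = ({1..int CARD('n)} \<rightarrow>\<^sub>E {0..<int q})"
  proof (intro equalityI subsetI)
    fix X assume "X \<in> label_fun q ` {x :: 'n \<Rightarrow> int. \<forall>i. x i \<in> {0..<int q}}"
    then show "X \<in> ({1..int CARD('n)} \<rightarrow>\<^sub>E {0..<int q})" using q by (auto simp: label_fun_def PiE_iff)
  next
    fix X assume X: "X \<in> ({1..int CARD('n)} \<rightarrow>\<^sub>E {0..<int q})"
    define x where "x i = (- X (label i)) mod int q" for i :: 'n
    have "label_fun q x = X"
    proof (rule extensionalityI[of _ "{1..int CARD('n)}"])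
      show "X \<in> extensional {1..int CARD('n)}" using X by (simp add: PiE_iff)
      fix s assume s: "s \<in> {1..int CARD('n)}"
      then obtain i :: 'n where i: "s = label i" using range_label[where 'n='n] by blast
      have r: "0 \<le> X s" "X s < int q" using X s by (auto simp: PiE_iff)
      have "label_fun q x s = (- ((- X s) mod int q)) mod int q" unfolding i label_fun_label x_def ..
      also have "\<dots> = X s mod int q" by (simp add: mod_minus_eq)
      finally show "label_fun q x s = X s" using r by simp
    qed (simp add: label_fun_def)
    moreover have "x \<in> {x. \<forall>i. x i \<in> {0..<int q}}" using q by (simp add: x_def)
    ultimately show "X \<in> label_fun q ` {x :: 'n \<Rightarrow> int. \<forall>i. x i \<in> {0..<int q}}" by blast
  qed
qed

text \<open>The pairs \<open>u < v\<close> and \<open>- v < - u\<close> express the same root. So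
  every condition on the circle is one of the four kinds of root values, and each kind
  arises.\<close>

lemma circ_valid_label_fun:
  fixes x :: "'n::{finite,linorder} \<Rightarrow> int"
  assumes m: "m = b + 1 - a" "a \<le> b" and L: "L = signed {1..int CARD('n)} \<or> L = insert 0 (signed {1..int CARD('n)})"
  shows "circ_valid full a m (int q) L (spos (label_fun q x)) \<longleftrightarrow>
    (\<forall>i j. i < j \<longrightarrow> nonres a b (int q) (x i - x j)) \<and> (\<forall>i j. i < j \<longrightarrow> nonres a b (int q) (x i + x j)) \<and>
    (full \<longrightarrow> (\<forall>i. nonres a b (int q) (2 * x i))) \<and> (0 \<in> L \<longrightarrow> (\<forall>i. nonres a b (int q) (x i)))"
proof -
  let ?p = "spos (label_fun q x)" and ?N = "nonres a b (int q)"
  have lp: "label i > 0" for i :: 'n using range_label[where 'n='n] by (metis atLeastAtMost_iff rangeI zero_less_one_class.zero_less_one less_le_trans)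
  have p: "?p (label i) = (- x i) mod int q" "?p (- label i) = - ((- x i) mod int q)" "?p 0 = 0" for i
    using lp[of i] label_fun_label[of q x i] by (auto simp: spos_def mpos_def)
  have labs: "u = 0 \<or> (\<exists>i :: 'n. u = label i) \<or> (\<exists>i :: 'n. u = - label i)" if "u \<in> L" for u
  proof -
    have "u = 0 \<or> u \<in> range (label :: 'n \<Rightarrow> int) \<or> - u \<in> range (label :: 'n \<Rightarrow> int)"
      using that L unfolding range_label by (auto simp: in_signed)
    then show ?thesis by (metis imageE minus_minus)
  qed
  have inL: "label i \<in> L" "- label i \<in> L" for i :: 'n
  proof -
    have "label i \<in> {1..int CARD('n)}" unfolding range_label[symmetric] by blast
    then show "label i \<in> L" "- label i \<in> L" using L by (auto simp: in_signed)
  qed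
  have n1: "?N (?p (- label i) - ?p (- label j)) \<longleftrightarrow> ?N (x i - x j)" for i j
  proof (rule nonres_cong)
    have "((- x j) mod int q - (- x i) mod int q) mod int q = ((- x j) - (- x i)) mod int q"
      by (simp only: mod_simps)
    then show "(?p (- label i) - ?p (- label j)) mod int q = (x i - x j) mod int q" by (simp add: p)
  qed
  have n2: "?N (?p (- label i) - ?p (label j)) \<longleftrightarrow> ?N (x i + x j)" for i j
  proof (rule nonres_cong)
    have "(- ((- x i) mod int q + (- x j) mod int q)) mod int q = (- (- x i + - x j)) mod int q"
      by (rule mod_minus_cong[OF mod_add_eq])
    then have "(- ((- x i) mod int q) - (- x j) mod int q) mod int q = (x i + x j) mod int q" by (simp add: add.commute)
    then show "(?p (- label i) - ?p (label j)) mod int q = (x i + x j) mod int q" by (simp add: p)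
  qed
  have n3: "?N (?p (label i) - ?p (label j)) \<longleftrightarrow> ?N (x j - x i)" for i j
  proof (rule nonres_cong)
    have "((- x i) mod int q - (- x j) mod int q) mod int q = ((- x i) - (- x j)) mod int q"
      by (simp only: mod_simps)
    then show "(?p (label i) - ?p (label j)) mod int q = (x j - x i) mod int q" by (simp add: p)
  qed
  have n4: "?N (?p (- label i) - ?p 0) \<longleftrightarrow> ?N (x i)" for i
  proof (rule nonres_cong)
    have "(- ((- x i) mod int q)) mod int q = (- (- x i)) mod int q" by (simp only: mod_simps)
    then show "(?p (- label i) - ?p 0) mod int q = x i mod int q" by (simp add: p)
  qed
  have n5: "?N (?p 0 - ?p (label i)) \<longleftrightarrow> ?N (x i)" for i
  proof (rule nonres_cong)
    have "(- ((- x i) mod int q)) mod int q = (- (- x i)) mod int q" by (simp only: mod_simps)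
    then show "(?p 0 - ?p (label i)) mod int q = x i mod int q" by (simp add: p)
  qed
  show ?thesis
    unfolding circ_valid_iff_nonres[OF m]
  proof (intro iffI conjI allI impI)
    assume *: "\<forall>u\<in>L. \<forall>v\<in>L. u < v \<longrightarrow> (u = - v \<longrightarrow> full) \<longrightarrow> ?N (?p u - ?p v)"
    fix i j :: 'n
    show "?N (x i - x j)" if ij: "i < j"
    proof -
      have "- label i < - label j" using ij by (simp add: label_less_iff)
      moreover have "- label i \<noteq> - (- label j)" using lp[of i] lp[of j] by linarith
      ultimately show ?thesis using *[rule_format, OF inL(2) inL(2), of i j] n1 by blast
    qed
    show "?N (x i + x j)" if ij: "i < j"
    proof -
      have "- label i < label j" using lp[of i] lp[of j] by linarith
      moreover have "- label i \<noteq> - label j" using ij by (simp add: label_eq_iff)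
      ultimately show ?thesis using *[rule_format, OF inL(2) inL(1), of i j] n2 by blast
    qed
  next
    fix i :: 'n
    assume *: "\<forall>u\<in>L. \<forall>v\<in>L. u < v \<longrightarrow> (u = - v \<longrightarrow> full) \<longrightarrow> ?N (?p u - ?p v)" and full
    have "- label i < label i" using lp[of i] by linarith
    then have "?N (?p (- label i) - ?p (label i))" using * inL \<open>full\<close> by blast
    then show "?N (2 * x i)" unfolding n2 by simp
  next
    fix i :: 'n
    assume *: "\<forall>u\<in>L. \<forall>v\<in>L. u < v \<longrightarrow> (u = - v \<longrightarrow> full) \<longrightarrow> ?N (?p u - ?p v)" and z: "0 \<in> L"
    have "- label i < 0" "- label i \<noteq> - 0" using lp[of i] by linarith+
    then have "?N (?p (- label i) - ?p 0)" using * inL z by blast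
    then show "?N (x i)" unfolding n4 .
  next
    assume *: "(\<forall>i j. i < j \<longrightarrow> ?N (x i - x j)) \<and> (\<forall>i j. i < j \<longrightarrow> ?N (x i + x j)) \<and>
      (full \<longrightarrow> (\<forall>i. ?N (2 * x i))) \<and> (0 \<in> L \<longrightarrow> (\<forall>i. ?N (x i)))"
    show "\<forall>u\<in>L. \<forall>v\<in>L. u < v \<longrightarrow> (u = - v \<longrightarrow> full) \<longrightarrow> ?N (?p u - ?p v)"
    proof (intro ballI impI)
      fix u v assume uv: "u \<in> L" "v \<in> L" "u < v" "u = - v \<longrightarrow> full"
      consider (zp) j where "u = 0" "v = label (j :: 'n)" | (nz) i where "u = - label (i :: 'n)" "v = 0"
        | (pp) i j where "u = label (i :: 'n)" "v = label (j :: 'n)" | (nn) i j where "u = - label (i :: 'n)" "v = - label (j :: 'n)"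
        | (np) i j where "u = - label (i :: 'n)" "v = label (j :: 'n)"
      proof -
        have no: "\<not> (0 < - label i)" "\<not> (label i < 0)" "\<not> (label i < - label j)" "\<not> (0 < (0::int))" for i j :: 'n
          using lp[of i] lp[of j] by linarith+
        show thesis using labs[OF uv(1)] labs[OF uv(2)] uv(3) no that by metis
      qed
      then show "?N (?p u - ?p v)"
      proof cases
        case zp
        then show ?thesis using * uv(1) n5 by simp
      next
        case nz
        then show ?thesis using * uv(2) n4 by simp
      next
        case pp
        then have "j < i" using uv(3) by (simp add: label_less_iff)
        then show ?thesis unfolding pp n3 using * by blast
      next
        case nn
        then have "i < j" using uv(3) by (simp add: label_less_iff)
        then show ?thesis unfolding nn n1 using * by blast
      next
        case np
        show ?thesis
          unfolding np n2
        proof (cases i j rule: linorder_cases)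
          case less
          then show "?N (x i + x j)" using * by blast
        next
          case equal
          then have "?N (2 * x i)" using * uv(4) np by simp
          then show "?N (x i + x j)" using equal by simp
        next
          case greater
          then have "?N (x j + x i)" using * by blast
          then show "?N (x i + x j)" by (simp add: add.commute)
        qed
      qed
    qed
  qed
qed

lemma card_avoiding_signed:
  assumes m: "m = b + 1 - a" "a \<le> b" and q: "q > 0" and t: "t \<noteq> TA"
  shows "card (avoiding t a b q :: ('n::{finite,linorder} \<Rightarrow> int) set)
    = card {X \<in> {1..int CARD('n)} \<rightarrow>\<^sub>E {0..<int q}. circ_valid (t \<in> {TC, TBC}) a m (int q)
        (if t \<in> {TB, TBC} then insert 0 (signed {1..int CARD('n)}) else signed {1..int CARD('n)}) (spos X)}"
proof (rule bij_betw_same_card)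
  let ?L = "if t \<in> {TB, TBC} then insert 0 (signed {1..int CARD('n)}) else signed {1..int CARD('n)}"
  have z: "0 \<in> ?L \<longleftrightarrow> t \<in> {TB, TBC}" by (auto simp: in_signed)
  have "avoiding t a b q = {x :: 'n \<Rightarrow> int. (\<forall>i. x i \<in> {0..<int q}) \<and>
    ((\<forall>i j. i < j \<longrightarrow> nonres a b (int q) (x i - x j)) \<and> (\<forall>i j. i < j \<longrightarrow> nonres a b (int q) (x i + x j)) \<and>
    (t \<in> {TC, TBC} \<longrightarrow> (\<forall>i. nonres a b (int q) (2 * x i))) \<and> (0 \<in> ?L \<longrightarrow> (\<forall>i. nonres a b (int q) (x i))))}"
    unfolding avoiding_eq z using t
    by (cases t; simp only: iroots_def root_type.case ball_Un ball_roots; blast)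
  also have "\<dots> = {x \<in> {x :: 'n \<Rightarrow> int. \<forall>i. x i \<in> {0..<int q}}. circ_valid (t \<in> {TC, TBC}) a m (int q) ?L (spos (label_fun q x))}"
    by (subst circ_valid_label_fun[OF m]) auto
  finally have e: "avoiding t a b q = {x \<in> {x :: 'n \<Rightarrow> int. \<forall>i. x i \<in> {0..<int q}}. circ_valid (t \<in> {TC, TBC}) a m (int q) ?L (spos (label_fun q x))}" .
  show "bij_betw (label_fun q) (avoiding t a b q :: ('n \<Rightarrow> int) set)
    {X \<in> {1..int CARD('n)} \<rightarrow>\<^sub>E {0..<int q}. circ_valid (t \<in> {TC, TBC}) a m (int q) ?L (spos X)}"
    unfolding e by (rule bij_betw_Collect[OF bij_label_fun[OF q]]) simp
qed

text \<open>Differences of coordinates do not change under a common translation by \<open>s\<close>,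
  while the sum changes by \<open>n * s\<close>. As \<open>n\<close> is invertible modulo
  \<open>q\<close>, each translation class has one member with sum 0 and one whose coordinate of
  rank 1 is 0.\<close>

lemma card_avoiding_TA:
  assumes m: "m = b + 1 - a" "a \<le> b" and q: "q > 0" "coprime (int q) (int CARD('n::{finite,linorder}))"
  shows "card (avoiding TA a b q :: ('n::{finite,linorder} \<Rightarrow> int) set)
    = card {f \<in> {2..int CARD('n)} \<rightarrow>\<^sub>E {0..<int q}. circ_valid True a m (int q) (insert 1 {2..int CARD('n)}) (f(1 := 0))}"
proof -
  let ?n = "int CARD('n)" and ?N = "nonres a b (int q)"
  let ?A = "{x :: 'n \<Rightarrow> int. (\<forall>i. x i \<in> {0..<int q}) \<and> int q dvd (\<Sum>i\<in>UNIV. x i)}"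
  have rg: "range (rank :: 'n \<Rightarrow> int) = {1..?n}" using bij_rank[where 'n='n] by (simp add: bij_betw_def)
  have "1 \<in> {1..?n}" by simp
  then obtain i0 :: 'n where i0: "rank i0 = 1" unfolding rg[symmetric] by (metis imageE)
  have inv: "inv rank (rank i) = i" for i :: 'n by (rule inv_f_f) (simp add: inj_def rank_eq_iff)
  have rS: "rank i \<in> {2..?n} \<longleftrightarrow> i \<noteq> i0" for i :: 'n
  proof -
    have "rank i \<in> {1..?n}" unfolding rg[symmetric] by blast
    then show ?thesis using i0 rank_eq_iff[of i i0] by auto
  qed
  have ins: "insert 1 {2..?n} = range (rank :: 'n \<Rightarrow> int)" unfolding rg by auto
  define F where "F x = restrict (\<lambda>s. (x (inv rank s) - x i0) mod int q) {2..?n}" for x :: "'n \<Rightarrow> int"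
  have Fr: "((F x)(1 := 0)) (rank i) = (x i - x i0) mod int q" for x i
  proof (cases "i = i0")
    case False
    then have "rank i \<in> {2..?n}" "rank i \<noteq> 1" using rS[of i] i0 rank_eq_iff[of i i0] by auto
    then show ?thesis by (simp add: F_def inv)
  qed (simp add: i0)
  have bij: "bij_betw F ?A ({2..?n} \<rightarrow>\<^sub>E {0..<int q})"
    unfolding bij_betw_def
  proof
    show "inj_on F ?A"
    proof (rule inj_onI)
      fix x y assume x: "x \<in> ?A" and y: "y \<in> ?A" and e: "F x = F y"
      have d: "int q dvd (x i - x i0) - (y i - y i0)" for i
        using Fr[of x i] Fr[of y i] e by (simp add: mod_eq_dvd_iff)
      have "int q dvd (\<Sum>i\<in>UNIV. (x i - x i0) - (y i - y i0))" by (intro dvd_sum d)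
      also have "(\<Sum>i\<in>UNIV. (x i - x i0) - (y i - y i0)) = (\<Sum>i\<in>UNIV. x i) - (\<Sum>i\<in>UNIV. y i) - ?n * (x i0 - y i0)"
        by (simp only: sum_subtractf sum_constant) (simp add: algebra_simps)
      finally have "int q dvd (\<Sum>i\<in>UNIV. x i) - (\<Sum>i\<in>UNIV. y i) - ?n * (x i0 - y i0)" .
      moreover have "int q dvd (\<Sum>i\<in>UNIV. x i) - (\<Sum>i\<in>UNIV. y i)" using x y by simp
      ultimately have "int q dvd ?n * (x i0 - y i0)" using dvd_diff_right_iff by blast
      then have d0: "int q dvd x i0 - y i0" using q(2) by (simp add: coprime_dvd_mult_right_iff)
      show "x = y"
      proof
        fix i
        have "int q dvd ((x i - x i0) - (y i - y i0)) + (x i0 - y i0)" using d[of i] d0 by (rule dvd_add)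
        then have "x i mod int q = y i mod int q" by (simp add: mod_eq_dvd_iff)
        moreover have "0 \<le> x i" "x i < int q" "0 \<le> y i" "y i < int q" using x y by auto
        ultimately show "x i = y i" by simp
      qed
    qed
    show "F ` ?A = ({2..?n} \<rightarrow>\<^sub>E {0..<int q})"
    proof (intro equalityI subsetI)
      fix f assume "f \<in> F ` ?A"
      then show "f \<in> ({2..?n} \<rightarrow>\<^sub>E {0..<int q})" using q(1) by (auto simp: F_def PiE_iff)
    next
      fix f assume f: "f \<in> ({2..?n} \<rightarrow>\<^sub>E {0..<int q})"
      obtain w where w: "[?n * w = 1] (mod int q)" using cong_solve_coprime_int[of ?n "int q"] q(2) by (auto simp: coprime_commute)
      define y where "y i = (f(1 := 0)) (rank i)" for i :: 'n
      \<comment> \<open>Subtracting this constant makes the sum of the coordinates 0 modulo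
        \<open>q\<close>, because \<open>w\<close> inverts \<open>n\<close>.\<close>
      define s where "s = w * (\<Sum>i\<in>UNIV. y i)"
      define x where "x i = (y i - s) mod int q" for i
      have y0: "y i0 = 0" by (simp add: y_def i0)
      have "(\<Sum>i\<in>UNIV. x i) mod int q = (\<Sum>i\<in>UNIV. y i - s) mod int q" unfolding x_def by (rule mod_sum_eq)
      also have "(\<Sum>i\<in>UNIV. y i - s) = (\<Sum>i\<in>UNIV. y i) * (1 - ?n * w)" by (simp add: sum_subtractf s_def algebra_simps)
      also have "\<dots> mod int q = 0"
      proof -
        have "int q dvd ?n * w - 1" using w by (simp add: cong_iff_dvd_diff)
        then have "int q dvd 1 - ?n * w" by (simp add: dvd_diff_commute)
        then show ?thesis by simp
      qed
      finally have xA: "x \<in> ?A" using q(1) by (auto simp: x_def)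
      have "F x = f"
      proof (rule extensionalityI[of _ "{2..?n}"])
        show "f \<in> extensional {2..?n}" using f by (simp add: PiE_iff)
        fix t assume t: "t \<in> {2..?n}"
        then have "t \<in> range (rank :: 'n \<Rightarrow> int)" unfolding rg by simp
        then obtain i :: 'n where i: "t = rank i" by blast
        have t1: "t \<noteq> 1" using t by simp
        have "F x t = ((F x)(1 := 0)) (rank i)" using t1 i by simp
        also have "\<dots> = ((y i - s) mod int q - (y i0 - s) mod int q) mod int q" unfolding Fr x_def ..
        also have "\<dots> = ((y i - s) - (y i0 - s)) mod int q" by (simp only: mod_simps)
        also have "\<dots> = f t mod int q" using t1 i y0 by (simp add: y_def)
        also have "\<dots> = f t" using f t by (auto simp: PiE_iff)
        finally show "F x t = f t" .
      qed (simp add: F_def)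
      then show "f \<in> F ` ?A" using xA by blast
    qed
  qed
  have valid: "circ_valid True a m (int q) (insert 1 {2..?n}) ((F x)(1 := 0)) \<longleftrightarrow> (\<forall>i j. i < j \<longrightarrow> ?N (x i - x j))" for x
  proof -
    have c: "?N (((F x)(1 := 0)) (rank i) - ((F x)(1 := 0)) (rank j)) \<longleftrightarrow> ?N (x i - x j)" for i j
      unfolding Fr
    proof (rule nonres_cong)
      have "((x i - x i0) mod int q - (x j - x i0) mod int q) mod int q = ((x i - x i0) - (x j - x i0)) mod int q"
        by (simp only: mod_simps)
      then show "((x i - x i0) mod int q - (x j - x i0) mod int q) mod int q = (x i - x j) mod int q" by simp
    qed
    show ?thesis
      unfolding circ_valid_iff_nonres[OF m] ins
    proof (intro iffI allI impI ballI)
      fix i j :: 'n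
      assume *: "\<forall>u\<in>range (rank :: 'n \<Rightarrow> int). \<forall>v\<in>range (rank :: 'n \<Rightarrow> int). u < v \<longrightarrow> (u = - v \<longrightarrow> True) \<longrightarrow>
        ?N (((F x)(1 := 0)) u - ((F x)(1 := 0)) v)" and ij: "i < j"
      then have "?N (((F x)(1 := 0)) (rank i) - ((F x)(1 := 0)) (rank j))" 
        using bspec[OF bspec[OF * rangeI[of rank i]] rangeI[of rank j]] rank_mono[OF ij] by blast
      then show "?N (x i - x j)" unfolding c .
    next
      fix u v assume *: "\<forall>i j. i < j \<longrightarrow> ?N (x i - x j)" and "u \<in> range (rank :: 'n \<Rightarrow> int)" "v \<in> range (rank :: 'n \<Rightarrow> int)" "u < v"
      then obtain i j :: 'n where ij: "u = rank i" "v = rank j" by blast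
      then have "i < j" using \<open>u < v\<close> rank_less_iff by blast
      then show "?N (((F x)(1 := 0)) u - ((F x)(1 := 0)) v)" unfolding ij c using * by blast
    qed
  qed
  have e: "avoiding TA a b q = {x \<in> ?A. \<forall>i j. i < j \<longrightarrow> ?N (x i - x j)}"
    unfolding avoiding_eq by (simp only: iroots_def root_type.case ball_roots) blast
  have "bij_betw F (avoiding TA a b q)
    {f \<in> {2..?n} \<rightarrow>\<^sub>E {0..<int q}. circ_valid True a m (int q) (insert 1 {2..?n}) (f(1 := 0))}"
    unfolding e by (rule bij_betw_Collect[OF bij]) (rule valid)
  then show ?thesis by (rule bij_betw_same_card)
qed

text \<open>The \<open>a + b\<close> forbidden integers are consecutive, hence have distinct
  residues when \<open>a + b \<le> q\<close>.\<close>

lemma card_nonres: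
  assumes q: "q > 0" "a + b \<le> q"
  shows "card {y \<in> {0..<int q}. nonres a b (int q) y} = q - (a + b)"
proof -
  let ?Z = "{0..<int q}" and ?I = "{1 - int a..int b}"
  have "?Z - {y \<in> ?Z. nonres a b (int q) y} = (\<lambda>k. k mod int q) ` ?I"
  proof (intro equalityI subsetI)
    fix y assume "y \<in> ?Z - {y \<in> ?Z. nonres a b (int q) y}"
    then obtain k where k: "k \<in> ?I" "int q dvd y - k" "0 \<le> y" "y < int q" by (auto simp: nonres_def)
    have 1: "y mod int q = k mod int q" using k(2) unfolding mod_eq_dvd_iff .
    have 2: "y mod int q = y" using k(3,4) by (rule mod_pos_pos_trivial)
    have "y = k mod int q" using 1 unfolding 2 .
    then show "y \<in> (\<lambda>k. k mod int q) ` ?I" using k(1) by blast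
  next
    fix y assume "y \<in> (\<lambda>k. k mod int q) ` ?I"
    then obtain k where k: "k \<in> ?I" "y = k mod int q" by blast
    then have "int q dvd y - k" by (simp add: mod_eq_dvd_iff[symmetric])
    then show "y \<in> ?Z - {y \<in> ?Z. nonres a b (int q) y}" using k q(1) by (auto simp: nonres_def)
  qed
  moreover have fin: "finite {y \<in> ?Z. nonres a b (int q) y}" by (rule finite_subset[of _ ?Z]) auto
  moreover have "card ((\<lambda>k. k mod int q) ` ?I) = a + b"
  proof -
    have "inj_on (\<lambda>k. k mod int q) ?I"
    proof (rule inj_onI)
      fix k k' assume k: "k \<in> ?I" "k' \<in> ?I" "k mod int q = k' mod int q"
      then have "int q dvd k - k'" by (simp add: mod_eq_dvd_iff)
      moreover have "\<bar>k - k'\<bar> < int q" using k q(2) by auto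
      ultimately show "k = k'" using dvd_imp_le_int[of "k - k'" "int q"] by force
    qed
    then show ?thesis by (simp add: card_image)
  qed
  moreover have "card (?Z - {y \<in> ?Z. nonres a b (int q) y}) = q - card {y \<in> ?Z. nonres a b (int q) y}"
    by (subst card_Diff_subset[OF fin]) auto
  moreover have "card {y \<in> ?Z. nonres a b (int q) y} \<le> card ?Z" by (rule card_mono) auto
  ultimately show ?thesis by simp
qed

text \<open>\<open>D_2\<close> is an orthogonal product of two rank one systems: for odd
  \<open>q\<close> the values \<open>x i - x j\<close> and \<open>x i + x j\<close> can be
  prescribed independently.\<close>

lemma card_avoiding_D2:
  assumes n: "CARD('n::{finite,linorder}) = 2" and q: "odd q" "a + b \<le> q"
  shows "card (avoiding TD a b q :: ('n::{finite,linorder} \<Rightarrow> int) set) = (q - (a + b)) ^ 2"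
proof -
  let ?N = "nonres a b (int q)" and ?Z = "{0..<int q}"
  let ?B = "{x :: 'n \<Rightarrow> int. \<forall>i. x i \<in> ?Z}" and ?G = "{y \<in> ?Z. ?N y}"
  have q0: "q > 0" using q(1) by (cases q) auto
  obtain i j :: 'n where ij: "i < j" "UNIV = {i, j}"
  proof -
    obtain u v :: 'n where uv: "u \<noteq> v" "UNIV = {u, v}" using n card_2_iff[of "UNIV :: 'n set"] by auto
    show thesis
    proof (cases "u < v")
      case True
      then show thesis using that uv by blast
    next
      case False
      then have "v < u" using uv(1) by simp
      then show thesis using that[of v u] uv(2) by (simp add: insert_commute)
    qed
  qed
  have less: "k < l \<longleftrightarrow> k = i \<and> l = j" for k l
  proof -
    have "k = i \<or> k = j" "l = i \<or> l = j" using ij(2) by blast+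
    then show ?thesis using ij(1) by auto
  qed
  define F where "F x = ((x i - x j) mod int q, (x i + x j) mod int q)" for x :: "'n \<Rightarrow> int"
  have inj: "inj_on F ?B"
  proof (rule inj_onI)
    fix x y assume x: "x \<in> ?B" and y: "y \<in> ?B" and e: "F x = F y"
    have d: "int q dvd (x i - x j) - (y i - y j)" "int q dvd (x i + x j) - (y i + y j)"
      using e by (auto simp: F_def mod_eq_dvd_iff)
    have "int q dvd ((x i - x j) - (y i - y j)) + ((x i + x j) - (y i + y j))" using d by (rule dvd_add)
    then have "int q dvd 2 * (x i - y i)" by (simp add: algebra_simps)
    moreover have "coprime (int q) 2" using q(1) by simp
    ultimately have di: "int q dvd x i - y i" using coprime_dvd_mult_right_iff by blast
    have "int q dvd ((x i + x j) - (y i + y j)) - (x i - y i)" using d(2) di by (rule dvd_diff)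
    then have dj: "int q dvd x j - y j" by (simp add: algebra_simps)
    have r: "0 \<le> x k" "x k < int q" "0 \<le> y k" "y k < int q" for k using x y by auto
    have "x i mod int q = y i mod int q" "x j mod int q = y j mod int q" using di dj by (auto simp: mod_eq_dvd_iff)
    then have xy: "x i = y i" "x j = y j" using r by auto
    show "x = y"
    proof
      fix k
      have "k = i \<or> k = j" using ij(2) by blast
      then show "x k = y k" using xy by blast
    qed
  qed
  have "card ?B = card ({1..int CARD('n)} \<rightarrow>\<^sub>E ?Z)"
    by (rule bij_betw_same_card) (rule bij_label_fun[OF q0])
  then have cB: "card ?B = q ^ 2" using n by (simp add: card_PiE)
  have sub: "F ` ?B \<subseteq> ?Z \<times> ?Z" using q0 by (auto simp: F_def)
  have "card (F ` ?B) = card (?Z \<times> ?Z)"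
    unfolding card_image[OF inj] cB card_cartesian_product by (simp add: power2_eq_square)
  then have "F ` ?B = ?Z \<times> ?Z" by (intro card_subset_eq sub) auto
  then have bij: "bij_betw F ?B (?Z \<times> ?Z)" using inj by (simp add: bij_betw_def)
  have "avoiding TD a b q = {x \<in> ?B. ?N (x i - x j) \<and> ?N (x i + x j)}"
    unfolding avoiding_eq by (simp only: iroots_def root_type.case ball_roots ball_Un less) auto
  moreover have "bij_betw F {x \<in> ?B. ?N (x i - x j) \<and> ?N (x i + x j)} {p \<in> ?Z \<times> ?Z. ?N (fst p) \<and> ?N (snd p)}"
  proof (rule bij_betw_Collect[OF bij])
    fix x
    have "?N ((x i - x j) mod int q) \<longleftrightarrow> ?N (x i - x j)" "?N ((x i + x j) mod int q) \<longleftrightarrow> ?N (x i + x j)"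
      by (rule nonres_cong, simp)+
    then show "(?N (fst (F x)) \<and> ?N (snd (F x))) \<longleftrightarrow> (?N (x i - x j) \<and> ?N (x i + x j))" by (simp add: F_def)
  qed
  moreover have "{p \<in> ?Z \<times> ?Z. ?N (fst p) \<and> ?N (snd p)} = ?G \<times> ?G" by auto
  ultimately have "card (avoiding TD a b q :: ('n \<Rightarrow> int) set) = card (?G \<times> ?G)"
    by (metis (no_types, lifting) bij_betw_same_card)
  then show ?thesis unfolding card_cartesian_product card_nonres[OF q0 q(2)] by (simp add: power2_eq_square)
qed

text \<open>Coprimality to the dimension serves type A, whose coordinates have a fixed sum. In the
  other types the label 0 distinguishes B and BC, the flag \<open>full\<close> distinguishes C and
  BC.\<close>

theorem avoiding_count_polynomial:
  assumes n: "CARD('n::{finite,linorder}) \<ge> 2" and ab: "a \<le> b"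
  shows "\<exists>H q0. aligned H \<and> (\<forall>q\<ge>q0. odd q \<longrightarrow> coprime (int q) (int CARD('n::{finite,linorder})) \<longrightarrow>
    of_nat (card (avoiding t a b q :: ('n::{finite,linorder} \<Rightarrow> int) set)) = poly H (of_nat q))"
proof -
  define m where "m = b + 1 - a"
  have m: "m > 0" using ab by (simp add: m_def)
  let ?S = "{1..int CARD('n)}"
  have S: "finite ?S" "\<And>s. s \<in> ?S \<Longrightarrow> s > 0" "?S \<noteq> {}" using n by auto
  have q0: "q > 0" if "odd q" for q :: nat using that by (cases q) auto
  show ?thesis
  proof (cases "t = TA")
    case True
    let ?C = "\<lambda>q. {f \<in> {2..int CARD('n)} \<rightarrow>\<^sub>E {0..<int q}. circ_valid True a m (int q) (insert 1 {2..int CARD('n)}) (f(1 := 0))}"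
    have "\<exists>H q0. aligned H \<and> (\<forall>q\<ge>q0. odd q \<longrightarrow> of_nat (card (?C q)) = poly H (of_nat q))"
      by (rule line_count_polynomial) (use n m in auto)
    then obtain H q1 where H: "aligned H" "\<And>q. q \<ge> q1 \<Longrightarrow> odd q \<Longrightarrow> of_nat (card (?C q)) = poly H (of_nat q)"
      by blast
    have "of_nat (card (avoiding t a b q :: ('n \<Rightarrow> int) set)) = poly H (of_nat q)"
      if "q \<ge> q1" "odd q" "coprime (int q) (int CARD('n))" for q
      unfolding True card_avoiding_TA[OF m_def ab q0[OF that(2)] that(3)] by (rule H(2)[OF that(1,2)])
    then show ?thesis using H(1) by blast
  next
    case False
    show ?thesis
    proof (cases "t = TD \<and> CARD('n) = 2")
      case True
      let ?H = "[:- of_nat (a + b), 1:] ^ 2 :: complex poly"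
      have "aligned ?H"
        unfolding aligned_def roots_on_line_def
        by (intro disjI2 exI[of _ "real (a + b)"] allI impI) (simp add: add_eq_0_iff)
      moreover have "of_nat (card (avoiding t a b q :: ('n \<Rightarrow> int) set)) = poly ?H (of_nat q)" if "q \<ge> a + b" "odd q" for q
        using card_avoiding_D2[of q a b, where 'n='n] True that by (simp add: of_nat_diff algebra_simps)
      ultimately show ?thesis by blast
    next
      case nD2: False
      let ?C = "\<lambda>q. {X \<in> ?S \<rightarrow>\<^sub>E {0..<int q}. circ_valid (t \<in> {TC, TBC}) a m (int q)
        (if t \<in> {TB, TBC} then insert 0 (signed ?S) else signed ?S) (spos X)}"
      have "\<exists>H q0. aligned H \<and> (\<forall>q\<ge>q0. odd q \<longrightarrow> of_nat (card (?C q)) = poly H (of_nat q))"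
      proof (cases "t \<in> {TB, TBC}")
        case True
        then show ?thesis using zero_label_count_polynomial[OF S m, of "t \<in> {TC, TBC}" a] by simp
      next
        case f: False
        show ?thesis
        proof (cases "t = TC")
          case True
          then show ?thesis using signed_full_count_polynomial[OF S m, of a] by simp
        next
          case False
          then have t: "t = TD" using f \<open>t \<noteq> TA\<close> by (cases t) auto
          then have "CARD('n) \<ge> 3" using nD2 n by simp
          then show ?thesis using signed_free_count_polynomial[of "CARD('n)" m a] m t by simp
        qed
      qed
      then obtain H q1 where H: "aligned H" "\<And>q. q \<ge> q1 \<Longrightarrow> odd q \<Longrightarrow> of_nat (card (?C q)) = poly H (of_nat q)"
        by blast
      have "of_nat (card (avoiding t a b q :: ('n \<Rightarrow> int) set)) = poly H (of_nat q)" if "q \<ge> q1" "odd q" for q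
        unfolding card_avoiding_signed[OF m_def ab q0[OF that(2)] False] by (rule H(2)[OF that])
      then show ?thesis using H(1) by blast
    qed
  qed
qed

lemma poly_map_poly_of_int: "poly (map_poly of_int p) (of_int x) = (of_int (poly p x) :: 'a::comm_ring_1)"
  by (induction p) (auto simp: map_poly_pCons)

theorem theorem1p2:
  fixes t :: root_type and a b :: nat and z :: complex
  assumes "CARD('n::{finite,linorder}) \<ge> 2"
    and "a \<noteq> 0 \<or> b \<noteq> 0" and "a \<le> b"
    and "poly (map_poly of_int
           (char_poly (ambient t :: (real ^ 'n::{finite,linorder}) set) (hat_arr (- int a + 1) (int b) t))) z = 0"
  shows "Re z = real (card (hat_arr (- int a + 1) (int b) t :: (real ^ 'n::{finite,linorder}) set set))
                / real (ambient_dim t TYPE('n::{finite,linorder}))"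
proof -
  define V where "V = (ambient t :: ((real, 'n) vec) set)"
  define A where "A = (hat_arr (- int a + 1) (int b) t :: ((real, 'n) vec) set set)"
  define ch where "ch = char_poly V A"
  define l where "l = ambient_dim t TYPE('n)"
  have n1: "CARD('n) \<ge> 1" using assms(1) by simp
  have l1: "l \<ge> 1" using assms(1) by (simp add: l_def ambient_dim_def) arith
  have Aeq: "A = (\<lambda>e. V \<inter> sol_real {e}) ` root_forms t a b"
    unfolding A_def V_def hat_arr_eq ambient_eq ..
  have finF: "finite (root_forms t a b :: (('n \<Rightarrow> int) \<times> int) set)"
    by (simp add: root_forms_def finite_iroots)
  have finE: "finite (ambient_forms t :: (('n \<Rightarrow> int) \<times> int) set)" by (simp add: ambient_forms_def)
  have Vne: "V \<noteq> {}" by (auto simp: V_def ambient_def intro!: exI[of _ 0])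
  have coeffs: "coeff ch l = 1" "coeff ch (l - 1) = - int (card A)" "degree ch \<le> l"
  proof -
    have "affine V" unfolding V_def by (rule affine_ambient)
    moreover have "aff_dim V = int l" unfolding V_def l_def by (rule aff_dim_ambient[OF n1])
    moreover have "finite A" unfolding Aeq using finF by simp
    moreover have "affine H \<and> H \<noteq> {} \<and> H \<subseteq> V \<and> aff_dim H = int l - 1" if "H \<in> A" for H
    proof -
      obtain e where "e \<in> root_forms t a b" "H = V \<inter> sol_real {e}" using \<open>H \<in> A\<close> unfolding Aeq by blast
      then show ?thesis using hyperplane_properties[OF n1, of e t a b] by (simp add: V_def l_def)
    qed
    ultimately show "coeff ch l = 1" "coeff ch (l - 1) = - int (card A)" "degree ch \<le> l"
      unfolding ch_def using char_poly_leading_coeffs[OF _ Vne _ l1] by blast+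
  qed
  have "\<exists>N>0. \<forall>q>1. coprime (int q) N \<longrightarrow>
    poly (char_poly (sol_real (ambient_forms t :: (('n \<Rightarrow> int) \<times> int) set)) ((\<lambda>e. sol_real (ambient_forms t) \<inter> sol_real {e}) ` root_forms t a b)) (int q)
      = int (card {x \<in> sol_mod q (ambient_forms t :: (('n \<Rightarrow> int) \<times> int) set). \<forall>e\<in>root_forms t a b. x \<notin> sol_mod q {e}})"
  proof (rule char_poly_eq_card_mod[OF finE finF])
    show "sol_real (ambient_forms t :: (('n \<Rightarrow> int) \<times> int) set) \<noteq> {}" using Vne unfolding V_def ambient_eq .
    fix e :: "('n \<Rightarrow> int) \<times> int" assume "e \<in> root_forms t a b"
    then show "\<not> sol_real (ambient_forms t) \<subseteq> sol_real {e}"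
      using hyperplane_properties(1)[OF n1, of e t a b] unfolding ambient_eq by blast
  qed
  then obtain N where N: "N > 0" "\<And>q. q > 1 \<Longrightarrow> coprime (int q) N \<Longrightarrow>
      poly ch (int q) = int (card (avoiding t a b q :: ('n \<Rightarrow> int) set))"
    unfolding avoiding_def ch_def Aeq V_def ambient_eq by blast
  obtain H q0 where H: "aligned H" "\<And>q. q \<ge> q0 \<Longrightarrow> odd q \<Longrightarrow> coprime (int q) (int CARD('n)) \<Longrightarrow>
      of_nat (card (avoiding t a b q :: ('n \<Rightarrow> int) set)) = poly H (of_nat q)"
    using avoiding_count_polynomial[OF assms(1,3), of t] by blast
  define f where "f = map_poly (of_int :: int \<Rightarrow> complex) ch"
  \<comment> \<open>Numbers that are 1 modulo \<open>K\<close> are odd and coprime to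
    \<open>N\<close> and to the dimension; the progression used below starts beyond
    \<open>q0\<close>.\<close>
  define K where "K = 2 * nat N * CARD('n)"
  have K: "K > 0" using N(1) by (simp add: K_def)
  have root: "poly (f - H) (of_nat (1 + K * (j + q0 + 1))) = 0" for j
  proof -
    define q where "q = 1 + K * (j + q0 + 1)"
    have Kle: "j + q0 + 1 \<le> K * (j + q0 + 1)" using mult_le_mono1[of 1 K "j + q0 + 1"] K by simp
    have "q > 1" "q \<ge> q0" using Kle unfolding q_def by linarith+
    have "odd q" by (simp add: q_def K_def)
    have cop: "coprime (int q) c" if c: "c dvd int K" for c
    proof (rule coprimeI)
      fix d assume d: "d dvd int q" "d dvd c"
      have "d dvd int K * int (j + q0 + 1)" using d(2) c by (meson dvd_mult2 dvd_trans)
      moreover have "int q = 1 + int K * int (j + q0 + 1)" by (simp add: q_def algebra_simps)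
      then have "d dvd 1 + int K * int (j + q0 + 1)" using d(1) by metis
      ultimately show "is_unit d" by (simp only: dvd_add_left_iff)
    qed
    have "N dvd int K" using N(1) by (simp add: K_def)
    then have "poly ch (int q) = int (card (avoiding t a b q :: ('n \<Rightarrow> int) set))"
      by (intro N(2) cop \<open>q > 1\<close>)
    moreover have "of_nat (card (avoiding t a b q :: ('n \<Rightarrow> int) set)) = poly H (of_nat q)"
      by (rule H(2)[OF \<open>q \<ge> q0\<close> \<open>odd q\<close>], rule cop) (simp add: K_def)
    ultimately have "poly f (of_int (int q)) = poly H (of_nat q)"
      unfolding f_def poly_map_poly_of_int by simp
    then show ?thesis unfolding q_def[symmetric] by simp
  qed
  have fH: "f = H"
  proof (rule ccontr)
    assume "f \<noteq> H"
    then have "finite {x. poly (f - H) x = 0}" by (intro poly_roots_finite) simp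
    moreover have "range (\<lambda>j. of_nat (1 + K * (j + q0 + 1))) \<subseteq> {x. poly (f - H) x = 0}" using root by blast
    ultimately have "finite (range (\<lambda>j. of_nat (1 + K * (j + q0 + 1)) :: complex))" by (rule finite_subset[rotated])
    moreover have "inj (\<lambda>j. of_nat (1 + K * (j + q0 + 1)) :: complex)"
    proof (rule injI)
      fix i j assume "of_nat (1 + K * (i + q0 + 1)) = (of_nat (1 + K * (j + q0 + 1)) :: complex)"
      then have "1 + K * (i + q0 + 1) = 1 + K * (j + q0 + 1)" unfolding of_nat_eq_iff .
      then show "i = j" using K by simp
    qed
    ultimately show False using finite_imageD infinite_UNIV_nat by blast
  qed
  have cl: "coeff f l = 1" "coeff f (l - 1) = - of_real (real (card A))"
    using coeffs by (auto simp: f_def coeff_map_poly)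
  have "degree f \<le> l" by (rule degree_le) (use coeffs(3) in \<open>auto simp: f_def coeff_map_poly coeff_eq_0\<close>)
  moreover have "l \<le> degree f" using cl(1) by (intro le_degree) simp
  ultimately have deg: "degree f = l" by simp
  \<comment> \<open>Being monic excludes the zero polynomial, so \<open>aligned\<close> provides an
    actual line.\<close>
  have "f \<noteq> 0" using cl(1) by auto
  then obtain r where r: "roots_on_line r f" using H(1) unfolding fH[symmetric] aligned_def by blast
  have "r = real (card A) / real l"
    by (rule roots_on_line_subleading[OF r deg _ _ cl(2)]) (use l1 deg cl(1) in auto)
  moreover have "poly f z = 0" using assms(4) unfolding f_def ch_def V_def A_def .
  ultimately show ?thesis using r unfolding roots_on_line_def A_def l_def by blast
qed

end
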